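(* Let $M,N\ge1$, $t,u\in[0,1)$, $a=(a_1,\dots,a_M)\in(0,1)^M$, $b=(b_1,\dots,b_N)\in(0,1)^N$. Let $(\vec\lambda,\vec\mu)$ be distributed according to the periodic Hall--Littlewood process $\mathbb{PHL}^{a,b}_{t,u}$, and let $S_1$, $S_2$ and $W$ denote respectively the outgoing arrows at the top, the outgoing arrows at the right, and the number of times arrows wind in the quasi-periodic stochastic six vertex model with the same parameters $u,t$ and rapidities $a,b$. Then for all nonnegative integers $n$, all $s_1\in\{0,1\}^M$ and all $s_2\in\{0,1\}^N$, $$\mathbb{PHL}^{a,b}_{t,u}\bigl(l(\lambda^{(0)})=n,\ [\vec\lambda]=s_1,\ [\vec\mu]^c=s_2\bigr)=\mathbb{P}(W+\chi=n,\ S_1=s_1,\ S_2=s_2),$$ where $\chi$ is an independent $u$-geometric random variable. Here the law of $(W,S_1,S_2)$ is understood as the limit in distribution as $L\to\infty$ of the corresponding observables of the quasi-periodic model of length $L$; the existence of this limit is part of the statement.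
   Context: Hall--Littlewood polynomials: $P_\lambda(x;0,t)$ are the Macdonald functions $P_\lambda(x;q,t)$ at $q=0$, and $Q_\lambda(x;0,t)$ the dual basis for $\langle p_\lambda,p_\mu\rangle=\delta_{\lambda\mu}z_\lambda\prod_i(1-t^{\lambda_i})^{-1}$, where $z_\lambda=\prod_i m_i(\lambda)!\,i^{m_i(\lambda)}$ and $m_i(\lambda)$ is the multiplicity of $i$ in $\lambda$. Skew versions: $\langle P_{\lambda/\mu},Q_\nu\rangle=\langle P_\lambda,Q_\mu Q_\nu\rangle$ for all $\nu$, and $Q_{\lambda/\mu}$ with $P,Q$ exchanged. Periodic Hall--Littlewood process $\mathbb{PHL}^{a,b}_{t,u}$: the probability measure on sequences of partitions $\vec\lambda=(\lambda^{(0)}\subseteq\cdots\subseteq\lambda^{(M)})$, $\vec\mu=(\mu^{(0)}\subseteq\cdots\subseteq\mu^{(N)})$ with $\mu^{(0)}=\lambda^{(0)}$ and $\mu^{(N)}=\lambda^{(M)}$, given by $$\frac{u^{|\mu^{(0)}|}}{\Phi(a,b;0,t,u)}\prod_{i=1}^MP_{\lambda^{(i)}/\lambda^{(i-1)}}(a_i;0,t)\prod_{j=1}^NQ_{\mu^{(j)}/\mu^{(j-1)}}(b_j;0,t),\qquad \Phi(a,b;0,t,u)=\frac{1}{(u;u)_\infty}\prod_{i,j}\prod_{l\ge0}\frac{1-tu^la_ib_j}{1-u^la_ib_j}.$$ $l(\lambda)$ is the number of nonzero parts. $[\vec\lambda]\in\{0,1\}^M$ has $i$th entry $1$ if $l(\lambda^{(i)})>l(\lambda^{(i-1)})$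 and $0$ otherwise; $[\vec\mu]^c\in\{0,1\}^N$ has $j$th entry $0$ if $l(\mu^{(j)})>l(\mu^{(j-1)})$ and $1$ otherwise. Stochastic six vertex model on an $M\times N$ rectangle with column rapidities $a_1,\dots,a_M$ (left to right) and row rapidities $b_1,\dots,b_N$ (bottom to top): arrows travel up and right along lattice edges, at most one arrow per edge; incoming arrows at the bottom and left boundary are specified; the probability of a configuration is the product of vertex weights. With $\mathbf p_{i,j}=\frac{1-a_ib_j}{1-ta_ib_j}$, the weight at the vertex in column $i$, row $j$ is: (no arrows in or out) $1$; (arrows on all four edges) $1$; (only a left incoming arrow) it exits right with weight $\mathbf p_{i,j}$ and up with weight $1-\mathbf p_{i,j}$; (only a bottom incoming arrow) it exits up with weight $t\mathbf p_{i,j}$ and right with weight $1-t\mathbf p_{i,j}$. Quasi-periodic model of length $L$: it consists of $L$ six vertex models on $M\times N$ rectangles, the $l$th one ($l=1,\dots,L$) having column rapidities $u^{l-1}a_1,\dots,u^{l-1}a_M$ and row rapidities $b_1,\dots,b_N$. For $l\ge2$, arrows exiting the top of column $i$ of the $l$th rectangle enter the bottom of column $i$ of the $(l-1)$th, and arrows exiting the right of row $j$ of the $l$th rectangle enter the left of row $j$ of the $(l-1)$th. The input to the $L$th rectangle has no arrows at the bottom and an arrow in every row on the left. $S_1\in\{0,1\}^M$ and $S_2\in\{0,1\}^N$ are the indicator vectors of arrows exiting the top (by column) and right (by row) of the $1$st rectangle, and $W$ is the total number (over all $L$ rectangles) of arrows entering a rectangle from its bottom boundary. The quasi-periodic stochastic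 six vertex model is the limit $L\to\infty$. $\chi$ is $u$-geometric if $\mathbb{P}(\chi=k)=u^k\frac{(u;u)_\infty}{(u;u)_k}$ for $k\ge0$, where $(z;u)_k=\prod_{m=0}^{k-1}(1-u^mz)$. *)

theory Defs
  imports "HOL-Library.Multiset" "HOL-Probability.Probability"
begin

section \<open>Partitions\<close>

text \<open>
  A partition is a weakly decreasing sequence with finitely many nonzero entries, indexed from 0:
  \<open>part lam i\<close> is the part usually written \<open>\<lambda>\<^sub>i\<^sub>+\<^sub>1\<close>.
\<close>

typedef partition = "{f :: nat \<Rightarrow> nat. antimono f \<and> finite {i. f i \<noteq> 0}}"
  morphisms part Partition
proof
  show "(\<lambda>_. 0) \<in> {f :: nat \<Rightarrow> nat. antimono f \<and> finite {i. f i \<noteq> 0}}"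
    by (simp add: antimono_def)
qed

definition psize :: "partition \<Rightarrow> nat" where
  "psize lam = (\<Sum>i | part lam i \<noteq> 0. part lam i)"

definition plength :: "partition \<Rightarrow> nat" where
  "plength lam = card {i. part lam i \<noteq> 0}"

text \<open>Only meaningful for \<open>i \<ge> 1\<close>.\<close>

definition part_mult :: "partition \<Rightarrow> nat \<Rightarrow> nat" where
  "part_mult lam i = card {j. part lam j = i}"

definition diagram_subset :: "partition \<Rightarrow> partition \<Rightarrow> bool" where
  "diagram_subset mu lam \<longleftrightarrow> (\<forall>i. part mu i \<le> part lam i)"

definition dominated :: "partition \<Rightarrow> partition \<Rightarrow> bool" where
  "dominated mu lam \<longleftrightarrow>
     psize mu = psize lam \<and> (\<forall>k. (\<Sum>i<k. part mu i) \<le> (\<Sum>i<k. part lam i))"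

definition z_factor :: "partition \<Rightarrow> real" where
  "z_factor lam = (\<Prod>i\<in>range (part lam) - {0}. fact (part_mult lam i) * real i ^ part_mult lam i)"


section \<open>Symmetric functions\<close>

text \<open>
  Formal power series over the reals in variables \<open>x\<^sub>0, x\<^sub>1, \<dots>\<close> are represented by their coefficients.
  A monomial is a finite multiset of variable indices: \<open>x\<^sub>0\<^sup>2 x\<^sub>3\<close> is \<open>{#0, 0, 3#}\<close>.
\<close>

type_synonym series = "nat multiset \<Rightarrow> real"

definition symmetric_function :: "series \<Rightarrow> bool" where
  "symmetric_function f \<longleftrightarrow>
     (\<forall>\<pi> \<alpha>. bij \<pi> \<longrightarrow> f (image_mset \<pi> \<alpha>) = f \<alpha>) \<and>
     (\<exists>d. \<forall>\<alpha>. size \<alpha> > d \<longrightarrow> f \<alpha> = 0)"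

definition series_one :: series where
  "series_one \<alpha> = (if \<alpha> = {#} then 1 else 0)"

definition series_mult :: "series \<Rightarrow> series \<Rightarrow> series" where
  "series_mult f g \<alpha> = (\<Sum>\<beta> | \<beta> \<subseteq># \<alpha>. f \<beta> * g (\<alpha> - \<beta>))"

text \<open>The value at \<open>x\<^sub>0 = a\<close> and \<open>x\<^sub>i = 0\<close> for \<open>i \<ge> 1\<close>, for series of bounded degree.\<close>

definition eval_single :: "series \<Rightarrow> real \<Rightarrow> real" where
  "eval_single f a = (\<Sum>k | f (replicate_mset k 0) \<noteq> 0. f (replicate_mset k 0) * a ^ k)"

definition monomial_sym :: "partition \<Rightarrow> series" where
  "monomial_sym lam \<alpha> = (if \<exists>\<pi>. bij \<pi> \<and> (\<forall>i. count \<alpha> (\<pi> i) = part lam i) then 1 else 0)"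

text \<open>For \<open>k \<ge> 1\<close>.\<close>

definition power_sum :: "nat \<Rightarrow> series" where
  "power_sum k \<alpha> = (if \<exists>i. \<alpha> = replicate_mset k i then 1 else 0)"

definition power_sum_partition :: "partition \<Rightarrow> series" where
  "power_sum_partition lam =
     foldr (\<lambda>i. series_mult (power_sum (part lam i))) [0..<plength lam] series_one"

text \<open>The coordinates of a symmetric function in the basis of power sums.\<close>

definition power_sum_coeff :: "series \<Rightarrow> partition \<Rightarrow> real" where
  "power_sum_coeff f = (THE c. finite {lam. c lam \<noteq> 0} \<and>
     (\<forall>\<alpha>. f \<alpha> = (\<Sum>lam | c lam \<noteq> 0. c lam * power_sum_partition lam \<alpha>)))"

text \<open>
  The bilinear form with
  \<open>\<langle>p\<^sub>\<lambda>, p\<^sub>\<mu>\<rangle> = \<delta>\<^sub>\<lambda>\<^sub>\<mu> z\<^sub>\<lambda> \<Prod>\<^sub>i (1 - q^\<lambda>\<^sub>i) / (1 - t^\<lambda>\<^sub>i)\<close>.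
\<close>

definition macdonald_inner :: "real \<Rightarrow> real \<Rightarrow> series \<Rightarrow> series \<Rightarrow> real" where
  "macdonald_inner q t f g =
     (\<Sum>lam | power_sum_coeff f lam \<noteq> 0 \<and> power_sum_coeff g lam \<noteq> 0.
        power_sum_coeff f lam * power_sum_coeff g lam *
        (z_factor lam * (\<Prod>i<plength lam. (1 - q ^ part lam i) / (1 - t ^ part lam i))))"


section \<open>Macdonald functions\<close>

text \<open>
  The Macdonald functions are the family that is unitriangular with respect to the monomial
  symmetric functions in dominance order, and orthogonal. The Hall-Littlewood functions are the
  case \<open>q = 0\<close>. The definitions below are meant for numerical \<open>q, t\<close> in \<open>[0, 1)\<close>, where the
  bilinear form is positive definite.
\<close>

definition macdonald_family :: "real \<Rightarrow> real \<Rightarrow> (partition \<Rightarrow> series) \<Rightarrow> bool" where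
  "macdonald_family q t P \<longleftrightarrow>
     (\<forall>lam. \<exists>c. \<forall>\<alpha>. P lam \<alpha> = monomial_sym lam \<alpha> +
        (\<Sum>mu | dominated mu lam \<and> mu \<noteq> lam. c mu * monomial_sym mu \<alpha>)) \<and>
     (\<forall>lam mu. lam \<noteq> mu \<longrightarrow> macdonald_inner q t (P lam) (P mu) = 0)"

definition macdonald_P :: "real \<Rightarrow> real \<Rightarrow> partition \<Rightarrow> series" where
  "macdonald_P q t = (THE P. macdonald_family q t P)"

definition macdonald_Q :: "real \<Rightarrow> real \<Rightarrow> partition \<Rightarrow> series" where
  "macdonald_Q q t = (THE Q. (\<forall>mu. symmetric_function (Q mu)) \<and>
     (\<forall>lam mu. macdonald_inner q t (macdonald_P q t lam) (Q mu) = (if lam = mu then 1 else 0)))"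

definition skew_P :: "real \<Rightarrow> real \<Rightarrow> partition \<Rightarrow> partition \<Rightarrow> series" where
  "skew_P q t lam mu = (THE f. symmetric_function f \<and>
     (\<forall>nu. macdonald_inner q t f (macdonald_Q q t nu) =
           macdonald_inner q t (macdonald_P q t lam)
             (series_mult (macdonald_Q q t mu) (macdonald_Q q t nu))))"

definition skew_Q :: "real \<Rightarrow> real \<Rightarrow> partition \<Rightarrow> partition \<Rightarrow> series" where
  "skew_Q q t lam mu = (THE f. symmetric_function f \<and>
     (\<forall>nu. macdonald_inner q t f (macdonald_P q t nu) =
           macdonald_inner q t (macdonald_Q q t lam)
             (series_mult (macdonald_P q t mu) (macdonald_P q t nu))))"


section \<open>The periodic Hall-Littlewood process\<close>

definition qpoch :: "real \<Rightarrow> real \<Rightarrow> nat \<Rightarrow> real" where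
  "qpoch z u k = (\<Prod>m<k. 1 - u ^ m * z)"

definition qpoch_inf :: "real \<Rightarrow> real \<Rightarrow> real" where
  "qpoch_inf z u = (\<Prod>m. 1 - u ^ m * z)"

definition phl_normalization :: "real list \<Rightarrow> real list \<Rightarrow> real \<Rightarrow> real \<Rightarrow> real" where
  "phl_normalization a b t u =
     1 / qpoch_inf u u *
     (\<Prod>i<length a. \<Prod>j<length b.
        \<Prod>l. (1 - t * u ^ l * (a ! i) * (b ! j)) / (1 - u ^ l * (a ! i) * (b ! j)))"

text \<open>
  The state is a pair of lists \<open>[\<lambda>\<^sup>(\<^sup>0\<^sup>), \<dots>, \<lambda>\<^sup>(\<^sup>M\<^sup>)]\<close> and \<open>[\<mu>\<^sup>(\<^sup>0\<^sup>), \<dots>, \<mu>\<^sup>(\<^sup>N\<^sup>)]\<close>, while the lists of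
  parameters start with \<open>a\<^sub>1\<close> and \<open>b\<^sub>1\<close>; hence \<open>a ! i\<close> goes with the step from \<open>\<lambda>\<^sup>(\<^sup>i\<^sup>)\<close> to \<open>\<lambda>\<^sup>(\<^sup>i\<^sup>+\<^sup>1\<^sup>)\<close>.
\<close>

definition phl_sequences :: "nat \<Rightarrow> nat \<Rightarrow> (partition list \<times> partition list) set" where
  "phl_sequences M N = {(lam, mu).
     length lam = M + 1 \<and> length mu = N + 1 \<and>
     (\<forall>i<M. diagram_subset (lam ! i) (lam ! (i + 1))) \<and>
     (\<forall>j<N. diagram_subset (mu ! j) (mu ! (j + 1))) \<and>
     mu ! 0 = lam ! 0 \<and> mu ! N = lam ! M}"

definition phl_weight ::
    "real list \<Rightarrow> real list \<Rightarrow> real \<Rightarrow> real \<Rightarrow> partition list \<times> partition list \<Rightarrow> real" where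
  "phl_weight a b t u = (\<lambda>(lam, mu).
     if (lam, mu) \<in> phl_sequences (length a) (length b) then
       u ^ psize (mu ! 0) / phl_normalization a b t u *
       (\<Prod>i<length a. eval_single (skew_P 0 t (lam ! (i + 1)) (lam ! i)) (a ! i)) *
       (\<Prod>j<length b. eval_single (skew_Q 0 t (mu ! (j + 1)) (mu ! j)) (b ! j))
     else 0)"

definition periodic_hall_littlewood ::
    "real list \<Rightarrow> real list \<Rightarrow> real \<Rightarrow> real \<Rightarrow> (partition list \<times> partition list) pmf" where
  "periodic_hall_littlewood a b t u = embed_pmf (phl_weight a b t u)"

text \<open>Vectors over \<open>{0, 1}\<close> are lists of Booleans, with \<open>True\<close> for 1.\<close>

definition length_jumps :: "partition list \<Rightarrow> bool list" where
  "length_jumps lam = map (\<lambda>i. plength (lam ! (i + 1)) > plength (lam ! i)) [0..<length lam - 1]"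

definition length_jumps_compl :: "partition list \<Rightarrow> bool list" where
  "length_jumps_compl mu = map Not (length_jumps mu)"


section \<open>The stochastic six vertex model\<close>

text \<open>
  The arguments of \<open>vertex_weight\<close> after \<open>t\<close> are the product \<open>x\<close> of the column and row rapidities
  and the occupation of the bottom, left (incoming), top and right (outgoing) edges.
\<close>

definition vertex_weight :: "real \<Rightarrow> real \<Rightarrow> bool \<Rightarrow> bool \<Rightarrow> bool \<Rightarrow> bool \<Rightarrow> real" where
  "vertex_weight t x bi li to ro =
     (let p = (1 - x) / (1 - t * x) in
      case (bi, li, to, ro) of
        (False, False, False, False) \<Rightarrow> 1
      | (True, True, True, True) \<Rightarrow> 1
      | (False, True, False, True) \<Rightarrow> p
      | (False, True, True, False) \<Rightarrow> 1 - p
      | (True, False, True, False) \<Rightarrow> t * p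
      | (True, False, False, True) \<Rightarrow> 1 - t * p
      | _ \<Rightarrow> 0)"

text \<open>
  Columns and rows are indexed from 0. A configuration is the pair \<open>(V, H)\<close> of its sets of occupied
  vertical and horizontal edges. The vertex in column \<open>i\<close> and row \<open>j\<close> has bottom edge \<open>(i, j)\<close>
  and top edge \<open>(i, j + 1)\<close> in \<open>V\<close>, left edge \<open>(i, j)\<close> and right edge \<open>(i + 1, j)\<close> in \<open>H\<close>.
\<close>

type_synonym config = "(nat \<times> nat) set \<times> (nat \<times> nat) set"

definition configs :: "nat \<Rightarrow> nat \<Rightarrow> bool list \<Rightarrow> bool list \<Rightarrow> config set" where
  "configs M N bottom left = {(V, H).
     V \<subseteq> {..<M} \<times> {..N} \<and> H \<subseteq> {..M} \<times> {..<N} \<and>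
     (\<forall>i<M. (i, 0) \<in> V \<longleftrightarrow> bottom ! i) \<and> (\<forall>j<N. (0, j) \<in> H \<longleftrightarrow> left ! j)}"

definition config_weight :: "real list \<Rightarrow> real list \<Rightarrow> real \<Rightarrow> config \<Rightarrow> real" where
  "config_weight a b t = (\<lambda>(V, H). \<Prod>i<length a. \<Prod>j<length b.
     vertex_weight t (a ! i * b ! j)
       ((i, j) \<in> V) ((i, j) \<in> H) ((i, j + 1) \<in> V) ((i + 1, j) \<in> H))"

definition six_vertex ::
    "real list \<Rightarrow> real list \<Rightarrow> real \<Rightarrow> bool list \<Rightarrow> bool list \<Rightarrow> config pmf" where
  "six_vertex a b t bottom left = embed_pmf (\<lambda>c.
     if c \<in> configs (length a) (length b) bottom left then config_weight a b t c else 0)"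

definition top_output :: "nat \<Rightarrow> nat \<Rightarrow> config \<Rightarrow> bool list" where
  "top_output M N = (\<lambda>(V, H). map (\<lambda>i. (i, N) \<in> V) [0..<M])"

definition right_output :: "nat \<Rightarrow> nat \<Rightarrow> config \<Rightarrow> bool list" where
  "right_output M N = (\<lambda>(V, H). map (\<lambda>j. (M, j) \<in> H) [0..<N])"

text \<open>
  \<open>run_rectangles a b t u l (w, bottom, left)\<close> passes the arrows \<open>bottom\<close> and \<open>left\<close> successively
  through the rectangles \<open>l, l - 1, \<dots>, 1\<close>, where rectangle \<open>k\<close> has column rapidities \<open>u^(k-1) * a\<^sub>i\<close>. It adds
  to \<open>w\<close> the number of arrows entering these rectangles from below, and returns this number together
  with the top and right outputs of rectangle 1.
\<close>

primrec run_rectangles ::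
    "real list \<Rightarrow> real list \<Rightarrow> real \<Rightarrow> real \<Rightarrow> nat \<Rightarrow>
     nat \<times> bool list \<times> bool list \<Rightarrow> (nat \<times> bool list \<times> bool list) pmf" where
  "run_rectangles a b t u 0 s = return_pmf s"
| "run_rectangles a b t u (Suc l) s = (case s of (w, bottom, left) \<Rightarrow>
     six_vertex (map (\<lambda>x. u ^ l * x) a) b t bottom left \<bind>
       (\<lambda>c. run_rectangles a b t u l
         (w + count_list bottom True,
          top_output (length a) (length b) c, right_output (length a) (length b) c)))"

text \<open>The joint law of \<open>(W, S\<^sub>1, S\<^sub>2)\<close> for the model of length \<open>L \<ge> 1\<close>.\<close>

definition quasi_periodic_law ::
    "real list \<Rightarrow> real list \<Rightarrow> real \<Rightarrow> real \<Rightarrow> nat \<Rightarrow> (nat \<times> bool list \<times> bool list) pmf" where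
  "quasi_periodic_law a b t u L =
     run_rectangles a b t u L (0, replicate (length a) False, replicate (length b) True)"

text \<open>
  Convergence in distribution for laws on a discrete space, where every bounded function is a
  bounded continuous test function.
\<close>

definition converges_in_distribution :: "(nat \<Rightarrow> 'a pmf) \<Rightarrow> 'a pmf \<Rightarrow> bool" where
  "converges_in_distribution X Y \<longleftrightarrow>
     (\<forall>f :: 'a \<Rightarrow> real. bounded (range f) \<longrightarrow>
        (\<lambda>L. measure_pmf.expectation (X L) f) \<longlonglongrightarrow> measure_pmf.expectation Y f)"

definition u_geometric :: "real \<Rightarrow> nat pmf" where
  "u_geometric u = embed_pmf (\<lambda>k. u ^ k * (qpoch_inf u u / qpoch u u k))"

end

theory Submission
  imports Defs
begin

text \<open>
  In one variable the skew functions \<open>P\<^sub>\<lambda>\<^sub>/\<^sub>\<mu>\<close> and \<open>Q\<^sub>\<lambda>\<^sub>/\<^sub>\<mu>\<close> have explicit product coefficients. The skew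
  Cauchy identity for them, refined by whether each of the two strips changes the length, has the
  six vertex weights as transition coefficients. Iterated over an \<open>M \<times> N\<close> rectangle it moves all
  \<open>Q\<close>-steps past all \<open>P\<close>-steps, and the bits recording the length jumps are transformed by the
  rectangle. Closing up periodically turns \<open>a\<close> into \<open>u a\<close>, so the joint law of
  \<open>(l(\<lambda>\<^sup>(\<^sup>0\<^sup>)), [\<lambda>], [\<mu>]\<^sup>c)\<close> with parameters \<open>a\<close> is the image of the law with parameters \<open>u a\<close> under one
  rectangle. After \<open>L\<close> rectangles the parameters \<open>u\<^sup>L a\<close> are so small that the process is nearly
  constant, with \<open>l(\<lambda>\<^sup>(\<^sup>0\<^sup>))\<close> nearly \<open>u\<close>-geometric. This gives the identity in the limit, and
  deconvolving by the geometric variable shows that the limit law exists.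
\<close>

section \<open>Column lengths and the refined skew Cauchy identity\<close>

text \<open>The skew functions are defined only through \<open>THE\<close> and a bilinear form, so
  their coefficients cannot be read off. The functions \<open>hall_P\<close> are built from the
  branching coefficients instead and identified with the defined ones through the Cauchy kernel. It
  is expanded in power sums by Newton identities and in \<open>hall_P\<close> by the Pieri rule;
  comparing both gives orthogonality. The Pieri rule is itself the skew Cauchy identity with the
  length bits forgotten, so one local identity feeds the algebra and the probability. Columns rather
  than rows are the coordinates because a horizontal strip then adds 0 or 1 in each coordinate, the
  weights couple only neighbouring columns, and the length is coordinate 0: the length bits are
  boundary data of the column recursion. The other obstacle is summability. A relation between the
  sum at \<open>a\<close> and the sum at \<open>u a\<close> in the extended reals says nothing if
  both are infinite. Truncated sums are finite but satisfy only an inequality, which suffices for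
  the upper bound; constant sequences give the lower one.\<close>

definition finsupp :: "(nat \<Rightarrow> nat) \<Rightarrow> bool" where
  "finsupp c \<longleftrightarrow> finite {j. c j \<noteq> 0}"

definition strip :: "(nat \<Rightarrow> nat) \<Rightarrow> (nat \<Rightarrow> nat) \<Rightarrow> bool" where
  "strip lam mu \<longleftrightarrow> (\<forall>j. lam j = mu j \<or> lam j = Suc (mu j))"

definition strip_size :: "(nat \<Rightarrow> nat) \<Rightarrow> (nat \<Rightarrow> nat) \<Rightarrow> nat" where
  "strip_size lam mu = card {j. lam j = Suc (mu j)}"

text \<open>The coefficient of a horizontal strip in the one-variable branching rule of
  Hall-Littlewood functions, in column coordinates. Entry \<open>j\<close> of a sequence is the
  length of column \<open>j + 1\<close>, so the exponent \<open>mu j - mu (Suc j)\<close> is the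
  multiplicity of the part \<open>j + 1\<close> in the smaller partition. \<open>phi_col\<close> is
  the counterpart for the dual functions and reads multiplicities in the larger partition.\<close>

definition psi_col :: "real \<Rightarrow> (nat \<Rightarrow> nat) \<Rightarrow> (nat \<Rightarrow> nat) \<Rightarrow> real" where
  "psi_col t lam mu =
     (\<Prod>j | lam j = mu j \<and> lam (Suc j) = Suc (mu (Suc j)). 1 - t ^ (mu j - mu (Suc j)))"

definition phi_col :: "real \<Rightarrow> (nat \<Rightarrow> nat) \<Rightarrow> (nat \<Rightarrow> nat) \<Rightarrow> real" where
  "phi_col t lam mu =
     (\<Prod>j | lam j = Suc (mu j) \<and> lam (Suc j) = mu (Suc j). 1 - t ^ (lam j - lam (Suc j)))"

definition wP :: "real \<Rightarrow> real \<Rightarrow> (nat \<Rightarrow> nat) \<Rightarrow> (nat \<Rightarrow> nat) \<Rightarrow> real" where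
  "wP t a lam mu = psi_col t lam mu * a ^ strip_size lam mu"

definition wQ :: "real \<Rightarrow> real \<Rightarrow> (nat \<Rightarrow> nat) \<Rightarrow> (nat \<Rightarrow> nat) \<Rightarrow> real" where
  "wQ t b lam mu = phi_col t lam mu * b ^ strip_size lam mu"

lemma Collect_nat_shift:
  "{j. P j} = (if P 0 then {0} else {}) \<union> Suc ` {j. P (Suc j)}"
proof -
  have "j \<in> Suc ` {j. P (Suc j)}" if "P j" "j \<noteq> 0" for j
    using that by (cases j) auto
  then show ?thesis by (auto split: if_splits)
qed

lemma prod_nat_shift:
  assumes "finite {j. P j}"
  shows "(\<Prod>j | P j. f j) = (if P 0 then f 0 else (1::real)) * (\<Prod>j | P (Suc j). f (Suc j))"
proof -
  have fin: "finite {j. P (Suc j)}"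
    using finite_vimageI[OF assms, of Suc] by (simp add: vimage_def)
  have "(\<Prod>j | P j. f j) = (\<Prod>j\<in>(if P 0 then {0} else {}) \<union> Suc ` {j. P (Suc j)}. f j)"
    by (subst Collect_nat_shift) simp
  also have "\<dots> = (\<Prod>j\<in>(if P 0 then {0} else {}). f j) * (\<Prod>j\<in>Suc ` {j. P (Suc j)}. f j)"
    by (intro prod.union_disjoint) (auto simp: fin)
  also have "(\<Prod>j\<in>Suc ` {j. P (Suc j)}. f j) = (\<Prod>j | P (Suc j). f (Suc j))"
    by (subst prod.reindex) auto
  finally show ?thesis by simp
qed

lemma card_nat_shift:
  assumes "finite {j. P j}"
  shows "card {j. P j} = (if P 0 then 1 else 0) + card {j. P (Suc j)}"
proof -
  have fin: "finite {j. P (Suc j)}"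
    using finite_vimageI[OF assms, of Suc] by (simp add: vimage_def)
  have "card {j. P j} = card ((if P 0 then {0} else {}) \<union> Suc ` {j. P (Suc j)})"
    by (subst Collect_nat_shift) simp
  also have "\<dots> = card (if P 0 then {0::nat} else {}) + card (Suc ` {j. P (Suc j)})"
    by (intro card_Un_disjoint) (auto simp: fin)
  finally show ?thesis by (simp add: card_image)
qed

lemma finsupp_shift: "finsupp c \<Longrightarrow> finsupp (\<lambda>j. c (Suc j))"
  unfolding finsupp_def using finite_vimageI[of "{j. c j \<noteq> 0}" Suc] by (simp add: vimage_def)

lemma finsupp_unshift: "finsupp (\<lambda>j. c (Suc j)) \<Longrightarrow> finsupp c"
  unfolding finsupp_def by (subst Collect_nat_shift) auto

lemma finite_strip_sets:
  assumes "finsupp lam"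
  shows "finite {j. lam j = Suc (mu j)}"
    "finite {j. lam j = mu j \<and> lam (Suc j) = Suc (mu (Suc j))}"
    "finite {j. lam j = Suc (mu j) \<and> lam (Suc j) = mu (Suc j)}"
proof -
  show 1: "finite {j. lam j = Suc (mu j)}"
    using assms unfolding finsupp_def by (rule finite_subset[rotated]) auto
  have "finite {j. lam (Suc j) = Suc (mu (Suc j))}"
    using finite_vimageI[OF 1, of Suc] by (simp add: vimage_def)
  then show "finite {j. lam j = mu j \<and> lam (Suc j) = Suc (mu (Suc j))}"
    by (rule finite_subset[rotated]) auto
  show "finite {j. lam j = Suc (mu j) \<and> lam (Suc j) = mu (Suc j)}"
    using 1 by (rule finite_subset[rotated]) auto
qed

text \<open>The weight is a transfer-matrix product: column 0 enters only through its own power of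
  \<open>a\<close> and the factor linking it to column 1. Sums over strips can therefore be computed
  by removing one column at a time.\<close>

lemma wP_shift:
  assumes "finsupp lam"
  shows "wP t a lam mu = (if lam 0 = Suc (mu 0) then a else 1) *
    (if lam 0 = mu 0 \<and> lam (Suc 0) = Suc (mu (Suc 0)) then 1 - t ^ (mu 0 - mu (Suc 0)) else 1) *
    wP t a (\<lambda>j. lam (Suc j)) (\<lambda>j. mu (Suc j))"
  unfolding wP_def psi_col_def strip_size_def
  by (subst prod_nat_shift, simp add: finite_strip_sets[OF assms],
      subst card_nat_shift, simp add: finite_strip_sets[OF assms]) simp

lemma wQ_shift:
  assumes "finsupp lam"
  shows "wQ t b lam mu = (if lam 0 = Suc (mu 0) then b else 1) *
    (if lam 0 = Suc (mu 0) \<and> lam (Suc 0) = mu (Suc 0) then 1 - t ^ (lam 0 - lam (Suc 0)) else 1) *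
    wQ t b (\<lambda>j. lam (Suc j)) (\<lambda>j. mu (Suc j))"
  unfolding wQ_def phi_col_def strip_size_def
  by (subst prod_nat_shift, simp add: finite_strip_sets[OF assms],
      subst card_nat_shift, simp add: finite_strip_sets[OF assms]) simp

definition upper :: "bool \<Rightarrow> bool \<Rightarrow> (nat \<Rightarrow> nat) \<Rightarrow> (nat \<Rightarrow> nat) \<Rightarrow> (nat \<Rightarrow> nat) set" where
  "upper s r mu nu = {lam. finsupp lam \<and> strip lam mu \<and> strip lam nu \<and>
     lam 0 = mu 0 + of_bool s \<and> lam 0 = nu 0 + of_bool r}"

definition lower :: "bool \<Rightarrow> bool \<Rightarrow> (nat \<Rightarrow> nat) \<Rightarrow> (nat \<Rightarrow> nat) \<Rightarrow> (nat \<Rightarrow> nat) set" where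
  "lower s r mu nu = {kap. finsupp kap \<and> strip nu kap \<and> strip mu kap \<and>
     nu 0 = kap 0 + of_bool s \<and> mu 0 = kap 0 + of_bool r}"

lemma strip_shift_iff:
  "strip lam mu \<longleftrightarrow> (lam 0 = mu 0 \<or> lam 0 = Suc (mu 0)) \<and> strip (\<lambda>j. lam (Suc j)) (\<lambda>j. mu (Suc j))"
  unfolding strip_def by (metis nat.exhaust)

lemma upper_eq_image:
  assumes "mu 0 + of_bool s = nu 0 + of_bool r"
  shows "upper s r mu nu = case_nat (mu 0 + of_bool s) `
    (\<Union>(s', r')\<in>UNIV. upper s' r' (\<lambda>j. mu (Suc j)) (\<lambda>j. nu (Suc j)))" (is "_ = ?f ` ?U")
proof (intro set_eqI iffI)
  fix lam assume lam: "lam \<in> upper s r mu nu"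
  let ?l = "\<lambda>j. lam (Suc j)"
  have eq: "lam = ?f ?l"
    using lam by (auto simp: upper_def fun_eq_iff split: nat.split)
  have st: "strip ?l (\<lambda>j. mu (Suc j))" "strip ?l (\<lambda>j. nu (Suc j))" and "finsupp ?l"
    using lam strip_shift_iff[of lam mu] strip_shift_iff[of lam nu] unfolding upper_def by (auto intro: finsupp_shift)
  moreover obtain s' r' where "?l 0 = mu (Suc 0) + of_bool s'" "?l 0 = nu (Suc 0) + of_bool r'"
    using st unfolding strip_def by (metis add.right_neutral add_Suc_right of_bool_eq(1,2) One_nat_def)
  ultimately have "?l \<in> upper s' r' (\<lambda>j. mu (Suc j)) (\<lambda>j. nu (Suc j))"
    by (auto simp: upper_def)
  then show "lam \<in> ?f ` ?U" using eq by blast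
next
  fix lam assume "lam \<in> ?f ` ?U"
  then obtain l s' r' where lam: "lam = ?f l" and l: "l \<in> upper s' r' (\<lambda>j. mu (Suc j)) (\<lambda>j. nu (Suc j))"
    by blast
  have "finsupp lam"
    by (rule finsupp_unshift) (use l lam in \<open>simp add: upper_def\<close>)
  moreover have "strip lam mu" "strip lam nu"
    unfolding strip_shift_iff[of lam]
    using l assms by (cases s; cases r; auto simp: upper_def lam)+
  ultimately show "lam \<in> upper s r mu nu"
    using lam assms by (simp add: upper_def)
qed

lemma lower_eq_image:
  assumes "nu 0 = v + of_bool s" "mu 0 = v + of_bool r"
  shows "lower s r mu nu = case_nat v `
    (\<Union>(s', r')\<in>UNIV. lower s' r' (\<lambda>j. mu (Suc j)) (\<lambda>j. nu (Suc j)))" (is "_ = ?f ` ?U")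
proof (intro set_eqI iffI)
  fix kap assume kap: "kap \<in> lower s r mu nu"
  let ?l = "\<lambda>j. kap (Suc j)"
  have eq: "kap = ?f ?l"
    using kap assms by (auto simp: lower_def fun_eq_iff split: nat.split)
  have st: "strip (\<lambda>j. mu (Suc j)) ?l" "strip (\<lambda>j. nu (Suc j)) ?l" and "finsupp ?l"
    using kap strip_shift_iff[of mu kap] strip_shift_iff[of nu kap] unfolding lower_def by (auto intro: finsupp_shift)
  moreover obtain s' r' where "nu (Suc 0) = ?l 0 + of_bool s'" "mu (Suc 0) = ?l 0 + of_bool r'"
    using st unfolding strip_def by (metis add.right_neutral add_Suc_right of_bool_eq(1,2) One_nat_def)
  ultimately have "?l \<in> lower s' r' (\<lambda>j. mu (Suc j)) (\<lambda>j. nu (Suc j))"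
    by (auto simp: lower_def)
  then show "kap \<in> ?f ` ?U" using eq by blast
next
  fix kap assume "kap \<in> ?f ` ?U"
  then obtain l s' r' where kap: "kap = ?f l" and l: "l \<in> lower s' r' (\<lambda>j. mu (Suc j)) (\<lambda>j. nu (Suc j))"
    by blast
  have "finsupp kap"
    by (rule finsupp_unshift) (use l kap in \<open>simp add: lower_def\<close>)
  moreover have "strip mu kap" "strip nu kap"
    unfolding strip_shift_iff[of mu kap] strip_shift_iff[of nu kap]
    using l assms by (cases s; cases r; auto simp: lower_def kap)+
  ultimately show "kap \<in> lower s r mu nu"
    using kap assms by (simp add: lower_def)
qed

lemma inj_on_case_nat: "inj_on (case_nat v) X"
proof (rule inj_onI)
  fix f g assume eq: "case_nat v f = case_nat v g"
  show "f = g"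
  proof
    fix j show "f j = g j" using fun_cong[OF eq, of "Suc j"] by simp
  qed
qed

lemma has_sum_bool_UN:
  fixes f :: "'a \<Rightarrow> real"
  assumes "\<And>s r. (f has_sum F s r) (A s r)"
    and "\<And>s r s' r'. (s, r) \<noteq> (s', r') \<Longrightarrow> A s r \<inter> A s' r' = {}"
  shows "(f has_sum (F False False + F True True + F True False + F False True)) (\<Union>(s, r)\<in>UNIV. A s r)"
proof -
  have eq: "(\<Union>(s, r)\<in>UNIV. A s r) = ((A False False \<union> A True True) \<union> A True False) \<union> A False True"
    (is "?l = ?r")
  proof -
    have "(\<Union>(s, r)\<in>UNIV. A s r) = (\<Union>s. \<Union>r. A s r)" by auto
    then show ?thesis by (auto simp: UNIV_bool)
  qed
  have d: "A False False \<inter> A True True = {}" "(A False False \<union> A True True) \<inter> A True False = {}"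
    "((A False False \<union> A True True) \<union> A True False) \<inter> A False True = {}"
    using assms(2)[of False False True True] assms(2)[of False False True False]
      assms(2)[of True True True False] assms(2)[of False False False True]
      assms(2)[of True True False True] assms(2)[of True False False True] by auto
  show ?thesis
    unfolding eq
    by (intro has_sum_Un_disjoint assms(1) d)
qed

text \<open>The factor of column 0, given whether column 0 grows (\<open>s\<close>,
  \<open>r\<close>) and whether column 1 grows (\<open>s'\<close>, \<open>r'\<close>). The argument
  \<open>m\<close> is the difference of these two columns, taken in the smaller partition for
  \<open>locP\<close> and in the larger one for \<open>locQ\<close>.\<close>

definition locP :: "real \<Rightarrow> real \<Rightarrow> bool \<Rightarrow> bool \<Rightarrow> nat \<Rightarrow> real" where
  "locP t a s s' m = (if s then a else if s' then 1 - t ^ m else 1)"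

definition locQ :: "real \<Rightarrow> real \<Rightarrow> bool \<Rightarrow> bool \<Rightarrow> nat \<Rightarrow> real" where
  "locQ t b r r' m = (if r then (if r' then b else b * (1 - t ^ m)) else 1)"

text \<open>The argument \<open>Suc (nu 0) - nu 1\<close> is read only when column 0 grows over
  \<open>nu\<close> and column 1 does not, and there it equals \<open>lam 0 - lam 1\<close>.\<close>

lemma upper_step:
  fixes mu nu :: "nat \<Rightarrow> nat" and t a b :: real
  defines "mu' \<equiv> \<lambda>j. mu (Suc j)" and "nu' \<equiv> \<lambda>j. nu (Suc j)"
  assumes IH: "\<And>s r. ((\<lambda>lam. wP t a lam mu' * wQ t b lam nu') has_sum L s r) (upper s r mu' nu')"
    and "mu 0 + of_bool s = nu 0 + of_bool r"
  shows "((\<lambda>lam. wP t a lam mu * wQ t b lam nu) has_sum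
     (let c = (\<lambda>s' r'. locP t a s s' (mu 0 - mu 1) * locQ t b r r' (Suc (nu 0) - nu 1) * L s' r') in
       c False False + c True True + c True False + c False True)) (upper s r mu nu)"
proof -
  let ?f = "case_nat (mu 0 + of_bool s)"
  let ?c = "\<lambda>s' r'. locP t a s s' (mu 0 - mu 1) * locQ t b r r' (Suc (nu 0) - nu 1)"
  let ?W = "\<lambda>lam. wP t a lam mu * wQ t b lam nu"
  have inj: "inj_on ?f X" for X :: "(nat \<Rightarrow> nat) set"
    by (rule inj_on_case_nat)
  have val: "?W (?f l) = ?c s' r' * (wP t a l mu' * wQ t b l nu')" if "l \<in> upper s' r' mu' nu'" for l s' r'
  proof -
    have fs: "finsupp (?f l)"
      by (rule finsupp_unshift) (use that in \<open>simp add: upper_def\<close>)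
    have l0: "l 0 = mu (Suc 0) + of_bool s'" "l 0 = nu (Suc 0) + of_bool r'"
      using that by (auto simp: upper_def mu'_def nu'_def)
    have 1: "wP t a (?f l) mu = locP t a s s' (mu 0 - mu 1) * wP t a l mu'"
      by (subst wP_shift[OF fs]) (use l0(1) in \<open>auto simp: locP_def mu'_def\<close>)
    have 2: "wQ t b (?f l) nu = locQ t b r r' (Suc (nu 0) - nu 1) * wQ t b l nu'"
      by (subst wQ_shift[OF fs]) (use l0(2) assms(4) in \<open>auto simp: locQ_def nu'_def\<close>)
    show ?thesis unfolding 1 2 by simp
  qed
  have "((?W \<circ> ?f) has_sum ?c s' r' * L s' r') (upper s' r' mu' nu')" for s' r'
    using has_sum_cmult_right[OF IH[of s' r'], of "?c s' r'"]
    by (subst has_sum_cong[where g = "\<lambda>l. ?c s' r' * (wP t a l mu' * wQ t b l nu')"])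
       (use val in auto)
  then have "((?W \<circ> ?f) has_sum (?c False False * L False False + ?c True True * L True True +
      ?c True False * L True False + ?c False True * L False True)) (\<Union>(s', r')\<in>UNIV. upper s' r' mu' nu')"
    by (rule has_sum_bool_UN) (auto simp: upper_def)
  then show ?thesis
    unfolding upper_eq_image[of mu s nu r, OF assms(4)] Let_def
    by (subst has_sum_reindex[OF inj]) (simp add: mu'_def nu'_def)
qed

text \<open>Here the smaller partition is the summation variable. \<open>locP\<close> reads its
  argument only when column 0 is unchanged and column 1 grows, and then \<open>kap 0 - kap 1\<close>
  is \<open>Suc (nu 0) - nu 1\<close>.\<close>

lemma lower_step:
  fixes mu nu :: "nat \<Rightarrow> nat" and t a b :: real
  defines "mu' \<equiv> \<lambda>j. mu (Suc j)" and "nu' \<equiv> \<lambda>j. nu (Suc j)"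
  assumes IH: "\<And>s r. ((\<lambda>kap. wP t a nu' kap * wQ t b mu' kap) has_sum R s r) (lower s r mu' nu')"
    and v: "nu 0 = v + of_bool s" "mu 0 = v + of_bool r" and fs: "finsupp mu" "finsupp nu"
  shows "((\<lambda>kap. wP t a nu kap * wQ t b mu kap) has_sum
     (let c = (\<lambda>s' r'. locP t a s s' (Suc (nu 0) - nu 1) * locQ t b r r' (mu 0 - mu 1) * R s' r') in
       c False False + c True True + c True False + c False True)) (lower s r mu nu)"
proof -
  let ?f = "case_nat v"
  let ?c = "\<lambda>s' r'. locP t a s s' (Suc (nu 0) - nu 1) * locQ t b r r' (mu 0 - mu 1)"
  let ?W = "\<lambda>kap. wP t a nu kap * wQ t b mu kap"
  have inj: "inj_on ?f X" for X :: "(nat \<Rightarrow> nat) set"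
    by (rule inj_on_case_nat)
  have val: "?W (?f l) = ?c s' r' * (wP t a nu' l * wQ t b mu' l)" if "l \<in> lower s' r' mu' nu'" for l s' r'
  proof -
    have l0: "nu (Suc 0) = l 0 + of_bool s'" "mu (Suc 0) = l 0 + of_bool r'"
      using that by (auto simp: lower_def mu'_def nu'_def)
    have 1: "wP t a nu (?f l) = locP t a s s' (Suc (nu 0) - nu 1) * wP t a nu' l"
      by (subst wP_shift[OF fs(2)]) (use l0(1) v in \<open>auto simp: locP_def nu'_def\<close>)
    have 2: "wQ t b mu (?f l) = locQ t b r r' (mu 0 - mu 1) * wQ t b mu' l"
      by (subst wQ_shift[OF fs(1)]) (use l0(2) v in \<open>auto simp: locQ_def mu'_def\<close>)
    show ?thesis unfolding 1 2 by simp
  qed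
  have "((?W \<circ> ?f) has_sum ?c s' r' * R s' r') (lower s' r' mu' nu')" for s' r'
    using has_sum_cmult_right[OF IH[of s' r'], of "?c s' r'"]
    by (subst has_sum_cong[where g = "\<lambda>l. ?c s' r' * (wP t a nu' l * wQ t b mu' l)"])
       (use val in auto)
  then have "((?W \<circ> ?f) has_sum (?c False False * R False False + ?c True True * R True True +
      ?c True False * R True False + ?c False True * R False True)) (\<Union>(s', r')\<in>UNIV. lower s' r' mu' nu')"
    by (rule has_sum_bool_UN) (auto simp: lower_def)
  then show ?thesis
    unfolding lower_eq_image[of nu v s mu r, OF v] Let_def
    by (subst has_sum_reindex[OF inj]) (simp add: mu'_def nu'_def)
qed

lemma has_sum_superset_zero:
  fixes f :: "'a \<Rightarrow> real"
  assumes "(f has_sum x) A" "A \<subseteq> B" "\<And>y. y \<in> B - A \<Longrightarrow> f y = 0"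
  shows "(f has_sum x) B"
  using iffD1[OF has_sum_cong_neutral[of B A f f x]] assms by blast

text \<open>Over two empty partitions \<open>lam\<close> is a 0-1 sequence, and a 0 followed by a 1
  produces the factor \<open>1 - t ^ 0\<close>. What survives are the one-row partitions; the one of
  length \<open>k > 0\<close> has weight \<open>(a * b) ^ k * (1 - t)\<close>, and a geometric
  series sums them.\<close>

lemma upper_base:
  fixes t a b :: real
  assumes x: "\<bar>a * b\<bar> < 1"
  defines "w \<equiv> (1 - t) / (1 - a * b)"
  shows "((\<lambda>lam. wP t a lam (\<lambda>_. 0) * wQ t b lam (\<lambda>_. 0)) has_sum
     (if s \<noteq> r then 0 else if s then a * b * w else 1)) (upper s r (\<lambda>_. 0) (\<lambda>_. 0))"
proof -
  let ?W = "\<lambda>lam. wP t a lam (\<lambda>_. 0) * wQ t b lam (\<lambda>_. 0)"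
  define blk where "blk r = (\<lambda>j. of_bool (j < r) :: nat)" for r :: nat
  have finblk: "finsupp (blk r)" for r
    by (auto simp: finsupp_def blk_def)
  have blk_Suc: "(\<lambda>j. blk (Suc r) (Suc j)) = blk r" "(\<lambda>j. blk 0 (Suc j)) = blk 0" for r
    by (auto simp: blk_def)
  have W0: "?W (blk 0) = 1"
    by (simp add: wP_def wQ_def psi_col_def phi_col_def strip_size_def blk_def)
  have W1: "?W (blk (Suc r)) = (a * b) ^ Suc r * (1 - t)" for r
  proof (induction r)
    case 0
    then show ?case using W0
      by (subst wP_shift[OF finblk], subst wQ_shift[OF finblk]) (simp add: blk_Suc, simp add: blk_def)
  next
    case (Suc r)
    have "?W (blk (Suc (Suc r))) = a * b * ?W (blk (Suc r))"
      by (subst wP_shift[OF finblk], subst wQ_shift[OF finblk]) (simp add: blk_Suc, simp add: blk_def)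
    then show ?case using Suc.IH by simp
  qed
  have zero: "?W lam = 0" if lam: "finsupp lam" "strip lam (\<lambda>_. 0)" "lam \<notin> range blk" for lam
  proof -
    have "\<exists>j. lam j = 0 \<and> lam (Suc j) = 1"
    proof (rule ccontr)
      assume "\<nexists>j. lam j = 0 \<and> lam (Suc j) = 1"
      then have nx: "\<not> (lam j = 0 \<and> lam (Suc j) = 1)" for j
        by blast
      then have step: "lam j = 0 \<Longrightarrow> lam (Suc j) = 0" for j
      proof -
        assume "lam j = 0"
        then have "lam (Suc j) \<noteq> 1" using nx[of j] by blast
        moreover have "lam (Suc j) = 0 \<or> lam (Suc j) = Suc 0"
          using lam(2) unfolding strip_def by blast
        ultimately show "lam (Suc j) = 0" by simp
      qed
      have ex: "\<exists>j. lam j = 0"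
        using lam(1) ex_new_if_finite[OF infinite_UNIV_nat, of "{j. lam j \<noteq> 0}"] unfolding finsupp_def by auto
      define k where "k = (LEAST j. lam j = 0)"
      have k: "lam k = 0" using LeastI_ex[OF ex] unfolding k_def .
      have ge: "lam j = 0" if "k \<le> j" for j
        using that by (induction rule: dec_induct) (simp add: k, simp add: step)
      have lt: "lam j = 1" if "j < k" for j
      proof -
        have "lam j \<noteq> 0"
          using not_less_Least[of j "\<lambda>j. lam j = 0"] that unfolding k_def by blast
        moreover have "lam j = 0 \<or> lam j = Suc 0"
          using lam(2) unfolding strip_def by blast
        ultimately show ?thesis by simp
      qed
      have "lam = blk k"
      proof
        fix j show "lam j = blk k j"
          using ge[of j] lt[of j] by (cases "j < k") (simp_all add: blk_def)
      qed
      then show False using lam(3) by auto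
    qed
    then have "psi_col t lam (\<lambda>_. 0) = 0"
      unfolding psi_col_def using finite_strip_sets(2)[OF lam(1), of "\<lambda>_. 0"] by (subst prod_zero_iff) auto
    then show ?thesis by (simp add: wP_def)
  qed
  have blk_upper: "blk k \<in> upper s r (\<lambda>_. 0) (\<lambda>_. 0) \<longleftrightarrow> (s \<longleftrightarrow> 0 < k) \<and> (r \<longleftrightarrow> 0 < k)" for k
  proof -
    have "strip (blk k) (\<lambda>_. 0)" by (simp add: strip_def blk_def)
    moreover have "blk k 0 = of_bool (0 < k)" by (simp add: blk_def)
    ultimately show ?thesis by (cases s; cases r) (simp_all add: upper_def finblk)
  qed
  consider "s \<noteq> r" | "\<not> s" "\<not> r" | "s" "r" by blast
  then show ?thesis
  proof cases
    case 1
    then have "upper s r (\<lambda>_. 0) (\<lambda>_. 0) = {}" by (auto simp: upper_def)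
    then show ?thesis using 1 by simp
  next
    case 2
    have sub: "{blk 0} \<subseteq> upper s r (\<lambda>_. 0) (\<lambda>_. 0)"
      using blk_upper[of 0] 2 by simp
    have out: "?W lam = 0" if "lam \<in> upper s r (\<lambda>_. 0) (\<lambda>_. 0) - {blk 0}" for lam
    proof (rule zero)
      show "lam \<notin> range blk"
      proof
        assume "lam \<in> range blk"
        then obtain k where k: "lam = blk k" by blast
        then show False using that blk_upper[of k] 2 by simp
      qed
    qed (use that in \<open>simp_all add: upper_def\<close>)
    have "(?W has_sum 1) {blk 0}"
      using has_sum_finite[of "{blk 0}" ?W] W0 by simp
    then have "(?W has_sum 1) (upper s r (\<lambda>_. 0) (\<lambda>_. 0))"
      by (rule has_sum_superset_zero[OF _ sub out])
    then show ?thesis using 2 by simp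
  next
    case 3
    have sub: "range (\<lambda>k. blk (Suc k)) \<subseteq> upper s r (\<lambda>_. 0) (\<lambda>_. 0)"
      using blk_upper 3 by (intro image_subsetI) simp
    have out: "?W lam = 0" if "lam \<in> upper s r (\<lambda>_. 0) (\<lambda>_. 0) - range (\<lambda>k. blk (Suc k))" for lam
    proof (rule zero)
      show "lam \<notin> range blk"
      proof
        assume "lam \<in> range blk"
        then obtain k where k: "lam = blk k" by blast
        then have "0 < k" using that blk_upper[of k] 3 by simp
        then have "lam = blk (Suc (k - 1))" using k by simp
        then show False using that by blast
      qed
    qed (use that in \<open>simp_all add: upper_def\<close>)
    have inj: "inj (\<lambda>k. blk (Suc k))"
    proof (rule injI)
      fix k l assume "blk (Suc k) = blk (Suc l)"
      then have "blk (Suc k) j = blk (Suc l) j" for j by simp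
      then have "(j < Suc k) = (j < Suc l)" for j
        unfolding blk_def of_bool_eq_iff by blast
      from this[of k] this[of l] show "k = l" by linarith
    qed
    have "((\<lambda>k. (a * b) ^ k) has_sum 1 / (1 - a * b)) UNIV"
    proof (rule norm_summable_imp_has_sum)
      show "summable (\<lambda>k. norm ((a * b) ^ k))"
        unfolding norm_power using x by (intro summable_geometric) simp
      show "(\<lambda>k. (a * b) ^ k) sums (1 / (1 - a * b))"
        using x by (intro geometric_sums) simp
    qed
    from has_sum_cmult_right[OF this, of "a * b * (1 - t)"]
    have "((?W \<circ> (\<lambda>k. blk (Suc k))) has_sum a * b * w) UNIV"
      unfolding o_def W1 w_def by (simp add: mult_ac)
    then have "(?W has_sum a * b * w) (range (\<lambda>k. blk (Suc k)))"
      by (subst has_sum_reindex[OF inj])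
    then have "(?W has_sum a * b * w) (upper s r (\<lambda>_. 0) (\<lambda>_. 0))"
      by (rule has_sum_superset_zero[OF _ sub out])
    then show ?thesis using 3 by simp
  qed
qed

lemma lower_base:
  "((\<lambda>kap. wP t a (\<lambda>_. 0) kap * wQ t b (\<lambda>_. 0) kap) has_sum (of_bool (\<not> s \<and> \<not> r) :: real))
     (lower s r (\<lambda>_. 0) (\<lambda>_. 0))"
proof (cases "s \<or> r")
  case True
  then have "lower s r (\<lambda>_. 0) (\<lambda>_. 0) = {}" by (auto simp: lower_def)
  then show ?thesis using True by auto
next
  case False
  have "kap = (\<lambda>_. 0)" if "kap \<in> lower s r (\<lambda>_. 0) (\<lambda>_. 0)" for kap
  proof
    fix j
    have "strip (\<lambda>_. 0) kap" using that by (simp add: lower_def)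
    then have "0 = kap j \<or> 0 = Suc (kap j)" unfolding strip_def by blast
    then show "kap j = 0" by simp
  qed
  moreover have "(\<lambda>_. 0) \<in> lower s r (\<lambda>_. 0) (\<lambda>_. 0)"
    using False by (auto simp: lower_def strip_def finsupp_def)
  ultimately have eq: "lower s r (\<lambda>_. 0) (\<lambda>_. 0) = {\<lambda>_. 0}" by blast
  show ?thesis unfolding eq
    using has_sum_finite[of "{\<lambda>_. 0::nat}" "\<lambda>kap. wP t a (\<lambda>_. 0) kap * wQ t b (\<lambda>_. 0) kap"] False
    by (simp add: wP_def wQ_def psi_col_def phi_col_def strip_size_def)
qed

text \<open>
  The Yang--Baxter equation behind the identity is the case analysis in the induction step; the
  induction strips the first column off all four partitions.
\<close>

lemma column_cauchy:
  fixes t a b :: real and mu nu :: "nat \<Rightarrow> nat"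
  assumes x: "\<bar>a * b\<bar> < 1" and "antimono mu" "antimono nu" "finsupp mu" "finsupp nu"
  defines "w \<equiv> (1 - t) / (1 - a * b)" and "\<Phi> \<equiv> (1 - t * (a * b)) / (1 - a * b)"
  shows "\<exists>R. (\<forall>s r. ((\<lambda>kap. wP t a nu kap * wQ t b mu kap) has_sum R s r) (lower s r mu nu)) \<and>
    (\<forall>s r. ((\<lambda>lam. wP t a lam mu * wQ t b lam nu) has_sum
       (if s \<noteq> r then \<Phi> * R s r
        else if s then a * b * w * R False False + t * R True True
        else R False False + w * R True True)) (upper s r mu nu))"
proof -
  have "\<exists>J. \<forall>j\<ge>J. mu j = 0 \<and> nu j = 0"
  proof -
    have "finite ({j. mu j \<noteq> 0} \<union> {j. nu j \<noteq> 0})"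
      using assms by (simp add: finsupp_def)
    then obtain J where J: "\<forall>j\<in>{j. mu j \<noteq> 0} \<union> {j. nu j \<noteq> 0}. j < J"
      using finite_nat_set_iff_bounded by blast
    show ?thesis
    proof (intro exI[of _ J] allI impI)
      fix j assume "J \<le> j"
      then have "j \<notin> {j. mu j \<noteq> 0} \<union> {j. nu j \<noteq> 0}" using J by (meson leD)
      then show "mu j = 0 \<and> nu j = 0" by simp
    qed
  qed
  then obtain J where "\<forall>j\<ge>J. mu j = 0 \<and> nu j = 0" by blast
  then show ?thesis using assms(2-5)
  proof (induction J arbitrary: mu nu)
    case 0
    then have mu: "mu = (\<lambda>_. 0)" and nu: "nu = (\<lambda>_. 0)" by auto
    show ?case unfolding mu nu
    proof (intro exI[of _ "\<lambda>s r. of_bool (\<not> s \<and> \<not> r)"] conjI allI lower_base)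
      fix s r
      show "((\<lambda>lam. wP t a lam (\<lambda>_. 0) * wQ t b lam (\<lambda>_. 0)) has_sum
       (if s \<noteq> r then \<Phi> * of_bool (\<not> s \<and> \<not> r)
        else if s then a * b * w * of_bool (\<not> False \<and> \<not> False) + t * of_bool (\<not> True \<and> \<not> True)
        else of_bool (\<not> False \<and> \<not> False) + w * of_bool (\<not> True \<and> \<not> True))) (upper s r (\<lambda>_. 0) (\<lambda>_. 0))"
        using upper_base[OF x, of t s r] unfolding w_def[symmetric] by (cases s; cases r) simp_all
    qed
  next
    case (Suc J)
    let ?mu = "\<lambda>j. mu (Suc j)" and ?nu = "\<lambda>j. nu (Suc j)"
    have "\<forall>j\<ge>J. ?mu j = 0 \<and> ?nu j = 0" "antimono ?mu" "antimono ?nu" "finsupp ?mu" "finsupp ?nu"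
      using Suc.prems by (auto simp: antimono_def intro: finsupp_shift)
    from Suc.IH[OF this] obtain R where
      R: "\<And>s r. ((\<lambda>kap. wP t a ?nu kap * wQ t b ?mu kap) has_sum R s r) (lower s r ?mu ?nu)" and
      L: "\<And>s r. ((\<lambda>lam. wP t a lam ?mu * wQ t b lam ?nu) has_sum
       (if s \<noteq> r then \<Phi> * R s r
        else if s then a * b * w * R False False + t * R True True
        else R False False + w * R True True)) (upper s r ?mu ?nu)" by blast
    define L' where "L' s r = (if s \<noteq> r then \<Phi> * R s r
        else if s then a * b * w * R False False + t * R True True
        else R False False + w * R True True)" for s r
    \<comment> \<open>If \<open>k\<close> is the first column of a lower tail, then
      \<open>nu 1 = k + s\<close> and \<open>mu 1 = k + r\<close>. So a nonempty lower set forces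
      \<open>mu 1 + s = nu 1 + r\<close>, and most of the four sums vanish.\<close>
    have R0: "R s r = 0" if "mu 1 + of_bool s \<noteq> nu 1 + of_bool r" for s r
    proof -
      have "lower s r ?mu ?nu = {}" using that by (auto simp: lower_def)
      then show ?thesis using has_sum_unique[OF R[of s r], of 0] by simp
    qed
    have R0': "R s r = 0" if "\<not> (of_bool s \<le> nu 1 \<and> of_bool r \<le> mu 1)" for s r
    proof -
      have "lower s r ?mu ?nu = {}" using that by (auto simp: lower_def)
      then show ?thesis using has_sum_unique[OF R[of s r], of 0] by simp
    qed
    \<comment> \<open>The guard says that column 0 of the lower partition,
      \<open>nu 0 - s = mu 0 - r\<close>, exists as a natural number; otherwise the lower set is
      empty and its sum is 0.\<close>
    define rr where "rr s r = (if mu 0 + of_bool s = nu 0 + of_bool r \<and> of_bool s \<le> nu 0 \<and> of_bool r \<le> mu 0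
      then (let c = (\<lambda>s' r'. locP t a s s' (Suc (nu 0) - nu 1) * locQ t b r r' (mu 0 - mu 1) * R s' r') in
       c False False + c True True + c True False + c False True) else 0)" for s r
    define ll where "ll s r = (if mu 0 + of_bool s = nu 0 + of_bool r
      then (let c = (\<lambda>s' r'. locP t a s s' (mu 0 - mu 1) * locQ t b r r' (Suc (nu 0) - nu 1) * L' s' r') in
       c False False + c True True + c True False + c False True) else 0)" for s r
    have low: "((\<lambda>kap. wP t a nu kap * wQ t b mu kap) has_sum rr s r) (lower s r mu nu)" for s r
    proof (cases "mu 0 + of_bool s = nu 0 + of_bool r \<and> of_bool s \<le> nu 0 \<and> of_bool r \<le> mu 0")
      case True
      then have "nu 0 = (nu 0 - of_bool s) + of_bool s" "mu 0 = (nu 0 - of_bool s) + of_bool r"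
        by auto
      from lower_step[of t a nu b mu R, OF R this Suc.prems(4,5)] show ?thesis using True by (simp add: rr_def)
    next
      case False
      then have "lower s r mu nu = {}" by (auto simp: lower_def)
      then show ?thesis using False by (auto simp: rr_def)
    qed
    have upp: "((\<lambda>lam. wP t a lam mu * wQ t b lam nu) has_sum ll s r) (upper s r mu nu)" for s r
    proof (cases "mu 0 + of_bool s = nu 0 + of_bool r")
      case True
      from upper_step[of t a mu b nu, OF L this] show ?thesis using True by (simp add: ll_def L'_def)
    next
      case False
      then have "upper s r mu nu = {}" by (auto simp: upper_def)
      then show ?thesis using False by (auto simp: ll_def)
    qed
    have key: "ll s r = (if s \<noteq> r then \<Phi> * rr s r
        else if s then a * b * w * rr False False + t * rr True True
        else rr False False + w * rr True True)" for s r
    proof -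
      \<comment> \<open>These relations remove all denominators: the cases below become polynomial
        identities in \<open>w\<close>, \<open>t\<close>, \<open>a * b\<close>, a power of
        \<open>t\<close> and the sums \<open>R\<close>.\<close>
      have wx: "w * (a * b) = w + t - 1" and Phi: "\<Phi> = w + t"
        using x by (auto simp: w_def \<Phi>_def field_simps)
      have ge: "mu 1 \<le> mu 0" "nu 1 \<le> nu 0"
        using Suc.prems(2,3) by (auto simp: antimono_def)
      show ?thesis
      proof (cases "mu 0 + of_bool s = nu 0 + of_bool r")
        case False
        then show ?thesis by (cases s; cases r) (simp_all add: ll_def rr_def)
      next
        case C0: True
        \<comment> \<open>The difference of the first tail columns decides which bits can occur:
          equal columns allow only equal bits, a difference of one allows a single pair of unequal
          bits, and a larger difference allows none.\<close>
        consider (eq) "mu 1 = nu 1" | (mu) "mu 1 = Suc (nu 1)" | (nu) "nu 1 = Suc (mu 1)"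
          | (far) "mu 1 > Suc (nu 1) \<or> nu 1 > Suc (mu 1)"
          by linarith
        then show ?thesis
        proof cases
          case eq
          have z: "R True False = 0" "R False True = 0" using R0 eq by auto
          have z1: "R True True = 0" if "mu 1 = 0" using R0'[of True True] that by auto
          obtain m where m: "mu 0 = mu 1 + m" using ge le_Suc_ex by blast
          have eq': "nu (Suc 0) = mu (Suc 0)" using eq by simp
          define T where "T = t ^ m"
          show ?thesis
          proof (cases "s = r")
            case True
            have n: "nu 0 = mu 1 + m" using C0 m True by simp
            \<comment> \<open>If column 0 is empty, the guard in \<open>rr\<close> makes the
              left-hand side 0; the right-hand side agrees because then \<open>T = 1\<close> and
              \<open>z1\<close> applies.\<close>
            have tt: "rr True True = a * b * ((1 - T) * R False False + R True True)"
              using z z1 by (cases "mu 1 + m = 0") (auto simp: rr_def locP_def locQ_def z m n eq[symmetric] eq' T_def algebra_simps)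
            have ff: "rr False False = R False False + (1 - t * T) * R True True"
              by (simp add: rr_def locP_def locQ_def z m n eq[symmetric] eq' T_def)
            show ?thesis
            proof (cases s)
              case s: True
              have "ll s r = a * b * ((1 - t * T) * (R False False + w * R True True)
                  + (a * b * w * R False False + t * R True True))"
                using True s by (simp add: ll_def L'_def locP_def locQ_def z m n eq[symmetric] eq' T_def algebra_simps)
              then show ?thesis using True s wx unfolding tt ff by simp algebra
            next
              case s: False
              have "ll s r = (R False False + w * R True True)
                  + (1 - T) * (a * b * w * R False False + t * R True True)"
                using True s by (simp add: ll_def L'_def locP_def locQ_def z m n eq[symmetric] eq' T_def algebra_simps)
              then show ?thesis using True s wx unfolding tt ff by simp algebra
            qed
          next
            case False
            define c where "c = (if s then a else b * (1 - T))"
            have n: "Suc (nu 0) - mu (Suc 0) = m" "1 \<le> mu 0" if "\<not> s" "r"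
              using C0 m that by auto
            have n': "1 \<le> nu 0" if "s" "\<not> r"
              using C0 that by auto
            have "ll s r = c * ((1 + w * (a * b)) * R False False + (w + t) * R True True)"
              using C0 False n n' eq' by (cases s; cases r) (simp_all add: ll_def L'_def locP_def locQ_def z T_def c_def algebra_simps)
            moreover have "rr s r = c * (R False False + R True True)"
              using C0 False n n' eq' by (cases s; cases r) (simp_all add: rr_def locP_def locQ_def z T_def c_def algebra_simps)
            ultimately show ?thesis using wx False Phi by (simp add: distrib_left)
          qed
        next
          case mu
          have z: "R True False = 0" "R False False = 0" "R True True = 0" using R0 mu by auto
          have ll: "ll s r = locP t a s False (mu 0 - mu 1) * locQ t b r True (Suc (nu 0) - nu 1) * (\<Phi> * R False True)"
            using C0 by (simp add: ll_def L'_def z)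
          have rr: "rr s r = locP t a s False (Suc (nu 0) - nu 1) * locQ t b r True (mu 0 - mu 1) * R False True"
            if "mu 0 + of_bool s = nu 0 + of_bool r" "of_bool s \<le> nu 0 \<and> of_bool r \<le> mu 0" for s r
            using that by (simp add: rr_def z)
          show ?thesis
          proof (cases "s = r")
            case True
            then have "mu 0 = nu 0" "1 \<le> mu 0" using C0 mu ge by auto
            then have "rr True True = a * b * R False True" "rr False False = R False True"
              by (auto simp: rr locP_def locQ_def)
            moreover have "ll s r = (if s then a * b else 1) * (w + t) * R False True"
              unfolding ll using True by (simp add: locP_def locQ_def Phi)
            ultimately show ?thesis using True wx by (cases s) (simp_all, algebra+)
          next
            case False
            then have "of_bool s \<le> nu 0 \<and> of_bool r \<le> mu 0" using C0 by (cases s; cases r) simp_all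
            then show ?thesis using False rr[OF C0] ll by (simp add: locP_def locQ_def)
          qed
        next
          case nu
          have z: "R False True = 0" "R False False = 0" "R True True = 0" using R0 nu by auto
          have ll: "ll s r = locP t a s True (mu 0 - mu 1) * locQ t b r False (Suc (nu 0) - nu 1) * (\<Phi> * R True False)"
            using C0 by (simp add: ll_def L'_def z)
          have rr: "rr s r = locP t a s True (Suc (nu 0) - nu 1) * locQ t b r False (mu 0 - mu 1) * R True False"
            if "mu 0 + of_bool s = nu 0 + of_bool r" "of_bool s \<le> nu 0 \<and> of_bool r \<le> mu 0" for s r
            using that by (simp add: rr_def z)
          show ?thesis
          proof (cases "s = r")
            case True
            then have e: "mu 0 = nu 0" "1 \<le> mu 0" using C0 nu ge by auto
            have m: "Suc (nu 0) - nu 1 = mu 0 - mu 1" using e nu by simp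
            define T where "T = 1 - t ^ (mu 0 - mu 1)"
            have "rr True True = a * b * T * R True False" "rr False False = T * R True False"
              using e m by (auto simp: rr locP_def locQ_def T_def)
            moreover have "ll s r = (if s then a * b else 1) * T * (w + t) * R True False"
              unfolding ll using True m by (simp add: locP_def locQ_def Phi T_def)
            ultimately show ?thesis using True wx by (cases s) (simp_all, algebra+)
          next
            case False
            then have "of_bool s \<le> nu 0 \<and> of_bool r \<le> mu 0" using C0 by (cases s; cases r) simp_all
            then show ?thesis using False rr[OF C0] ll by (simp add: locP_def locQ_def)
          qed
        next
          case far
          have z: "R s r = 0" for s r by (rule R0) (use far in \<open>cases s; cases r; auto\<close>)
          show ?thesis by (cases s; cases r) (simp_all add: ll_def rr_def L'_def z)
        qed
      qed
    qed
    show ?case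
      by (intro exI[of _ rr] conjI allI low) (use upp key in simp)
  qed
qed

section \<open>Partitions through their column lengths\<close>

lemma part_antimono: "i \<le> j \<Longrightarrow> part lam j \<le> part lam i"
  using part[of lam] by (simp add: antimono_def)

lemma finite_part: "finite {i. part lam i \<noteq> 0}"
  using part[of lam] by simp

definition cols :: "partition \<Rightarrow> nat \<Rightarrow> nat" where
  "cols lam j = card {i. j < part lam i}"

lemma down_closed_eq_lessThan:
  assumes "finite A" "\<And>i j. j \<in> A \<Longrightarrow> i \<le> j \<Longrightarrow> i \<in> A"
  shows "A = {..<card A}"
proof (rule ccontr)
  assume ne: "A \<noteq> {..<card A}"
  have "\<not> A \<subseteq> {..<card A}"
    using ne card_subset_eq[of "{..<card A}" A] by auto
  then obtain j where "j \<in> A" "card A \<le> j" by (auto simp: subset_iff not_less)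
  then have "{..card A} \<subseteq> A" using assms(2) by (meson atMost_iff le_trans subsetI)
  from card_mono[OF assms(1) this] show False by simp
qed

text \<open>Both sides say that the box in row \<open>i\<close> and column \<open>j\<close> lies in
  the diagram. The facts about conjugation below rest on this symmetry.\<close>

lemma less_cols_iff: "i < cols lam j \<longleftrightarrow> j < part lam i"
proof -
  have fin: "finite {i. j < part lam i}"
    by (rule finite_subset[OF _ finite_part[of lam]]) auto
  have "{i. j < part lam i} = {..<cols lam j}"
    unfolding cols_def
    by (rule down_closed_eq_lessThan[OF fin]) (use part_antimono[of _ _ lam] less_le_trans in blast)
  then show ?thesis by auto
qed

lemma cols_le_iff: "cols lam j \<le> i \<longleftrightarrow> part lam i \<le> j"
  using less_cols_iff[of i lam j] by linarith

lemma antimono_cols: "antimono (cols lam)"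
  unfolding antimono_def using cols_le_iff by (meson le_refl le_trans)

lemma cols_zero_iff: "cols lam j = 0 \<longleftrightarrow> part lam 0 \<le> j"
  using cols_le_iff[of lam j 0] by simp

lemma finsupp_cols: "finsupp (cols lam)"
  unfolding finsupp_def by (rule finite_subset[of _ "{..<part lam 0}"]) (auto simp: cols_zero_iff)

lemma plength_eq_cols: "plength lam = cols lam 0"
  by (simp add: plength_def cols_def)

lemma part_zero_iff: "part lam i = 0 \<longleftrightarrow> plength lam \<le> i"
  unfolding plength_eq_cols cols_le_iff by simp

lemma cols_inject: "cols lam = cols mu \<longleftrightarrow> lam = mu"
proof
  assume "cols lam = cols mu"
  then have "(j < part lam i) = (j < part mu i)" for i j
    by (metis less_cols_iff)
  then have "part lam i = part mu i" for i
    by (meson less_irrefl linorder_neqE_nat)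
  then show "lam = mu" using part_inject[of lam mu] by auto
qed simp

text \<open>The partition is the conjugate of \<open>c\<close>, and conjugating again returns
  \<open>c\<close>. This turns the sequences handled by the column recursion back into
  partitions.\<close>

lemma ex_cols:
  assumes "antimono c" "finsupp c"
  shows "\<exists>lam. cols lam = c"
proof -
  define f where "f i = card {j. i < c j}" for i
  have fin: "finite {j. i < c j}" for i
    by (rule finite_subset[OF _ assms(2)[unfolded finsupp_def]]) auto
  have "antimono f"
    unfolding antimono_def f_def by (auto intro!: card_mono fin)
  have iff: "j < f i \<longleftrightarrow> i < c j" for i j
  proof -
    have "{j. i < c j} = {..<card {j. i < c j}}"
      by (rule down_closed_eq_lessThan[OF fin])
         (use assms(1) in \<open>auto simp: antimono_def intro: less_le_trans\<close>)
    then show ?thesis unfolding f_def by auto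
  qed
  have "{i. f i \<noteq> 0} \<subseteq> {..<c 0}"
    using iff[of 0] by auto
  then have "finite {i. f i \<noteq> 0}" by (rule finite_subset) simp
  then have p: "part (Partition f) = f"
    using \<open>antimono f\<close> by (simp add: Partition_inverse)
  have "cols (Partition f) j = c j" for j
    unfolding cols_def p iff by simp
  then show ?thesis by blast
qed

lemma diagram_subset_iff_cols: "diagram_subset mu lam \<longleftrightarrow> (\<forall>j. cols mu j \<le> cols lam j)"
proof
  assume "diagram_subset mu lam"
  then show "\<forall>j. cols mu j \<le> cols lam j"
    by (meson cols_le_iff diagram_subset_def le_refl le_trans)
next
  assume "\<forall>j. cols mu j \<le> cols lam j"
  then show "diagram_subset mu lam"
    by (meson cols_le_iff diagram_subset_def le_refl le_trans)
qed

lemma psize_parts: "plength lam \<le> n \<Longrightarrow> psize lam = (\<Sum>i<n. part lam i)"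
  unfolding psize_def
  by (rule sum.mono_neutral_left) (auto simp: part_zero_iff)

lemma psize_cols:
  assumes "part lam 0 \<le> J"
  shows "psize lam = (\<Sum>j<J. cols lam j)"
proof -
  let ?n = "plength lam"
  have le: "part lam i \<le> J" for i using part_antimono[of 0 i lam] assms by simp
  have "psize lam = (\<Sum>i<?n. card {j\<in>{..<J}. j < part lam i})"
    unfolding psize_parts[OF le_refl]
  proof (intro sum.cong refl)
    fix i
    have "{j\<in>{..<J}. j < part lam i} = {..<part lam i}" using le[of i] by auto
    then show "part lam i = card {j\<in>{..<J}. j < part lam i}" by simp
  qed
  also have "\<dots> = (\<Sum>i<?n. \<Sum>j<J. of_bool (j < part lam i))"
    by (simp add: sum.If_cases of_bool_def Collect_conj_eq lessThan_def)
  also have "\<dots> = (\<Sum>j<J. \<Sum>i<?n. of_bool (i < cols lam j))"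
    by (subst sum.swap) (simp add: less_cols_iff)
  also have "\<dots> = (\<Sum>j<J. cols lam j)"
  proof (intro sum.cong refl)
    fix j
    have "cols lam j \<le> ?n" unfolding plength_eq_cols using antimono_cols by (auto simp: antimono_def)
    then have "{i. i < ?n} \<inter> {i. i < cols lam j} = {..<cols lam j}" by auto
    then show "(\<Sum>i<?n. of_bool (i < cols lam j)) = cols lam j"
      by (simp add: sum.If_cases of_bool_def lessThan_def)
  qed
  finally show ?thesis .
qed

lemma psize_cols': "psize lam = (\<Sum>j | cols lam j \<noteq> 0. cols lam j)"
  unfolding psize_cols[OF le_refl] by (rule sum.mono_neutral_right) (auto simp: cols_zero_iff)

lemma plength_le_psize: "plength lam \<le> psize lam"
proof (cases "part lam 0 = 0")
  case True
  then show ?thesis by (simp add: part_zero_iff)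
next
  case False
  then show ?thesis unfolding psize_cols[OF le_refl] plength_eq_cols
    by (intro member_le_sum) auto
qed

lemma part_le_psize: "part lam i \<le> psize lam"
proof (cases "part lam i = 0")
  case False
  then show ?thesis unfolding psize_def using finite_part[of lam] by (intro member_le_sum) simp_all
qed simp

lemma part_eqI: "(\<And>i. part lam i = part mu i) \<Longrightarrow> lam = mu"
  using part_inject[of lam mu] by auto

lemma finite_psize_le: "finite {lam. psize lam \<le> n}"
proof -
  have "inj_on (\<lambda>lam. map (part lam) [0..<n]) {lam. psize lam \<le> n}"
  proof (rule inj_onI, rule part_eqI)
    fix lam mu i
    assume a: "lam \<in> {lam. psize lam \<le> n}" "mu \<in> {lam. psize lam \<le> n}"
      and eq: "map (part lam) [0..<n] = map (part mu) [0..<n]"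
    show "part lam i = part mu i"
    proof (cases "i < n")
      case True
      then show ?thesis using eq by (auto simp: list_eq_iff_nth_eq)
    next
      case False
      then have "part lam i = 0" "part mu i = 0"
        using a plength_le_psize[of lam] plength_le_psize[of mu] by (auto simp: part_zero_iff)
      then show ?thesis by simp
    qed
  qed
  moreover have "(\<lambda>lam. map (part lam) [0..<n]) ` {lam. psize lam \<le> n} \<subseteq> {xs. set xs \<subseteq> {..n} \<and> length xs = n}"
    using part_le_psize le_trans by (fastforce simp: subset_iff)
  then have "finite ((\<lambda>lam. map (part lam) [0..<n]) ` {lam. psize lam \<le> n})"
    by (rule finite_subset) (rule finite_lists_length_eq, simp)
  ultimately show ?thesis by (rule finite_imageD[rotated])
qed

lemma finite_psize_eq: "finite {lam. psize lam = n}"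
  by (rule finite_subset[OF _ finite_psize_le[of n]]) auto

lemma psize_mono: "diagram_subset mu lam \<Longrightarrow> psize mu \<le> psize lam"
  using psize_cols[of mu "max (part mu 0) (part lam 0)"] psize_cols[of lam "max (part mu 0) (part lam 0)"]
  by (simp add: diagram_subset_iff_cols sum_mono)

lemma diagram_subset_antisym_size:
  assumes "diagram_subset mu lam" "psize lam \<le> psize mu"
  shows "lam = mu"
proof (rule part_eqI)
  fix i
  let ?n = "Suc (max i (max (plength mu) (plength lam)))"
  have "psize mu = (\<Sum>i<?n. part mu i)" "psize lam = (\<Sum>i<?n. part lam i)"
    by (rule psize_parts, simp)+
  then have "(\<Sum>i<?n. part mu i) = (\<Sum>i<?n. part lam i)"
    using assms(2) psize_mono[OF assms(1)] by simp
  then show "part lam i = part mu i"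
    using sum_mono_inv[of "part mu" "{..<?n}" "part lam" i] assms(1)
    by (simp add: diagram_subset_def less_Suc_eq_le del: sum.lessThan_Suc)
qed

lemma diagram_subset_trans: "diagram_subset a b \<Longrightarrow> diagram_subset b c \<Longrightarrow> diagram_subset a c"
  unfolding diagram_subset_def by (meson le_trans)

lemma finite_diagram_subset: "finite {mu. diagram_subset mu lam}"
  by (rule finite_subset[OF _ finite_psize_le[of "psize lam"]]) (auto intro: psize_mono)

definition hstrip :: "partition \<Rightarrow> partition \<Rightarrow> bool" where
  "hstrip lam mu \<longleftrightarrow> strip (cols lam) (cols mu)"

definition psi :: "real \<Rightarrow> partition \<Rightarrow> partition \<Rightarrow> real" where
  "psi t lam mu = (if hstrip lam mu then psi_col t (cols lam) (cols mu) else 0)"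

definition phi :: "real \<Rightarrow> partition \<Rightarrow> partition \<Rightarrow> real" where
  "phi t lam mu = (if hstrip lam mu then phi_col t (cols lam) (cols mu) else 0)"

lemma hstrip_subset: "hstrip lam mu \<Longrightarrow> diagram_subset mu lam"
  unfolding hstrip_def strip_def diagram_subset_iff_cols by (metis eq_refl le_SucI)

lemma hstrip_refl [simp]: "hstrip lam lam"
  by (simp add: hstrip_def strip_def)

lemma finite_hstrip_lower: "finite {mu. hstrip lam mu}"
  by (rule finite_subset[OF _ finite_diagram_subset[of lam]]) (auto intro: hstrip_subset)

lemma hstrip_psize_mono: "hstrip lam mu \<Longrightarrow> psize mu \<le> psize lam"
  by (intro psize_mono hstrip_subset)

lemma hstrip_same_size: "hstrip lam mu \<Longrightarrow> psize lam = psize mu \<Longrightarrow> lam = mu"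
  by (simp add: diagram_subset_antisym_size hstrip_subset)

lemma hstrip_plength: "hstrip lam mu \<Longrightarrow> plength lam = plength mu \<or> plength lam = Suc (plength mu)"
  by (simp add: hstrip_def strip_def plength_eq_cols)

lemma psi_refl [simp]: "psi t lam lam = 1"
  by (simp add: psi_def psi_col_def)

lemma phi_refl [simp]: "phi t lam lam = 1"
  by (simp add: phi_def phi_col_def)

lemma psi_nonneg: "0 \<le> t \<Longrightarrow> t < 1 \<Longrightarrow> 0 \<le> psi t lam mu"
  unfolding psi_def psi_col_def by (auto intro!: prod_nonneg simp: power_le_one)

lemma phi_nonneg: "0 \<le> t \<Longrightarrow> t < 1 \<Longrightarrow> 0 \<le> phi t lam mu"
  unfolding phi_def phi_col_def by (auto intro!: prod_nonneg simp: power_le_one)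

lemma hstrip_strip_size:
  assumes "hstrip lam mu"
  shows "psize lam = psize mu + strip_size (cols lam) (cols mu)"
proof -
  let ?J = "max (part lam 0) (part mu 0)"
  have st: "cols lam j = cols mu j + of_bool (cols lam j = Suc (cols mu j))" for j
    using assms unfolding hstrip_def strip_def by (metis Suc_eq_plus1 add.right_neutral of_bool_eq(1,2))
  have "psize lam = (\<Sum>j<?J. cols mu j + of_bool (cols lam j = Suc (cols mu j)))"
    using st by (simp add: psize_cols[of lam ?J])
  also have "\<dots> = psize mu + (\<Sum>j<?J. of_bool (cols lam j = Suc (cols mu j)))"
    by (simp add: psize_cols[of mu ?J] sum.distrib)
  also have "(\<Sum>j<?J. of_bool (cols lam j = Suc (cols mu j))) = (\<Sum>j | cols lam j = Suc (cols mu j). 1::nat)"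
  proof (rule sum.mono_neutral_cong_right)
    have "part lam 0 > j" if "cols lam j = Suc (cols mu j)" for j
      using that cols_zero_iff[of lam j] by linarith
    then show "{j. cols lam j = Suc (cols mu j)} \<subseteq> {..<?J}" by (auto simp: less_max_iff_disj)
  qed auto
  finally show ?thesis by (simp add: strip_size_def)
qed

text \<open>The constant usually written \<open>b_lambda(t)\<close>: for every part size a product
  \<open>(1 - t) ... (1 - t ^ m)\<close> with \<open>m\<close> its multiplicity. It is the ratio of
  the dual function to \<open>hall_P\<close>.\<close>

definition mult_coeff :: "real \<Rightarrow> partition \<Rightarrow> real" where
  "mult_coeff t lam = (\<Prod>j<part lam 0. \<Prod>k=1..cols lam j - cols lam (Suc j). 1 - t ^ k)"

lemma mult_coeff_pos: "0 \<le> t \<Longrightarrow> t < 1 \<Longrightarrow> 0 < mult_coeff t lam"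
  unfolding mult_coeff_def by (intro prod_pos) (auto simp: power_less_one_iff)

lemma mult_coeff_ge:
  assumes "part lam 0 \<le> J"
  shows "mult_coeff t lam = (\<Prod>j<J. \<Prod>k=1..cols lam j - cols lam (Suc j). 1 - t ^ k)"
  unfolding mult_coeff_def
proof (rule prod.mono_neutral_left)
  show "\<forall>i\<in>{..<J} - {..<part lam 0}. (\<Prod>k = 1..cols lam i - cols lam (Suc i). 1 - t ^ k) = 1"
  proof
    fix i assume "i \<in> {..<J} - {..<part lam 0}"
    then have "cols lam i = 0" by (simp add: cols_zero_iff)
    then show "(\<Prod>k = 1..cols lam i - cols lam (Suc i). 1 - t ^ k) = 1" by simp
  qed
qed (use assms in auto)

text \<open>Compare the factors column by column. The multiplicities of a part in \<open>lam\<close>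
  and \<open>mu\<close> differ, and then by one, exactly when one of two neighbouring columns grows
  and the other does not. The extra factor of the longer product is the one recorded by
  \<open>phi\<close> or by \<open>psi\<close>.\<close>

lemma phi_mult_coeff:
  "phi t lam mu * mult_coeff t mu = mult_coeff t lam * psi t lam mu"
proof (cases "hstrip lam mu")
  case True
  let ?J = "Suc (max (part lam 0) (part mu 0))"
  let ?L = "cols lam" and ?M = "cols mu"
  have st: "?L j = ?M j \<or> ?L j = Suc (?M j)" for j
    using True by (auto simp: hstrip_def strip_def)
  have nz: "j < ?J" if "?L (Suc j) = Suc (?M (Suc j)) \<or> ?L j = Suc (?M j)" for j
  proof -
    have "0 < ?L (Suc j) \<or> 0 < ?L j" using that by auto
    then have "Suc j < part lam 0 \<or> j < part lam 0" by (simp add: less_cols_iff)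
    then show ?thesis by auto
  qed
  have fin: "finite {j. j < ?J}" by simp
  have phi: "phi t lam mu = (\<Prod>j<?J. if ?L j = Suc (?M j) \<and> ?L (Suc j) = ?M (Suc j) then 1 - t ^ (?L j - ?L (Suc j)) else 1)"
    unfolding phi_def phi_col_def using True
    by (simp only: if_True, intro prod.mono_neutral_cong_left) (use nz in \<open>auto simp: less_Suc_eq_le[symmetric]\<close>)
  have psi: "psi t lam mu = (\<Prod>j<?J. if ?L j = ?M j \<and> ?L (Suc j) = Suc (?M (Suc j)) then 1 - t ^ (?M j - ?M (Suc j)) else 1)"
    unfolding psi_def psi_col_def using True
    by (simp only: if_True, intro prod.mono_neutral_cong_left) (use nz in \<open>auto simp: less_Suc_eq_le[symmetric]\<close>)
  have bl: "mult_coeff t lam = (\<Prod>j<?J. \<Prod>k=1..?L j - ?L (Suc j). 1 - t ^ k)"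
    and bm: "mult_coeff t mu = (\<Prod>j<?J. \<Prod>k=1..?M j - ?M (Suc j). 1 - t ^ k)"
    by (rule mult_coeff_ge, simp)+
  have "(if ?L j = Suc (?M j) \<and> ?L (Suc j) = ?M (Suc j) then 1 - t ^ (?L j - ?L (Suc j)) else 1) *
       (\<Prod>k=1..?M j - ?M (Suc j). 1 - t ^ k) =
     (\<Prod>k=1..?L j - ?L (Suc j). 1 - t ^ k) *
     (if ?L j = ?M j \<and> ?L (Suc j) = Suc (?M (Suc j)) then 1 - t ^ (?M j - ?M (Suc j)) else 1)" for j
  proof -
    have le: "?M (Suc j) \<le> ?M j" "?L (Suc j) \<le> ?L j" using antimono_cols by (auto simp: antimono_def)
    consider "?L j = ?M j" "?L (Suc j) = ?M (Suc j)" | "?L j = Suc (?M j)" "?L (Suc j) = Suc (?M (Suc j))"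
      | "?L j = Suc (?M j)" "?L (Suc j) = ?M (Suc j)" | "?L j = ?M j" "?L (Suc j) = Suc (?M (Suc j))"
      using st[of j] st[of "Suc j"] by blast
    then show ?thesis
    proof cases
      case 3
      have "?L j - ?L (Suc j) = Suc (?M j - ?M (Suc j))" using 3 le by simp
      then show ?thesis using 3 by simp
    next
      case 4
      have "?M j - ?M (Suc j) = Suc (?L j - ?L (Suc j))" using 4 le by simp
      then show ?thesis using 4 by simp
    qed simp_all
  qed
  then show ?thesis unfolding phi psi bl bm prod.distrib[symmetric] by simp
qed (simp add: phi_def psi_def)

definition jumps :: "partition \<Rightarrow> partition \<Rightarrow> bool" where
  "jumps lam mu \<longleftrightarrow> plength mu < plength lam"

definition weight_P :: "real \<Rightarrow> real \<Rightarrow> partition \<Rightarrow> partition \<Rightarrow> real" where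
  "weight_P t a lam mu = psi t lam mu * a ^ (psize lam - psize mu)"

definition weight_Q :: "real \<Rightarrow> real \<Rightarrow> partition \<Rightarrow> partition \<Rightarrow> real" where
  "weight_Q t b lam mu = phi t lam mu * b ^ (psize lam - psize mu)"

lemma weight_P_eq: "hstrip lam mu \<Longrightarrow> weight_P t a lam mu = wP t a (cols lam) (cols mu)"
  by (simp add: weight_P_def wP_def psi_def hstrip_strip_size)

lemma weight_Q_eq: "hstrip lam mu \<Longrightarrow> weight_Q t b lam mu = wQ t b (cols lam) (cols mu)"
  by (simp add: weight_Q_def wQ_def phi_def hstrip_strip_size)

lemma jumps_iff: "hstrip lam mu \<Longrightarrow> jumps lam mu = s \<longleftrightarrow> cols lam 0 = cols mu 0 + of_bool s"
  using hstrip_plength[of lam mu] by (auto simp: jumps_def plength_eq_cols)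

definition strips_above :: "bool \<Rightarrow> bool \<Rightarrow> partition \<Rightarrow> partition \<Rightarrow> partition set" where
  "strips_above s r mu nu = {lam. hstrip lam mu \<and> hstrip lam nu \<and> jumps lam mu = s \<and> jumps lam nu = r}"

definition strips_below :: "bool \<Rightarrow> bool \<Rightarrow> partition \<Rightarrow> partition \<Rightarrow> partition set" where
  "strips_below s r mu nu = {kap. hstrip nu kap \<and> hstrip mu kap \<and> jumps nu kap = s \<and> jumps mu kap = r}"

lemma not_antimonoE:
  assumes "\<not> antimono (c :: nat \<Rightarrow> nat)"
  obtains j where "c j < c (Suc j)"
  using assms decseq_SucI[of c] by (metis not_le)

lemma cols_above: "cols ` strips_above s r mu nu = upper s r (cols mu) (cols nu) \<inter> {c. antimono c}"
proof (intro set_eqI iffI)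
  fix c assume "c \<in> upper s r (cols mu) (cols nu) \<inter> {c. antimono c}"
  moreover from this obtain lam where c: "c = cols lam" using ex_cols[of c] by (auto simp: upper_def)
  ultimately have "lam \<in> strips_above s r mu nu"
    using jumps_iff[of lam mu s] jumps_iff[of lam nu r] by (simp add: strips_above_def upper_def hstrip_def[symmetric])
  then show "c \<in> cols ` strips_above s r mu nu" using c by blast
next
  fix c assume "c \<in> cols ` strips_above s r mu nu"
  then obtain lam where "lam \<in> strips_above s r mu nu" "c = cols lam" by blast
  then show "c \<in> upper s r (cols mu) (cols nu) \<inter> {c. antimono c}"
    using jumps_iff[of lam mu s] jumps_iff[of lam nu r]
    by (simp add: strips_above_def upper_def hstrip_def finsupp_cols antimono_cols)
qed

lemma cols_below: "cols ` strips_below s r mu nu = lower s r (cols mu) (cols nu) \<inter> {c. antimono c}"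
proof (intro set_eqI iffI)
  fix c assume "c \<in> lower s r (cols mu) (cols nu) \<inter> {c. antimono c}"
  moreover from this obtain lam where c: "c = cols lam" using ex_cols[of c] by (auto simp: lower_def)
  ultimately have "lam \<in> strips_below s r mu nu"
    using jumps_iff[of nu lam s] jumps_iff[of mu lam r] by (simp add: strips_below_def lower_def hstrip_def[symmetric])
  then show "c \<in> cols ` strips_below s r mu nu" using c by blast
next
  fix c assume "c \<in> cols ` strips_below s r mu nu"
  then obtain lam where "lam \<in> strips_below s r mu nu" "c = cols lam" by blast
  then show "c \<in> lower s r (cols mu) (cols nu) \<inter> {c. antimono c}"
    using jumps_iff[of nu lam s] jumps_iff[of mu lam r]
    by (simp add: strips_below_def lower_def hstrip_def finsupp_cols antimono_cols)
qed

text \<open>Sequences that do not come from partitions drop out of the column identity. An ascent of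
  \<open>kap\<close> forces two equal neighbouring columns in \<open>mu\<close>, where
  \<open>phi_col\<close> has the factor \<open>1 - t ^ 0\<close>; an ascent of \<open>lam\<close>
  likewise kills \<open>psi_col\<close>. Each sum above is then a fixed combination of the sums
  below, with coefficients that turn into vertex weights.\<close>

lemma refined_skew_cauchy:
  fixes t a b :: real
  assumes x: "\<bar>a * b\<bar> < 1"
  defines "w \<equiv> (1 - t) / (1 - a * b)" and "\<Phi> \<equiv> (1 - t * (a * b)) / (1 - a * b)"
  shows "\<exists>R. (\<forall>s r. ((\<lambda>kap. weight_P t a nu kap * weight_Q t b mu kap) has_sum R s r) (strips_below s r mu nu)) \<and>
    (\<forall>s r. ((\<lambda>lam. weight_P t a lam mu * weight_Q t b lam nu) has_sum
       (if s \<noteq> r then \<Phi> * R s r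
        else if s then a * b * w * R False False + t * R True True
        else R False False + w * R True True)) (strips_above s r mu nu))"
proof -
  have inj: "inj_on cols X" for X by (auto simp: inj_on_def cols_inject)
  have below: "((\<lambda>kap. weight_P t a nu kap * weight_Q t b mu kap) has_sum S) (strips_below s r mu nu)"
    if "((\<lambda>kap. wP t a (cols nu) kap * wQ t b (cols mu) kap) has_sum S) (lower s r (cols mu) (cols nu))" for S s r
  proof -
    let ?f = "\<lambda>kap. wP t a (cols nu) kap * wQ t b (cols mu) kap"
    have zero: "?f kap = 0" if kap: "kap \<in> lower s r (cols mu) (cols nu)" "\<not> antimono kap" for kap
    proof -
      obtain j where j: "kap j < kap (Suc j)" using not_antimonoE[OF kap(2)] .
      have st: "strip (cols mu) kap" "cols mu (Suc j) \<le> cols mu j"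
        using kap(1) antimono_cols[of mu] by (auto simp: lower_def antimono_def)
      then have "cols mu j = Suc (kap j)" "cols mu (Suc j) = kap (Suc j)" "cols mu j - cols mu (Suc j) = 0"
        using j st(1)[unfolded strip_def, rule_format, of j] st(1)[unfolded strip_def, rule_format, of "Suc j"]
        by linarith+
      then have "phi_col t (cols mu) kap = 0"
        unfolding phi_col_def using finite_strip_sets(3)[OF finsupp_cols[of mu], of kap]
        by (subst prod_zero_iff) (auto intro!: exI[of _ j])
      then show ?thesis by (simp add: wQ_def)
    qed
    have "(?f has_sum S) (cols ` strips_below s r mu nu)"
      using that unfolding cols_below
      by (subst has_sum_cong_neutral[of "lower s r (cols mu) (cols nu)" _ ?f ?f]) (use zero in auto)
    then have "((?f \<circ> cols) has_sum S) (strips_below s r mu nu)"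
      by (simp add: has_sum_reindex[OF inj])
    then show ?thesis
      by (subst has_sum_cong[where g = "?f \<circ> cols"]) (auto simp: strips_below_def weight_P_eq weight_Q_eq)
  qed
  have above: "((\<lambda>lam. weight_P t a lam mu * weight_Q t b lam nu) has_sum S) (strips_above s r mu nu)"
    if "((\<lambda>lam. wP t a lam (cols mu) * wQ t b lam (cols nu)) has_sum S) (upper s r (cols mu) (cols nu))" for S s r
  proof -
    let ?f = "\<lambda>lam. wP t a lam (cols mu) * wQ t b lam (cols nu)"
    have zero: "?f lam = 0" if lam: "lam \<in> upper s r (cols mu) (cols nu)" "\<not> antimono lam" for lam
    proof -
      obtain j where j: "lam j < lam (Suc j)" using not_antimonoE[OF lam(2)] .
      have st: "strip lam (cols mu)" "cols mu (Suc j) \<le> cols mu j" and fs: "finsupp lam"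
        using lam(1) antimono_cols[of mu] by (auto simp: upper_def antimono_def)
      then have "lam j = cols mu j" "lam (Suc j) = Suc (cols mu (Suc j))" "cols mu j - cols mu (Suc j) = 0"
        using j st(1)[unfolded strip_def, rule_format, of j] st(1)[unfolded strip_def, rule_format, of "Suc j"]
        by linarith+
      then have "psi_col t lam (cols mu) = 0"
        unfolding psi_col_def using finite_strip_sets(2)[OF fs, of "cols mu"]
        by (subst prod_zero_iff) (auto intro!: exI[of _ j])
      then show ?thesis by (simp add: wP_def)
    qed
    have "(?f has_sum S) (cols ` strips_above s r mu nu)"
      using that unfolding cols_above
      by (subst has_sum_cong_neutral[of "upper s r (cols mu) (cols nu)" _ ?f ?f]) (use zero in auto)
    then have "((?f \<circ> cols) has_sum S) (strips_above s r mu nu)"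
      by (simp add: has_sum_reindex[OF inj])
    then show ?thesis
      by (subst has_sum_cong[where g = "?f \<circ> cols"]) (auto simp: strips_above_def weight_P_eq weight_Q_eq)
  qed
  from column_cauchy[OF x antimono_cols antimono_cols finsupp_cols finsupp_cols, of t nu mu] above below
  show ?thesis unfolding w_def \<Phi>_def by meson
qed

section \<open>The unrefined identity, coefficient by coefficient\<close>

definition cauchy_coeff :: "real \<Rightarrow> nat \<Rightarrow> real" where
  "cauchy_coeff t n = (if n = 0 then 1 else 1 - t)"

lemma cauchy_coeff_sums:
  fixes t z :: real
  assumes "\<bar>z\<bar> < 1"
  shows "(\<lambda>n. cauchy_coeff t n * z ^ n) sums ((1 - t * z) / (1 - z))"
proof -
  have "(\<lambda>n. (1 - t) * z ^ n) sums ((1 - t) * (1 / (1 - z)))"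
    by (intro sums_mult geometric_sums) (use assms in simp)
  moreover have "(\<lambda>n. (if n = 0 then t else 0)) sums t"
    using sums_single[of 0 "\<lambda>_. t"] by (simp add: eq_commute)
  ultimately have "(\<lambda>n. (1 - t) * z ^ n + (if n = 0 then t else 0)) sums ((1 - t) * (1 / (1 - z)) + t)"
    by (rule sums_add)
  moreover have "(1 - t) * (1 / (1 - z)) + t = (1 - t * z) / (1 - z)"
    using assms by (simp add: field_simps)
  moreover have "(\<lambda>n. (1 - t) * z ^ n + (if n = 0 then t else 0)) = (\<lambda>n. cauchy_coeff t n * z ^ n)"
    by (auto simp: cauchy_coeff_def)
  ultimately show ?thesis by simp
qed

text \<open>The induction step divides the series by \<open>z\<close>, which is why the hypothesis
  is stated on the punctured disc.\<close>

lemma powser_sums_zero_imp_zero: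
  fixes f :: "nat \<Rightarrow> real"
  assumes "\<And>z. z \<noteq> 0 \<Longrightarrow> \<bar>z\<bar> < 1 \<Longrightarrow> (\<lambda>n. f n * z ^ n) sums 0"
  shows "f n = 0"
  using assms
proof (induction n arbitrary: f)
  case (0 f)
  have "((\<lambda>_. 0) \<longlongrightarrow> f 0) (at (0::real))"
    by (rule powser_limit_0_strong[of 1 f]) (use 0 in simp_all)
  then show ?case using LIM_const_eq[of 0 "f 0" 0] by simp
next
  case (Suc n f)
  have "((\<lambda>_. 0) \<longlongrightarrow> f 0) (at (0::real))"
    by (rule powser_limit_0_strong[of 1 f]) (use Suc.prems in simp_all)
  then have f0: "f 0 = 0" using LIM_const_eq[of 0 "f 0" 0] by simp
  show ?case
  proof (rule Suc.IH)
    fix z :: real assume z: "z \<noteq> 0" "\<bar>z\<bar> < 1"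
    have "(\<lambda>n. f (Suc n) * z ^ Suc n) sums 0"
      using Suc.prems[OF z] f0 by (subst sums_Suc_iff) simp
    then have "(\<lambda>n. f (Suc n) * z ^ Suc n / z) sums (0 / z)"
      by (rule sums_divide)
    then show "(\<lambda>n. f (Suc n) * z ^ n) sums 0" using z by simp
  qed
qed

lemma powser_coeff_unique:
  fixes f g :: "nat \<Rightarrow> real"
  assumes "\<And>z. \<bar>z\<bar> < 1 \<Longrightarrow> (\<lambda>n. f n * z ^ n) sums S z" "\<And>z. \<bar>z\<bar> < 1 \<Longrightarrow> (\<lambda>n. g n * z ^ n) sums S z"
  shows "f n = g n"
proof -
  have "(\<lambda>n. (f n - g n) * z ^ n) sums 0" if "\<bar>z\<bar> < 1" for z
    using sums_diff[OF assms[OF that]] by (simp add: left_diff_distrib)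
  from powser_sums_zero_imp_zero[of "\<lambda>n. f n - g n", OF this] show ?thesis by simp
qed

text \<open>Forgetting the bits makes the refined identity uniform: \<open>1 + z * w\<close> and
  \<open>t + w\<close> both equal \<open>(1 - t * z) / (1 - z)\<close>, so every lower sum receives
  the same factor. With \<open>a = z\<close> and \<open>b = 1\<close> both sides are power series in
  \<open>z\<close>, and \<open>cauchy_coeff\<close> lists the coefficients of that factor.\<close>

lemma skew_cauchy_coeff:
  fixes t :: real
  shows "(\<Sum>lam | hstrip lam mu \<and> hstrip lam nu \<and> psize lam = psize mu + n. psi t lam mu * phi t lam nu) =
    (\<Sum>kap | hstrip nu kap \<and> hstrip mu kap \<and> psize nu \<le> psize kap + n.
       psi t nu kap * phi t mu kap * cauchy_coeff t (psize kap + n - psize nu))"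
proof -
  define K where "K = {kap. hstrip nu kap \<and> hstrip mu kap}"
  define X where "X = {lam. hstrip lam mu \<and> hstrip lam nu}"
  have finK: "finite K" unfolding K_def by (rule finite_subset[OF _ finite_hstrip_lower[of nu]]) auto
  define S where "S z = (\<Sum>kap\<in>K. weight_P t z nu kap * weight_Q t 1 mu kap) * ((1 - t * z) / (1 - z))" for z
  have left: "(\<lambda>n. (\<Sum>lam | hstrip lam mu \<and> hstrip lam nu \<and> psize lam = psize mu + n. psi t lam mu * phi t lam nu) * z ^ n) sums S z"
    if z: "\<bar>z\<bar> < 1" for z
  proof -
    define w where "w = (1 - t) / (1 - z)"
    define \<Phi> where "\<Phi> = (1 - t * z) / (1 - z)"
    let ?W = "\<lambda>lam. weight_P t z lam mu * weight_Q t 1 lam nu"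
    let ?V = "\<lambda>kap. weight_P t z nu kap * weight_Q t 1 mu kap"
    obtain R where R: "\<And>s r. (?V has_sum R s r) (strips_below s r mu nu)"
      and L: "\<And>s r. (?W has_sum
       (if s \<noteq> r then \<Phi> * R s r
        else if s then z * w * R False False + t * R True True
        else R False False + w * R True True)) (strips_above s r mu nu)"
    proof -
      have "\<bar>z * 1\<bar> < 1" using z by simp
      from refined_skew_cauchy[OF this, of t nu mu]
       show ?thesis using that unfolding w_def \<Phi>_def by (simp only: mult_1_right) blast
    qed
    have "(?V has_sum (R False False + R True True + R True False + R False True)) (\<Union>(s, r)\<in>UNIV. strips_below s r mu nu)"
      by (rule has_sum_bool_UN[OF R]) (auto simp: strips_below_def)
    moreover have "(\<Union>(s, r)\<in>UNIV. strips_below s r mu nu) = K" by (auto simp: strips_below_def K_def)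
    ultimately have RK: "R False False + R True True + R True False + R False True = sum ?V K"
      using has_sum_finite[OF finK, of ?V] has_sum_unique by metis
    have phi: "\<Phi> = w + t" "w * z = w + t - 1"
      using z by (auto simp: w_def \<Phi>_def field_simps)
    have "(?W has_sum (R False False + w * R True True + (z * w * R False False + t * R True True) + \<Phi> * R True False + \<Phi> * R False True)) (\<Union>(s, r)\<in>UNIV. strips_above s r mu nu)"
      by (rule has_sum_bool_UN[where F = "\<lambda>s r. if s \<noteq> r then \<Phi> * R s r
        else if s then z * w * R False False + t * R True True
        else R False False + w * R True True", OF L, simplified]) (auto simp: strips_above_def)
    moreover have "(\<Union>(s, r)\<in>UNIV. strips_above s r mu nu) = X" by (auto simp: strips_above_def X_def)
    moreover have "R False False + w * R True True + (z * w * R False False + t * R True True) + \<Phi> * R True False + \<Phi> * R False True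
      = (R False False + R True True + R True False + R False True) * \<Phi>"
      using phi by algebra
    ultimately have "(?W has_sum S z) X"
      unfolding S_def RK \<Phi>_def by simp
    \<comment> \<open>Grading the strips by \<open>psize lam - psize mu\<close> turns the unordered
      sum into a power series in \<open>z\<close>.\<close>
    moreover have X: "X = snd ` Sigma UNIV (\<lambda>n. {lam\<in>X. psize lam = psize mu + n})"
    proof -
      have "lam \<in> X \<Longrightarrow> psize lam = psize mu + (psize lam - psize mu)" for lam
        using hstrip_psize_mono[of lam mu] by (auto simp: X_def)
      then show ?thesis by (force simp: image_iff)
    qed
    moreover have inj: "inj_on snd (Sigma UNIV (\<lambda>n. {lam\<in>X. psize lam = psize mu + n}))"
      by (auto simp: inj_on_def)
    ultimately have "((?W \<circ> snd) has_sum S z) (Sigma UNIV (\<lambda>n. {lam\<in>X. psize lam = psize mu + n}))"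
      using has_sum_reindex[OF inj, of ?W "S z"] by simp
    then have "((\<lambda>n. \<Sum>lam\<in>{lam\<in>X. psize lam = psize mu + n}. ?W lam) has_sum S z) UNIV"
    proof (rule has_sum_SigmaD)
      fix n :: nat
      have "finite {lam\<in>X. psize lam = psize mu + n}"
        by (rule finite_subset[OF _ finite_psize_eq[of "psize mu + n"]]) auto
      then show "((\<lambda>y. (?W \<circ> snd) (n, y)) has_sum sum ?W {lam\<in>X. psize lam = psize mu + n}) {lam\<in>X. psize lam = psize mu + n}"
        by (simp add: has_sum_finite)
    qed
    then have "(\<lambda>n. \<Sum>lam\<in>{lam\<in>X. psize lam = psize mu + n}. ?W lam) sums S z"
      by (rule has_sum_imp_sums)
    moreover have "(\<Sum>lam\<in>{lam\<in>X. psize lam = psize mu + n}. ?W lam) =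
       (\<Sum>lam | hstrip lam mu \<and> hstrip lam nu \<and> psize lam = psize mu + n. psi t lam mu * phi t lam nu) * z ^ n" for n
      unfolding sum_distrib_right
      by (rule sum.cong) (auto simp: X_def weight_P_def weight_Q_def)
    ultimately show ?thesis by simp
  qed
  have right: "(\<lambda>n. (\<Sum>kap | hstrip nu kap \<and> hstrip mu kap \<and> psize nu \<le> psize kap + n.
       psi t nu kap * phi t mu kap * cauchy_coeff t (psize kap + n - psize nu)) * z ^ n) sums S z"
    if z: "\<bar>z\<bar> < 1" for z
  proof -
    let ?d = "\<lambda>kap. psize nu - psize kap"
    have one: "(\<lambda>n. if psize nu \<le> psize kap + n then cauchy_coeff t (psize kap + n - psize nu) * z ^ n else 0)
       sums (z ^ ?d kap * ((1 - t * z) / (1 - z)))" if "kap \<in> K" for kap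
    proof -
      have le: "psize kap \<le> psize nu" using that hstrip_psize_mono by (auto simp: K_def)
      let ?g = "\<lambda>n. if psize nu \<le> psize kap + n then cauchy_coeff t (psize kap + n - psize nu) * z ^ n else 0"
      have "(\<lambda>n. ?g (n + ?d kap)) = (\<lambda>n. z ^ ?d kap * (cauchy_coeff t n * z ^ n))"
      proof
        fix n
        have c: "psize nu \<le> psize kap + (n + ?d kap)" "psize kap + (n + ?d kap) - psize nu = n"
          using le by simp_all
        show "?g (n + ?d kap) = z ^ ?d kap * (cauchy_coeff t n * z ^ n)"
          by (simp only: c if_True power_add mult_ac)
      qed
      moreover have "(\<lambda>n. z ^ ?d kap * (cauchy_coeff t n * z ^ n)) sums (z ^ ?d kap * ((1 - t * z) / (1 - z)))"
        by (intro sums_mult cauchy_coeff_sums z)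
      ultimately have "(\<lambda>n. ?g (n + ?d kap)) sums (z ^ ?d kap * ((1 - t * z) / (1 - z)))" by simp
      moreover have "(\<Sum>n<?d kap. ?g n) = 0" using le by (intro sum.neutral) auto
      ultimately show ?thesis using sums_iff_shift[of ?g "?d kap"] by simp
    qed
    have "(\<lambda>n. \<Sum>kap\<in>K. psi t nu kap * phi t mu kap *
        (if psize nu \<le> psize kap + n then cauchy_coeff t (psize kap + n - psize nu) * z ^ n else 0))
       sums (\<Sum>kap\<in>K. psi t nu kap * phi t mu kap * (z ^ ?d kap * ((1 - t * z) / (1 - z))))"
      by (intro sums_sum sums_mult one)
    moreover have "(\<Sum>kap\<in>K. psi t nu kap * phi t mu kap * (z ^ ?d kap * ((1 - t * z) / (1 - z)))) = S z"
      unfolding S_def sum_distrib_right by (simp add: weight_P_def weight_Q_def mult_ac)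
    moreover have "(\<Sum>kap\<in>K. psi t nu kap * phi t mu kap *
        (if psize nu \<le> psize kap + n then cauchy_coeff t (psize kap + n - psize nu) * z ^ n else 0)) =
      (\<Sum>kap | hstrip nu kap \<and> hstrip mu kap \<and> psize nu \<le> psize kap + n.
       psi t nu kap * phi t mu kap * cauchy_coeff t (psize kap + n - psize nu)) * z ^ n" for n
      unfolding sum_distrib_right
      by (rule sum.mono_neutral_cong_right) (use finK in \<open>auto simp: K_def\<close>)
    ultimately show ?thesis by simp
  qed
  show ?thesis by (rule powser_coeff_unique[OF left right])
qed

section \<open>Symmetric functions and the Cauchy kernel\<close>

lemma finite_submultisets: "finite {\<beta>. \<beta> \<subseteq># \<alpha>}"
proof (induction \<alpha>)
  case (add x \<alpha>)
  have "{\<beta>. \<beta> \<subseteq># add_mset x \<alpha>} \<subseteq> {\<beta>. \<beta> \<subseteq># \<alpha>} \<union> add_mset x ` {\<beta>. \<beta> \<subseteq># \<alpha>}"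
  proof
    fix \<beta> assume b: "\<beta> \<in> {\<beta>. \<beta> \<subseteq># add_mset x \<alpha>}"
    show "\<beta> \<in> {\<beta>. \<beta> \<subseteq># \<alpha>} \<union> add_mset x ` {\<beta>. \<beta> \<subseteq># \<alpha>}"
    proof (cases "x \<in># \<beta>")
      case True
      then obtain \<gamma> where "\<beta> = add_mset x \<gamma>" by (meson mset_add)
      then show ?thesis using b by auto
    next
      case False
      have "count \<beta> a \<le> count \<alpha> a" for a
        using mset_subset_eq_count[of \<beta> "add_mset x \<alpha>" a] b False
        by (cases "a = x") (auto simp: not_in_iff)
      then show ?thesis by (simp add: subseteq_mset_def)
    qed
  qed
  then show ?case using add.IH by (meson finite_UnI finite_imageI finite_subset)
qed simp

lemma series_mult_commute: "series_mult f g = series_mult g f"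
proof
  fix \<alpha>
  show "series_mult f g \<alpha> = series_mult g f \<alpha>"
    unfolding series_mult_def
    by (rule sum.reindex_bij_witness[of _ "\<lambda>\<beta>. \<alpha> - \<beta>" "\<lambda>\<beta>. \<alpha> - \<beta>"])
       (auto simp: subset_mset.diff_diff_right mult.commute)
qed

lemma series_mult_assoc: "series_mult (series_mult f g) h = series_mult f (series_mult g h)"
proof
  fix \<alpha>
  let ?S = "\<lambda>\<alpha>. {\<beta>. \<beta> \<subseteq># \<alpha>}"
  have "series_mult (series_mult f g) h \<alpha> =
      (\<Sum>\<beta>\<in>?S \<alpha>. \<Sum>\<gamma>\<in>?S \<beta>. f \<gamma> * g (\<beta> - \<gamma>) * h (\<alpha> - \<beta>))"
    by (simp add: series_mult_def sum_distrib_right)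
  also have "\<dots> = (\<Sum>(\<beta>, \<gamma>)\<in>Sigma (?S \<alpha>) ?S. f \<gamma> * g (\<beta> - \<gamma>) * h (\<alpha> - \<beta>))"
    by (rule sum.Sigma) (auto simp: finite_submultisets)
  also have "\<dots> = (\<Sum>(\<gamma>, \<delta>)\<in>Sigma (?S \<alpha>) (\<lambda>\<gamma>. ?S (\<alpha> - \<gamma>)). f \<gamma> * (g \<delta> * h (\<alpha> - \<gamma> - \<delta>)))"
    by (rule sum.reindex_bij_witness[of _ "\<lambda>(\<gamma>, \<delta>). (\<gamma> + \<delta>, \<gamma>)" "\<lambda>(\<beta>, \<gamma>). (\<gamma>, \<beta> - \<gamma>)"])
       (auto simp: subset_mset.add_diff_inverse subset_mset.le_diff_conv2 subset_mset.diff_add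
         add.commute intro: subset_mset.order_trans)
  also have "\<dots> = (\<Sum>\<gamma>\<in>?S \<alpha>. \<Sum>\<delta>\<in>?S (\<alpha> - \<gamma>). f \<gamma> * (g \<delta> * h (\<alpha> - \<gamma> - \<delta>)))"
    by (rule sum.Sigma[symmetric]) (auto simp: finite_submultisets)
  also have "\<dots> = series_mult f (series_mult g h) \<alpha>"
    by (simp add: series_mult_def sum_distrib_left)
  finally show "series_mult (series_mult f g) h \<alpha> = series_mult f (series_mult g h) \<alpha>" .
qed

lemma series_mult_one: "series_mult series_one f = f"
proof
  fix \<alpha>
  have "series_mult series_one f \<alpha> = (\<Sum>\<beta>\<in>{{#}}. series_one \<beta> * f (\<alpha> - \<beta>))"
    unfolding series_mult_def
    by (rule sum.mono_neutral_right) (auto simp: finite_submultisets series_one_def)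
  then show "series_mult series_one f \<alpha> = f \<alpha>" by (simp add: series_one_def)
qed

text \<open>Makes products over a multiset of factors well defined, so that power sums can be
  indexed by multisets of parts.\<close>

interpretation smult: comm_monoid_mset series_mult series_one
proof
  fix a b c show "series_mult (series_mult a b) c = series_mult a (series_mult b c)"
    by (rule series_mult_assoc)
  show "series_mult a b = series_mult b a" by (rule series_mult_commute)
  show "series_mult a series_one = a" by (simp add: series_mult_commute[of a] series_mult_one)
qed

lemma series_mult_sum_right:
  "series_mult f (\<lambda>\<gamma>. \<Sum>i\<in>I. c i * h i \<gamma>) = (\<lambda>\<alpha>. \<Sum>i\<in>I. c i * series_mult f (h i) \<alpha>)"
proof
  fix \<alpha>
  have "series_mult f (\<lambda>\<gamma>. \<Sum>i\<in>I. c i * h i \<gamma>) \<alpha> =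
      (\<Sum>\<beta> | \<beta> \<subseteq># \<alpha>. \<Sum>i\<in>I. c i * (f \<beta> * h i (\<alpha> - \<beta>)))"
    by (simp add: series_mult_def sum_distrib_left mult_ac)
  also have "\<dots> = (\<Sum>i\<in>I. \<Sum>\<beta> | \<beta> \<subseteq># \<alpha>. c i * (f \<beta> * h i (\<alpha> - \<beta>)))" by (rule sum.swap)
  finally show "series_mult f (\<lambda>\<gamma>. \<Sum>i\<in>I. c i * h i \<gamma>) \<alpha> = (\<Sum>i\<in>I. c i * series_mult f (h i) \<alpha>)"
    by (simp add: series_mult_def sum_distrib_left)
qed

lemma series_mult_sum_left:
  "series_mult (\<lambda>\<gamma>. \<Sum>i\<in>I. c i * h i \<gamma>) f = (\<lambda>\<alpha>. \<Sum>i\<in>I. c i * series_mult (h i) f \<alpha>)"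
  by (simp add: series_mult_commute[of _ f] series_mult_sum_right)

lemma replicate_mset_subset_iff: "replicate_mset k i \<subseteq># \<alpha> \<longleftrightarrow> k \<le> count \<alpha> i"
  by (simp add: count_le_replicate_mset_subset_eq)

lemma power_sum_mult:
  assumes "1 \<le> k"
  shows "series_mult (power_sum k) f \<alpha> =
    (\<Sum>i | i \<in># \<alpha> \<and> k \<le> count \<alpha> i. f (\<alpha> - replicate_mset k i))"
proof -
  have inj: "inj_on (replicate_mset k) A" for A :: "nat set"
    using assms by (auto simp: inj_on_def replicate_mset_eq_iff)
  have "series_mult (power_sum k) f \<alpha> =
      (\<Sum>\<beta>\<in>replicate_mset k ` {i. i \<in># \<alpha> \<and> k \<le> count \<alpha> i}. f (\<alpha> - \<beta>))"
    unfolding series_mult_def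
  proof (rule sum.mono_neutral_cong_right)
    show "replicate_mset k ` {i. i \<in># \<alpha> \<and> k \<le> count \<alpha> i} \<subseteq> {\<beta>. \<beta> \<subseteq># \<alpha>}"
      by (auto simp: replicate_mset_subset_iff)
    show "\<forall>\<beta>\<in>{\<beta>. \<beta> \<subseteq># \<alpha>} - replicate_mset k ` {i. i \<in># \<alpha> \<and> k \<le> count \<alpha> i}.
        power_sum k \<beta> * f (\<alpha> - \<beta>) = 0"
    proof
      fix \<beta> assume b: "\<beta> \<in> {\<beta>. \<beta> \<subseteq># \<alpha>} - replicate_mset k ` {i. i \<in># \<alpha> \<and> k \<le> count \<alpha> i}"
      have "\<beta> \<noteq> replicate_mset k i" for i
      proof
        assume e: "\<beta> = replicate_mset k i"
        then have "k \<le> count \<alpha> i" using b by (simp add: replicate_mset_subset_iff)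
        moreover from this have "i \<in># \<alpha>" using assms by (metis count_greater_eq_one_iff le_trans)
        ultimately show False using b e by blast
      qed
      then show "power_sum k \<beta> * f (\<alpha> - \<beta>) = 0" by (simp add: power_sum_def)
    qed
  qed (auto simp: finite_submultisets power_sum_def)
  then show ?thesis by (simp add: sum.reindex[OF inj])
qed

definition power_sum_mset :: "nat multiset \<Rightarrow> series" where
  "power_sum_mset \<rho> = smult.F (image_mset power_sum \<rho>)"

lemma power_sum_mset_empty [simp]: "power_sum_mset {#} = series_one"
  by (simp add: power_sum_mset_def)

lemma power_sum_mset_add [simp]:
  "power_sum_mset (add_mset k \<rho>) = series_mult (power_sum k) (power_sum_mset \<rho>)"
  by (simp add: power_sum_mset_def)

lemma power_sum_mset_size:
  "0 \<notin># \<rho> \<Longrightarrow> power_sum_mset \<rho> \<alpha> \<noteq> 0 \<Longrightarrow> size \<alpha> = sum_mset \<rho>"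
proof (induction \<rho> arbitrary: \<alpha>)
  case empty
  then show ?case by (auto simp: series_one_def split: if_splits)
next
  case (add k \<rho>)
  have k: "1 \<le> k" using add.prems by (cases k) auto
  obtain i where i: "k \<le> count \<alpha> i" "power_sum_mset \<rho> (\<alpha> - replicate_mset k i) \<noteq> 0"
    using add.prems(2) unfolding power_sum_mset_add power_sum_mult[OF k]
    by (elim sum.not_neutral_contains_not_neutral) auto
  then have "size (\<alpha> - replicate_mset k i) = sum_mset \<rho>" using add by simp
  moreover have "size \<alpha> = size (\<alpha> - replicate_mset k i) + k"
    using i(1) by (simp add: size_Diff_submset replicate_mset_subset_iff count_le_size le_trans[OF _ count_le_size])
  ultimately show ?case by simp
qed

text \<open>The one-row function \<open>q_m(x; t)\<close>, the coefficient of \<open>y ^ m\<close>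
  in the product over \<open>i\<close> of \<open>(1 - t x_i y) / (1 - x_i y)\<close>: each variable
  that occurs contributes \<open>1 - t\<close>, whatever its exponent.\<close>

definition one_row :: "real \<Rightarrow> nat \<Rightarrow> series" where
  "one_row t m \<alpha> = (if size \<alpha> = m then (1 - t) ^ card (set_mset \<alpha>) else 0)"

lemma sum_power_telescope:
  fixes t :: real
  assumes "1 \<le> c"
  shows "(\<Sum>k=1..<c. 1 - t ^ k) * (1 - t) + (1 - t ^ c) = (1 - t) * c"
  using assms by (induction c rule: dec_induct) (auto simp: algebra_simps)

text \<open>The Newton identity that comes from the logarithmic derivative of the generating
  function. On a monomial it splits over the variables: removing \<open>k\<close> copies of
  \<open>i\<close> loses a factor \<open>1 - t\<close> only when \<open>k\<close> is the full
  exponent, and \<open>sum_power_telescope\<close> adds these terms up to the exponent of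
  \<open>i\<close>, times the common power of \<open>1 - t\<close>.\<close>

lemma one_row_newton:
  "real m * one_row t m \<alpha> =
    (\<Sum>k=1..m. (1 - t ^ k) * series_mult (power_sum k) (one_row t (m - k)) \<alpha>)"
proof -
  define s where "s = card (set_mset \<alpha>)"
  have pm: "series_mult (power_sum k) (one_row t (m - k)) \<alpha> =
     (\<Sum>i | i \<in># \<alpha> \<and> k \<le> count \<alpha> i. if size \<alpha> = m then (1 - t) ^ (s - of_bool (k = count \<alpha> i)) else 0)"
    if k: "k \<in> {1..m}" for k
  proof -
    have "one_row t (m - k) (\<alpha> - replicate_mset k i) =
        (if size \<alpha> = m then (1 - t) ^ (s - of_bool (k = count \<alpha> i)) else 0)"
      if i: "i \<in># \<alpha>" "k \<le> count \<alpha> i" for i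
    proof -
      have sz: "size (\<alpha> - replicate_mset k i) = size \<alpha> - k" "k \<le> size \<alpha>"
        using i(2) count_le_size[of \<alpha> i] by (simp_all add: size_Diff_submset replicate_mset_subset_iff)
      have "set_mset (\<alpha> - replicate_mset k i) = (if k = count \<alpha> i then set_mset \<alpha> - {i} else set_mset \<alpha>)"
        using i by (auto simp: set_mset_diff split: if_splits)
      then show ?thesis using sz k i unfolding one_row_def s_def by auto
    qed
    then show ?thesis using k by (subst power_sum_mult) auto
  qed
  show ?thesis
  proof (cases "size \<alpha> = m")
    case False
    then show ?thesis using pm by (simp add: one_row_def)
  next
    case True
    have inner: "(\<Sum>k | k \<in> {1..m} \<and> k \<le> count \<alpha> i. (1 - t ^ k) * (1 - t) ^ (s - of_bool (k = count \<alpha> i)))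
        = (1 - t) ^ s * count \<alpha> i" if i: "i \<in># \<alpha>" for i
    proof -
      let ?c = "count \<alpha> i"
      have c: "1 \<le> ?c" "?c \<le> m" using i count_le_size[of \<alpha> i] True by (auto simp: Suc_le_eq)
      have s: "s = Suc (s - 1)" using i unfolding s_def by (simp add: card_gt_0_iff) (metis card_gt_0_iff empty_iff finite_set_mset Suc_pred)
      have "{k. k \<in> {1..m} \<and> k \<le> ?c} = insert ?c {1..<?c}" using c by auto
      then have "(\<Sum>k | k \<in> {1..m} \<and> k \<le> ?c. (1 - t ^ k) * (1 - t) ^ (s - of_bool (k = ?c)))
          = (1 - t ^ ?c) * (1 - t) ^ (s - 1) + (\<Sum>k=1..<?c. (1 - t ^ k) * (1 - t) ^ s)"
        by simp
      also have "\<dots> = (1 - t) ^ (s - 1) * ((\<Sum>k=1..<?c. 1 - t ^ k) * (1 - t) + (1 - t ^ ?c))"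
        by (subst (2) s) (simp add: sum_distrib_left sum_distrib_right algebra_simps)
      also have "\<dots> = (1 - t) ^ s * ?c"
        unfolding sum_power_telescope[OF c(1)] by (subst (2) s) simp
      finally show ?thesis .
    qed
    have "(\<Sum>k=1..m. (1 - t ^ k) * series_mult (power_sum k) (one_row t (m - k)) \<alpha>) =
        (\<Sum>k=1..m. \<Sum>i | i \<in> set_mset \<alpha> \<and> k \<le> count \<alpha> i. (1 - t ^ k) * (1 - t) ^ (s - of_bool (k = count \<alpha> i)))"
      by (rule sum.cong) (auto simp: pm True sum_distrib_left)
    also have "\<dots> = (\<Sum>i\<in>set_mset \<alpha>. \<Sum>k | k \<in> {1..m} \<and> k \<le> count \<alpha> i. (1 - t ^ k) * (1 - t) ^ (s - of_bool (k = count \<alpha> i)))"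
      by (rule sum.swap_restrict) auto
    also have "\<dots> = (\<Sum>i\<in>set_mset \<alpha>. (1 - t) ^ s * count \<alpha> i)"
      by (rule sum.cong[OF refl inner]) auto
    also have "\<dots> = real m * one_row t m \<alpha>"
      using True by (simp add: one_row_def s_def sum_distrib_left[symmetric] size_multiset_overloaded_eq[symmetric] of_nat_sum[symmetric] del: of_nat_sum)
    finally show ?thesis by simp
  qed
qed

text \<open>\<open>row_product t K \<beta>\<close> is \<open>\<Prod>\<^sub>i\<^sub><\<^sub>K g\<^sub>\<beta>\<^sub>i\<close>, the coefficient of \<open>y\<^sup>\<beta>\<close> in the Cauchy kernel.\<close>

primrec row_product :: "real \<Rightarrow> nat \<Rightarrow> nat multiset \<Rightarrow> series" where
  "row_product t 0 \<beta> = series_one"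
| "row_product t (Suc K) \<beta> = series_mult (one_row t (count \<beta> K)) (row_product t K \<beta>)"

lemma row_product_cong:
  "(\<And>i. i < K \<Longrightarrow> count \<alpha> i = count \<beta> i) \<Longrightarrow> row_product t K \<alpha> = row_product t K \<beta>"
  by (induction K) auto

text \<open>The degree in the second set of variables is a derivation, so the Newton identities of
  the factors add up by the Leibniz rule. The bound \<open>n\<close> provides one range of
  \<open>k\<close> for all factors.\<close>

lemma row_product_newton:
  assumes "\<And>i. i < K \<Longrightarrow> count \<beta> i \<le> n"
  shows "real (\<Sum>i<K. count \<beta> i) * row_product t K \<beta> \<alpha> =
    (\<Sum>k=1..n. (1 - t ^ k) * series_mult (power_sum k)
       (\<lambda>\<gamma>. \<Sum>i | i < K \<and> k \<le> count \<beta> i. row_product t K (\<beta> - replicate_mset k i) \<gamma>) \<alpha>)"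
  using assms
proof (induction K arbitrary: \<alpha>)
  case 0
  have "series_mult f (\<lambda>\<gamma>. 0) \<alpha> = 0" for f by (simp add: series_mult_def)
  then show ?case by simp
next
  case (Suc K)
  let ?b = "count \<beta> K" and ?G = "row_product t K \<beta>"
  have fin: "finite {i. i < K \<and> P i}" for P by simp
  have split: "(\<lambda>\<gamma>. \<Sum>i | i < Suc K \<and> k \<le> count \<beta> i. row_product t (Suc K) (\<beta> - replicate_mset k i) \<gamma>) =
    (\<lambda>\<gamma>. (if k \<le> ?b then series_mult (one_row t (?b - k)) ?G \<gamma> else 0) +
       series_mult (one_row t ?b) (\<lambda>\<gamma>. \<Sum>i | i < K \<and> k \<le> count \<beta> i. row_product t K (\<beta> - replicate_mset k i) \<gamma>) \<gamma>)" for k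
  proof
    fix \<gamma>
    have e1: "row_product t (Suc K) (\<beta> - replicate_mset k K) = series_mult (one_row t (?b - k)) ?G"
      using row_product_cong[of K "\<beta> - replicate_mset k K" \<beta> t] by simp
    have e2: "row_product t (Suc K) (\<beta> - replicate_mset k i) = series_mult (one_row t ?b) (row_product t K (\<beta> - replicate_mset k i))"
      if "i < K" for i
      using that by simp
    have "{i. i < Suc K \<and> k \<le> count \<beta> i} = (if k \<le> ?b then {K} else {}) \<union> {i. i < K \<and> k \<le> count \<beta> i}"
      by (auto simp: less_Suc_eq)
    then have "(\<Sum>i | i < Suc K \<and> k \<le> count \<beta> i. row_product t (Suc K) (\<beta> - replicate_mset k i) \<gamma>) =
       (\<Sum>i\<in>(if k \<le> ?b then {K} else {}). row_product t (Suc K) (\<beta> - replicate_mset k i) \<gamma>) +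
       (\<Sum>i | i < K \<and> k \<le> count \<beta> i. row_product t (Suc K) (\<beta> - replicate_mset k i) \<gamma>)"
      by (subst sum.union_disjoint[symmetric]) auto
    also have "(\<Sum>i | i < K \<and> k \<le> count \<beta> i. row_product t (Suc K) (\<beta> - replicate_mset k i) \<gamma>) =
        series_mult (one_row t ?b) (\<lambda>\<gamma>. \<Sum>i | i < K \<and> k \<le> count \<beta> i. 1 * row_product t K (\<beta> - replicate_mset k i) \<gamma>) \<gamma>"
      unfolding series_mult_sum_right by (rule sum.cong) (auto simp: e2 simp del: row_product.simps)
    finally show "(\<Sum>i | i < Suc K \<and> k \<le> count \<beta> i. row_product t (Suc K) (\<beta> - replicate_mset k i) \<gamma>) =
      (if k \<le> ?b then series_mult (one_row t (?b - k)) ?G \<gamma> else 0) +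
       series_mult (one_row t ?b) (\<lambda>\<gamma>. \<Sum>i | i < K \<and> k \<le> count \<beta> i. row_product t K (\<beta> - replicate_mset k i) \<gamma>) \<gamma>"
      by (simp add: e1 del: row_product.simps)
  qed
  have add: "series_mult f (\<lambda>\<gamma>. p \<gamma> + q \<gamma>) \<alpha> = series_mult f p \<alpha> + series_mult f q \<alpha>" for f p q
    by (simp add: series_mult_def distrib_left sum.distrib)
  have zero: "series_mult f (\<lambda>\<gamma>. 0) \<alpha> = 0" for f by (simp add: series_mult_def)
  define H where "H k = (\<lambda>\<gamma>. \<Sum>i | i < K \<and> k \<le> count \<beta> i. row_product t K (\<beta> - replicate_mset k i) \<gamma>)" for k
  have "(\<Sum>k=1..n. (1 - t ^ k) * series_mult (power_sum k)
       (\<lambda>\<gamma>. \<Sum>i | i < Suc K \<and> k \<le> count \<beta> i. row_product t (Suc K) (\<beta> - replicate_mset k i) \<gamma>) \<alpha>) =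
     (\<Sum>k=1..n. (1 - t ^ k) * (if k \<le> ?b then series_mult (power_sum k) (series_mult (one_row t (?b - k)) ?G) \<alpha> else 0)) +
     (\<Sum>k=1..n. (1 - t ^ k) * series_mult (power_sum k) (series_mult (one_row t ?b) (H k)) \<alpha>)"
    unfolding split sum.distrib[symmetric] distrib_left[symmetric] H_def
    by (intro sum.cong refl arg_cong[where f = "\<lambda>x. _ * x"]) (simp add: add zero)
  also have "(\<Sum>k=1..n. (1 - t ^ k) * (if k \<le> ?b then series_mult (power_sum k) (series_mult (one_row t (?b - k)) ?G) \<alpha> else 0)) =
      (\<Sum>k=1..?b. (1 - t ^ k) * series_mult (series_mult (power_sum k) (one_row t (?b - k))) ?G \<alpha>)"
    unfolding series_mult_assoc
    by (rule sum.mono_neutral_cong_right) (use Suc.prems[of K] in auto)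
  also have "\<dots> = series_mult (\<lambda>\<gamma>. real ?b * one_row t ?b \<gamma>) ?G \<alpha>"
    unfolding one_row_newton series_mult_sum_left ..
  also have "(\<Sum>k=1..n. (1 - t ^ k) * series_mult (power_sum k) (series_mult (one_row t ?b) (H k)) \<alpha>) =
      series_mult (one_row t ?b) (\<lambda>\<gamma>. \<Sum>k=1..n. (1 - t ^ k) * series_mult (power_sum k) (H k) \<gamma>) \<alpha>"
    unfolding series_mult_sum_right smult.left_commute[of "one_row t ?b"] ..
  also have "(\<lambda>\<gamma>. \<Sum>k=1..n. (1 - t ^ k) * series_mult (power_sum k) (H k) \<gamma>) =
      (\<lambda>\<gamma>. real (\<Sum>i<K. count \<beta> i) * ?G \<gamma>)"
    unfolding H_def using Suc.IH Suc.prems by (intro ext) (simp del: of_nat_sum)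
  finally show ?case
    by (simp add: series_mult_def sum_distrib_left distrib_left distrib_right sum.distrib mult_ac del: of_nat_sum)
qed

definition part_msets :: "nat \<Rightarrow> nat multiset set" where
  "part_msets n = {\<rho>. 0 \<notin># \<rho> \<and> sum_mset \<rho> = n}"

text \<open>The norm of a power sum product at \<open>q = 0\<close>: the factor
  \<open>z_factor\<close> divided by the product of \<open>1 - t ^ k\<close> over the parts
  \<open>k\<close>, with both collected by multiplicity.\<close>

definition z_mset :: "real \<Rightarrow> nat multiset \<Rightarrow> real" where
  "z_mset t \<rho> = (\<Prod>k\<in>set_mset \<rho>. fact (count \<rho> k) * (real k / (1 - t ^ k)) ^ count \<rho> k)"

lemma z_mset_add:
  "z_mset t (add_mset k \<rho>) = z_mset t \<rho> * (real (count \<rho> k + 1) * (real k / (1 - t ^ k)))"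
proof -
  let ?f = "\<lambda>\<rho> k. fact (count \<rho> k) * (real k / (1 - t ^ k)) ^ count \<rho> k"
  have A: "z_mset t \<rho> = (\<Prod>j\<in>set_mset \<rho> - {k}. ?f \<rho> j) * ?f \<rho> k" for \<rho>
  proof (cases "k \<in># \<rho>")
    case True
    then show ?thesis unfolding z_mset_def by (subst prod.remove[of _ k]) (auto simp: mult.commute)
  next
    case False
    then show ?thesis unfolding z_mset_def by (simp add: not_in_iff)
  qed
  have "(\<Prod>j\<in>set_mset (add_mset k \<rho>) - {k}. ?f (add_mset k \<rho>) j) = (\<Prod>j\<in>set_mset \<rho> - {k}. ?f \<rho> j)"
    by (rule prod.cong) auto
  then show ?thesis unfolding A by (simp add: mult_ac)
qed

lemma z_mset_pos:
  assumes "0 \<notin># \<rho>" "0 \<le> t" "t < 1"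
  shows "0 < z_mset t \<rho>"
  unfolding z_mset_def
proof (rule prod_pos)
  fix k assume "k \<in> set_mset \<rho>"
  then have "k \<noteq> 0" using assms(1) by metis
  then have "0 < real k / (1 - t ^ k)" using assms by (simp add: power_less_one_iff)
  then show "0 < fact (count \<rho> k) * (real k / (1 - t ^ k)) ^ count \<rho> k" by simp
qed

lemma sum_mset_ge: "k \<in># \<rho> \<Longrightarrow> k \<le> sum_mset (\<rho> :: nat multiset)"
  by (metis le_add1 mset_add sum_mset.add_mset)

lemma part_msets_size_le: "\<rho> \<in> part_msets n \<Longrightarrow> size \<rho> \<le> n"
proof -
  have "0 \<notin># \<rho> \<Longrightarrow> size \<rho> \<le> sum_mset \<rho>" for \<rho> :: "nat multiset"
  proof (induction \<rho>)
    case (add x \<rho>)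
    then show ?case by (cases x) auto
  qed simp
  then show "\<rho> \<in> part_msets n \<Longrightarrow> size \<rho> \<le> n" by (auto simp: part_msets_def)
qed

lemma finite_part_msets: "finite (part_msets n)"
proof -
  have "part_msets n \<subseteq> mset ` {xs. set xs \<subseteq> {..n} \<and> length xs \<le> n}"
  proof
    fix \<rho> assume r: "\<rho> \<in> part_msets n"
    obtain xs where xs: "mset xs = \<rho>" using ex_mset by blast
    have "set xs \<subseteq> {..n}" using r sum_mset_ge xs by (auto simp: part_msets_def)
    moreover have "length xs \<le> n" using part_msets_size_le[OF r] xs by auto
    ultimately show "\<rho> \<in> mset ` {xs. set xs \<subseteq> {..n} \<and> length xs \<le> n}" using xs by blast
  qed
  then show ?thesis by (rule finite_subset) (intro finite_imageI finite_lists_length_le, simp)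
qed

lemma sum_mset_eq_sum_count: "sum_mset \<rho> = (\<Sum>k\<in>set_mset \<rho>. count \<rho> k * k)"
proof (induction \<rho>)
  case (add k \<rho>)
  have A: "(\<Sum>j\<in>set_mset \<rho>. count \<rho> j * j) = (\<Sum>j\<in>set_mset \<rho> - {k}. count \<rho> j * j) + count \<rho> k * k" for \<rho>
    by (cases "k \<in># \<rho>") (simp_all add: sum.remove[of _ k] not_in_iff)
  have "(\<Sum>j\<in>set_mset (add_mset k \<rho>) - {k}. count (add_mset k \<rho>) j * j) = (\<Sum>j\<in>set_mset \<rho> - {k}. count \<rho> j * j)"
    by (rule sum.cong) auto
  then show ?case using add.IH A[of \<rho>] by (simp only: A[of "add_mset k \<rho>"]) simp
qed simp

text \<open>The Cauchy kernel in two sets of variables, read off at the monomials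
  \<open>\<beta>\<close> and \<open>\<alpha>\<close>. Both expansions obey the same recursion in the
  degree: multiplying by the power sum of degree \<open>k\<close> in both sets of variables adds the
  part \<open>k\<close> to \<open>\<rho>\<close>.\<close>

lemma kernel_expansion:
  assumes t: "0 \<le> t" "t < 1" and "set_mset \<beta> \<subseteq> {..<K}"
  shows "row_product t K \<beta> \<alpha> =
    (\<Sum>\<rho>\<in>part_msets (size \<beta>). power_sum_mset \<rho> \<beta> * power_sum_mset \<rho> \<alpha> / z_mset t \<rho>)"
  using assms(3)
proof (induction "size \<beta>" arbitrary: \<beta> \<alpha> rule: less_induct)
  case less
  define n where "n = size \<beta>"
  have sz: "(\<Sum>i<K. count \<beta> i) = n"
    unfolding n_def size_multiset_overloaded_eq
    by (rule sum.mono_neutral_right) (use less.prems in \<open>auto simp: not_in_iff\<close>)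
  show ?case
  proof (cases "n = 0")
    case True
    have "part_msets 0 = {{#}}"
      using part_msets_size_le[of _ 0] by (auto simp: part_msets_def)
    moreover have "row_product t K {#} = series_one"
    proof -
      have "one_row t 0 = series_one" by (auto simp: one_row_def series_one_def)
      then have "row_product t K {#} = series_one" by (induction K) (simp_all add: series_mult_one)
      then show ?thesis .
    qed
    ultimately show ?thesis using True by (simp add: n_def series_one_def z_mset_def)
  next
    case False
    let ?p = power_sum_mset and ?z = "z_mset t"
    have le: "count \<beta> i \<le> n" for i unfolding n_def by (rule count_le_size)
    have sub: "row_product t K (\<beta> - replicate_mset k i) \<gamma> =
        (\<Sum>\<sigma>\<in>part_msets (n - k). ?p \<sigma> (\<beta> - replicate_mset k i) * ?p \<sigma> \<gamma> / ?z \<sigma>)"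
      if "1 \<le> k" "k \<le> count \<beta> i" for k i \<gamma>
    proof -
      have s: "size (\<beta> - replicate_mset k i) = n - k"
        using that by (simp add: size_Diff_submset replicate_mset_subset_iff n_def)
      have "set_mset (\<beta> - replicate_mset k i) \<subseteq> {..<K}"
        using less.prems by (meson in_diffD subset_iff)
      moreover have "size (\<beta> - replicate_mset k i) < size \<beta>" using s that False unfolding n_def by linarith
      ultimately show ?thesis using less.hyps[of "\<beta> - replicate_mset k i" \<gamma>] unfolding s by blast
    qed
    have inner: "series_mult (power_sum k)
       (\<lambda>\<gamma>. \<Sum>i | i < K \<and> k \<le> count \<beta> i. row_product t K (\<beta> - replicate_mset k i) \<gamma>) \<alpha> =
       (\<Sum>\<sigma>\<in>part_msets (n - k). ?p (add_mset k \<sigma>) \<beta> * ?p (add_mset k \<sigma>) \<alpha> / ?z \<sigma>)" if k: "k \<in> {1..n}" for k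
    proof -
      have k1: "1 \<le> k" using k by simp
      have "(\<lambda>\<gamma>. \<Sum>i | i < K \<and> k \<le> count \<beta> i. row_product t K (\<beta> - replicate_mset k i) \<gamma>) =
        (\<lambda>\<gamma>. \<Sum>i | i < K \<and> k \<le> count \<beta> i. \<Sum>\<sigma>\<in>part_msets (n - k). ?p \<sigma> (\<beta> - replicate_mset k i) * ?p \<sigma> \<gamma> / ?z \<sigma>)"
        by (intro ext sum.cong refl sub) (use k1 in auto)
      also have "\<dots> = (\<lambda>\<gamma>. \<Sum>\<sigma>\<in>part_msets (n - k). (\<Sum>i | i < K \<and> k \<le> count \<beta> i. ?p \<sigma> (\<beta> - replicate_mset k i)) / ?z \<sigma> * ?p \<sigma> \<gamma>)"
        by (intro ext, subst sum.swap)
           (simp add: sum_distrib_left sum_distrib_right sum_divide_distrib mult_ac)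
      also have "\<dots> = (\<lambda>\<gamma>. \<Sum>\<sigma>\<in>part_msets (n - k). (?p (add_mset k \<sigma>) \<beta> / ?z \<sigma>) * ?p \<sigma> \<gamma>)"
      proof -
        have "{i. i \<in># \<beta> \<and> k \<le> count \<beta> i} = {i. i < K \<and> k \<le> count \<beta> i}"
          using less.prems k1 by (auto simp: subset_iff) (metis count_greater_zero_iff less_le_trans zero_less_one less_eq_Suc_le One_nat_def)
        then show ?thesis unfolding power_sum_mset_add power_sum_mult[OF k1] by simp
      qed
      finally have e: "(\<lambda>\<gamma>. \<Sum>i | i < K \<and> k \<le> count \<beta> i. row_product t K (\<beta> - replicate_mset k i) \<gamma>) =
        (\<lambda>\<gamma>. \<Sum>\<sigma>\<in>part_msets (n - k). (?p (add_mset k \<sigma>) \<beta> / ?z \<sigma>) * ?p \<sigma> \<gamma>)" .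
      show ?thesis unfolding e series_mult_sum_right by simp
    qed
    have "real n * row_product t K \<beta> \<alpha> =
        (\<Sum>k=1..n. \<Sum>\<sigma>\<in>part_msets (n - k). (1 - t ^ k) * (?p (add_mset k \<sigma>) \<beta> * ?p (add_mset k \<sigma>) \<alpha> / ?z \<sigma>))"
      using row_product_newton[of K \<beta> n t \<alpha>] le unfolding sz
      by (simp add: inner sum_distrib_left del: power_sum_mset_add)
    also have "\<dots> = (\<Sum>(k, \<sigma>)\<in>Sigma {1..n} (\<lambda>k. part_msets (n - k)). (1 - t ^ k) * (?p (add_mset k \<sigma>) \<beta> * ?p (add_mset k \<sigma>) \<alpha> / ?z \<sigma>))"
      by (rule sum.Sigma) (auto simp: finite_part_msets)
    \<comment> \<open>Adding the part \<open>k\<close> to \<open>\<sigma>\<close> multiplies the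
      norm by \<open>count \<rho> k * k / (1 - t ^ k)\<close>, where \<open>\<rho>\<close> is the
      result. So the factor \<open>1 - t ^ k\<close> is traded for
      \<open>count \<rho> k * k\<close>, and these sum to the degree \<open>n\<close> over the
      distinct parts.\<close>
    also have "\<dots> = (\<Sum>(\<rho>, k)\<in>Sigma (part_msets n) set_mset. real (count \<rho> k * k) * (?p \<rho> \<beta> * ?p \<rho> \<alpha> / ?z \<rho>))"
    proof (rule sum.reindex_bij_witness[of _ "\<lambda>(\<rho>, k). (k, \<rho> - {#k#})" "\<lambda>(k, \<sigma>). (add_mset k \<sigma>, k)"])
      fix x assume "x \<in> Sigma {1..n} (\<lambda>k. part_msets (n - k))"
      then obtain k \<sigma> where x: "x = (k, \<sigma>)" "k \<in> {1..n}" "\<sigma> \<in> part_msets (n - k)" by blast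
      have z: "?z \<sigma> \<noteq> 0" using z_mset_pos[OF _ t, of \<sigma>] x by (auto simp: part_msets_def)
      have "t ^ k < 1" using t x by (simp add: power_less_one_iff)
      then have "real (count (add_mset k \<sigma>) k * k) / ?z (add_mset k \<sigma>) = (1 - t ^ k) / ?z \<sigma>"
      proof -
        have "(c * k') / (z * (c * (k' / A))) = A / z" if "c \<noteq> 0" "k' \<noteq> 0" "z \<noteq> 0" "A \<noteq> 0" for c k' z A :: real
          using that by (simp add: field_simps)
        moreover have "real (count (add_mset k \<sigma>) k * k) = real (count \<sigma> k + 1) * real k"
          by (simp add: algebra_simps)
        moreover have "real (count \<sigma> k + 1) \<noteq> 0" "real k \<noteq> 0" "1 - t ^ k \<noteq> 0"
          using x \<open>t ^ k < 1\<close> by auto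
        ultimately show ?thesis unfolding z_mset_add using z by metis
      qed
      then have "real (count (add_mset k \<sigma>) k * k) * (?p (add_mset k \<sigma>) \<beta> * ?p (add_mset k \<sigma>) \<alpha> / ?z (add_mset k \<sigma>)) =
          (1 - t ^ k) * (?p (add_mset k \<sigma>) \<beta> * ?p (add_mset k \<sigma>) \<alpha> / ?z \<sigma>)"
        by (metis (no_types, opaque_lifting) times_divide_eq_left times_divide_eq_right mult.commute)
      then show "(case case x of (k, \<sigma>) \<Rightarrow> (add_mset k \<sigma>, k) of (\<rho>, k) \<Rightarrow> real (count \<rho> k * k) * (?p \<rho> \<beta> * ?p \<rho> \<alpha> / ?z \<rho>)) =
         (case x of (k, \<sigma>) \<Rightarrow> (1 - t ^ k) * (?p (add_mset k \<sigma>) \<beta> * ?p (add_mset k \<sigma>) \<alpha> / ?z \<sigma>))"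
        by (simp only: x prod.case)
    next
      fix y assume "y \<in> Sigma (part_msets n) set_mset"
      then obtain \<rho> k where y: "y = (\<rho>, k)" "\<rho> \<in> part_msets n" "k \<in># \<rho>" by blast
      obtain \<sigma> where s: "\<rho> = add_mset k \<sigma>" using y(3) by (meson mset_add)
      then show "(case y of (\<rho>, k) \<Rightarrow> (k, \<rho> - {#k#})) \<in> Sigma {1..n} (\<lambda>k. part_msets (n - k))"
        using y by (auto simp: part_msets_def Suc_le_eq)
    qed (auto simp: part_msets_def)
    also have "\<dots> = (\<Sum>\<rho>\<in>part_msets n. \<Sum>k\<in>set_mset \<rho>. real (count \<rho> k * k) * (?p \<rho> \<beta> * ?p \<rho> \<alpha> / ?z \<rho>))"
      by (rule sum.Sigma[symmetric]) (auto simp: finite_part_msets)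
    also have "\<dots> = (\<Sum>\<rho>\<in>part_msets n. real n * (?p \<rho> \<beta> * ?p \<rho> \<alpha> / ?z \<rho>))"
    proof (rule sum.cong[OF refl])
      fix \<rho> assume "\<rho> \<in> part_msets n"
      then have "n = (\<Sum>k\<in>set_mset \<rho>. count \<rho> k * k)"
        unfolding part_msets_def using sum_mset_eq_sum_count[of \<rho>] by simp
      then show "(\<Sum>k\<in>set_mset \<rho>. real (count \<rho> k * k) * (?p \<rho> \<beta> * ?p \<rho> \<alpha> / ?z \<rho>)) = real n * (?p \<rho> \<beta> * ?p \<rho> \<alpha> / ?z \<rho>)"
        by (simp only: sum_distrib_right[symmetric] of_nat_sum)
    qed
    finally have "real n * row_product t K \<beta> \<alpha> = real n * (\<Sum>\<rho>\<in>part_msets n. ?p \<rho> \<beta> * ?p \<rho> \<alpha> / ?z \<rho>)"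
      by (simp add: sum_distrib_left)
    then show ?thesis using False by (simp add: n_def)
  qed
qed

section \<open>Hall-Littlewood functions by the branching rule\<close>

text \<open>\<open>chain_P t K \<alpha> lam\<close> is the coefficient of \<open>x\<^sup>\<alpha>\<close> in \<open>P\<^sub>\<lambda>(x\<^sub>0, \<dots>, x\<^sub>K\<^sub>-\<^sub>1)\<close>, by the branching rule.\<close>

primrec chain_P :: "real \<Rightarrow> nat \<Rightarrow> nat multiset \<Rightarrow> partition \<Rightarrow> real" where
  "chain_P t 0 \<alpha> lam = of_bool (psize lam = 0)"
| "chain_P t (Suc K) \<alpha> lam =
    (\<Sum>kap | hstrip lam kap \<and> psize lam = psize kap + count \<alpha> K. psi t lam kap * chain_P t K \<alpha> kap)"

text \<open>Adding \<open>i + 1\<close> over the monomial exceeds every index that occurs, so this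
  many variables contain the monomial.\<close>

definition var_bound :: "nat multiset \<Rightarrow> nat" where
  "var_bound \<alpha> = sum_mset (image_mset Suc \<alpha>)"

definition hall_P :: "real \<Rightarrow> partition \<Rightarrow> series" where
  "hall_P t lam \<alpha> = chain_P t (var_bound \<alpha>) \<alpha> lam"

lemma var_bound: "set_mset \<alpha> \<subseteq> {..<var_bound \<alpha>}"
proof
  fix i assume "i \<in># \<alpha>"
  then have "Suc i \<le> sum_mset (image_mset Suc \<alpha>)" by (intro sum_mset_ge) auto
  then show "i \<in> {..<var_bound \<alpha>}" by (simp add: var_bound_def)
qed

lemma finite_hstrip_conj: "finite {kap. hstrip lam kap \<and> Q kap}"
  by (rule finite_subset[OF _ finite_hstrip_lower[of lam]]) auto

lemma chain_P_cong:
  "(\<And>i. i < K \<Longrightarrow> count \<alpha> i = count \<beta> i) \<Longrightarrow> chain_P t K \<alpha> lam = chain_P t K \<beta> lam"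
proof (induction K arbitrary: lam)
  case (Suc K)
  have IH: "chain_P t K \<alpha> kap = chain_P t K \<beta> kap" for kap
    by (rule Suc.IH) (use Suc.prems in auto)
  show ?case using Suc.prems[of K] by (simp add: IH)
qed simp

text \<open>A variable of exponent 0 contributes a strip of size 0, so the chain pauses
  there.\<close>

lemma chain_P_stable:
  assumes "set_mset \<alpha> \<subseteq> {..<K}" "K \<le> L"
  shows "chain_P t L \<alpha> lam = chain_P t K \<alpha> lam"
  using assms(2)
proof (induction rule: dec_induct)
  case (step L)
  have "L \<notin># \<alpha>" using assms step by auto
  then have "count \<alpha> L = 0" by (simp add: not_in_iff)
  then have "{kap. hstrip lam kap \<and> psize lam = psize kap + count \<alpha> L} = {lam}"
    using hstrip_same_size by auto
  then show ?case using step by simp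
qed simp

lemma hall_P_eq_chain:
  assumes "set_mset \<alpha> \<subseteq> {..<K}"
  shows "hall_P t lam \<alpha> = chain_P t K \<alpha> lam"
  unfolding hall_P_def
  using chain_P_stable[OF assms, of "max K (var_bound \<alpha>)"] chain_P_stable[OF var_bound, of \<alpha> "max K (var_bound \<alpha>)"]
  by simp

text \<open>The source of the dominance triangularity of \<open>hall_P\<close>. Every step adds at
  most one row and only enlarges the diagram, so partial row sums are inherited from the previous
  partition of the chain; the last partial sum is the total size.\<close>

lemma chain_P_nonzeroD:
  assumes "chain_P t K \<alpha> lam \<noteq> 0"
  shows "plength lam \<le> K \<and> psize lam = (\<Sum>i<K. count \<alpha> i) \<and>
    (\<forall>k\<le>K. (\<Sum>i<k. count \<alpha> i) \<le> (\<Sum>i<k. part lam i))"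
  using assms
proof (induction K arbitrary: lam)
  case 0
  then show ?case using plength_le_psize[of lam] by (auto split: if_splits)
next
  case (Suc K)
  obtain kap where kap: "hstrip lam kap" "psize lam = psize kap + count \<alpha> K" "chain_P t K \<alpha> kap \<noteq> 0"
    using Suc.prems unfolding chain_P.simps by (elim sum.not_neutral_contains_not_neutral) auto
  note IH = Suc.IH[OF kap(3)]
  have sz: "psize lam = (\<Sum>i<Suc K. count \<alpha> i)" using IH kap(2) by simp
  have len: "plength lam \<le> Suc K" using IH hstrip_plength[OF kap(1)] by auto
  have "(\<Sum>i<k. count \<alpha> i) \<le> (\<Sum>i<k. part lam i)" if "k \<le> Suc K" for k
  proof (cases "k = Suc K")
    case True
    then show ?thesis using psize_parts[OF len] sz by simp
  next
    case False
    then have "(\<Sum>i<k. count \<alpha> i) \<le> (\<Sum>i<k. part kap i)" using that IH by auto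
    also have "\<dots> \<le> (\<Sum>i<k. part lam i)"
      using hstrip_subset[OF kap(1)] by (intro sum_mono) (simp add: diagram_subset_def)
    finally show ?thesis .
  qed
  then show ?case using sz len by blast
qed

lemma one_row_shift:
  assumes "K \<notin># \<gamma>"
  shows "one_row t m (\<gamma> + replicate_mset r K) = (if r \<le> m then cauchy_coeff t r * one_row t (m - r) \<gamma> else 0)"
proof (cases "r = 0")
  case False
  have "set_mset (\<gamma> + replicate_mset r K) = insert K (set_mset \<gamma>)" using False by auto
  then have "card (set_mset (\<gamma> + replicate_mset r K)) = Suc (card (set_mset \<gamma>))" using assms by simp
  then show ?thesis using False by (auto simp: one_row_def cauchy_coeff_def)
qed (simp add: cauchy_coeff_def)

lemma submultiset_split:
  assumes "K \<notin># \<alpha>'"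
  shows "bij_betw (\<lambda>(\<beta>, j). \<beta> + replicate_mset j K) ({\<beta>. \<beta> \<subseteq># \<alpha>'} \<times> {..n}) {\<beta>. \<beta> \<subseteq># \<alpha>' + replicate_mset n K}"
proof (rule bij_betw_byWitness[where f' = "\<lambda>\<beta>. (filter_mset (\<lambda>i. i \<noteq> K) \<beta>, count \<beta> K)"])
  have c: "count \<alpha>' K = 0" using assms by (simp add: not_in_iff)
  show "\<forall>a\<in>{\<beta>. \<beta> \<subseteq># \<alpha>'} \<times> {..n}. (\<lambda>\<beta>. (filter_mset (\<lambda>i. i \<noteq> K) \<beta>, count \<beta> K)) ((\<lambda>(\<beta>, j). \<beta> + replicate_mset j K) a) = a"
  proof
    fix a assume "a \<in> {\<beta>. \<beta> \<subseteq># \<alpha>'} \<times> {..n}"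
    then obtain \<beta> j where a: "a = (\<beta>, j)" "\<beta> \<subseteq># \<alpha>'" by blast
    then have "count \<beta> K = 0" using mset_subset_eq_count[of \<beta> \<alpha>' K] c by simp
    then have "(filter_mset (\<lambda>i. i \<noteq> K) (\<beta> + replicate_mset j K), count (\<beta> + replicate_mset j K) K) = (\<beta>, j)"
      by (auto simp: multiset_eq_iff)
    then show "(\<lambda>\<beta>. (filter_mset (\<lambda>i. i \<noteq> K) \<beta>, count \<beta> K)) ((\<lambda>(\<beta>, j). \<beta> + replicate_mset j K) a) = a"
      by (simp only: a prod.case)
  qed
  show "\<forall>a'\<in>{\<beta>. \<beta> \<subseteq># \<alpha>' + replicate_mset n K}. (\<lambda>(\<beta>, j). \<beta> + replicate_mset j K) (filter_mset (\<lambda>i. i \<noteq> K) a', count a' K) = a'"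
    by (auto simp: multiset_eq_iff)
  show "(\<lambda>(\<beta>, j). \<beta> + replicate_mset j K) ` ({\<beta>. \<beta> \<subseteq># \<alpha>'} \<times> {..n}) \<subseteq> {\<beta>. \<beta> \<subseteq># \<alpha>' + replicate_mset n K}"
    by (auto intro!: subset_mset.add_mono simp: replicate_mset_subset_iff)
  show "(\<lambda>\<beta>. (filter_mset (\<lambda>i. i \<noteq> K) \<beta>, count \<beta> K)) ` {\<beta>. \<beta> \<subseteq># \<alpha>' + replicate_mset n K} \<subseteq> {\<beta>. \<beta> \<subseteq># \<alpha>'} \<times> {..n}"
  proof (rule image_subsetI)
    fix \<beta> assume "\<beta> \<in> {\<beta>. \<beta> \<subseteq># \<alpha>' + replicate_mset n K}"
    then have b: "\<beta> \<subseteq># \<alpha>' + replicate_mset n K" by simp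
    have "filter_mset (\<lambda>i. i \<noteq> K) \<beta> \<subseteq># \<alpha>'"
      unfolding subseteq_mset_def
    proof
      fix a show "count (filter_mset (\<lambda>i. i \<noteq> K) \<beta>) a \<le> count \<alpha>' a"
        using mset_subset_eq_count[OF b, of a] by (cases "a = K") simp_all
    qed
    moreover have "count \<beta> K \<le> n" using mset_subset_eq_count[OF b, of K] c by simp
    ultimately show "(filter_mset (\<lambda>i. i \<noteq> K) \<beta>, count \<beta> K) \<in> {\<beta>. \<beta> \<subseteq># \<alpha>'} \<times> {..n}" by simp
  qed
qed

text \<open>Induction on the number of variables. The last variable splits a \<open>psi\<close>-step
  off the chain of \<open>lam\<close>; the skew Cauchy identity moves the \<open>phi\<close>-step
  below it, where the induction hypothesis applies, and the leftover power of the last variable is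
  absorbed by the one-row function.\<close>

lemma pieri_chain:
  assumes "set_mset \<alpha> \<subseteq> {..<K}"
  shows "(\<Sum>lam | hstrip lam nu \<and> psize lam = psize nu + m. phi t lam nu * chain_P t K \<alpha> lam) =
    (\<Sum>\<beta> | \<beta> \<subseteq># \<alpha>. chain_P t K \<beta> nu * one_row t m (\<alpha> - \<beta>))"
  using assms
proof (induction K arbitrary: \<alpha> nu m)
  case 0
  then have a: "\<alpha> = {#}" by auto
  have "(\<Sum>lam | hstrip lam nu \<and> psize lam = psize nu + m. phi t lam nu * chain_P t 0 \<alpha> lam) = of_bool (psize nu = 0 \<and> m = 0)"
  proof (cases "psize nu = 0 \<and> m = 0")
    case True
    then have "{lam. hstrip lam nu \<and> psize lam = psize nu + m} = {nu}" using hstrip_same_size by auto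
    then show ?thesis using True by simp
  next
    case False
    then show ?thesis by (auto intro!: sum.neutral)
  qed
  moreover have "(\<Sum>\<beta> | \<beta> \<subseteq># \<alpha>. chain_P t 0 \<beta> nu * one_row t m (\<alpha> - \<beta>)) = of_bool (psize nu = 0 \<and> m = 0)"
    by (auto simp: a one_row_def)
  ultimately show ?case by simp
next
  case (Suc K)
  define n where "n = count \<alpha> K"
  define \<alpha>' where "\<alpha>' = filter_mset (\<lambda>i. i \<noteq> K) \<alpha>"
  have K: "K \<notin># \<alpha>'" by (simp add: \<alpha>'_def)
  have \<alpha>: "\<alpha> = \<alpha>' + replicate_mset n K" by (auto simp: \<alpha>'_def n_def multiset_eq_iff)
  have a': "set_mset \<alpha>' \<subseteq> {..<K}" using Suc.prems by (auto simp: \<alpha>'_def less_Suc_eq)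
  have cong: "chain_P t K (\<beta> + replicate_mset j K) kap = chain_P t K \<beta> kap" for \<beta> j kap
    by (rule chain_P_cong) auto
  let ?C = "\<lambda>\<beta> kap. chain_P t K \<beta> kap"
  let ?M = "{mu. psize mu + n = psize nu + m}"
  let ?L = "{lam. psize lam = psize nu + m}"
  let ?N = "{kap. hstrip nu kap \<and> psize nu \<le> psize kap + n}"
  have finM: "finite ?M"
    by (rule finite_subset[OF _ finite_psize_le[of "psize nu + m"]]) auto
  have finL: "finite ?L" by (rule finite_psize_eq)
  have finN: "finite ?N" by (rule finite_hstrip_conj)
  have "(\<Sum>lam | hstrip lam nu \<and> psize lam = psize nu + m. phi t lam nu * chain_P t (Suc K) \<alpha> lam) =
      (\<Sum>lam | lam \<in> ?L \<and> hstrip lam nu. \<Sum>mu | mu \<in> ?M \<and> hstrip lam mu. phi t lam nu * (psi t lam mu * ?C \<alpha>' mu))"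
    unfolding chain_P.simps sum_distrib_left
    by (intro sum.cong) (auto simp: \<alpha> cong n_def[symmetric] not_in_iff[THEN iffD1, OF K])
  also have "\<dots> = (\<Sum>lam\<in>?L. \<Sum>mu | mu \<in> ?M \<and> hstrip lam mu \<and> hstrip lam nu. phi t lam nu * (psi t lam mu * ?C \<alpha>' mu))"
    by (rule sum.mono_neutral_cong_left) (auto simp: finL intro!: sum.cong)
  also have "\<dots> = (\<Sum>mu\<in>?M. \<Sum>lam | lam \<in> ?L \<and> hstrip lam mu \<and> hstrip lam nu. phi t lam nu * (psi t lam mu * ?C \<alpha>' mu))"
    by (rule sum.swap_restrict[OF finL finM])
  also have "\<dots> = (\<Sum>mu\<in>?M. ?C \<alpha>' mu * (\<Sum>lam | hstrip lam mu \<and> hstrip lam nu \<and> psize lam = psize mu + n. psi t lam mu * phi t lam nu))"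
  proof (rule sum.cong[OF refl])
    fix mu assume "mu \<in> ?M"
    then have "{lam \<in> ?L. hstrip lam mu \<and> hstrip lam nu} = {lam. hstrip lam mu \<and> hstrip lam nu \<and> psize lam = psize mu + n}" by auto
    then show "(\<Sum>lam | lam \<in> ?L \<and> hstrip lam mu \<and> hstrip lam nu. phi t lam nu * (psi t lam mu * ?C \<alpha>' mu)) =
       ?C \<alpha>' mu * (\<Sum>lam | hstrip lam mu \<and> hstrip lam nu \<and> psize lam = psize mu + n. psi t lam mu * phi t lam nu)"
      by (simp add: sum_distrib_left mult_ac)
  qed
  \<comment> \<open>The exchange of the two steps: the sum over common larger partitions becomes one
    over common smaller ones, at the price of \<open>cauchy_coeff\<close>.\<close>
  also have "\<dots> = (\<Sum>mu\<in>?M. \<Sum>kap | kap \<in> ?N \<and> hstrip mu kap. ?C \<alpha>' mu * (psi t nu kap * phi t mu kap * cauchy_coeff t (psize kap + n - psize nu)))"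
    unfolding skew_cauchy_coeff sum_distrib_left
    by (intro sum.cong refl) auto
  also have "\<dots> = (\<Sum>kap\<in>?N. \<Sum>mu | mu \<in> ?M \<and> hstrip mu kap. ?C \<alpha>' mu * (psi t nu kap * phi t mu kap * cauchy_coeff t (psize kap + n - psize nu)))"
    by (rule sum.swap_restrict[OF finM finN])
  \<comment> \<open>Of the \<open>n\<close> copies of the variable \<open>K\<close>,
    \<open>psize nu - psize kap\<close> belong to the \<open>psi\<close>-step. The remaining ones
    join the one-row function, where \<open>one_row_shift\<close> recognizes
    \<open>cauchy_coeff\<close> as their contribution.\<close>
  also have "\<dots> = (\<Sum>kap\<in>?N. \<Sum>\<beta> | \<beta> \<subseteq># \<alpha>'. psi t nu kap * ?C \<beta> kap * one_row t m (\<alpha>' - \<beta> + replicate_mset (psize kap + n - psize nu) K))"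
  proof (rule sum.cong[OF refl])
    fix kap assume kap: "kap \<in> ?N"
    define r where "r = psize kap + n - psize nu"
    have notin: "K \<notin># \<alpha>' - \<beta>" for \<beta> using K by (meson in_diffD)
    show "(\<Sum>mu | mu \<in> ?M \<and> hstrip mu kap. ?C \<alpha>' mu * (psi t nu kap * phi t mu kap * cauchy_coeff t (psize kap + n - psize nu))) =
      (\<Sum>\<beta> | \<beta> \<subseteq># \<alpha>'. psi t nu kap * ?C \<beta> kap * one_row t m (\<alpha>' - \<beta> + replicate_mset (psize kap + n - psize nu) K))"
    proof (cases "r \<le> m")
      case True
      have "{mu \<in> ?M. hstrip mu kap} = {mu. hstrip mu kap \<and> psize mu = psize kap + (m - r)}"
        using kap True by (auto simp: r_def)
      then have "(\<Sum>mu | mu \<in> ?M \<and> hstrip mu kap. ?C \<alpha>' mu * (psi t nu kap * phi t mu kap * cauchy_coeff t r)) =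
          psi t nu kap * cauchy_coeff t r * (\<Sum>mu | hstrip mu kap \<and> psize mu = psize kap + (m - r). phi t mu kap * ?C \<alpha>' mu)"
        by (simp add: sum_distrib_left mult_ac)
      also have "\<dots> = (\<Sum>\<beta> | \<beta> \<subseteq># \<alpha>'. psi t nu kap * ?C \<beta> kap * one_row t m (\<alpha>' - \<beta> + replicate_mset r K))"
        unfolding Suc.IH[OF a'] one_row_shift[OF notin] sum_distrib_left using True by (simp add: mult_ac)
      finally show ?thesis by (simp add: r_def)
    next
      case False
      have e: "{mu. mu \<in> ?M \<and> hstrip mu kap} = {}"
        using kap False hstrip_psize_mono[of _ kap] by (fastforce simp: r_def)
      then have "(\<Sum>mu | mu \<in> ?M \<and> hstrip mu kap. ?C \<alpha>' mu * (psi t nu kap * phi t mu kap * cauchy_coeff t r)) = 0"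
        unfolding e by simp
      also have "\<dots> = (\<Sum>\<beta> | \<beta> \<subseteq># \<alpha>'. psi t nu kap * ?C \<beta> kap * one_row t m (\<alpha>' - \<beta> + replicate_mset r K))"
        unfolding one_row_shift[OF notin] using False by simp
      finally show ?thesis by (simp add: r_def)
    qed
  qed
  \<comment> \<open>From here on the goal is to recognize submultisets of \<open>\<alpha>\<close>:
    the exponent \<open>j\<close> of \<open>K\<close> is introduced as a second index, although
    \<open>kap\<close> determines it.\<close>
  also have "\<dots> = (\<Sum>\<beta> | \<beta> \<subseteq># \<alpha>'. \<Sum>kap\<in>?N. psi t nu kap * ?C \<beta> kap * one_row t m (\<alpha>' - \<beta> + replicate_mset (psize kap + n - psize nu) K))"
    by (rule sum.swap)
  also have "\<dots> = (\<Sum>\<beta> | \<beta> \<subseteq># \<alpha>'. \<Sum>j\<le>n. \<Sum>kap | kap \<in> ?N \<and> psize nu = psize kap + j.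
      psi t nu kap * ?C \<beta> kap * one_row t m (\<alpha>' - \<beta> + replicate_mset (n - j) K))"
  proof (rule sum.cong[OF refl])
    fix \<beta>
    have "(\<Sum>kap\<in>?N. psi t nu kap * ?C \<beta> kap * one_row t m (\<alpha>' - \<beta> + replicate_mset (psize kap + n - psize nu) K)) =
       (\<Sum>kap\<in>?N. \<Sum>j | j \<in> {..n} \<and> psize nu = psize kap + j. psi t nu kap * ?C \<beta> kap * one_row t m (\<alpha>' - \<beta> + replicate_mset (n - j) K))"
    proof (rule sum.cong[OF refl])
      fix kap assume kap: "kap \<in> ?N"
      then have "{j. j \<in> {..n} \<and> psize nu = psize kap + j} = {psize nu - psize kap}"
        using hstrip_psize_mono[of nu kap] by auto
      moreover have "psize kap + n - psize nu = n - (psize nu - psize kap)"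
        using kap hstrip_psize_mono[of nu kap] by auto
      ultimately show "psi t nu kap * ?C \<beta> kap * one_row t m (\<alpha>' - \<beta> + replicate_mset (psize kap + n - psize nu) K) =
        (\<Sum>j | j \<in> {..n} \<and> psize nu = psize kap + j. psi t nu kap * ?C \<beta> kap * one_row t m (\<alpha>' - \<beta> + replicate_mset (n - j) K))"
        by simp
    qed
    also have "\<dots> = (\<Sum>j\<le>n. \<Sum>kap | kap \<in> ?N \<and> psize nu = psize kap + j. psi t nu kap * ?C \<beta> kap * one_row t m (\<alpha>' - \<beta> + replicate_mset (n - j) K))"
      by (rule sum.swap_restrict[OF finN]) simp
    finally show "(\<Sum>kap\<in>?N. psi t nu kap * ?C \<beta> kap * one_row t m (\<alpha>' - \<beta> + replicate_mset (psize kap + n - psize nu) K)) = \<dots>" .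
  qed
  also have "\<dots> = (\<Sum>\<beta> | \<beta> \<subseteq># \<alpha>'. \<Sum>j\<le>n. chain_P t (Suc K) (\<beta> + replicate_mset j K) nu * one_row t m (\<alpha> - (\<beta> + replicate_mset j K)))"
  proof (intro sum.cong refl)
    fix \<beta> j assume b: "\<beta> \<in> {\<beta>. \<beta> \<subseteq># \<alpha>'}" and j: "j \<in> {..n}"
    have c: "count \<beta> K = 0" using b mset_subset_eq_count[of \<beta> \<alpha>' K] K by (simp add: not_in_iff)
    have d: "\<alpha>' - \<beta> + replicate_mset (n - j) K = \<alpha> - (\<beta> + replicate_mset j K)"
      using b j c by (auto simp: \<alpha> multiset_eq_iff dest: mset_subset_eq_count)
    have s: "{kap. kap \<in> ?N \<and> psize nu = psize kap + j} = {kap. hstrip nu kap \<and> psize nu = psize kap + count (\<beta> + replicate_mset j K) K}"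
      using j c by auto
    show "(\<Sum>kap | kap \<in> ?N \<and> psize nu = psize kap + j. psi t nu kap * ?C \<beta> kap * one_row t m (\<alpha>' - \<beta> + replicate_mset (n - j) K)) =
       chain_P t (Suc K) (\<beta> + replicate_mset j K) nu * one_row t m (\<alpha> - (\<beta> + replicate_mset j K))"
      unfolding s d chain_P.simps cong sum_distrib_right ..
  qed
  also have "\<dots> = (\<Sum>(\<beta>, j)\<in>{\<beta>. \<beta> \<subseteq># \<alpha>'} \<times> {..n}. chain_P t (Suc K) (\<beta> + replicate_mset j K) nu * one_row t m (\<alpha> - (\<beta> + replicate_mset j K)))"
    by (rule sum.cartesian_product)
  also have "\<dots> = (\<Sum>\<beta> | \<beta> \<subseteq># \<alpha>. chain_P t (Suc K) \<beta> nu * one_row t m (\<alpha> - \<beta>))"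
    using sum.reindex_bij_betw[OF submultiset_split[OF K, of n], of "\<lambda>\<beta>. chain_P t (Suc K) \<beta> nu * one_row t m (\<alpha> - \<beta>)"]
    unfolding \<alpha>[symmetric] by (simp add: case_prod_unfold)
  finally show ?case .
qed

theorem pieri:
  "series_mult (hall_P t nu) (one_row t m) =
    (\<lambda>\<alpha>. \<Sum>lam | hstrip lam nu \<and> psize lam = psize nu + m. phi t lam nu * hall_P t lam \<alpha>)"
proof
  fix \<alpha>
  have "hall_P t nu \<beta> = chain_P t (var_bound \<alpha>) \<beta> nu" if "\<beta> \<subseteq># \<alpha>" for \<beta>
    by (rule hall_P_eq_chain) (use set_mset_mono[OF that] var_bound[of \<alpha>] in blast)
  then show "series_mult (hall_P t nu) (one_row t m) \<alpha> =
     (\<Sum>lam | hstrip lam nu \<and> psize lam = psize nu + m. phi t lam nu * hall_P t lam \<alpha>)"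
    unfolding series_mult_def hall_P_def[of t _ \<alpha>] pieri_chain[OF var_bound] by (intro sum.cong) auto
qed

lemma ex_empty_partition: "\<exists>lam. psize lam = 0"
proof -
  obtain lam where "cols lam = (\<lambda>_. 0)"
    using ex_cols[of "\<lambda>_. 0"] by (auto simp: antimono_def finsupp_def)
  then show ?thesis by (intro exI[of _ lam]) (simp add: psize_cols')
qed

lemma psize_0_unique: "psize lam = 0 \<Longrightarrow> psize mu = 0 \<Longrightarrow> lam = mu"
  using part_le_psize[of lam] part_le_psize[of mu] by (intro part_eqI) (metis le_zero_eq)

lemma mult_coeff_0: "psize lam = 0 \<Longrightarrow> mult_coeff t lam = 1"
  using part_le_psize[of lam 0] by (simp add: mult_coeff_def)

text \<open>Applying the Pieri rule once per variable gives chains weighted by \<open>phi\<close>.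
  By \<open>phi_mult_coeff\<close> the factor \<open>mult_coeff\<close> travels along the chain and
  converts each \<open>phi\<close> into \<open>psi\<close>, so the chain sum becomes a coefficient
  of the same function in the second set of variables.\<close>

lemma row_product_expansion:
  "row_product t K \<beta> \<alpha> =
    (\<Sum>lam | psize lam = (\<Sum>i<K. count \<beta> i). mult_coeff t lam * chain_P t K \<beta> lam * hall_P t lam \<alpha>)"
proof (induction K arbitrary: \<alpha>)
  case 0
  obtain e where e: "psize e = 0" using ex_empty_partition by blast
  have "{lam. psize lam = 0} = {e}" using psize_0_unique e by auto
  moreover have "hall_P t e = series_one"
  proof
    fix \<alpha>
    have "chain_P t K \<alpha> e = of_bool (set_mset \<alpha> \<inter> {..<K} = {})" for K
    proof (induction K)
      case (Suc K)
      have "{kap. hstrip e kap \<and> psize e = psize kap + count \<alpha> K} = (if K \<in># \<alpha> then {} else {e})"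
        using e psize_0_unique by (auto simp: not_in_iff)
      then show ?case using Suc by (auto simp: lessThan_Suc)
    qed (simp add: e)
    then have "hall_P t e \<alpha> = of_bool (set_mset \<alpha> \<inter> {..<var_bound \<alpha>} = {})" by (simp add: hall_P_def)
    also have "\<dots> = series_one \<alpha>" using var_bound[of \<alpha>] by (auto simp: series_one_def)
    finally show "hall_P t e \<alpha> = series_one \<alpha>" .
  qed
  ultimately show ?case using e by (simp add: mult_coeff_0)
next
  case (Suc K)
  let ?n = "\<Sum>i<K. count \<beta> i" and ?m = "count \<beta> K"
  let ?A = "{mu. psize mu = ?n}" and ?B = "{lam. psize lam = ?n + ?m}"
  have "row_product t K \<beta> = (\<lambda>\<alpha>. \<Sum>mu\<in>?A. mult_coeff t mu * chain_P t K \<beta> mu * hall_P t mu \<alpha>)"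
    using Suc.IH by blast
  then have "row_product t (Suc K) \<beta> \<alpha> =
      (\<Sum>mu\<in>?A. mult_coeff t mu * chain_P t K \<beta> mu * series_mult (hall_P t mu) (one_row t ?m) \<alpha>)"
    by (simp add: series_mult_sum_right series_mult_commute[of "one_row t ?m"] series_mult_sum_left)
  also have "\<dots> = (\<Sum>mu\<in>?A. \<Sum>lam | lam \<in> ?B \<and> hstrip lam mu. mult_coeff t mu * chain_P t K \<beta> mu * (phi t lam mu * hall_P t lam \<alpha>))"
    unfolding pieri sum_distrib_left by (intro sum.cong refl) auto
  also have "\<dots> = (\<Sum>lam\<in>?B. \<Sum>mu | mu \<in> ?A \<and> hstrip lam mu. mult_coeff t mu * chain_P t K \<beta> mu * (phi t lam mu * hall_P t lam \<alpha>))"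
    by (rule sum.swap_restrict) (auto simp: finite_psize_eq)
  also have "\<dots> = (\<Sum>lam\<in>?B. mult_coeff t lam * chain_P t (Suc K) \<beta> lam * hall_P t lam \<alpha>)"
  proof (rule sum.cong[OF refl])
    fix lam assume lam: "lam \<in> ?B"
    have s: "{mu. mu \<in> ?A \<and> hstrip lam mu} = {mu. hstrip lam mu \<and> psize lam = psize mu + ?m}" using lam by auto
    have w: "mult_coeff t mu * chain_P t K \<beta> mu * (phi t lam mu * hall_P t lam \<alpha>) =
        mult_coeff t lam * (psi t lam mu * chain_P t K \<beta> mu) * hall_P t lam \<alpha>" for mu
      using phi_mult_coeff[of t lam mu] by (metis (no_types, opaque_lifting) mult.assoc mult.commute)
    show "(\<Sum>mu | mu \<in> ?A \<and> hstrip lam mu. mult_coeff t mu * chain_P t K \<beta> mu * (phi t lam mu * hall_P t lam \<alpha>)) =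
       mult_coeff t lam * chain_P t (Suc K) \<beta> lam * hall_P t lam \<alpha>"
      unfolding s w chain_P.simps sum_distrib_left sum_distrib_right ..
  qed
  finally show ?case by simp
qed

section \<open>Unitriangularity in the dominance order\<close>

definition partition_monomial :: "partition \<Rightarrow> nat multiset" where
  "partition_monomial lam = Abs_multiset (part lam)"

lemma count_partition_monomial [simp]: "count (partition_monomial lam) i = part lam i"
  unfolding partition_monomial_def by (subst count_Abs_multiset) (use finite_part[of lam] in \<open>simp_all add: neq0_conv\<close>)

lemma set_partition_monomial: "set_mset (partition_monomial lam) = {..<plength lam}"
proof -
  have "i \<in># partition_monomial lam \<longleftrightarrow> part lam i \<noteq> 0" for i
    by (simp flip: count_greater_zero_iff)
  then show ?thesis by (auto simp: part_zero_iff not_le)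
qed

lemma size_partition_monomial [simp]: "size (partition_monomial lam) = psize lam"
  unfolding size_multiset_overloaded_eq set_partition_monomial psize_parts[OF le_refl] by simp

lemma hall_P_monomial_dominated:
  assumes "hall_P t lam (partition_monomial mu) \<noteq> 0"
  shows "dominated mu lam"
proof -
  let ?K = "max (plength lam) (plength mu)"
  have sub: "set_mset (partition_monomial mu) \<subseteq> {..<?K}" by (auto simp: set_partition_monomial)
  have "chain_P t ?K (partition_monomial mu) lam \<noteq> 0"
    using assms hall_P_eq_chain[OF sub] by simp
  note D = chain_P_nonzeroD[OF this]
  have sz: "psize mu = psize lam" using D psize_parts[of mu ?K] by simp
  have "(\<Sum>i<k. part mu i) \<le> (\<Sum>i<k. part lam i)" for k
  proof (cases "k \<le> ?K")
    case True
    then show ?thesis using D by simp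
  next
    case False
    then show ?thesis using psize_parts[of mu k] psize_parts[of lam k] sz by simp
  qed
  then show ?thesis using sz by (simp add: dominated_def)
qed

lemma nat_eqI_less:
  fixes a b :: nat
  assumes "\<And>j. j < a \<longleftrightarrow> j < b"
  shows "a = b"
  using assms[of a] assms[of b] by linarith

text \<open>The partition made of the first \<open>K\<close> rows of \<open>lam\<close>: every
  column is cut at height \<open>K\<close>.\<close>

lemma ex_truncation: "\<exists>mu. cols mu = (\<lambda>j. min (cols lam j) K)"
proof (rule ex_cols)
  show "antimono (\<lambda>j. min (cols lam j) K)"
    using antimono_cols[of lam] by (auto simp: antimono_def min_le_iff_disj)
  show "finsupp (\<lambda>j. min (cols lam j) K)"
    using finsupp_cols[of lam] unfolding finsupp_def by (rule finite_subset[rotated]) auto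
qed

lemma part_truncation:
  assumes "cols mu = (\<lambda>j. min (cols lam j) K)"
  shows "part mu i = (if i < K then part lam i else 0)"
proof -
  have "j < part mu i \<longleftrightarrow> j < (if i < K then part lam i else 0)" for j
    using less_cols_iff[of i mu j] less_cols_iff[of i lam j] assms by auto
  then show ?thesis by (rule nat_eqI_less)
qed

text \<open>Only the chain that adds the rows of \<open>lam\<close> one after another contributes.
  No factor of \<open>psi\<close> occurs along it because columns decrease: if column
  \<open>j + 1\<close> reaches the new row, so does column \<open>j\<close>.\<close>

lemma chain_P_leading:
  assumes "cols mu = (\<lambda>j. min (cols lam j) K)"
  shows "chain_P t K (partition_monomial lam) mu = 1"
  using assms
proof (induction K arbitrary: mu)
  case 0
  then show ?case by (simp add: psize_cols')
next
  case (Suc K)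
  obtain kap where kap: "cols kap = (\<lambda>j. min (cols lam j) K)" using ex_truncation by blast
  have "strip (cols mu) (cols kap)"
    unfolding strip_def Suc.prems kap by auto
  then have st: "hstrip mu kap" by (simp add: hstrip_def)
  have s: "{j. cols mu j = cols kap j \<and> cols mu (Suc j) = Suc (cols kap (Suc j))} = {}"
  proof -
    have "cols lam (Suc j) \<le> cols lam j" for j using antimono_cols[of lam] by (simp add: antimono_def)
    then show ?thesis unfolding Suc.prems kap by (auto simp: min_def split: if_splits) (metis le_trans not_less_eq_eq)+
  qed
  then have psi1: "psi t mu kap = 1" using st unfolding psi_def psi_col_def s by simp
  have pm: "part mu i = (if i < Suc K then part lam i else 0)" and pk: "part kap i = (if i < K then part lam i else 0)" for i
    using part_truncation[OF Suc.prems] part_truncation[OF kap] by auto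
  have "plength mu \<le> Suc K" "plength kap \<le> K"
    using part_zero_iff[of mu "Suc K"] part_zero_iff[of kap K] pm pk by auto
  then have szs: "psize mu = (\<Sum>i<Suc K. part lam i)" "psize kap = (\<Sum>i<K. part lam i)"
    using psize_parts[of mu "Suc K"] psize_parts[of kap K] pm pk by auto
  have "(\<Sum>ka | hstrip mu ka \<and> psize mu = psize ka + part lam K. psi t mu ka * chain_P t K (partition_monomial lam) ka) =
     (\<Sum>ka\<in>{kap}. psi t mu ka * chain_P t K (partition_monomial lam) ka)"
  proof (rule sum.mono_neutral_right)
    show "finite {ka. hstrip mu ka \<and> psize mu = psize ka + part lam K}" by (rule finite_hstrip_conj)
    show "{kap} \<subseteq> {ka. hstrip mu ka \<and> psize mu = psize ka + part lam K}" using st szs by simp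
    show "\<forall>ka\<in>{ka. hstrip mu ka \<and> psize mu = psize ka + part lam K} - {kap}. psi t mu ka * chain_P t K (partition_monomial lam) ka = 0"
    proof
      fix ka assume ka: "ka \<in> {ka. hstrip mu ka \<and> psize mu = psize ka + part lam K} - {kap}"
      \<comment> \<open>A contributing predecessor has at most \<open>K\<close> rows and the size of
        the first \<open>K\<close> rows of \<open>lam\<close>; being contained in \<open>mu\<close>,
        it lies inside those rows and hence equals them.\<close>
      have "chain_P t K (partition_monomial lam) ka = 0"
      proof (rule ccontr)
        assume "chain_P t K (partition_monomial lam) ka \<noteq> 0"
        then have D: "plength ka \<le> K" "psize ka = (\<Sum>i<K. part lam i)" using chain_P_nonzeroD by fastforce+
        have "diagram_subset ka kap"
          unfolding diagram_subset_def
        proof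
          fix i
          have "part ka i \<le> part mu i" using ka hstrip_subset by (auto simp: diagram_subset_def)
          then show "part ka i \<le> part kap i" using D(1) part_zero_iff[of ka i] unfolding pm pk by (cases "i < K") auto
        qed
        then have "kap = ka" using diagram_subset_antisym_size[of ka kap] D szs by simp
        then show False using ka by simp
      qed
      then show "psi t mu ka * chain_P t K (partition_monomial lam) ka = 0" by simp
    qed
  qed
  then show ?case using psi1 Suc.IH[OF kap] by simp
qed

lemma hall_P_monomial_leading: "hall_P t lam (partition_monomial lam) = 1"
proof -
  have "cols lam j \<le> plength lam" for j
    using antimono_cols[of lam] by (simp add: plength_eq_cols antimono_def)
  then have "cols lam = (\<lambda>j. min (cols lam j) (plength lam))" by auto
  from chain_P_leading[OF this] show ?thesis
    by (subst hall_P_eq_chain[of _ "plength lam"]) (simp_all add: set_partition_monomial)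
qed

section \<open>Symmetry of the branching functions and monomial expansions\<close>

definition perm_invariant :: "series \<Rightarrow> bool" where
  "perm_invariant f \<longleftrightarrow> (\<forall>\<pi> \<alpha>. bij \<pi> \<longrightarrow> f (image_mset \<pi> \<alpha>) = f \<alpha>)"

lemma perm_invariant_one_row: "perm_invariant (one_row t m)"
  unfolding perm_invariant_def one_row_def
  by (auto simp: card_image bij_def inj_on_subset)

lemma image_mset_inv:
  assumes "bij \<pi>"
  shows "image_mset (inv \<pi>) (image_mset \<pi> \<beta>) = \<beta>" "image_mset \<pi> (image_mset (inv \<pi>) \<beta>) = \<beta>"
  using assms by (simp_all add: multiset.map_comp o_def bij_is_inj bij_is_surj surj_f_inv_f)

lemma perm_invariant_mult:
  assumes "perm_invariant f" "perm_invariant g"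
  shows "perm_invariant (series_mult f g)"
  unfolding perm_invariant_def
proof (intro allI impI)
  fix \<pi> :: "nat \<Rightarrow> nat" and \<alpha> assume p: "bij \<pi>"
  note inv = image_mset_inv[OF p]
  show "series_mult f g (image_mset \<pi> \<alpha>) = series_mult f g \<alpha>"
    unfolding series_mult_def
  proof (rule sum.reindex_bij_witness[of _ "image_mset \<pi>" "image_mset (inv \<pi>)"])
    fix \<beta> assume b: "\<beta> \<in> {\<beta>. \<beta> \<subseteq># image_mset \<pi> \<alpha>}"
    then have "image_mset (inv \<pi>) \<beta> \<subseteq># image_mset (inv \<pi>) (image_mset \<pi> \<alpha>)"
      by (intro image_mset_subseteq_mono) simp
    then show sub: "image_mset (inv \<pi>) \<beta> \<in> {\<beta>. \<beta> \<subseteq># \<alpha>}" by (simp only: inv mem_Collect_eq)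
    have "f (image_mset (inv \<pi>) \<beta>) = f \<beta>"
      using assms(1) p inv(2)[of \<beta>] unfolding perm_invariant_def by metis
    moreover have "g (\<alpha> - image_mset (inv \<pi>) \<beta>) = g (image_mset \<pi> \<alpha> - \<beta>)"
    proof -
      have "image_mset \<pi> (\<alpha> - image_mset (inv \<pi>) \<beta>) = image_mset \<pi> \<alpha> - \<beta>"
        using sub by (simp only: mem_Collect_eq image_mset_Diff inv)
      then show ?thesis using assms(2) p unfolding perm_invariant_def by metis
    qed
    ultimately show "f (image_mset (inv \<pi>) \<beta>) * g (\<alpha> - image_mset (inv \<pi>) \<beta>) = f \<beta> * g (image_mset \<pi> \<alpha> - \<beta>)"
      by simp
  qed (use inv in \<open>auto intro: image_mset_subseteq_mono\<close>)
qed

lemma symmetric_function_iff: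
  "symmetric_function f \<longleftrightarrow> perm_invariant f \<and> (\<exists>d. \<forall>\<alpha>. size \<alpha> > d \<longrightarrow> f \<alpha> = 0)"
  by (simp add: symmetric_function_def perm_invariant_def)

lemma symmetric_function_sum:
  assumes "finite I" "\<And>i. i \<in> I \<Longrightarrow> symmetric_function (h i)"
  shows "symmetric_function (\<lambda>\<alpha>. \<Sum>i\<in>I. c i * h i \<alpha>)"
proof -
  have "perm_invariant (\<lambda>\<alpha>. \<Sum>i\<in>I. c i * h i \<alpha>)"
    using assms(2) unfolding symmetric_function_iff perm_invariant_def by (auto intro!: sum.cong)
  moreover obtain d where d: "\<And>i. i \<in> I \<Longrightarrow> \<forall>\<alpha>. size \<alpha> > d i \<longrightarrow> h i \<alpha> = 0"
    using assms(2) unfolding symmetric_function_iff by metis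
  have "\<forall>\<alpha>. size \<alpha> > Max (insert 0 (d ` I)) \<longrightarrow> (\<Sum>i\<in>I. c i * h i \<alpha>) = 0"
  proof (intro allI impI sum.neutral ballI)
    fix \<alpha> :: "nat multiset" and i assume "size \<alpha> > Max (insert 0 (d ` I))" "i \<in> I"
    then have "size \<alpha> > d i" using assms(1) by auto
    then show "c i * h i \<alpha> = 0" using d \<open>i \<in> I\<close> by simp
  qed
  ultimately show ?thesis unfolding symmetric_function_iff by blast
qed

lemma symmetric_function_mult:
  assumes "symmetric_function f" "symmetric_function g"
  shows "symmetric_function (series_mult f g)"
proof -
  obtain d e where d: "\<And>\<alpha>. size \<alpha> > d \<Longrightarrow> f \<alpha> = 0" and e: "\<And>\<alpha>. size \<alpha> > e \<Longrightarrow> g \<alpha> = 0"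
    using assms unfolding symmetric_function_iff by metis
  have "series_mult f g \<alpha> = 0" if "size \<alpha> > d + e" for \<alpha>
    unfolding series_mult_def
  proof (intro sum.neutral ballI)
    fix \<beta> assume "\<beta> \<in> {\<beta>. \<beta> \<subseteq># \<alpha>}"
    then have "size \<alpha> = size \<beta> + size (\<alpha> - \<beta>)"
      by (metis mem_Collect_eq size_union subset_mset.add_diff_inverse)
    then have "size \<beta> > d \<or> size (\<alpha> - \<beta>) > e" using that by linarith
    then show "f \<beta> * g (\<alpha> - \<beta>) = 0" using d e by auto
  qed
  then show ?thesis
    using perm_invariant_mult assms unfolding symmetric_function_iff by blast
qed

lemma symmetric_function_row_product: "symmetric_function (row_product t K \<beta>)"
proof (induction K)
  case 0
  show ?case
    by (auto simp: symmetric_function_iff perm_invariant_def series_one_def intro!: exI[of _ 0])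
next
  case (Suc K)
  have "symmetric_function (one_row t m)" for m
    unfolding symmetric_function_iff using perm_invariant_one_row
    by (auto simp: one_row_def intro!: exI[of _ m])
  then show ?case using Suc by (simp add: symmetric_function_mult)
qed

text \<open>An integer that increases strictly along dominance. It drives inductions in both
  directions; going up, the measure is the distance to the bound in
  \<open>dominance_rank_le\<close>.\<close>

definition dominance_rank :: "partition \<Rightarrow> nat" where
  "dominance_rank lam = (\<Sum>k\<le>psize lam. \<Sum>i<k. part lam i)"

lemma dominated_rank:
  assumes "dominated mu lam" "mu \<noteq> lam"
  shows "dominance_rank mu < dominance_rank lam"
proof -
  have sz: "psize mu = psize lam" and le: "\<And>k. (\<Sum>i<k. part mu i) \<le> (\<Sum>i<k. part lam i)"
    using assms(1) by (auto simp: dominated_def)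
  have "\<exists>k\<le>psize lam. (\<Sum>i<k. part mu i) \<noteq> (\<Sum>i<k. part lam i)"
  proof (rule ccontr)
    assume "\<not> (\<exists>k\<le>psize lam. (\<Sum>i<k. part mu i) \<noteq> (\<Sum>i<k. part lam i))"
    then have eq: "\<And>k. k \<le> psize lam \<Longrightarrow> (\<Sum>i<k. part mu i) = (\<Sum>i<k. part lam i)" by blast
    have "part mu i = part lam i" for i
    proof (cases "i < psize lam")
      case True
      then show ?thesis using eq[of i] eq[of "Suc i"] by simp
    next
      case False
      then have "plength lam \<le> i" "plength mu \<le> i"
        using plength_le_psize[of lam] plength_le_psize[of mu] sz by linarith+
      then show ?thesis using part_zero_iff by metis
    qed
    then show False using assms(2) part_eqI by blast
  qed
  then obtain k where "k \<le> psize lam" "(\<Sum>i<k. part mu i) \<noteq> (\<Sum>i<k. part lam i)" by blast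
  moreover from this have "(\<Sum>i<k. part mu i) < (\<Sum>i<k. part lam i)"
    using le[of k] by linarith
  ultimately have "\<exists>k\<in>{..psize lam}. (\<Sum>i<k. part mu i) < (\<Sum>i<k. part lam i)" by blast
  then show ?thesis unfolding dominance_rank_def sz
    by (intro sum_strict_mono_ex1) (use le in auto)
qed

lemma dominated_refl [simp]: "dominated lam lam"
  by (simp add: dominated_def)

lemma dominance_rank_le: "dominance_rank lam \<le> Suc (psize lam) * psize lam"
proof -
  have "(\<Sum>i<k. part lam i) \<le> psize lam" for k
    using psize_parts[of lam "max k (plength lam)"] sum_mono2[of "{..<max k (plength lam)}" "{..<k}" "part lam"] by auto
  then have "dominance_rank lam \<le> (\<Sum>k\<le>psize lam. psize lam)"
    unfolding dominance_rank_def by (intro sum_mono)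
  then show ?thesis by simp
qed

text \<open>Abstracting the property lets one triangular inversion serve twice: for symmetry of
  \<open>hall_P\<close>, and for its membership in the span of the power sums.\<close>

definition linear_closed :: "(series \<Rightarrow> bool) \<Rightarrow> bool" where
  "linear_closed V \<longleftrightarrow> (\<forall>(I :: partition set) c h. finite I \<longrightarrow> (\<forall>i\<in>I. V (h i)) \<longrightarrow> V (\<lambda>\<alpha>. \<Sum>i\<in>I. c i * h i \<alpha>))"

lemma linear_closedD:
  "linear_closed V \<Longrightarrow> finite (I :: partition set) \<Longrightarrow> (\<And>i. i \<in> I \<Longrightarrow> V (h i)) \<Longrightarrow> V (\<lambda>\<alpha>. \<Sum>i\<in>I. c i * h i \<alpha>)"
  unfolding linear_closed_def by blast

lemma finite_dominated: "finite {mu. dominated mu lam \<and> Q mu}" "finite {mu. dominated lam mu \<and> Q mu}"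
  by (rule finite_subset[OF _ finite_psize_eq[of "psize lam"]], auto simp: dominated_def)+

text \<open>Evaluated at the monomial of a partition, the expansion is triangular: only dominating
  partitions survive, and \<open>lam\<close> itself appears with coefficient
  \<open>mult_coeff t lam\<close>.\<close>

lemma row_product_monomial:
  "row_product t (plength lam) (partition_monomial lam) \<alpha> =
    (\<Sum>mu | dominated lam mu. mult_coeff t mu * hall_P t mu (partition_monomial lam) * hall_P t mu \<alpha>)"
proof -
  have sub: "set_mset (partition_monomial lam) \<subseteq> {..<plength lam}" by (simp add: set_partition_monomial)
  have sz: "(\<Sum>i<plength lam. count (partition_monomial lam) i) = psize lam"
    using psize_parts[OF le_refl, of lam] by simp
  show ?thesis
    unfolding row_product_expansion sz hall_P_eq_chain[OF sub, symmetric]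
    by (rule sum.mono_neutral_right)
       (use hall_P_monomial_dominated in \<open>auto simp: finite_psize_eq dominated_def\<close>)
qed

text \<open>Dominance triangularity lets one solve the expansion of the kernel for \<open>P\<^sub>\<lambda>\<close>.\<close>

lemma hall_P_linear_closed:
  assumes t: "0 \<le> t" "t < 1" and V: "linear_closed V" "\<And>K \<beta>. V (row_product t K \<beta>)"
  shows "V (hall_P t lam)"
proof (induction "Suc (psize lam) * psize lam - dominance_rank lam" arbitrary: lam rule: less_induct)
  case less
  let ?I = "{mu. dominated lam mu \<and> mu \<noteq> lam}"
  let ?b = "mult_coeff t"
  define h where "h mu = (if mu = lam then row_product t (plength lam) (partition_monomial lam) else hall_P t mu)" for mu
  define c where "c mu = (if mu = lam then 1 else - ?b mu * hall_P t mu (partition_monomial lam)) / ?b lam" for mu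
  have fin: "finite ?I" by (rule finite_dominated)
  have b: "?b lam > 0" by (rule mult_coeff_pos[OF t])
  have VP: "V (hall_P t mu)" if "mu \<in> ?I" for mu
  proof (rule less.hyps)
    have "psize mu = psize lam" using that by (simp add: dominated_def)
    moreover have "dominance_rank lam < dominance_rank mu" using dominated_rank[of lam mu] that by auto
    ultimately show "Suc (psize mu) * psize mu - dominance_rank mu < Suc (psize lam) * psize lam - dominance_rank lam"
      using dominance_rank_le[of mu] by simp
  qed
  have "V (\<lambda>\<alpha>. \<Sum>mu\<in>insert lam ?I. c mu * h mu \<alpha>)"
    by (rule linear_closedD[OF V(1)]) (use VP V(2) fin in \<open>auto simp: h_def\<close>)
  moreover have "(\<Sum>mu\<in>insert lam ?I. c mu * h mu \<alpha>) = hall_P t lam \<alpha>" for \<alpha>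
  proof -
    have "{mu. dominated lam mu} = insert lam ?I" by auto
    then have r: "row_product t (plength lam) (partition_monomial lam) \<alpha> = ?b lam * hall_P t lam \<alpha> +
        (\<Sum>mu\<in>?I. ?b mu * hall_P t mu (partition_monomial lam) * hall_P t mu \<alpha>)"
      unfolding row_product_monomial using fin by (simp add: hall_P_monomial_leading)
    have "(\<Sum>mu\<in>insert lam ?I. c mu * h mu \<alpha>) = row_product t (plength lam) (partition_monomial lam) \<alpha> / ?b lam +
        (\<Sum>mu\<in>?I. c mu * h mu \<alpha>)"
      using fin by (simp add: c_def h_def)
    also have "(\<Sum>mu\<in>?I. c mu * h mu \<alpha>) = - (\<Sum>mu\<in>?I. ?b mu * hall_P t mu (partition_monomial lam) * hall_P t mu \<alpha>) / ?b lam"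
      unfolding sum_negf[symmetric] sum_divide_distrib by (rule sum.cong) (auto simp: c_def h_def)
    finally show ?thesis unfolding r using b by (simp add: field_simps)
  qed
  ultimately show ?case by simp
qed

lemma linear_closed_symmetric: "linear_closed symmetric_function"
  unfolding linear_closed_def using symmetric_function_sum by blast

lemma symmetric_function_hall_P: "0 \<le> t \<Longrightarrow> t < 1 \<Longrightarrow> symmetric_function (hall_P t lam)"
  by (rule hall_P_linear_closed[OF _ _ linear_closed_symmetric symmetric_function_row_product])

text \<open>Equal level counts give equally many positions for each positive value, and the value 0
  is taken infinitely often on both sides. Gluing bijections of the fibres yields a permutation of
  all variables, as the definition of \<open>monomial_sym\<close> demands.\<close>

lemma bij_of_equal_fibres:
  fixes f g :: "nat \<Rightarrow> nat"
  assumes fin: "finite {i. f i \<noteq> 0}" "finite {i. g i \<noteq> 0}"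
    and card: "\<And>v. card {i. v < f i} = card {i. v < g i}"
  shows "\<exists>\<pi>. bij \<pi> \<and> (\<forall>i. f (\<pi> i) = g i)"
proof -
  have "\<exists>h. bij_betw h {i. g i = v} {i. f i = v}" for v
  proof (cases v)
    case 0
    have inf: "infinite {i. f i = 0}" "infinite {i. g i = 0}"
    proof -
      have e: "{i. k i = 0} = UNIV - {i. k i \<noteq> 0}" for k :: "nat \<Rightarrow> nat" by auto
      show "infinite {i. f i = 0}" "infinite {i. g i = 0}"
        unfolding e[of f] e[of g] by (intro Diff_infinite_finite fin infinite_UNIV_nat)+
    qed
    have "bij_betw (enumerate {i. f i = 0} \<circ> inv_into UNIV (enumerate {i. g i = 0})) {i. g i = 0} {i. f i = 0}"
      by (rule bij_betw_trans[OF bij_betw_inv_into[OF bij_enumerate[OF inf(2)]] bij_enumerate[OF inf(1)]])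
    then show ?thesis using 0 by blast
  next
    case (Suc w)
    have c: "card {i. k i = Suc w} = card {i. w < k i} - card {i. Suc w < k i}" "finite {i. k i = Suc w}"
      if "finite {i. k i \<noteq> 0}" for k :: "nat \<Rightarrow> nat"
    proof -
      have fin: "finite {i. w < k i}" by (rule finite_subset[OF _ that]) auto
      show "finite {i. k i = Suc w}" by (rule finite_subset[OF _ that]) auto
      have "{i. k i = Suc w} = {i. w < k i} - {i. Suc w < k i}" by auto
      moreover have "{i. Suc w < k i} \<subseteq> {i. w < k i}" by auto
      ultimately show "card {i. k i = Suc w} = card {i. w < k i} - card {i. Suc w < k i}"
        using fin by (simp add: card_Diff_subset finite_subset)
    qed
    have "card {i. f i = v} = card {i. g i = v}" "finite {i. f i = v}" "finite {i. g i = v}"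
      using c[OF fin(1)] c[OF fin(2)] card Suc by simp_all
    then show ?thesis by (intro finite_same_card_bij) simp_all
  qed
  note ex = this
  define h where "h v = (SOME h. bij_betw h {i. g i = v} {i. f i = v})" for v
  have h: "bij_betw (h v) {i. g i = v} {i. f i = v}" for v
    unfolding h_def by (rule someI_ex[OF ex])
  define \<pi> where "\<pi> i = h (g i) i" for i
  have fpi: "f (\<pi> i) = g i" for i
    using bij_betwE[OF h[of "g i"]] by (simp add: \<pi>_def)
  have "inj \<pi>"
  proof (rule injI)
    fix i j assume e: "\<pi> i = \<pi> j"
    then have "g i = g j" using fpi by metis
    then show "i = j" using e bij_betw_imp_inj_on[OF h[of "g i"]] by (auto simp: \<pi>_def inj_on_def)
  qed
  moreover have "surj \<pi>"
    unfolding surj_def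
  proof
    fix j
    have "j \<in> h (f j) ` {i. g i = f j}" using h[of "f j"] by (auto simp: bij_betw_def)
    then obtain i where "g i = f j" "j = h (f j) i" by auto
    then have "j = \<pi> i" by (simp add: \<pi>_def)
    then show "\<exists>i. j = \<pi> i" by blast
  qed
  ultimately show ?thesis using fpi by (auto simp: bij_def)
qed

lemma ex_shape: "\<exists>lam. \<forall>j. cols lam j = card {i. j < count \<alpha> i}"
proof -
  have fin: "finite {i. j < count \<alpha> i}" for j
    by (rule finite_subset[OF _ finite_set_mset[of \<alpha>]]) (auto simp flip: count_greater_zero_iff)
  have "antimono (\<lambda>j. card {i. j < count \<alpha> i})"
    unfolding antimono_def using fin by (auto intro!: card_mono)
  moreover have "{j. card {i. j < count \<alpha> i} \<noteq> 0} \<subseteq> {..<size \<alpha>}"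
  proof
    fix j assume "j \<in> {j. card {i. j < count \<alpha> i} \<noteq> 0}"
    then obtain i where "j < count \<alpha> i" by (metis (mono_tags, lifting) card.empty empty_Collect_eq mem_Collect_eq)
    then show "j \<in> {..<size \<alpha>}" using count_le_size[of \<alpha> i] by simp
  qed
  then have "finsupp (\<lambda>j. card {i. j < count \<alpha> i})"
    unfolding finsupp_def by (rule finite_subset) simp
  ultimately obtain lam where "cols lam = (\<lambda>j. card {i. j < count \<alpha> i})" using ex_cols by blast
  then show ?thesis by (intro exI[of _ lam]) simp
qed

definition shape :: "nat multiset \<Rightarrow> partition" where
  "shape \<alpha> = (SOME lam. \<forall>j. cols lam j = card {i. j < count \<alpha> i})"

lemma cols_shape: "cols (shape \<alpha>) j = card {i. j < count \<alpha> i}"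
  using someI_ex[OF ex_shape[of \<alpha>]] unfolding shape_def by blast

lemma ex_shape_perm: "\<exists>\<pi>. bij \<pi> \<and> (\<forall>i. count \<alpha> (\<pi> i) = part (shape \<alpha>) i)"
proof (rule bij_of_equal_fibres)
  show "finite {i. count \<alpha> i \<noteq> 0}"
    by (rule finite_subset[OF _ finite_set_mset[of \<alpha>]]) auto
  show "finite {i. part (shape \<alpha>) i \<noteq> 0}" by (rule finite_part)
  show "card {i. v < count \<alpha> i} = card {i. v < part (shape \<alpha>) i}" for v
    unfolding cols_shape[symmetric] cols_def ..
qed

lemma monomial_sym_eq: "monomial_sym lam \<alpha> = of_bool (shape \<alpha> = lam)"
proof -
  have "shape \<alpha> = lam" if "bij \<pi>" "\<forall>i. count \<alpha> (\<pi> i) = part lam i" for \<pi>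
  proof -
    have "cols (shape \<alpha>) j = cols lam j" for j
    proof -
      have "{i. j < count \<alpha> i} = \<pi> ` {i. j < part lam i}"
        using that by (auto simp: image_iff) (metis bij_pointE)
      then have "card {i. j < count \<alpha> i} = card {i. j < part lam i}"
        using card_image[OF inj_on_subset[OF bij_is_inj[OF that(1)]], of "{i. j < part lam i}"] by simp
      then show ?thesis unfolding cols_shape by (simp add: cols_def)
    qed
    then have "cols (shape \<alpha>) = cols lam" by (rule ext)
    then show ?thesis by (simp add: cols_inject)
  qed
  then show ?thesis using ex_shape_perm[of \<alpha>] unfolding monomial_sym_def by auto
qed

lemma count_image_bij: "bij \<pi> \<Longrightarrow> count (image_mset \<pi> \<alpha>) (\<pi> i) = count \<alpha> i"
proof -
  assume "bij \<pi>"
  then have "\<pi> -` {\<pi> i} = {i}" by (auto simp: bij_def inj_def)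
  then show ?thesis by (cases "i \<in># \<alpha>") (simp_all add: count_image_mset not_in_iff)
qed

lemma perm_invariant_shape:
  assumes "perm_invariant f"
  shows "f \<alpha> = f (partition_monomial (shape \<alpha>))" "size \<alpha> = psize (shape \<alpha>)"
proof -
  obtain \<pi> where p: "bij \<pi>" "\<And>i. count \<alpha> (\<pi> i) = part (shape \<alpha>) i" using ex_shape_perm by blast
  have "count (image_mset \<pi> (partition_monomial (shape \<alpha>))) j = count \<alpha> j" for j
  proof -
    obtain i where "j = \<pi> i" using p(1) by (metis bij_pointE)
    then show ?thesis using p count_image_bij[OF p(1)] by simp
  qed
  then have e: "image_mset \<pi> (partition_monomial (shape \<alpha>)) = \<alpha>" by (simp add: multiset_eq_iff)
  show "f \<alpha> = f (partition_monomial (shape \<alpha>))"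
    using assms p(1) e unfolding perm_invariant_def by metis
  show "size \<alpha> = psize (shape \<alpha>)"
    using arg_cong[OF e, of size] by simp
qed

lemma monomial_expansion:
  assumes "perm_invariant f" "\<And>\<alpha>. f \<alpha> \<noteq> 0 \<Longrightarrow> shape \<alpha> \<in> S" "finite S"
  shows "f \<alpha> = (\<Sum>lam\<in>S. f (partition_monomial lam) * monomial_sym lam \<alpha>)"
proof -
  have "(\<Sum>lam\<in>S. f (partition_monomial lam) * monomial_sym lam \<alpha>) =
      (if shape \<alpha> \<in> S then f (partition_monomial (shape \<alpha>)) else 0)"
    using assms(3) by (simp add: monomial_sym_eq of_bool_def if_distrib cong: if_cong)
  then show ?thesis using assms(2)[of \<alpha>] perm_invariant_shape(1)[OF assms(1), of \<alpha>] by (cases "shape \<alpha> \<in> S") auto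
qed

lemma hall_P_monomial_expansion:
  assumes "0 \<le> t" "t < 1"
  shows "hall_P t lam \<alpha> = monomial_sym lam \<alpha> +
    (\<Sum>mu | dominated mu lam \<and> mu \<noteq> lam. hall_P t lam (partition_monomial mu) * monomial_sym mu \<alpha>)"
proof -
  have pi: "perm_invariant (hall_P t lam)"
    using symmetric_function_hall_P[OF assms] by (simp add: symmetric_function_iff)
  have "hall_P t lam \<alpha> = (\<Sum>mu | dominated mu lam. hall_P t lam (partition_monomial mu) * monomial_sym mu \<alpha>)"
  proof (rule monomial_expansion[OF pi])
    fix \<alpha> assume "hall_P t lam \<alpha> \<noteq> 0"
    then show "shape \<alpha> \<in> {mu. dominated mu lam}"
      unfolding perm_invariant_shape(1)[OF pi, of \<alpha>] using hall_P_monomial_dominated by simp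
  qed (use finite_dominated(1)[of lam "\<lambda>_. True"] in simp)
  moreover have "{mu. dominated mu lam} = insert lam {mu. dominated mu lam \<and> mu \<noteq> lam}" by auto
  ultimately show ?thesis by (simp add: finite_dominated hall_P_monomial_leading)
qed

section \<open>Power sums form a basis\<close>

definition part_mset :: "partition \<Rightarrow> nat multiset" where
  "part_mset lam = image_mset (part lam) (mset_set {..<plength lam})"

lemma part_mset_monomial:
  "part_mset lam = image_mset (count (partition_monomial lam)) (mset_set (set_mset (partition_monomial lam)))"
  unfolding part_mset_def set_partition_monomial by (rule image_mset_cong) simp

lemma size_part_mset [simp]: "size (part_mset lam) = plength lam"
  by (simp add: part_mset_def)

lemma sum_part_mset: "sum_mset (part_mset lam) = psize lam"
  by (simp add: part_mset_def psize_parts[OF le_refl] sum_unfold_sum_mset)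

lemma zero_notin_part_mset: "0 \<notin># part_mset lam"
  by (auto simp: part_mset_def part_zero_iff)

lemma part_pos_iff: "0 < part lam i \<longleftrightarrow> i < plength lam"
  using part_zero_iff[of lam i] by linarith

lemma cols_part_mset: "cols lam j = size (filter_mset (\<lambda>k. j < k) (part_mset lam))"
proof -
  have "i < plength lam" if "j < part lam i" for i
    using that part_pos_iff[of lam i] by linarith
  then have "{i. j < part lam i} = {i. i < plength lam \<and> j < part lam i}" by blast
  then show ?thesis
    unfolding cols_def part_mset_def by (simp add: filter_mset_image_mset filter_mset_mset_set)
qed

lemma mset_eqI_filter:
  assumes "0 \<notin># \<rho>" "0 \<notin># \<sigma>"
    and "\<And>j. size (filter_mset (\<lambda>k. j < k) \<rho>) = size (filter_mset (\<lambda>k. j < k) \<sigma>)"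
  shows "\<rho> = (\<sigma> :: nat multiset)"
proof (rule multiset_eqI)
  fix k
  have "count \<rho> (Suc j) = size (filter_mset (\<lambda>k. j < k) \<rho>) - size (filter_mset (\<lambda>k. Suc j < k) \<rho>)" for j and \<rho> :: "nat multiset"
  proof -
    have "filter_mset (\<lambda>k. j < k) \<rho> = filter_mset (\<lambda>k. Suc j < k) \<rho> + filter_mset (\<lambda>k. k = Suc j) \<rho>"
      by (auto simp: multiset_eq_iff)
    then show ?thesis by (simp add: filter_eq_replicate_mset)
  qed
  then show "count \<rho> k = count \<sigma> k" using assms by (cases k) (auto simp: not_in_iff)
qed

lemma part_mset_inject: "part_mset lam = part_mset mu \<longleftrightarrow> lam = mu"
proof
  assume "part_mset lam = part_mset mu"
  then have "cols lam j = cols mu j" for j by (simp add: cols_part_mset)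
  then have "cols lam = cols mu" by (rule ext)
  then show "lam = mu" by (simp add: cols_inject)
qed simp

lemma ex_part_mset:
  assumes "0 \<notin># \<rho>"
  shows "\<exists>lam. part_mset lam = \<rho>"
proof -
  let ?c = "\<lambda>j. size (filter_mset (\<lambda>k. j < k) \<rho>)"
  have "antimono ?c"
    unfolding antimono_def by (auto intro!: size_mset_mono simp: subseteq_mset_def)
  moreover have "{j. ?c j \<noteq> 0} \<subseteq> {..<sum_mset \<rho>}"
  proof
    fix j assume "j \<in> {j. ?c j \<noteq> 0}"
    then have "filter_mset (\<lambda>k. j < k) \<rho> \<noteq> {#}" by auto
    then obtain k where "k \<in># filter_mset (\<lambda>k. j < k) \<rho>" by (meson multiset_nonemptyE)
    then have "k \<in># \<rho>" "j < k" by simp_all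
    then show "j \<in> {..<sum_mset \<rho>}" using sum_mset_ge[of k \<rho>] by simp
  qed
  then have "finsupp ?c" unfolding finsupp_def by (rule finite_subset) simp
  ultimately obtain lam where l: "cols lam = ?c" using ex_cols by blast
  have "part_mset lam = \<rho>"
    by (rule mset_eqI_filter[OF zero_notin_part_mset assms]) (simp add: cols_part_mset[symmetric] l)
  then show ?thesis by blast
qed

lemma bij_betw_part_mset: "bij_betw part_mset {lam. psize lam = n} (part_msets n)"
proof (rule bij_betwI')
  fix \<rho> assume "\<rho> \<in> part_msets n"
  then show "\<exists>lam\<in>{lam. psize lam = n}. \<rho> = part_mset lam"
    using ex_part_mset[of \<rho>] sum_part_mset by (auto simp: part_msets_def)
qed (auto simp: part_mset_inject part_msets_def sum_part_mset zero_notin_part_mset)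

lemma power_sum_partition_eq: "power_sum_partition lam = power_sum_mset (part_mset lam)"
proof -
  have "foldr (\<lambda>i. series_mult (power_sum (part lam i))) xs series_one =
      power_sum_mset (image_mset (part lam) (mset xs))" for xs
    by (induction xs) simp_all
  then show ?thesis
    unfolding power_sum_partition_def part_mset_def by (simp add: mset_set_upto_eq_mset_upto lessThan_atLeast0)
qed

lemma count_part_mset: "k \<noteq> 0 \<Longrightarrow> count (part_mset lam) k = part_mult lam k"
proof -
  assume k: "k \<noteq> 0"
  have "count (part_mset lam) k = size (filter_mset (\<lambda>x. x = k) (part_mset lam))"
    by (simp add: filter_eq_replicate_mset)
  also have "\<dots> = card {i. i < plength lam \<and> part lam i = k}"
    by (simp add: part_mset_def filter_mset_image_mset filter_mset_mset_set)
  also have "{i. i < plength lam \<and> part lam i = k} = {i. part lam i = k}"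
  proof -
    have "i < plength lam" if "part lam i = k" for i
      using k that part_pos_iff[of lam i] by simp
    then show ?thesis by blast
  qed
  finally show ?thesis by (simp add: part_mult_def)
qed

text \<open>Rows below \<open>plength lam\<close> have positive length, so
  \<open>0 ^ part lam i\<close> vanishes and the numerators are 1. The rest regroups the product
  over rows as one over part sizes with multiplicity.\<close>

lemma inner_norm_eq:
  "z_factor lam * (\<Prod>i<plength lam. (1 - 0 ^ part lam i) / (1 - t ^ part lam i)) = z_mset t (part_mset lam)"
proof -
  let ?M = "part_mset lam"
  have set: "set_mset ?M = range (part lam) - {0}"
  proof -
    have "set_mset ?M = part lam ` {..<plength lam}" by (simp add: part_mset_def)
    moreover have "part lam i \<in> part lam ` {..<plength lam}" if "part lam i \<noteq> 0" for i
      using that part_pos_iff[of lam i] by simp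
    moreover have "part lam i \<noteq> 0" if "i < plength lam" for i
      using that part_pos_iff[of lam i] by simp
    ultimately show ?thesis by fastforce
  qed
  have "(\<Prod>i<plength lam. (1 - 0 ^ part lam i) / (1 - t ^ part lam i)) = (\<Prod>i<plength lam. 1 / (1 - t ^ part lam i))"
    by (rule prod.cong) (use part_zero_iff[of lam] in \<open>auto simp: power_0_left\<close>)
  also have "\<dots> = prod_mset (image_mset (\<lambda>k. 1 / (1 - t ^ k)) ?M)"
    by (simp add: part_mset_def prod_unfold_prod_mset multiset.map_comp o_def)
  also have "\<dots> = (\<Prod>k\<in>set_mset ?M. (1 / (1 - t ^ k)) ^ count ?M k)"
    by (rule image_prod_mset_multiplicity)
  finally have P: "(\<Prod>i<plength lam. (1 - 0 ^ part lam i) / (1 - t ^ part lam i)) = (\<Prod>k\<in>set_mset ?M. (1 / (1 - t ^ k)) ^ count ?M k)" .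
  have Z: "z_factor lam = (\<Prod>k\<in>set_mset ?M. fact (count ?M k) * real k ^ count ?M k)"
    unfolding z_factor_def set by (rule prod.cong) (auto simp: count_part_mset)
  show ?thesis unfolding P Z z_mset_def prod.distrib[symmetric]
    by (rule prod.cong) (simp_all add: power_divide)
qed

lemma power_sum_mset_nonneg: "0 \<notin># \<rho> \<Longrightarrow> 0 \<le> power_sum_mset \<rho> \<alpha>"
proof (induction \<rho> arbitrary: \<alpha>)
  case empty
  show ?case by (simp add: series_one_def)
next
  case (add k \<rho>)
  then show ?case
    unfolding power_sum_mset_add series_mult_def
    by (intro sum_nonneg mult_nonneg_nonneg) (auto simp: power_sum_def)
qed

lemma image_count_diff:
  assumes "i \<in># \<alpha>"
  shows "image_mset (count \<alpha>) (mset_set (set_mset \<alpha>)) =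
    add_mset (count \<alpha> i) (image_mset (count (\<alpha> - replicate_mset (count \<alpha> i) i)) (mset_set (set_mset (\<alpha> - replicate_mset (count \<alpha> i) i))))"
proof -
  let ?\<gamma> = "\<alpha> - replicate_mset (count \<alpha> i) i"
  have "set_mset ?\<gamma> = set_mset \<alpha> - {i}" by (auto simp: set_mset_diff split: if_splits)
  moreover have "mset_set (set_mset \<alpha>) = add_mset i (mset_set (set_mset \<alpha> - {i}))"
    using assms by (simp add: mset_set.remove)
  moreover have "image_mset (count \<alpha>) (mset_set (set_mset \<alpha> - {i})) = image_mset (count ?\<gamma>) (mset_set (set_mset \<alpha> - {i}))"
    by (rule image_mset_cong) auto
  ultimately show ?thesis by simp
qed

text \<open>Each factor of the product puts its exponent on a single variable, so at most
  \<open>size \<rho>\<close> variables occur. If there are exactly that many, no two factors share a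
  variable and the exponents are the parts of \<open>\<rho>\<close>.\<close>

lemma power_sum_mset_support:
  assumes "0 \<notin># \<rho>" "power_sum_mset \<rho> \<alpha> \<noteq> 0"
  shows "card (set_mset \<alpha>) \<le> size \<rho> \<and>
    (card (set_mset \<alpha>) = size \<rho> \<longrightarrow> \<rho> = image_mset (count \<alpha>) (mset_set (set_mset \<alpha>)))"
  using assms
proof (induction \<rho> arbitrary: \<alpha>)
  case empty
  then show ?case by (auto simp: series_one_def split: if_splits)
next
  case (add k \<rho>)
  have k: "1 \<le> k" using add.prems by (cases k) auto
  obtain i where i: "i \<in># \<alpha>" "k \<le> count \<alpha> i" "power_sum_mset \<rho> (\<alpha> - replicate_mset k i) \<noteq> 0"
    using add.prems(2) unfolding power_sum_mset_add power_sum_mult[OF k]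
    by (elim sum.not_neutral_contains_not_neutral) auto
  let ?\<gamma> = "\<alpha> - replicate_mset k i"
  have "0 \<notin># \<rho>" using add.prems by simp
  note IH = add.IH[OF this i(3)]
  show ?case
  proof (cases "k = count \<alpha> i")
    case True
    have s: "set_mset ?\<gamma> = set_mset \<alpha> - {i}" using True by (auto simp: set_mset_diff split: if_splits)
    then have c: "card (set_mset \<alpha>) = Suc (card (set_mset ?\<gamma>))" using card.remove[OF finite_set_mset i(1)] by simp
    show ?thesis
    proof (intro conjI impI)
      show "card (set_mset \<alpha>) \<le> size (add_mset k \<rho>)" using c IH by simp
      assume "card (set_mset \<alpha>) = size (add_mset k \<rho>)"
      then have "card (set_mset ?\<gamma>) = size \<rho>" using c by simp
      then have e: "\<rho> = image_mset (count ?\<gamma>) (mset_set (set_mset ?\<gamma>))" using IH by blast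
      show "add_mset k \<rho> = image_mset (count \<alpha>) (mset_set (set_mset \<alpha>))"
        unfolding image_count_diff[OF i(1)] True[symmetric] by (rule arg_cong[OF e])
    qed
  next
    case False
    then have "set_mset ?\<gamma> = set_mset \<alpha>" using i by (auto simp: set_mset_diff split: if_splits)
    then have "card (set_mset \<alpha>) \<le> size \<rho>" using IH by simp
    then show ?thesis by simp
  qed
qed

text \<open>Coefficients of products of power sums are nonnegative, so it is enough to exhibit one
  contribution: the assignment of each part to the variable having it as exponent.\<close>

lemma power_sum_mset_leading:
  "0 < power_sum_mset (image_mset (count \<alpha>) (mset_set (set_mset \<alpha>))) \<alpha>"
proof (induction "card (set_mset \<alpha>)" arbitrary: \<alpha>)
  case 0
  then show ?case by (simp add: series_one_def)
next
  case (Suc n)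
  then have "set_mset \<alpha> \<noteq> {}" by auto
  then obtain i where i: "i \<in># \<alpha>" by blast
  let ?k = "count \<alpha> i"
  let ?\<gamma> = "\<alpha> - replicate_mset ?k i"
  let ?\<rho> = "image_mset (count ?\<gamma>) (mset_set (set_mset ?\<gamma>))"
  have k: "1 \<le> ?k" using i by (simp add: Suc_le_eq)
  have "set_mset ?\<gamma> = set_mset \<alpha> - {i}" by (auto simp: set_mset_diff split: if_splits)
  then have "n = card (set_mset ?\<gamma>)" using Suc.hyps(2) card.remove[OF finite_set_mset i] by simp
  from Suc.hyps(1)[OF this] have pos: "0 < power_sum_mset ?\<rho> ?\<gamma>" .
  have z: "0 \<notin># ?\<rho>"
  proof
    assume "0 \<in># ?\<rho>"
    then have "0 \<in> count ?\<gamma> ` set_mset ?\<gamma>"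
      by (simp only: set_image_mset finite_set_mset_mset_set[OF finite_set_mset])
    then obtain j where j: "j \<in># ?\<gamma>" "0 = count ?\<gamma> j" by (rule imageE)
    then show False using count_greater_zero_iff[of ?\<gamma> j] by linarith
  qed
  show ?case
    unfolding image_count_diff[OF i] power_sum_mset_add power_sum_mult[OF k]
  proof (rule sum_pos2)
    show "finite {j. j \<in># \<alpha> \<and> ?k \<le> count \<alpha> j}"
      by (rule finite_subset[OF _ finite_set_mset[of \<alpha>]]) blast
    show "i \<in> {j. j \<in># \<alpha> \<and> ?k \<le> count \<alpha> j}" using i by blast
    show "0 < power_sum_mset ?\<rho> ?\<gamma>" by (rule pos)
  qed (rule power_sum_mset_nonneg[OF z])
qed

lemma power_sum_partition_triangular:
  "power_sum_partition mu (partition_monomial lam) \<noteq> 0 \<Longrightarrow> plength mu \<le> plength lam \<Longrightarrow> mu = lam"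
proof -
  assume "power_sum_partition mu (partition_monomial lam) \<noteq> 0" and le: "plength mu \<le> plength lam"
  then have "power_sum_mset (part_mset mu) (partition_monomial lam) \<noteq> 0" by (simp add: power_sum_partition_eq)
  note S = power_sum_mset_support[OF zero_notin_part_mset this]
  have c: "card (set_mset (partition_monomial lam)) = plength lam" by (simp add: set_partition_monomial)
  have "plength mu = plength lam" using S le unfolding c by simp
  then have "part_mset mu = part_mset lam" using S unfolding c part_mset_monomial[of lam] by simp
  then show "mu = lam" by (simp add: part_mset_inject)
qed

lemma power_sum_partition_leading: "0 < power_sum_partition lam (partition_monomial lam)"
  unfolding power_sum_partition_eq part_mset_monomial by (rule power_sum_mset_leading)

text \<open>Among the partitions with nonzero coefficient, one of maximal length is tested on its
  own monomial, where all others of at most that length vanish.\<close>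

lemma power_sum_independent:
  assumes "finite S" "\<And>\<alpha>. (\<Sum>lam\<in>S. c lam * power_sum_partition lam \<alpha>) = 0" "lam \<in> S"
  shows "c lam = 0"
proof (rule ccontr)
  assume "c lam \<noteq> 0"
  let ?T = "{lam\<in>S. c lam \<noteq> 0}"
  have "finite ?T" "?T \<noteq> {}" using assms \<open>c lam \<noteq> 0\<close> by auto
  then obtain mu where mu: "mu \<in> ?T" "\<And>nu. nu \<in> ?T \<Longrightarrow> plength nu \<le> plength mu"
  proof -
    have "Max (plength ` ?T) \<in> plength ` ?T" using \<open>finite ?T\<close> \<open>?T \<noteq> {}\<close> by (intro Max_in) auto
    then obtain mu where "mu \<in> ?T" "plength mu = Max (plength ` ?T)" by auto
    then show ?thesis using that[of mu] \<open>finite ?T\<close> by simp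
  qed
  have "(\<Sum>lam\<in>S. c lam * power_sum_partition lam (partition_monomial mu)) = c mu * power_sum_partition mu (partition_monomial mu)"
  proof (subst sum.mono_neutral_right[of S "{mu}"])
    show "\<forall>i\<in>S - {mu}. c i * power_sum_partition i (partition_monomial mu) = 0"
      using mu power_sum_partition_triangular by fastforce
  qed (use assms mu in auto)
  then show False using assms(2) mu(1) power_sum_partition_leading[of mu] by simp
qed

definition power_sum_span :: "series \<Rightarrow> bool" where
  "power_sum_span f \<longleftrightarrow> (\<exists>S c. finite S \<and> f = (\<lambda>\<alpha>. \<Sum>lam\<in>S. c lam * power_sum_partition lam \<alpha>))"

text \<open>Independence makes the description inside \<open>power_sum_coeff\<close> unique, so any
  finite expansion computes the coordinates.\<close>

lemma power_sum_coeff_eq: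
  assumes "finite S" "f = (\<lambda>\<alpha>. \<Sum>lam\<in>S. c lam * power_sum_partition lam \<alpha>)"
  shows "power_sum_coeff f = (\<lambda>lam. if lam \<in> S then c lam else 0)"
  unfolding power_sum_coeff_def
proof (rule the_equality, intro conjI allI)
  let ?c = "\<lambda>lam. if lam \<in> S then c lam else 0"
  show fin: "finite {lam. ?c lam \<noteq> 0}"
    by (rule finite_subset[OF _ assms(1)]) (auto split: if_splits)
  show val: "f \<alpha> = (\<Sum>lam | ?c lam \<noteq> 0. ?c lam * power_sum_partition lam \<alpha>)" for \<alpha>
    unfolding assms(2) by (rule sum.mono_neutral_cong_right) (use assms(1) in \<open>auto split: if_splits\<close>)
  fix d assume d: "finite {lam. d lam \<noteq> 0} \<and> (\<forall>\<alpha>. f \<alpha> = (\<Sum>lam | d lam \<noteq> 0. d lam * power_sum_partition lam \<alpha>))"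
  show "d = ?c"
  proof
    fix lam
    let ?U = "{lam. d lam \<noteq> 0} \<union> S \<union> {lam}"
    have finU: "finite ?U" using d assms by simp
    have "d lam - ?c lam = 0"
    proof (rule power_sum_independent[OF finU])
      fix \<alpha>
      have "f \<alpha> = (\<Sum>lam\<in>?U. d lam * power_sum_partition lam \<alpha>)"
        using d finU by (subst sum.mono_neutral_right[of ?U "{lam. d lam \<noteq> 0}"]) auto
      moreover have "f \<alpha> = (\<Sum>lam\<in>?U. ?c lam * power_sum_partition lam \<alpha>)"
        unfolding assms(2) by (rule sum.mono_neutral_cong_left) (use finU in auto)
      ultimately show "(\<Sum>lam\<in>?U. (d lam - ?c lam) * power_sum_partition lam \<alpha>) = 0"
        by (simp only: left_diff_distrib sum_subtractf)
    qed simp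
    then show "d lam = ?c lam" by simp
  qed
qed

lemma linear_closed_span: "linear_closed power_sum_span"
  unfolding linear_closed_def
proof (intro allI impI)
  fix I :: "partition set" and c h assume I: "finite I" and "\<forall>i\<in>I. power_sum_span (h i)"
  then obtain S d where S: "\<And>i. i \<in> I \<Longrightarrow> finite (S i)"
    and h: "\<And>i. i \<in> I \<Longrightarrow> h i = (\<lambda>\<alpha>. \<Sum>lam\<in>S i. d i lam * power_sum_partition lam \<alpha>)"
    unfolding power_sum_span_def by metis
  let ?U = "\<Union>i\<in>I. S i"
  let ?e = "\<lambda>i lam. if lam \<in> S i then d i lam else 0"
  have fin: "finite ?U" using I S by simp
  have "(\<Sum>i\<in>I. c i * h i \<alpha>) = (\<Sum>lam\<in>?U. (\<Sum>i\<in>I. c i * ?e i lam) * power_sum_partition lam \<alpha>)" for \<alpha>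
  proof -
    have "h i \<alpha> = (\<Sum>lam\<in>?U. ?e i lam * power_sum_partition lam \<alpha>)" if "i \<in> I" for i
      unfolding h[OF that] by (rule sum.mono_neutral_cong_left) (use fin that in auto)
    then have "(\<Sum>i\<in>I. c i * h i \<alpha>) = (\<Sum>i\<in>I. \<Sum>lam\<in>?U. c i * ?e i lam * power_sum_partition lam \<alpha>)"
      by (auto intro!: sum.cong simp: sum_distrib_left mult.assoc)
    also have "\<dots> = (\<Sum>lam\<in>?U. \<Sum>i\<in>I. c i * ?e i lam * power_sum_partition lam \<alpha>)" by (rule sum.swap)
    finally show ?thesis by (simp only: sum_distrib_right)
  qed
  then show "power_sum_span (\<lambda>\<alpha>. \<Sum>i\<in>I. c i * h i \<alpha>)"
    unfolding power_sum_span_def using fin by (intro exI[of _ ?U] exI[of _ "\<lambda>lam. \<Sum>i\<in>I. c i * ?e i lam"]) auto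
qed

lemma kernel_partition_expansion:
  assumes "0 \<le> t" "t < 1" "set_mset \<beta> \<subseteq> {..<K}"
  shows "row_product t K \<beta> = (\<lambda>\<alpha>. \<Sum>lam | psize lam = size \<beta>.
    (power_sum_partition lam \<beta> / z_mset t (part_mset lam)) * power_sum_partition lam \<alpha>)"
proof
  fix \<alpha>
  show "row_product t K \<beta> \<alpha> = (\<Sum>lam | psize lam = size \<beta>.
    (power_sum_partition lam \<beta> / z_mset t (part_mset lam)) * power_sum_partition lam \<alpha>)"
    unfolding kernel_expansion[OF assms] power_sum_partition_eq
    by (subst sum.reindex_bij_betw[OF bij_betw_part_mset, symmetric]) simp
qed

lemma power_sum_span_row_product:
  assumes "0 \<le> t" "t < 1"
  shows "power_sum_span (row_product t K \<beta>)"
proof -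
  let ?\<beta> = "filter_mset (\<lambda>i. i < K) \<beta>"
  have e: "row_product t K \<beta> = row_product t K ?\<beta>" by (rule row_product_cong) simp
  have "set_mset ?\<beta> \<subseteq> {..<K}" by auto
  from kernel_partition_expansion[OF assms this] show ?thesis
    unfolding power_sum_span_def e using finite_psize_eq[of "size ?\<beta>"] by (intro exI conjI)
qed

text \<open>The span is reached through the kernel: row products lie in it by the power sum
  expansion, hence so do the functions \<open>hall_P\<close>, and their unitriangular expansion is
  solved for the monomial functions. Here \<open>t\<close> is a parameter of the method; it is set
  to 0 in the application to arbitrary symmetric functions.\<close>

lemma power_sum_span_monomial:
  fixes t :: real
  assumes "0 \<le> t" "t < 1"
  shows "power_sum_span (monomial_sym lam)"
proof (induction "dominance_rank lam" arbitrary: lam rule: less_induct)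
  case less
  let ?I = "{mu. dominated mu lam \<and> mu \<noteq> lam}"
  define h where "h mu = (if mu = lam then hall_P t lam else monomial_sym mu)" for mu
  define c where "c mu = (if mu = lam then 1 else - hall_P t lam (partition_monomial mu))" for mu
  have fin: "finite ?I" by (rule finite_dominated)
  have sp: "power_sum_span (hall_P t lam)"
    by (rule hall_P_linear_closed[OF assms linear_closed_span power_sum_span_row_product[OF assms]])
  have "power_sum_span (\<lambda>\<alpha>. \<Sum>mu\<in>insert lam ?I. c mu * h mu \<alpha>)"
    by (rule linear_closedD[OF linear_closed_span]) (use sp fin less.hyps dominated_rank in \<open>auto simp: h_def\<close>)
  moreover have "(\<Sum>mu\<in>insert lam ?I. c mu * h mu \<alpha>) = monomial_sym lam \<alpha>" for \<alpha>
  proof -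
    have "(\<Sum>mu\<in>?I. c mu * h mu \<alpha>) = - (\<Sum>mu\<in>?I. hall_P t lam (partition_monomial mu) * monomial_sym mu \<alpha>)"
      unfolding sum_negf[symmetric] by (rule sum.cong) (auto simp: c_def h_def)
    then show ?thesis using fin hall_P_monomial_expansion[OF assms, of lam \<alpha>] by (simp add: c_def h_def)
  qed
  ultimately show ?case by simp
qed

lemma symmetric_power_sum_span:
  assumes "symmetric_function f"
  shows "power_sum_span f"
proof -
  obtain d where pi: "perm_invariant f" and d: "\<And>\<alpha>. size \<alpha> > d \<Longrightarrow> f \<alpha> = 0"
    using assms unfolding symmetric_function_iff by blast
  have "shape \<alpha> \<in> {lam. psize lam \<le> d}" if "f \<alpha> \<noteq> 0" for \<alpha>
    using d[of \<alpha>] that perm_invariant_shape(2)[OF pi, of \<alpha>] by (simp add: not_less[symmetric]) blast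
  from monomial_expansion[OF pi this finite_psize_le]
  have e: "f = (\<lambda>\<alpha>. \<Sum>lam | psize lam \<le> d. f (partition_monomial lam) * monomial_sym lam \<alpha>)" by blast
  show ?thesis
    by (subst e, rule linear_closedD[OF linear_closed_span finite_psize_le power_sum_span_monomial[of 0]]) auto
qed

section \<open>Skew functions in one variable\<close>

lemma power_sum_coeff_symmetric:
  assumes "symmetric_function f"
  shows "finite {lam. power_sum_coeff f lam \<noteq> 0}"
    "f \<alpha> = (\<Sum>lam | power_sum_coeff f lam \<noteq> 0. power_sum_coeff f lam * power_sum_partition lam \<alpha>)"
proof -
  obtain S c where S: "finite S" "f = (\<lambda>\<alpha>. \<Sum>lam\<in>S. c lam * power_sum_partition lam \<alpha>)"
    using symmetric_power_sum_span[OF assms] unfolding power_sum_span_def by blast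
  note e = power_sum_coeff_eq[OF S]
  show "finite {lam. power_sum_coeff f lam \<noteq> 0}"
    by (rule finite_subset[OF _ S(1)]) (auto simp: e split: if_splits)
  show "f \<alpha> = (\<Sum>lam | power_sum_coeff f lam \<noteq> 0. power_sum_coeff f lam * power_sum_partition lam \<alpha>)"
    unfolding e by (subst S(2), rule sum.mono_neutral_cong_right) (use S(1) in \<open>auto split: if_splits\<close>)
qed

lemma power_sum_coeff_sum:
  assumes "finite I" "\<And>i. i \<in> I \<Longrightarrow> symmetric_function (h i)"
  shows "power_sum_coeff (\<lambda>\<alpha>. \<Sum>i\<in>I. c i * h i \<alpha>) lam = (\<Sum>i\<in>I. c i * power_sum_coeff (h i) lam)"
proof -
  define U where "U = (\<Union>i\<in>I. {lam. power_sum_coeff (h i) lam \<noteq> 0})"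
  have fin: "finite U" using assms power_sum_coeff_symmetric(1) by (auto simp: U_def)
  have h: "h i \<alpha> = (\<Sum>lam\<in>U. power_sum_coeff (h i) lam * power_sum_partition lam \<alpha>)" if "i \<in> I" for i \<alpha>
    unfolding power_sum_coeff_symmetric(2)[OF assms(2)[OF that], of \<alpha>]
    by (rule sum.mono_neutral_left) (use fin that in \<open>auto simp: U_def\<close>)
  have "(\<Sum>i\<in>I. c i * h i \<alpha>) = (\<Sum>lam\<in>U. (\<Sum>i\<in>I. c i * power_sum_coeff (h i) lam) * power_sum_partition lam \<alpha>)" for \<alpha>
  proof -
    have "(\<Sum>i\<in>I. c i * h i \<alpha>) = (\<Sum>i\<in>I. \<Sum>lam\<in>U. c i * power_sum_coeff (h i) lam * power_sum_partition lam \<alpha>)"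
      by (auto intro!: sum.cong simp: sum_distrib_left mult.assoc h)
    also have "\<dots> = (\<Sum>lam\<in>U. \<Sum>i\<in>I. c i * power_sum_coeff (h i) lam * power_sum_partition lam \<alpha>)" by (rule sum.swap)
    finally show ?thesis by (simp only: sum_distrib_right)
  qed
  then have "(\<lambda>\<alpha>. \<Sum>i\<in>I. c i * h i \<alpha>) = (\<lambda>\<alpha>. \<Sum>lam\<in>U. (\<Sum>i\<in>I. c i * power_sum_coeff (h i) lam) * power_sum_partition lam \<alpha>)"
    by (rule ext)
  note e = power_sum_coeff_eq[OF fin this]
  have "(\<Sum>i\<in>I. c i * power_sum_coeff (h i) lam) = 0" if "lam \<notin> U"
    by (rule sum.neutral) (use that in \<open>auto simp: U_def\<close>)
  then show ?thesis unfolding e by simp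
qed

lemma inner_eq:
  assumes "finite S" "\<And>lam. power_sum_coeff f lam \<noteq> 0 \<Longrightarrow> power_sum_coeff g lam \<noteq> 0 \<Longrightarrow> lam \<in> S"
  shows "macdonald_inner 0 t f g = (\<Sum>lam\<in>S. power_sum_coeff f lam * power_sum_coeff g lam * z_mset t (part_mset lam))"
  unfolding macdonald_inner_def inner_norm_eq
  by (rule sum.mono_neutral_left) (use assms in auto)

lemma inner_commute: "macdonald_inner q t f g = macdonald_inner q t g f"
  unfolding macdonald_inner_def by (simp add: conj_commute mult.commute[of "power_sum_coeff f _"])

lemma inner_sum_right:
  assumes "symmetric_function f" "finite I" "\<And>i. i \<in> I \<Longrightarrow> symmetric_function (h i)"
  shows "macdonald_inner 0 t f (\<lambda>\<alpha>. \<Sum>i\<in>I. c i * h i \<alpha>) = (\<Sum>i\<in>I. c i * macdonald_inner 0 t f (h i))"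
proof -
  let ?S = "{lam. power_sum_coeff f lam \<noteq> 0}"
  note fin = power_sum_coeff_symmetric(1)[OF assms(1)]
  have e: "macdonald_inner 0 t f g = (\<Sum>lam\<in>?S. power_sum_coeff f lam * power_sum_coeff g lam * z_mset t (part_mset lam))" for g
    by (rule inner_eq[OF fin]) auto
  have p: "power_sum_coeff (\<lambda>\<alpha>. \<Sum>i\<in>I. c i * h i \<alpha>) lam = (\<Sum>i\<in>I. c i * power_sum_coeff (h i) lam)" for lam
    by (rule power_sum_coeff_sum[OF assms(2,3)])
  have "macdonald_inner 0 t f (\<lambda>\<alpha>. \<Sum>i\<in>I. c i * h i \<alpha>) =
      (\<Sum>lam\<in>?S. \<Sum>i\<in>I. c i * (power_sum_coeff f lam * power_sum_coeff (h i) lam * z_mset t (part_mset lam)))"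
    unfolding e p by (simp add: sum_distrib_left sum_distrib_right mult_ac)
  also have "\<dots> = (\<Sum>i\<in>I. \<Sum>lam\<in>?S. c i * (power_sum_coeff f lam * power_sum_coeff (h i) lam * z_mset t (part_mset lam)))"
    by (rule sum.swap)
  finally show ?thesis unfolding e sum_distrib_left .
qed

lemma inner_sum_left:
  assumes "symmetric_function f" "finite I" "\<And>i. i \<in> I \<Longrightarrow> symmetric_function (h i)"
  shows "macdonald_inner 0 t (\<lambda>\<alpha>. \<Sum>i\<in>I. c i * h i \<alpha>) f = (\<Sum>i\<in>I. c i * macdonald_inner 0 t (h i) f)"
  unfolding inner_commute[of 0 t _ f] by (rule inner_sum_right[OF assms])

text \<open>Restricting the power sum expansion of a homogeneous function to partitions of its
  degree still represents it, so by uniqueness no others occur. Different degrees then share no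
  coordinate.\<close>

lemma inner_homogeneous:
  assumes "symmetric_function f" "symmetric_function g" "m \<noteq> n"
    and f: "\<And>\<alpha>. f \<alpha> \<noteq> 0 \<Longrightarrow> size \<alpha> = m" and g: "\<And>\<alpha>. g \<alpha> \<noteq> 0 \<Longrightarrow> size \<alpha> = n"
  shows "macdonald_inner 0 t f g = 0"
proof -
  have "psize lam = m" if "symmetric_function f" "\<And>\<alpha>. f \<alpha> \<noteq> 0 \<Longrightarrow> size \<alpha> = m" "power_sum_coeff f lam \<noteq> 0" for f lam m
  proof -
    let ?S = "{lam. power_sum_coeff f lam \<noteq> 0}"
    let ?T = "{lam\<in>?S. psize lam = m}"
    have "f \<alpha> = (\<Sum>lam\<in>?T. power_sum_coeff f lam * power_sum_partition lam \<alpha>)" for \<alpha>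
    proof (cases "size \<alpha> = m")
      case True
      have "power_sum_partition lam \<alpha> = 0" if "psize lam \<noteq> m" for lam
        using power_sum_mset_size[OF zero_notin_part_mset, of lam \<alpha>] that True
        by (auto simp: power_sum_partition_eq sum_part_mset)
      then show ?thesis unfolding power_sum_coeff_symmetric(2)[OF that(1), of \<alpha>]
        by (intro sum.mono_neutral_right power_sum_coeff_symmetric(1)[OF that(1)]) auto
    next
      case False
      have "power_sum_partition lam \<alpha> = 0" if "psize lam = m" for lam
        using power_sum_mset_size[OF zero_notin_part_mset, of lam \<alpha>] that False
        by (auto simp: power_sum_partition_eq sum_part_mset)
      then have "(\<Sum>lam\<in>?T. power_sum_coeff f lam * power_sum_partition lam \<alpha>) = 0" by (intro sum.neutral) auto
      then show ?thesis using that(2)[of \<alpha>] False by metis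
    qed
    then have F: "f = (\<lambda>\<alpha>. \<Sum>lam\<in>?T. power_sum_coeff f lam * power_sum_partition lam \<alpha>)" by (rule ext)
    have "finite ?T" using power_sum_coeff_symmetric(1)[OF that(1)] by simp
    from power_sum_coeff_eq[OF this F] have "power_sum_coeff f lam = (if lam \<in> ?T then power_sum_coeff f lam else 0)"
      by (rule fun_cong)
    then show "psize lam = m" using that(3) by (auto split: if_splits)
  qed
  from this[OF assms(1) f] this[OF assms(2) g]
  have "{lam. power_sum_coeff f lam \<noteq> 0 \<and> power_sum_coeff g lam \<noteq> 0} = {}"
    using assms(3) by blast
  then show ?thesis unfolding macdonald_inner_def by (simp only: sum.empty)
qed

text \<open>The kernel reproduces coefficients: \<open>\<langle>f, g\<^sub>\<beta>\<rangle>\<close> is the coefficient of \<open>x\<^sup>\<beta>\<close> in \<open>f\<close>.\<close>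

lemma inner_row_product:
  assumes t: "0 \<le> t" "t < 1" and f: "symmetric_function f" and "set_mset \<beta> \<subseteq> {..<K}"
  shows "macdonald_inner 0 t f (row_product t K \<beta>) = f \<beta>"
proof -
  let ?S = "{lam. power_sum_coeff f lam \<noteq> 0}"
  have c: "power_sum_coeff (row_product t K \<beta>) lam = power_sum_partition lam \<beta> / z_mset t (part_mset lam)" for lam
  proof -
    have "power_sum_partition lam \<beta> = 0" if "psize lam \<noteq> size \<beta>"
      using power_sum_mset_size[OF zero_notin_part_mset, of lam \<beta>] that
      by (auto simp: power_sum_partition_eq sum_part_mset)
    then show ?thesis
      unfolding power_sum_coeff_eq[OF finite_psize_eq kernel_partition_expansion[OF t assms(4)]] by auto
  qed
  have z: "z_mset t (part_mset lam) \<noteq> 0" for lam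
    using z_mset_pos[OF zero_notin_part_mset t, of lam] by simp
  have "macdonald_inner 0 t f (row_product t K \<beta>) = (\<Sum>lam\<in>?S. power_sum_coeff f lam * power_sum_partition lam \<beta>)"
    by (subst inner_eq[OF power_sum_coeff_symmetric(1)[OF f]]) (auto simp: c z)
  then show ?thesis by (simp only: power_sum_coeff_symmetric(2)[OF f, of \<beta>, symmetric])
qed

lemma hall_P_homogeneous: "hall_P t lam \<alpha> \<noteq> 0 \<Longrightarrow> size \<alpha> = psize lam"
proof -
  assume "hall_P t lam \<alpha> \<noteq> 0"
  then have "psize lam = (\<Sum>i<var_bound \<alpha>. count \<alpha> i)"
    using chain_P_nonzeroD unfolding hall_P_def by blast
  also have "\<dots> = size \<alpha>"
    unfolding size_multiset_overloaded_eq
    by (rule sum.mono_neutral_right) (use var_bound[of \<alpha>] in \<open>auto simp: not_in_iff\<close>)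
  finally show ?thesis by simp
qed

context
  fixes t :: real
  assumes t: "0 \<le> t" "t < 1"
begin

text \<open>Pairing with the row product of \<open>mu\<close> gives, by reproduction, a coefficient
  of \<open>hall_P t lam\<close> and, by expansion, a sum over the partitions dominating
  \<open>mu\<close>. The difference is a unitriangular homogeneous system for the deviations
  \<open>x\<close>, solved from the top of the dominance order.\<close>

lemma hall_P_orthogonal:
  "macdonald_inner 0 t (hall_P t lam) (hall_P t mu) = (if lam = mu then 1 / mult_coeff t mu else 0)"
proof -
  let ?b = "mult_coeff t" and ?I = "macdonald_inner 0 t (hall_P t lam)"
  note sym = symmetric_function_hall_P[OF t]
  define x where "x mu = ?b mu * ?I (hall_P t mu) - of_bool (lam = mu)" for mu
  have "x mu = 0"
  proof (induction "Suc (psize mu) * psize mu - dominance_rank mu" arbitrary: mu rule: less_induct)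
    case less
    let ?J = "{nu. dominated mu nu \<and> nu \<noteq> mu}"
    let ?A = "\<lambda>nu. hall_P t nu (partition_monomial mu)"
    have fin: "finite {nu. dominated mu nu}" using finite_dominated(2)[of mu "\<lambda>_. True"] by simp
    have zero: "x nu = 0" if "nu \<in> ?J" for nu
    proof (rule less.hyps)
      have "psize nu = psize mu" using that by (simp add: dominated_def)
      moreover have "dominance_rank mu < dominance_rank nu" using dominated_rank[of mu nu] that by auto
      ultimately show "Suc (psize nu) * psize nu - dominance_rank nu < Suc (psize mu) * psize mu - dominance_rank mu"
        using dominance_rank_le[of nu] by simp
    qed
    have "row_product t (plength mu) (partition_monomial mu) = (\<lambda>\<alpha>. \<Sum>nu | dominated mu nu. (?b nu * ?A nu) * hall_P t nu \<alpha>)"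
      by (rule ext, rule row_product_monomial)
    then have "?I (row_product t (plength mu) (partition_monomial mu)) = (\<Sum>nu | dominated mu nu. ?b nu * ?A nu * ?I (hall_P t nu))"
      by (simp only: inner_sum_right[OF sym fin sym])
    moreover have "?I (row_product t (plength mu) (partition_monomial mu)) = hall_P t lam (partition_monomial mu)"
      by (rule inner_row_product[OF t sym]) (simp add: set_partition_monomial)
    moreover have "hall_P t lam (partition_monomial mu) = (\<Sum>nu | dominated mu nu. ?A nu * of_bool (lam = nu))"
    proof -
      have "(\<Sum>nu | dominated mu nu. ?A nu * of_bool (lam = nu)) = (if dominated mu lam then ?A lam else 0)"
        using fin by (simp add: of_bool_def if_distrib cong: if_cong)
      then show ?thesis using hall_P_monomial_dominated by auto
    qed
    ultimately have "(\<Sum>nu | dominated mu nu. ?A nu * x nu) = 0"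
      by (simp add: x_def right_diff_distrib sum_subtractf mult_ac)
    moreover have "{nu. dominated mu nu} = insert mu ?J" by auto
    moreover have "finite ?J" by (rule finite_dominated)
    ultimately have "?A mu * x mu = 0" using zero by simp
    then show "x mu = 0" by (simp add: hall_P_monomial_leading)
  qed
  then show ?thesis using mult_coeff_pos[OF t, of mu] by (auto simp: x_def field_simps)
qed

text \<open>Every coefficient of \<open>f\<close> is its pairing with a row product, and row
  products are combinations of the functions \<open>hall_P\<close>.\<close>

lemma symmetric_zero_if_orthogonal:
  assumes "symmetric_function f" "\<And>lam. macdonald_inner 0 t f (hall_P t lam) = 0"
  shows "f = (\<lambda>_. 0)"
proof
  fix \<beta>
  note sym = symmetric_function_hall_P[OF t]
  let ?K = "var_bound \<beta>"
  have "row_product t ?K \<beta> = (\<lambda>\<alpha>. \<Sum>lam | psize lam = (\<Sum>i<?K. count \<beta> i). (mult_coeff t lam * chain_P t ?K \<beta> lam) * hall_P t lam \<alpha>)"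
    by (rule ext, rule row_product_expansion)
  then have "macdonald_inner 0 t f (row_product t ?K \<beta>) = 0"
    by (simp only: inner_sum_right[OF assms(1) finite_psize_eq sym] assms(2)) simp
  then show "f \<beta> = 0" using inner_row_product[OF t assms(1) var_bound] by simp
qed

lemma symmetric_diff:
  assumes "symmetric_function f" "symmetric_function g"
  shows "symmetric_function (\<lambda>\<alpha>. f \<alpha> - g \<alpha>)"
    "symmetric_function h \<Longrightarrow> macdonald_inner 0 t (\<lambda>\<alpha>. f \<alpha> - g \<alpha>) h = macdonald_inner 0 t f h - macdonald_inner 0 t g h"
proof -
  let ?k = "\<lambda>b. if b then f else g" and ?c = "\<lambda>b. if b then 1 else - 1 :: real"
  have e: "(\<lambda>\<alpha>. f \<alpha> - g \<alpha>) = (\<lambda>\<alpha>. \<Sum>b\<in>(UNIV :: bool set). ?c b * ?k b \<alpha>)"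
    by (simp add: UNIV_bool)
  have k: "symmetric_function (?k b)" for b using assms by simp
  show "symmetric_function (\<lambda>\<alpha>. f \<alpha> - g \<alpha>)" unfolding e by (rule symmetric_function_sum) (use k in auto)
  assume h: "symmetric_function h"
  show "macdonald_inner 0 t (\<lambda>\<alpha>. f \<alpha> - g \<alpha>) h = macdonald_inner 0 t f h - macdonald_inner 0 t g h"
    unfolding e by (subst inner_sum_left[OF h _ k]) (simp_all add: UNIV_bool)
qed

lemma symmetric_eqI:
  assumes "symmetric_function f" "symmetric_function g"
    and "\<And>lam. macdonald_inner 0 t f (hall_P t lam) = macdonald_inner 0 t g (hall_P t lam)"
  shows "f = g"
proof -
  have "(\<lambda>\<alpha>. f \<alpha> - g \<alpha>) = (\<lambda>_. 0)"
    by (rule symmetric_zero_if_orthogonal)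
       (simp_all add: symmetric_diff[OF assms(1,2)] symmetric_function_hall_P[OF t] assms(3))
  then show ?thesis by (simp add: fun_eq_iff)
qed

lemma monomial_sym_via_hall_P:
  "monomial_sym lam = (\<lambda>\<alpha>. hall_P t lam \<alpha> -
    (\<Sum>mu | dominated mu lam \<and> mu \<noteq> lam. hall_P t lam (partition_monomial mu) * monomial_sym mu \<alpha>))"
proof
  fix \<alpha> show "monomial_sym lam \<alpha> = hall_P t lam \<alpha> -
    (\<Sum>mu | dominated mu lam \<and> mu \<noteq> lam. hall_P t lam (partition_monomial mu) * monomial_sym mu \<alpha>)"
    using hall_P_monomial_expansion[OF t, of lam \<alpha>] by linarith
qed

lemma symmetric_function_monomial: "symmetric_function (monomial_sym lam)"
proof (induction "dominance_rank lam" arbitrary: lam rule: less_induct)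
  case less
  let ?I = "{mu. dominated mu lam \<and> mu \<noteq> lam}"
  have "symmetric_function (\<lambda>\<alpha>. \<Sum>mu\<in>?I. hall_P t lam (partition_monomial mu) * monomial_sym mu \<alpha>)"
    by (rule symmetric_function_sum) (use less.hyps dominated_rank finite_dominated in auto)
  then show ?case by (subst monomial_sym_via_hall_P) (rule symmetric_diff(1)[OF symmetric_function_hall_P[OF t]])
qed

lemma macdonald_family_hall_P: "macdonald_family 0 t (hall_P t)"
  unfolding macdonald_family_def
proof (intro conjI allI impI)
  fix lam
  show "\<exists>c. \<forall>\<alpha>. hall_P t lam \<alpha> = monomial_sym lam \<alpha> + (\<Sum>mu | dominated mu lam \<and> mu \<noteq> lam. c mu * monomial_sym mu \<alpha>)"
    by (intro exI[of _ "\<lambda>mu. hall_P t lam (partition_monomial mu)"] allI hall_P_monomial_expansion[OF t])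
qed (simp add: hall_P_orthogonal)

text \<open>The difference \<open>D\<close> is a combination of monomial functions strictly below
  \<open>lam\<close>. It is orthogonal to \<open>hall_P t nu\<close> for \<open>nu\<close> strictly
  below \<open>lam\<close> by induction and the orthogonality of both families, and for all other
  \<open>nu\<close> because a monomial function pairs nontrivially with \<open>hall_P t nu\<close>
  only if its index dominates \<open>nu\<close>.\<close>

lemma macdonald_family_unique:
  assumes "macdonald_family 0 t P"
  shows "P lam = hall_P t lam"
proof (induction "dominance_rank lam" arbitrary: lam rule: less_induct)
  case less
  let ?I = "{mu. dominated mu lam \<and> mu \<noteq> lam}"
  note fin = finite_dominated(1)[of lam "\<lambda>mu. mu \<noteq> lam"]
  note symP = symmetric_function_hall_P[OF t]
  note fam = assms[unfolded macdonald_family_def]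
  obtain c where "\<forall>\<alpha>. P lam \<alpha> = monomial_sym lam \<alpha> + (\<Sum>mu\<in>?I. c mu * monomial_sym mu \<alpha>)"
    using spec[OF conjunct1[OF fam], of lam] by (rule exE)
  then have c: "P lam \<alpha> = monomial_sym lam \<alpha> + (\<Sum>mu\<in>?I. c mu * monomial_sym mu \<alpha>)" for \<alpha>
    by (rule spec)
  have orth: "macdonald_inner 0 t (P lam) (P mu) = 0" if "lam \<noteq> mu" for mu
    using conjunct2[OF fam] that by simp
  let ?d = "\<lambda>mu. c mu - hall_P t lam (partition_monomial mu)"
  define D where "D = (\<lambda>\<alpha>. P lam \<alpha> - hall_P t lam \<alpha>)"
  have D: "D = (\<lambda>\<alpha>. \<Sum>mu\<in>?I. ?d mu * monomial_sym mu \<alpha>)"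
  proof
    fix \<alpha>
    show "D \<alpha> = (\<Sum>mu\<in>?I. ?d mu * monomial_sym mu \<alpha>)"
      unfolding left_diff_distrib sum_subtractf D_def
      using c[of \<alpha>] hall_P_monomial_expansion[OF t, of lam \<alpha>] by linarith
  qed
  have symD: "symmetric_function D" unfolding D
    by (rule symmetric_function_sum[OF fin symmetric_function_monomial])
  \<comment> \<open>Symmetry of \<open>P lam\<close> is deduced from the monomial expansion of
    \<open>D\<close>; the double negation is there to reuse closure under differences.\<close>
  have eq: "P lam = (\<lambda>\<alpha>. hall_P t lam \<alpha> - (- 1 * D \<alpha>))" by (simp add: D_def)
  have symN: "symmetric_function (\<lambda>\<alpha>. - 1 * D \<alpha>)"
    using symmetric_function_sum[of "{()}" "\<lambda>_. D" "\<lambda>_. - 1"] symD by simp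
  have symPl: "symmetric_function (P lam)" unfolding eq by (rule symmetric_diff(1)[OF symP symN])
  have inD: "macdonald_inner 0 t D (hall_P t mu) = macdonald_inner 0 t (P lam) (hall_P t mu) - macdonald_inner 0 t (hall_P t lam) (hall_P t mu)" for mu
    unfolding D_def by (rule symmetric_diff(2)[OF symPl symP symP])
  have below: "macdonald_inner 0 t D (hall_P t mu) = 0" if "mu \<in> ?I" for mu
  proof -
    have "P mu = hall_P t mu" using less.hyps that dominated_rank by blast
    then have "macdonald_inner 0 t (P lam) (hall_P t mu) = 0"
      using orth[of mu] that by auto
    then show ?thesis using that by (auto simp: inD hall_P_orthogonal)
  qed
  have mono: "macdonald_inner 0 t (monomial_sym mu) (hall_P t nu) = 0"
    if "\<not> dominated nu mu" for mu nu
    using that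
  proof (induction "dominance_rank mu" arbitrary: mu rule: less_induct)
    case (less mu)
    let ?J = "{kap. dominated kap mu \<and> kap \<noteq> mu}"
    note fin' = finite_dominated(1)[of mu "\<lambda>kap. kap \<noteq> mu"]
    have S: "symmetric_function (\<lambda>\<alpha>. \<Sum>kap\<in>?J. hall_P t mu (partition_monomial kap) * monomial_sym kap \<alpha>)"
      by (rule symmetric_function_sum[OF fin' symmetric_function_monomial])
    have ne: "mu \<noteq> nu" using less.prems by auto
    have zero: "macdonald_inner 0 t (monomial_sym kap) (hall_P t nu) = 0" if "kap \<in> ?J" for kap
    proof (rule less.hyps)
      show "dominance_rank kap < dominance_rank mu" using that dominated_rank by blast
      show "\<not> dominated nu kap" using that less.prems by (auto simp: dominated_def intro: le_trans)
    qed
    have "macdonald_inner 0 t (\<lambda>\<alpha>. \<Sum>kap\<in>?J. hall_P t mu (partition_monomial kap) * monomial_sym kap \<alpha>) (hall_P t nu) = 0"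
      unfolding inner_sum_left[OF symP fin' symmetric_function_monomial] using zero by (intro sum.neutral) auto
    then show ?case
      using symmetric_diff(2)[OF symP S symP, of mu nu] ne
      unfolding monomial_sym_via_hall_P[of mu, symmetric] by (simp add: hall_P_orthogonal)
  qed
  have "macdonald_inner 0 t D (hall_P t nu) = 0" for nu
  proof (cases "nu \<in> ?I")
    case False
    have "macdonald_inner 0 t D (hall_P t nu) = (\<Sum>mu\<in>?I. ?d mu * macdonald_inner 0 t (monomial_sym mu) (hall_P t nu))"
      unfolding D by (rule inner_sum_left[OF symP fin symmetric_function_monomial])
    also have "\<dots> = 0"
    proof (intro sum.neutral ballI)
      fix mu assume mu: "mu \<in> ?I"
      have "\<not> dominated nu mu"
      proof
        assume "dominated nu mu"
        then have "dominated nu lam" using mu by (auto simp: dominated_def intro: le_trans)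
        then have "nu = lam" using False by simp
        then show False using mu \<open>dominated nu mu\<close> dominated_rank[of lam mu] dominated_rank[of mu lam] by auto
      qed
      then show "?d mu * macdonald_inner 0 t (monomial_sym mu) (hall_P t nu) = 0" using mono by simp
    qed
    finally show ?thesis .
  qed (rule below)
  then have "D = (\<lambda>_. 0)" by (rule symmetric_zero_if_orthogonal[OF symD])
  then show ?case by (simp add: D_def fun_eq_iff)
qed

lemma macdonald_P_eq: "macdonald_P 0 t = hall_P t"
  unfolding macdonald_P_def
proof (rule the_equality)
  show "macdonald_family 0 t (hall_P t)" by (rule macdonald_family_hall_P)
qed (rule ext, rule macdonald_family_unique)

text \<open>A scalar multiple written as a sum over a one-element index set, so that the linearity
  rules for finite sums apply to it.\<close>

definition hall_Q :: "partition \<Rightarrow> series" where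
  "hall_Q lam = (\<lambda>\<alpha>. \<Sum>_\<in>{()}. mult_coeff t lam * hall_P t lam \<alpha>)"

lemma symmetric_function_hall_Q: "symmetric_function (hall_Q lam)"
  unfolding hall_Q_def by (rule symmetric_function_sum) (simp_all add: symmetric_function_hall_P[OF t])

lemma inner_hall_Q:
  "symmetric_function f \<Longrightarrow> macdonald_inner 0 t f (hall_Q mu) = mult_coeff t mu * macdonald_inner 0 t f (hall_P t mu)"
  unfolding hall_Q_def by (subst inner_sum_right) (simp_all add: symmetric_function_hall_P[OF t])

lemma hall_P_Q_dual: "macdonald_inner 0 t (hall_P t lam) (hall_Q mu) = (if lam = mu then 1 else 0)"
  using mult_coeff_pos[OF t, of mu]
  by (simp add: inner_hall_Q symmetric_function_hall_P[OF t] hall_P_orthogonal)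

lemma macdonald_Q_eq: "macdonald_Q 0 t = hall_Q"
  unfolding macdonald_Q_def macdonald_P_eq
proof (rule the_equality)
  fix Q assume Q: "(\<forall>mu. symmetric_function (Q mu)) \<and>
    (\<forall>lam mu. macdonald_inner 0 t (hall_P t lam) (Q mu) = (if lam = mu then 1 else 0))"
  show "Q = hall_Q"
  proof
    fix mu show "Q mu = hall_Q mu"
      by (rule symmetric_eqI)
         (use Q in \<open>simp_all add: symmetric_function_hall_Q inner_commute[of 0 t _ "hall_P t _"] hall_P_Q_dual\<close>)
  qed
qed (simp add: symmetric_function_hall_Q hall_P_Q_dual)

lemma pieri_hall_Q:
  "series_mult (hall_Q mu) (one_row t k) =
    (\<lambda>\<alpha>. \<Sum>lam | hstrip lam mu \<and> psize lam = psize mu + k. psi t lam mu * hall_Q lam \<alpha>)"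
proof -
  have "series_mult (hall_Q mu) (one_row t k) = (\<lambda>\<alpha>. \<Sum>_\<in>{()}. mult_coeff t mu * series_mult (hall_P t mu) (one_row t k) \<alpha>)"
    unfolding hall_Q_def by (rule series_mult_sum_left)
  also have "\<dots> = (\<lambda>\<alpha>. \<Sum>lam | hstrip lam mu \<and> psize lam = psize mu + k. psi t lam mu * hall_Q lam \<alpha>)"
  proof
    fix \<alpha>
    have "mult_coeff t mu * (phi t lam mu * hall_P t lam \<alpha>) = psi t lam mu * hall_Q lam \<alpha>" for lam
      using phi_mult_coeff[of t lam mu] by (simp add: hall_Q_def mult_ac)
    then show "(\<Sum>_\<in>{()}. mult_coeff t mu * series_mult (hall_P t mu) (one_row t k) \<alpha>) =
        (\<Sum>lam | hstrip lam mu \<and> psize lam = psize mu + k. psi t lam mu * hall_Q lam \<alpha>)"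
      by (simp add: pieri sum_distrib_left)
  qed
  finally show ?thesis .
qed

lemma mult_hall_homogeneous:
  assumes "\<And>\<alpha>. f \<alpha> \<noteq> 0 \<Longrightarrow> size \<alpha> = m" "\<And>\<alpha>. g \<alpha> \<noteq> 0 \<Longrightarrow> size \<alpha> = n" "series_mult f g \<alpha> \<noteq> 0"
  shows "size \<alpha> = m + n"
proof -
  obtain \<beta> where "\<beta> \<subseteq># \<alpha>" "f \<beta> * g (\<alpha> - \<beta>) \<noteq> 0"
    using assms(3) unfolding series_mult_def by (elim sum.not_neutral_contains_not_neutral) auto
  moreover from this have "size \<alpha> = size \<beta> + size (\<alpha> - \<beta>)"
    by (metis size_union subset_mset.add_diff_inverse)
  ultimately show ?thesis using assms(1)[of \<beta>] assms(2)[of "\<alpha> - \<beta>"] by simp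
qed

text \<open>
  Both skew functions are instances of \<open>\<langle>X\<^sub>\<lambda>\<^sub>/\<^sub>\<mu>, B\<^sub>\<nu>\<rangle> = \<langle>A\<^sub>\<lambda>, B\<^sub>\<mu> B\<^sub>\<nu>\<rangle>\<close> with \<open>A, B\<close> dual. Since
  \<open>\<langle>f, g\<^sub>k\<rangle>\<close> is the coefficient of \<open>x\<^sub>0\<^sup>k\<close>, the one variable specialization is read off from the
  Pieri rule for \<open>B\<^sub>\<mu> g\<^sub>k\<close>.
\<close>

lemma skew_unique_existence:
  fixes A B :: "partition \<Rightarrow> series" and w :: "partition \<Rightarrow> real" and lam mu :: partition
  assumes A: "\<And>lam. symmetric_function (A lam)" "\<And>lam \<alpha>. A lam \<alpha> \<noteq> 0 \<Longrightarrow> size \<alpha> = psize lam"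
    and B: "\<And>lam. symmetric_function (B lam)" "\<And>lam \<alpha>. B lam \<alpha> \<noteq> 0 \<Longrightarrow> size \<alpha> = psize lam"
    and dual: "\<And>lam mu. macdonald_inner 0 t (A lam) (B mu) = (if lam = mu then 1 else 0)"
    and span: "\<And>lam. \<exists>c. hall_P t lam = (\<lambda>\<alpha>. \<Sum>_\<in>{()}. c * B lam \<alpha>)"
    and pieri: "\<And>k. series_mult (B mu) (one_row t k) =
      (\<lambda>\<alpha>. \<Sum>lam | hstrip lam mu \<and> psize lam = psize mu + k. w lam * B lam \<alpha>)"
  defines "f \<equiv> THE f. symmetric_function f \<and>
     (\<forall>nu. macdonald_inner 0 t f (B nu) = macdonald_inner 0 t (A lam) (series_mult (B mu) (B nu)))"
  shows "f (replicate_mset k 0) = (if hstrip lam mu \<and> psize lam = psize mu + k then w lam else 0)"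
proof -
  let ?P = "\<lambda>f. symmetric_function f \<and>
     (\<forall>nu. macdonald_inner 0 t f (B nu) = macdonald_inner 0 t (A lam) (series_mult (B mu) (B nu)))"
  define c where "c nu = macdonald_inner 0 t (A lam) (series_mult (B mu) (B nu))" for nu
  let ?S = "{nu. psize nu \<le> psize lam}"
  \<comment> \<open>By duality this is the expansion any solution must have. It is finite because
    degrees force \<open>c nu = 0\<close> unless \<open>psize nu \<le> psize lam\<close>.\<close>
  define f0 where "f0 = (\<lambda>\<alpha>. \<Sum>nu\<in>?S. c nu * A nu \<alpha>)"
  note symm = symmetric_function_mult[OF B(1) B(1)]
  have c0: "c nu = 0" if "nu \<notin> ?S" for nu
    unfolding c_def
    by (rule inner_homogeneous[OF A(1) symm _ A(2) mult_hall_homogeneous[OF B(2) B(2)]]) (use that in auto)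
  have P0: "?P f0"
  proof (intro conjI allI)
    show "symmetric_function f0" unfolding f0_def by (rule symmetric_function_sum[OF finite_psize_le A(1)])
    fix nu
    have "macdonald_inner 0 t f0 (B nu) = (\<Sum>ka\<in>?S. c ka * macdonald_inner 0 t (A ka) (B nu))"
      unfolding f0_def by (rule inner_sum_left[OF B(1) finite_psize_le A(1)])
    also have "\<dots> = (if nu \<in> ?S then c nu else 0)"
      using finite_psize_le by (simp add: dual if_distrib cong: if_cong)
    finally show "macdonald_inner 0 t f0 (B nu) = macdonald_inner 0 t (A lam) (series_mult (B mu) (B nu))"
      using c0 by (auto simp: c_def)
  qed
  have uniq: "g = h" if "?P g" "?P h" for g h
  proof (rule symmetric_eqI)
    fix nu
    obtain d where d: "hall_P t nu = (\<lambda>\<alpha>. \<Sum>_\<in>{()}. d * B nu \<alpha>)" using span by blast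
    have "macdonald_inner 0 t k (hall_P t nu) = d * macdonald_inner 0 t k (B nu)" if "symmetric_function k" for k
      unfolding d by (subst inner_sum_right[OF that _ B(1)]) simp_all
    then show "macdonald_inner 0 t g (hall_P t nu) = macdonald_inner 0 t h (hall_P t nu)" using that by simp
  qed (use that in auto)
  have "f = f0"
    unfolding f_def
  proof (rule the_equality)
    show "?P f0" by (rule P0)
    fix g assume "?P g"
    then show "g = f0" using P0 by (rule uniq)
  qed
  then have "?P f" using P0 by simp
  then have symf: "symmetric_function f" and fB: "\<And>nu. macdonald_inner 0 t f (B nu) = c nu"
    by (auto simp: c_def)
  define \<beta> where "\<beta> = replicate_mset k (0::nat)"
  have row: "row_product t 1 \<beta> = one_row t k"
    by (simp add: \<beta>_def series_mult_commute[of _ series_one] series_mult_one)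
  \<comment> \<open>A one-row function is a row product in a single variable, hence a combination of
    the \<open>B nu\<close>. This allows the defining pairings, known only against the
    \<open>B nu\<close>, to be evaluated at it.\<close>
  have "\<exists>d. one_row t k = (\<lambda>\<alpha>. \<Sum>nu | psize nu = k. d nu * B nu \<alpha>)"
  proof -
    have sz: "(\<Sum>i<1. count \<beta> i) = k" by (simp add: \<beta>_def)
    obtain d where d: "\<And>nu. hall_P t nu = (\<lambda>\<alpha>. \<Sum>_\<in>{()}. d nu * B nu \<alpha>)" using span by metis
    have "one_row t k = (\<lambda>\<alpha>. \<Sum>nu | psize nu = k. (mult_coeff t nu * chain_P t 1 \<beta> nu * d nu) * B nu \<alpha>)"
      unfolding row[symmetric] row_product_expansion[of t 1 \<beta>] sz by (rule ext) (simp add: d mult.assoc)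
    then show ?thesis by (intro exI[of _ "\<lambda>nu. mult_coeff t nu * chain_P t 1 \<beta> nu * d nu"])
  qed
  then obtain d where d: "one_row t k = (\<lambda>\<alpha>. \<Sum>nu | psize nu = k. d nu * B nu \<alpha>)" by blast
  have "f \<beta> = macdonald_inner 0 t f (one_row t k)"
    unfolding row[symmetric] by (rule inner_row_product[OF t symf, symmetric]) (auto simp: \<beta>_def)
  also have "\<dots> = (\<Sum>nu | psize nu = k. d nu * c nu)"
    unfolding d inner_sum_right[OF symf finite_psize_eq B(1)] fB ..
  also have "\<dots> = macdonald_inner 0 t (A lam) (series_mult (B mu) (one_row t k))"
    unfolding d series_mult_sum_right inner_sum_right[OF A(1) finite_psize_eq symm] c_def ..
  also have "\<dots> = (\<Sum>nu | hstrip nu mu \<and> psize nu = psize mu + k. w nu * macdonald_inner 0 t (A lam) (B nu))"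
    unfolding pieri
    by (rule inner_sum_right[OF A(1) _ B(1)]) (rule finite_subset[OF _ finite_psize_eq[of "psize mu + k"]], auto)
  also have "\<dots> = (if hstrip lam mu \<and> psize lam = psize mu + k then w lam else 0)"
  proof -
    have "finite {nu. hstrip nu mu \<and> psize nu = psize mu + k}"
      by (rule finite_subset[OF _ finite_psize_eq[of "psize mu + k"]]) auto
    then show ?thesis by (simp add: dual if_distrib cong: if_cong)
  qed
  finally show ?thesis by (simp add: \<beta>_def)
qed

lemma hall_Q_homogeneous: "hall_Q lam \<alpha> \<noteq> 0 \<Longrightarrow> size \<alpha> = psize lam"
  using hall_P_homogeneous by (auto simp: hall_Q_def)

lemma eval_single_strip:
  assumes "\<And>k. f (replicate_mset k 0) = (if hstrip lam mu \<and> psize lam = psize mu + k then w else 0)"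
    "\<not> hstrip lam mu \<Longrightarrow> w = 0"
  shows "eval_single f a = w * a ^ (psize lam - psize mu)"
proof -
  have "(\<Sum>k | f (replicate_mset k 0) \<noteq> 0. f (replicate_mset k 0) * a ^ k) =
      (\<Sum>k\<in>{psize lam - psize mu}. f (replicate_mset k 0) * a ^ k)"
    by (rule sum.mono_neutral_left) (use assms in \<open>auto split: if_splits\<close>)
  also have "\<dots> = w * a ^ (psize lam - psize mu)"
    using assms(2) hstrip_psize_mono[of lam mu] by (auto simp: assms(1))
  finally show ?thesis by (simp add: eval_single_def)
qed

text \<open>Together with its dual below, the passage from the abstractly defined skew functions to
  explicit weights.\<close>

theorem eval_skew_P: "eval_single (skew_P 0 t lam mu) a = weight_P t a lam mu"
  unfolding weight_P_def
proof (rule eval_single_strip)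
  fix k
  show "skew_P 0 t lam mu (replicate_mset k 0) = (if hstrip lam mu \<and> psize lam = psize mu + k then psi t lam mu else 0)"
    unfolding skew_P_def macdonald_P_eq macdonald_Q_eq
  proof (rule skew_unique_existence[OF symmetric_function_hall_P[OF t] hall_P_homogeneous
        symmetric_function_hall_Q hall_Q_homogeneous hall_P_Q_dual _ pieri_hall_Q])
    fix lam
    show "\<exists>c. hall_P t lam = (\<lambda>\<alpha>. \<Sum>_\<in>{()}. c * hall_Q lam \<alpha>)"
      using mult_coeff_pos[OF t, of lam] by (intro exI[of _ "1 / mult_coeff t lam"]) (simp add: hall_Q_def)
  qed
qed (simp add: psi_def)

theorem eval_skew_Q: "eval_single (skew_Q 0 t lam mu) a = weight_Q t a lam mu"
  unfolding weight_Q_def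
proof (rule eval_single_strip)
  fix k
  show "skew_Q 0 t lam mu (replicate_mset k 0) = (if hstrip lam mu \<and> psize lam = psize mu + k then phi t lam mu else 0)"
    unfolding skew_Q_def macdonald_P_eq macdonald_Q_eq
  proof (rule skew_unique_existence[OF symmetric_function_hall_Q hall_Q_homogeneous
        symmetric_function_hall_P[OF t] hall_P_homogeneous _ _ pieri])
    fix lam mu
    show "macdonald_inner 0 t (hall_Q lam) (hall_P t mu) = (if lam = mu then 1 else 0)"
      using hall_P_Q_dual[of mu lam] by (auto simp: inner_commute[of 0 t "hall_Q lam"])
    show "\<exists>c. hall_P t lam = (\<lambda>\<alpha>. \<Sum>_\<in>{()}. c * hall_P t lam \<alpha>)"
      by (intro exI[of _ 1]) simp
  qed
qed (simp add: phi_def)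

end

section \<open>Exchange relations\<close>

text \<open>All weights are nonnegative, so sums are taken in the extended nonnegative reals, where
  they may be interchanged freely; finiteness is settled separately.\<close>

abbreviation esum :: "('a \<Rightarrow> ennreal) \<Rightarrow> ennreal" where
  "esum f \<equiv> (\<integral>\<^sup>+x. f x \<partial>count_space UNIV)"

lemma esum_swap: "esum (\<lambda>x. esum (\<lambda>y. f x y)) = esum (\<lambda>y. esum (\<lambda>x. f x y))"
proof -
  have "esum (\<lambda>x. esum (\<lambda>y. f x y)) = esum (\<lambda>(x, y). f x y)"
    using nn_integral_fst_count_space[of "\<lambda>(x, y). f x y"] by simp
  also have "\<dots> = esum (\<lambda>y. esum (\<lambda>x. f x y))"
    using nn_integral_snd_count_space[of "\<lambda>(x, y). f x y"] by simp
  finally show ?thesis .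
qed

lemma esum_cmult: "esum (\<lambda>x. c * f x) = c * esum f"
  by (rule nn_integral_cmult) simp

lemma esum_multc: "esum (\<lambda>x. f x * c) = esum f * c"
  by (rule nn_integral_multc) simp

lemma esum_sum: "esum (\<lambda>x. \<Sum>i\<in>I. f i x) = (\<Sum>i\<in>I. esum (f i))"
  by (rule nn_integral_sum) simp

lemma esum_single: "esum (\<lambda>x. f x * of_bool (x = a)) = f a"
  by (subst nn_integral_count_space'[of "{a}"]) auto

lemma esum_single': "esum (\<lambda>x. of_bool (a = x) * f x) = f a"
  by (subst nn_integral_count_space'[of "{a}"]) auto

lemma esum_has_sum:
  fixes f :: "'a \<Rightarrow> real"
  assumes "(f has_sum S) A" "\<And>x. x \<in> A \<Longrightarrow> 0 \<le> f x"
  shows "esum (\<lambda>x. ennreal (f x) * of_bool (x \<in> A)) = ennreal S"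
proof -
  have "f summable_on A" using assms(1) by (auto simp: summable_on_def)
  then have "(\<lambda>x. norm (f x)) summable_on A"
    by (rule summable_on_cong[THEN iffD1, rotated]) (use assms(2) in simp)
  then have abs: "Infinite_Set_Sum.abs_summable_on f A"
    by (rule abs_summable_equivalent[THEN iffD1])
  have "esum (\<lambda>x. ennreal (f x) * of_bool (x \<in> A)) = (\<integral>\<^sup>+x. ennreal (f x) \<partial>count_space A)"
    by (subst (2) nn_integral_count_space_indicator) (auto intro!: nn_integral_cong simp: indicator_def)
  also have "\<dots> = ennreal (infsetsum f A)"
    by (rule nn_integral_conv_infsetsum[OF abs assms(2)])
  also have "infsetsum f A = S"
    using infsetsum_infsum[OF abs] infsumI[OF assms(1)] by simp
  finally show ?thesis .
qed

definition bit_P :: "real \<Rightarrow> real \<Rightarrow> bool \<Rightarrow> partition \<Rightarrow> partition \<Rightarrow> ennreal" where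
  "bit_P t a e lam mu = ennreal (weight_P t a lam mu) * of_bool (jumps lam mu = e)"

text \<open>On the horizontal edges an arrow stands for the absence of a jump.\<close>

definition bit_Q :: "real \<Rightarrow> real \<Rightarrow> bool \<Rightarrow> partition \<Rightarrow> partition \<Rightarrow> ennreal" where
  "bit_Q t b r lam mu = ennreal (weight_Q t b lam mu) * of_bool (jumps lam mu = (\<not> r))"

lemma weight_nonneg:
  assumes "0 \<le> t" "t < 1" "0 \<le> a"
  shows "0 \<le> weight_P t a lam mu" "0 \<le> weight_Q t a lam mu"
  using assms by (simp_all add: weight_P_def weight_Q_def psi_nonneg phi_nonneg)

lemma weight_eq_0: "\<not> hstrip lam mu \<Longrightarrow> weight_P t a lam mu = 0" "\<not> hstrip lam mu \<Longrightarrow> weight_Q t a lam mu = 0"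
  by (simp_all add: weight_P_def weight_Q_def psi_def phi_def)

definition cell_factor :: "real \<Rightarrow> real \<Rightarrow> real" where
  "cell_factor t x = (1 - t * x) / (1 - x)"

lemma vertex_weight_nonneg:
  assumes "0 \<le> t" "t < 1" "0 \<le> x" "x < 1"
  shows "0 \<le> vertex_weight t x bi li to ro"
proof -
  let ?p = "(1 - x) / (1 - t * x)"
  have "t * x < 1" using assms by (metis less_1_mult mult_le_one mult_less_cancel_right2 not_le order.strict_trans1 less_eq_real_def mult_right_le_one_le)
  moreover have "t * x \<le> x" using assms by (simp add: mult_left_le_one_le)
  ultimately have "0 \<le> ?p" "?p \<le> 1" using assms by (simp_all add: field_simps)
  moreover from this have "0 \<le> t * ?p" "t * ?p \<le> 1"
    using assms by (auto intro: mult_nonneg_nonneg mult_le_one simp del: times_divide_eq_right)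
  ultimately show ?thesis
    by (cases bi; cases li; cases to; cases ro) (simp_all add: vertex_weight_def Let_def)
qed

lemma UNIV_bool_sum: "(\<Sum>x\<in>(UNIV :: bool set). f x) = f False + (f True :: 'a :: comm_monoid_add)"
  by (simp add: UNIV_bool add.commute)

lemma vertex_weight_stochastic: "(\<Sum>to\<in>UNIV. \<Sum>ro\<in>UNIV. vertex_weight t x bi li to ro) = 1"
  by (cases bi; cases li) (simp_all add: UNIV_bool_sum vertex_weight_def Let_def)

text \<open>The refined skew Cauchy identity in arrow language. A horizontal arrow marks the absence
  of a jump, so equal jump bits mean a single arrow at the vertex and unequal ones mean none or two.
  With prefactor \<open>\<Phi>\<close> and \<open>p = (1 - x) / (1 - t * x)\<close> one has
  \<open>\<Phi> * p = 1\<close>, which turns the coefficients of the lower sums into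
  \<open>\<Phi>\<close> times vertex weights.\<close>

lemma cell_exchange:
  assumes t: "0 \<le> t" "t < 1" and ab: "0 \<le> a" "0 \<le> b" "a * b < 1"
  shows "esum (\<lambda>lam. bit_P t a e lam mu * bit_Q t b r lam nu) =
    ennreal (cell_factor t (a * b)) * (\<Sum>e'\<in>UNIV. \<Sum>r'\<in>UNIV. ennreal (vertex_weight t (a * b) e' r' e r) *
      esum (\<lambda>kap. bit_P t a e' nu kap * bit_Q t b r' mu kap))"
proof -
  define x where "x = a * b"
  define w where "w = (1 - t) / (1 - x)"
  define \<Phi> where "\<Phi> = (1 - t * x) / (1 - x)"
  have x: "0 \<le> x" "x < 1" using ab by (simp_all add: x_def)
  have "\<bar>a * b\<bar> < 1" using ab by simp
  from refined_skew_cauchy[OF this, of t nu mu] obtain R where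
    R: "\<And>s r. ((\<lambda>kap. weight_P t a nu kap * weight_Q t b mu kap) has_sum R s r) (strips_below s r mu nu)" and
    L: "\<And>s r. ((\<lambda>lam. weight_P t a lam mu * weight_Q t b lam nu) has_sum
       (if s \<noteq> r then \<Phi> * R s r
        else if s then x * w * R False False + t * R True True
        else R False False + w * R True True)) (strips_above s r mu nu)"
    unfolding w_def \<Phi>_def x_def by blast
  have Rpos: "0 \<le> R s r" for s r
    by (rule has_sum_nonneg[OF R]) (use t ab in \<open>simp add: weight_nonneg\<close>)
  have low: "esum (\<lambda>kap. bit_P t a e' nu kap * bit_Q t b r' mu kap) = ennreal (R e' (\<not> r'))" for e' r'
  proof -
    have "bit_P t a e' nu kap * bit_Q t b r' mu kap = ennreal (weight_P t a nu kap * weight_Q t b mu kap) * of_bool (kap \<in> strips_below e' (\<not> r') mu nu)" for kap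
      using weight_nonneg[of t a nu kap] weight_nonneg[of t b mu kap] t ab
        weight_eq_0(1)[of nu kap t a] weight_eq_0(2)[of mu kap t b]
      by (auto simp: bit_P_def bit_Q_def strips_below_def ennreal_mult'')
    then show ?thesis using esum_has_sum[OF R, of e' "\<not> r'"] t ab by (simp add: weight_nonneg)
  qed
  have upp: "esum (\<lambda>lam. bit_P t a e lam mu * bit_Q t b r lam nu) = ennreal
       (if e = r then \<Phi> * R e (\<not> r)
        else if e then x * w * R False False + t * R True True
        else R False False + w * R True True)"
  proof -
    have "bit_P t a e lam mu * bit_Q t b r lam nu = ennreal (weight_P t a lam mu * weight_Q t b lam nu) * of_bool (lam \<in> strips_above e (\<not> r) mu nu)" for lam
      using weight_nonneg[of t a lam mu] weight_nonneg[of t b lam nu] t ab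
        weight_eq_0(1)[of lam mu t a] weight_eq_0(2)[of lam nu t b]
      by (auto simp: bit_P_def bit_Q_def strips_above_def ennreal_mult'')
    then show ?thesis using esum_has_sum[OF L, of e "\<not> r"] t ab by (simp add: weight_nonneg)
  qed
  have tx: "1 - t * x > 0" using t x by (metis diff_gt_0_iff_gt less_1_mult mult_le_one mult_less_cancel_right2 not_le order.strict_trans1 less_eq_real_def mult_right_le_one_le)
  have Phi_pos: "0 \<le> \<Phi>" using tx x by (simp add: \<Phi>_def)
  have real: "(if e = r then \<Phi> * R e (\<not> r)
        else if e then x * w * R False False + t * R True True
        else R False False + w * R True True) =
      \<Phi> * (\<Sum>e'\<in>UNIV. \<Sum>r'\<in>UNIV. vertex_weight t x e' r' e r * R e' (\<not> r'))"
  proof -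
    have "A / B * (B / A) = 1" if "A \<noteq> 0" "B \<noteq> 0" for A B :: real using that by simp
    from this[of "1 - t * x" "1 - x"] have p: "\<Phi> * ((1 - x) / (1 - t * x)) = 1"
      using tx x unfolding \<Phi>_def by linarith
    have w: "x * w = \<Phi> - 1" "w = \<Phi> - t" using x by (simp_all add: w_def \<Phi>_def field_simps)
    define p where "p = (1 - x) / (1 - t * x)"
    have p1: "\<Phi> * p = 1" unfolding p_def by (rule p)
    show ?thesis
    proof (cases "e = r")
      case True
      then show ?thesis by (cases r) (simp_all add: UNIV_bool_sum vertex_weight_def Let_def)
    next
      case False
      have "x * w * R False False + t * R True True = \<Phi> * ((1 - p) * R False False + t * p * R True True)"
        "R False False + w * R True True = \<Phi> * (p * R False False + (1 - t * p) * R True True)"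
        using p1 w by algebra+
      then show ?thesis
        unfolding UNIV_bool_sum vertex_weight_def Let_def p_def[symmetric]
        using False by (cases e; cases r) simp_all
    qed
  qed
  have "ennreal (\<Phi> * (\<Sum>e'\<in>UNIV. \<Sum>r'\<in>UNIV. vertex_weight t x e' r' e r * R e' (\<not> r'))) =
     ennreal \<Phi> * (\<Sum>e'\<in>UNIV. \<Sum>r'\<in>UNIV. ennreal (vertex_weight t x e' r' e r) * ennreal (R e' (\<not> r')))"
    using Phi_pos Rpos vertex_weight_nonneg[OF t x]
    by (simp add: ennreal_mult sum_ennreal[symmetric] sum_nonneg)
  then show ?thesis
    unfolding upp real low by (simp add: x_def \<Phi>_def cell_factor_def)
qed

text \<open>The arguments \<open>s'\<close>, \<open>l\<close>, \<open>s\<close>, \<open>r\<close>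
  are the bottom, left, top and right bits of one row; the inner horizontal edges are summed out
  from left to right.\<close>

fun row_kernel :: "real \<Rightarrow> real \<Rightarrow> real list \<Rightarrow> bool list \<Rightarrow> bool \<Rightarrow> bool list \<Rightarrow> bool \<Rightarrow> real" where
  "row_kernel t b [] [] l [] r = of_bool (l = r)"
| "row_kernel t b (a # as) (e' # s') l (e # s) r =
    (\<Sum>m\<in>UNIV. vertex_weight t (a * b) e' l e m * row_kernel t b as s' m s r)"
| "row_kernel t b _ _ l _ r = 0"

definition bits :: "nat \<Rightarrow> bool list set" where
  "bits n = {s. length s = n}"

lemma finite_bits [simp]: "finite (bits n)"
  using finite_lists_length_eq[of "UNIV :: bool set" n] by (simp add: bits_def)

lemma bits_0 [simp]: "bits 0 = {[]}"
  by (auto simp: bits_def)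

lemma sum_bits_Suc:
  fixes f :: "bool list \<Rightarrow> 'a :: comm_monoid_add"
  shows "(\<Sum>s\<in>bits (Suc n). f s) = (\<Sum>e\<in>UNIV. \<Sum>s\<in>bits n. f (e # s))"
proof -
  have "bits (Suc n) = (\<lambda>(e, s). e # s) ` (UNIV \<times> bits n)"
    by (auto simp: bits_def length_Suc_conv image_iff)
  moreover have "inj_on (\<lambda>(e, s). e # s) (UNIV \<times> bits n)" by (auto simp: inj_on_def)
  ultimately show ?thesis
    by (simp add: sum.reindex sum.cartesian_product case_prod_unfold)
qed

fun rect_kernel :: "real \<Rightarrow> real list \<Rightarrow> real list \<Rightarrow> bool list \<Rightarrow> bool list \<Rightarrow> bool list \<Rightarrow> bool list \<Rightarrow> real" where
  "rect_kernel t as [] bo [] to [] = of_bool (bo = to)"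
| "rect_kernel t as (b # bs) bo (l # ls) to (r # rs) =
    (\<Sum>m\<in>bits (length as). row_kernel t b as bo l m r * rect_kernel t as bs m ls to rs)"
| "rect_kernel t as _ bo _ to _ = 0"

lemma row_kernel_nonneg:
  assumes "0 \<le> t" "t < 1" "\<forall>a\<in>set as. 0 \<le> a \<and> a < 1" "0 \<le> b" "b < 1"
  shows "0 \<le> row_kernel t b as s' l s r"
  using assms
proof (induction t b as s' l s r rule: row_kernel.induct)
  case (2 t b a as e' s' l e s r)
  have "0 \<le> a * b" "a * b < 1"
    using 2 mult_strict_mono[of a 1 b 1] by auto
  then show ?case using 2 by (auto intro!: sum_nonneg mult_nonneg_nonneg vertex_weight_nonneg)
qed auto

lemma rect_kernel_nonneg:
  assumes "0 \<le> t" "t < 1" "\<forall>a\<in>set as. 0 \<le> a \<and> a < 1" "\<forall>b\<in>set bs. 0 \<le> b \<and> b < 1"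
  shows "0 \<le> rect_kernel t as bs bo ls to rs"
  using assms
  by (induction t as bs bo ls to rs rule: rect_kernel.induct)
     (auto intro!: sum_nonneg mult_nonneg_nonneg row_kernel_nonneg)

lemma row_kernel_stochastic:
  "length s' = length as \<Longrightarrow> (\<Sum>s\<in>bits (length as). \<Sum>r\<in>UNIV. row_kernel t b as s' l s r) = 1"
proof (induction as arbitrary: s' l)
  case Nil
  then show ?case by (simp add: UNIV_bool_sum)
next
  case (Cons a as)
  then obtain e' s'' where s': "s' = e' # s''" "length s'' = length as" by (cases s') auto
  have "(\<Sum>s\<in>bits (length (a # as)). \<Sum>r\<in>UNIV. row_kernel t b (a # as) s' l s r) =
      (\<Sum>e\<in>UNIV. \<Sum>m\<in>UNIV. vertex_weight t (a * b) e' l e m * (\<Sum>s\<in>bits (length as). \<Sum>r\<in>UNIV. row_kernel t b as s'' m s r))"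
    by (simp add: s' sum_bits_Suc UNIV_bool_sum sum.distrib sum_distrib_left distrib_left)
  then show ?case using Cons.IH[OF s'(2)] vertex_weight_stochastic by simp
qed

lemma rect_kernel_stochastic:
  "length bo = length as \<Longrightarrow> length ls = length bs \<Longrightarrow>
    (\<Sum>to\<in>bits (length as). \<Sum>rs\<in>bits (length bs). rect_kernel t as bs bo ls to rs) = 1"
proof (induction bs arbitrary: bo ls)
  case Nil
  then have "bo \<in> bits (length as)" by (simp add: bits_def)
  then show ?case using Nil by (simp add: of_bool_def)
next
  case (Cons b bs)
  then obtain l ls' where ls: "ls = l # ls'" "length ls' = length bs" by (cases ls) auto
  let ?M = "bits (length as)"
  have "(\<Sum>to\<in>?M. \<Sum>rs\<in>bits (length (b # bs)). rect_kernel t as (b # bs) bo ls to rs) =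
      (\<Sum>to\<in>?M. \<Sum>r\<in>UNIV. \<Sum>rs\<in>bits (length bs). \<Sum>m\<in>?M. row_kernel t b as bo l m r * rect_kernel t as bs m ls' to rs)"
    by (simp add: ls sum_bits_Suc)
  also have "\<dots> = (\<Sum>m\<in>?M. \<Sum>r\<in>UNIV. row_kernel t b as bo l m r * (\<Sum>to\<in>?M. \<Sum>rs\<in>bits (length bs). rect_kernel t as bs m ls' to rs))"
  proof -
    have "(\<Sum>to\<in>?M. \<Sum>rs\<in>bits (length bs). \<Sum>m\<in>?M. f m * g m to rs) = (\<Sum>m\<in>?M. f m * (\<Sum>to\<in>?M. \<Sum>rs\<in>bits (length bs). g m to rs))"
      for f :: "bool list \<Rightarrow> real" and g
    proof -
      have "(\<Sum>to\<in>?M. \<Sum>rs\<in>bits (length bs). \<Sum>m\<in>?M. f m * g m to rs) = (\<Sum>to\<in>?M. \<Sum>m\<in>?M. \<Sum>rs\<in>bits (length bs). f m * g m to rs)"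
        by (intro sum.cong refl sum.swap)
      also have "\<dots> = (\<Sum>m\<in>?M. \<Sum>to\<in>?M. \<Sum>rs\<in>bits (length bs). f m * g m to rs)" by (rule sum.swap)
      finally show ?thesis by (simp add: sum_distrib_left)
    qed
    then show ?thesis by (simp add: UNIV_bool_sum sum.distrib)
  qed
  also have "\<dots> = (\<Sum>m\<in>?M. \<Sum>r\<in>UNIV. row_kernel t b as bo l m r)"
    using Cons.IH[OF _ ls(2)] by (intro sum.cong refl) (simp add: bits_def)
  finally show ?case using row_kernel_stochastic[OF Cons.prems(1)] by simp
qed

fun chain_sum :: "(real \<Rightarrow> bool \<Rightarrow> partition \<Rightarrow> partition \<Rightarrow> ennreal) \<Rightarrow> real list \<Rightarrow> bool list \<Rightarrow> partition \<Rightarrow> partition \<Rightarrow> ennreal" where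
  "chain_sum B [] [] mu lam = of_bool (mu = lam)"
| "chain_sum B (a # as) (e # s) mu lam = esum (\<lambda>rho. B a e rho mu * chain_sum B as s rho lam)"
| "chain_sum B _ _ mu lam = 0"

definition row_factor :: "real \<Rightarrow> real list \<Rightarrow> real \<Rightarrow> real" where
  "row_factor t as b = (\<Prod>a\<leftarrow>as. cell_factor t (a * b))"

definition rect_factor :: "real \<Rightarrow> real list \<Rightarrow> real list \<Rightarrow> real" where
  "rect_factor t as bs = (\<Prod>b\<leftarrow>bs. row_factor t as b)"

lemma cell_factor_ge_1: "t < 1 \<Longrightarrow> 0 \<le> x \<Longrightarrow> x < 1 \<Longrightarrow> 1 \<le> cell_factor t x"
  using mult_right_mono[of t 1 x] by (simp add: cell_factor_def)

lemma row_factor_ge_1: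
  "t < 1 \<Longrightarrow> \<forall>a\<in>set as. 0 \<le> a \<and> a < 1 \<Longrightarrow> 0 \<le> b \<Longrightarrow> b < 1 \<Longrightarrow> 1 \<le> row_factor t as b"
proof (induction as)
  case (Cons a as)
  have "1 \<le> cell_factor t (a * b)"
    using Cons.prems mult_strict_mono[of a 1 b 1] by (intro cell_factor_ge_1) auto
  then have "1 * 1 \<le> cell_factor t (a * b) * row_factor t as b" using Cons by (intro mult_mono) auto
  then show ?case by (simp add: row_factor_def)
qed (simp add: row_factor_def)

lemma rect_factor_ge_1:
  "t < 1 \<Longrightarrow> \<forall>a\<in>set as. 0 \<le> a \<and> a < 1 \<Longrightarrow> \<forall>b\<in>set bs. 0 \<le> b \<and> b < 1 \<Longrightarrow> 1 \<le> rect_factor t as bs"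
proof (induction bs)
  case (Cons b bs)
  have "1 \<le> row_factor t as b" using Cons.prems by (intro row_factor_ge_1) auto
  then have "1 * 1 \<le> row_factor t as b * rect_factor t as bs" using Cons by (intro mult_mono) auto
  then show ?case by (simp add: rect_factor_def)
qed (simp add: rect_factor_def)

text \<open>One \<open>Q\<close>-step crosses a whole chain of \<open>P\<close>-steps. On the
  left-hand side paths from \<open>mu\<close> and \<open>nu\<close> meet at an upper corner
  \<open>lam\<close>; on the right-hand side they leave a lower corner \<open>kap\<close>. The
  induction hypothesis crosses the later \<open>P\<close>-steps first, so the crossing proceeds from
  the right end of the row to its left end.\<close>

lemma row_exchange:
  assumes t: "0 \<le> t" "t < 1" and as: "\<forall>a\<in>set as. 0 \<le> a \<and> a < 1" and b: "0 \<le> b" "b < 1"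
    and "length s = length as"
  shows "esum (\<lambda>lam. chain_sum (bit_P t) as s mu lam * bit_Q t b r lam nu) =
    ennreal (row_factor t as b) * (\<Sum>s'\<in>bits (length as). \<Sum>l\<in>UNIV. ennreal (row_kernel t b as s' l s r) *
      esum (\<lambda>kap. chain_sum (bit_P t) as s' kap nu * bit_Q t b l mu kap))"
  using as assms(6)
proof (induction as arbitrary: s mu)
  case Nil
  have "esum (\<lambda>lam. of_bool (mu = lam) * bit_Q t b r lam nu) = bit_Q t b r mu nu" by (rule esum_single')
  moreover have "esum (\<lambda>kap. of_bool (kap = nu) * bit_Q t b l mu kap) = bit_Q t b l mu nu" for l
    using esum_single[of "bit_Q t b l mu" nu] by (simp add: mult.commute)
  ultimately show ?case using Nil by (cases r) (simp_all add: row_factor_def UNIV_bool_sum)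
next
  case (Cons a as)
  then obtain e s2 where s: "s = e # s2" "length s2 = length as" by (cases s) auto
  let ?P = "chain_sum (bit_P t)" and ?n = "length as" and ?Q = "bit_Q t b"
  let ?F = "ennreal (row_factor t as b)" and ?G = "ennreal (cell_factor t (a * b))"
  have ab: "0 \<le> a" "0 \<le> b" "a * b < 1" using Cons.prems b mult_strict_mono[of a 1 b 1] by auto
  have IH: "esum (\<lambda>lam. ?P as s2 rho lam * ?Q r lam nu) =
    ?F * (\<Sum>s'\<in>bits ?n. \<Sum>l\<in>UNIV. ennreal (row_kernel t b as s' l s2 r) * esum (\<lambda>kap. ?P as s' kap nu * ?Q l rho kap))" for rho
    by (rule Cons.IH) (use Cons.prems s in auto)
  have "esum (\<lambda>lam. ?P (a # as) s mu lam * ?Q r lam nu) =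
      esum (\<lambda>lam. esum (\<lambda>rho. bit_P t a e rho mu * (?P as s2 rho lam * ?Q r lam nu)))"
    by (simp add: s esum_multc[symmetric] mult.assoc)
  also have "\<dots> = esum (\<lambda>rho. bit_P t a e rho mu * esum (\<lambda>lam. ?P as s2 rho lam * ?Q r lam nu))"
    by (subst esum_swap) (simp add: esum_cmult)
  also have "\<dots> = esum (\<lambda>rho. \<Sum>s'\<in>bits ?n. \<Sum>m\<in>UNIV. ?F * ennreal (row_kernel t b as s' m s2 r) *
      esum (\<lambda>kap. ?P as s' kap nu * (bit_P t a e rho mu * ?Q m rho kap)))"
    unfolding IH by (simp add: sum_distrib_left esum_cmult[symmetric] mult_ac)
  also have "\<dots> = (\<Sum>s'\<in>bits ?n. \<Sum>m\<in>UNIV. ?F * ennreal (row_kernel t b as s' m s2 r) *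
      esum (\<lambda>kap. ?P as s' kap nu * esum (\<lambda>rho. bit_P t a e rho mu * ?Q m rho kap)))"
    by (simp only: esum_sum esum_cmult) (subst esum_swap, simp only: esum_cmult)
  also have "\<dots> = (\<Sum>s'\<in>bits ?n. \<Sum>m\<in>UNIV. \<Sum>e'\<in>UNIV. \<Sum>l\<in>UNIV. ?F * ?G * (ennreal (row_kernel t b as s' m s2 r) *
      ennreal (vertex_weight t (a * b) e' l e m)) *
      esum (\<lambda>kap. ?P as s' kap nu * esum (\<lambda>kap'. bit_P t a e' kap kap' * ?Q l mu kap')))"
  proof (intro sum.cong refl)
    fix s' m
    have "esum (\<lambda>kap. ?P as s' kap nu * esum (\<lambda>rho. bit_P t a e rho mu * ?Q m rho kap)) =
       esum (\<lambda>kap. \<Sum>e'\<in>UNIV. \<Sum>l\<in>UNIV. ?G * ennreal (vertex_weight t (a * b) e' l e m) *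
         (?P as s' kap nu * esum (\<lambda>kap'. bit_P t a e' kap kap' * ?Q l mu kap')))"
      unfolding cell_exchange[OF t ab] by (simp add: sum_distrib_left mult_ac)
    also have "\<dots> = (\<Sum>e'\<in>UNIV. \<Sum>l\<in>UNIV. ?G * ennreal (vertex_weight t (a * b) e' l e m) *
         esum (\<lambda>kap. ?P as s' kap nu * esum (\<lambda>kap'. bit_P t a e' kap kap' * ?Q l mu kap')))"
      by (simp only: esum_sum esum_cmult)
    finally show "?F * ennreal (row_kernel t b as s' m s2 r) *
        esum (\<lambda>kap. ?P as s' kap nu * esum (\<lambda>rho. bit_P t a e rho mu * ?Q m rho kap)) =
      (\<Sum>e'\<in>UNIV. \<Sum>l\<in>UNIV. ?F * ?G * (ennreal (row_kernel t b as s' m s2 r) * ennreal (vertex_weight t (a * b) e' l e m)) *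
      esum (\<lambda>kap. ?P as s' kap nu * esum (\<lambda>kap'. bit_P t a e' kap kap' * ?Q l mu kap')))"
      by (simp add: sum_distrib_left mult_ac)
  qed
  also have "\<dots> = (\<Sum>s'\<in>bits ?n. \<Sum>m\<in>UNIV. \<Sum>e'\<in>UNIV. \<Sum>l\<in>UNIV. ?F * ?G * (ennreal (row_kernel t b as s' m s2 r) *
      ennreal (vertex_weight t (a * b) e' l e m)) * esum (\<lambda>kap'. ?P (a # as) (e' # s') kap' nu * ?Q l mu kap'))"
  proof (intro sum.cong refl arg_cong[where f = "\<lambda>z. _ * z"])
    fix s' e' l
    have "esum (\<lambda>kap. ?P as s' kap nu * esum (\<lambda>kap'. bit_P t a e' kap kap' * ?Q l mu kap')) =
       esum (\<lambda>kap. esum (\<lambda>kap'. bit_P t a e' kap kap' * ?P as s' kap nu * ?Q l mu kap'))"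
      by (simp add: esum_cmult[symmetric] mult_ac)
    also have "\<dots> = esum (\<lambda>kap'. ?P (a # as) (e' # s') kap' nu * ?Q l mu kap')"
      by (subst esum_swap) (simp add: esum_multc)
    finally show "esum (\<lambda>kap. ?P as s' kap nu * esum (\<lambda>kap'. bit_P t a e' kap kap' * ?Q l mu kap')) =
      esum (\<lambda>kap'. ?P (a # as) (e' # s') kap' nu * ?Q l mu kap')" .
  qed
  also have "\<dots> = (\<Sum>e'\<in>UNIV. \<Sum>s'\<in>bits ?n. \<Sum>l\<in>UNIV. ?F * ?G * (\<Sum>m\<in>UNIV. ennreal (row_kernel t b as s' m s2 r) *
      ennreal (vertex_weight t (a * b) e' l e m)) * esum (\<lambda>kap'. ?P (a # as) (e' # s') kap' nu * ?Q l mu kap'))"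
    by (simp add: UNIV_bool_sum sum.distrib distrib_left distrib_right add_ac)
  also have "\<dots> = (\<Sum>e'\<in>UNIV. \<Sum>s'\<in>bits ?n. \<Sum>l\<in>UNIV. ?F * ?G * ennreal (row_kernel t b (a # as) (e' # s') l s r) *
      esum (\<lambda>kap'. ?P (a # as) (e' # s') kap' nu * ?Q l mu kap'))"
  proof -
    have "(\<Sum>m\<in>UNIV. ennreal (row_kernel t b as s' m s2 r) * ennreal (vertex_weight t (a * b) e' l e m)) =
        ennreal (row_kernel t b (a # as) (e' # s') l s r)" for s' e' l
    proof -
      have nn: "0 \<le> vertex_weight t (a * b) e' l e m" "0 \<le> row_kernel t b as s' m s2 r" for m
        using vertex_weight_nonneg[OF t _ ab(3)] ab row_kernel_nonneg[OF t _ b, of as] Cons.prems by auto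
      then show ?thesis by (simp add: s UNIV_bool_sum ennreal_mult[symmetric] ennreal_plus[symmetric] mult.commute del: ennreal_plus)
    qed
    then show ?thesis by simp
  qed
  finally show ?case
    using row_factor_ge_1[OF t(2) _ b, of as] cell_factor_ge_1[OF t(2) _ ab(3)] ab Cons.prems
    by (simp add: sum_bits_Suc sum_distrib_left row_factor_def ennreal_mult'' mult_ac del: row_kernel.simps chain_sum.simps)
qed

text \<open>Repeats the row exchange for every \<open>Q\<close>-step. The upper rows are crossed
  first, and the kernels compose over the vertical bits \<open>m\<close> between the bottom row and
  the rest.\<close>

lemma rect_exchange:
  assumes t: "0 \<le> t" "t < 1" and as: "\<forall>a\<in>set as. 0 \<le> a \<and> a < 1" and bs: "\<forall>b\<in>set bs. 0 \<le> b \<and> b < 1"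
    and "length s = length as" "length rs = length bs"
  shows "esum (\<lambda>lam. chain_sum (bit_P t) as s mu lam * chain_sum (bit_Q t) bs rs nu lam) =
    ennreal (rect_factor t as bs) * (\<Sum>s'\<in>bits (length as). \<Sum>ls\<in>bits (length bs). ennreal (rect_kernel t as bs s' ls s rs) *
      esum (\<lambda>kap. chain_sum (bit_P t) as s' kap nu * chain_sum (bit_Q t) bs ls kap mu))"
  using bs assms(6)
proof (induction bs arbitrary: rs nu)
  case Nil
  have "(\<Sum>s'\<in>bits (length as). ennreal (of_bool (s' = s)) * X s') = X s" for X
  proof -
    have "s \<in> bits (length as)" using assms(5) by (simp add: bits_def)
    moreover have "(\<Sum>s'\<in>bits (length as). ennreal (of_bool (s' = s)) * X s') = (\<Sum>s'\<in>bits (length as). if s' = s then X s' else 0)"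
      by (rule sum.cong) auto
    ultimately show ?thesis by simp
  qed
  moreover have "esum (\<lambda>lam. chain_sum (bit_P t) as s mu lam * of_bool (nu = lam)) = chain_sum (bit_P t) as s mu nu"
    using esum_single[of "chain_sum (bit_P t) as s mu" nu] by (simp add: eq_commute)
  moreover have "esum (\<lambda>kap. chain_sum (bit_P t) as s' kap nu * of_bool (kap = mu)) = chain_sum (bit_P t) as s' mu nu" for s'
    by (rule esum_single)
  ultimately show ?case using Nil by (simp add: rect_factor_def)
next
  case (Cons b bs)
  then obtain r rs2 where rs: "rs = r # rs2" "length rs2 = length bs" by (cases rs) auto
  let ?P = "chain_sum (bit_P t)" and ?Q = "chain_sum (bit_Q t)" and ?M = "bits (length as)" and ?N = "bits (length bs)"
  let ?F = "ennreal (rect_factor t as bs)" and ?G = "ennreal (row_factor t as b)"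
  have b: "0 \<le> b" "b < 1" using Cons.prems by auto
  have IH: "esum (\<lambda>lam. ?P as s mu lam * ?Q bs rs2 rho lam) =
    ?F * (\<Sum>m\<in>?M. \<Sum>ls\<in>?N. ennreal (rect_kernel t as bs m ls s rs2) * esum (\<lambda>kap. ?P as m kap rho * ?Q bs ls kap mu))" for rho
    by (rule Cons.IH) (use Cons.prems rs in auto)
  have "esum (\<lambda>lam. ?P as s mu lam * ?Q (b # bs) rs nu lam) =
      esum (\<lambda>lam. esum (\<lambda>rho. bit_Q t b r rho nu * (?P as s mu lam * ?Q bs rs2 rho lam)))"
    by (simp add: rs esum_cmult[symmetric] mult_ac)
  also have "\<dots> = esum (\<lambda>rho. bit_Q t b r rho nu * esum (\<lambda>lam. ?P as s mu lam * ?Q bs rs2 rho lam))"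
    by (subst esum_swap) (simp add: esum_cmult)
  also have "\<dots> = esum (\<lambda>rho. \<Sum>m\<in>?M. \<Sum>ls\<in>?N. ?F * ennreal (rect_kernel t as bs m ls s rs2) *
      esum (\<lambda>kap. ?Q bs ls kap mu * (?P as m kap rho * bit_Q t b r rho nu)))"
    unfolding IH by (simp add: sum_distrib_left esum_cmult[symmetric] mult_ac)
  also have "\<dots> = (\<Sum>m\<in>?M. \<Sum>ls\<in>?N. ?F * ennreal (rect_kernel t as bs m ls s rs2) *
      esum (\<lambda>kap. ?Q bs ls kap mu * esum (\<lambda>rho. ?P as m kap rho * bit_Q t b r rho nu)))"
    by (simp only: esum_sum esum_cmult) (subst esum_swap, simp only: esum_cmult)
  also have "\<dots> = (\<Sum>m\<in>?M. \<Sum>ls\<in>?N. \<Sum>s'\<in>?M. \<Sum>l\<in>UNIV. ?F * ?G * (ennreal (row_kernel t b as s' l m r) * ennreal (rect_kernel t as bs m ls s rs2)) *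
      esum (\<lambda>kap'. ?P as s' kap' nu * ?Q (b # bs) (l # ls) kap' mu))"
  proof (intro sum.cong refl)
    fix m ls assume "m \<in> ?M"
    then have m: "length m = length as" by (simp add: bits_def)
    have "esum (\<lambda>kap. ?Q bs ls kap mu * esum (\<lambda>rho. ?P as m kap rho * bit_Q t b r rho nu)) =
       esum (\<lambda>kap. \<Sum>s'\<in>?M. \<Sum>l\<in>UNIV. ?G * ennreal (row_kernel t b as s' l m r) *
         (?Q bs ls kap mu * esum (\<lambda>kap'. ?P as s' kap' nu * bit_Q t b l kap kap')))"
      unfolding row_exchange[OF t as b m] by (simp add: sum_distrib_left mult_ac)
    also have "\<dots> = (\<Sum>s'\<in>?M. \<Sum>l\<in>UNIV. ?G * ennreal (row_kernel t b as s' l m r) *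
         esum (\<lambda>kap. ?Q bs ls kap mu * esum (\<lambda>kap'. ?P as s' kap' nu * bit_Q t b l kap kap')))"
      by (simp only: esum_sum esum_cmult)
    also have "\<dots> = (\<Sum>s'\<in>?M. \<Sum>l\<in>UNIV. ?G * ennreal (row_kernel t b as s' l m r) *
         esum (\<lambda>kap'. ?P as s' kap' nu * ?Q (b # bs) (l # ls) kap' mu))"
    proof (intro sum.cong refl arg_cong[where f = "\<lambda>z. _ * z"])
      fix s' l
      have "esum (\<lambda>kap. ?Q bs ls kap mu * esum (\<lambda>kap'. ?P as s' kap' nu * bit_Q t b l kap kap')) =
         esum (\<lambda>kap. esum (\<lambda>kap'. ?P as s' kap' nu * (bit_Q t b l kap kap' * ?Q bs ls kap mu)))"
        by (simp add: esum_cmult[symmetric] mult_ac)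
      also have "\<dots> = esum (\<lambda>kap'. ?P as s' kap' nu * ?Q (b # bs) (l # ls) kap' mu)"
        by (subst esum_swap) (simp add: esum_cmult)
      finally show "esum (\<lambda>kap. ?Q bs ls kap mu * esum (\<lambda>kap'. ?P as s' kap' nu * bit_Q t b l kap kap')) =
        esum (\<lambda>kap'. ?P as s' kap' nu * ?Q (b # bs) (l # ls) kap' mu)" .
    qed
    finally show "?F * ennreal (rect_kernel t as bs m ls s rs2) *
        esum (\<lambda>kap. ?Q bs ls kap mu * esum (\<lambda>rho. ?P as m kap rho * bit_Q t b r rho nu)) =
      (\<Sum>s'\<in>?M. \<Sum>l\<in>UNIV. ?F * ?G * (ennreal (row_kernel t b as s' l m r) * ennreal (rect_kernel t as bs m ls s rs2)) *
        esum (\<lambda>kap'. ?P as s' kap' nu * ?Q (b # bs) (l # ls) kap' mu))"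
      by (simp add: sum_distrib_left mult_ac del: chain_sum.simps)
  qed
  also have "\<dots> = (\<Sum>s'\<in>?M. \<Sum>l\<in>UNIV. \<Sum>ls\<in>?N. \<Sum>m\<in>?M. ?F * ?G * (ennreal (row_kernel t b as s' l m r) * ennreal (rect_kernel t as bs m ls s rs2)) *
      esum (\<lambda>kap'. ?P as s' kap' nu * ?Q (b # bs) (l # ls) kap' mu))"
  proof -
    have sw: "(\<Sum>m\<in>?M. \<Sum>ls\<in>?N. \<Sum>s'\<in>?M. \<Sum>l\<in>(UNIV::bool set). f m ls s' l) = (\<Sum>s'\<in>?M. \<Sum>l\<in>(UNIV::bool set). \<Sum>ls\<in>?N. \<Sum>m\<in>?M. f m ls s' l)"
      for f :: "bool list \<Rightarrow> bool list \<Rightarrow> bool list \<Rightarrow> bool \<Rightarrow> ennreal"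
    proof -
      have "(\<Sum>m\<in>?M. \<Sum>ls\<in>?N. \<Sum>s'\<in>?M. \<Sum>l\<in>(UNIV::bool set). f m ls s' l) = (\<Sum>m\<in>?M. \<Sum>s'\<in>?M. \<Sum>ls\<in>?N. \<Sum>l\<in>(UNIV::bool set). f m ls s' l)"
        by (intro sum.cong refl sum.swap)
      also have "\<dots> = (\<Sum>s'\<in>?M. \<Sum>m\<in>?M. \<Sum>ls\<in>?N. \<Sum>l\<in>(UNIV::bool set). f m ls s' l)" by (rule sum.swap)
      also have "\<dots> = (\<Sum>s'\<in>?M. \<Sum>m\<in>?M. \<Sum>l\<in>(UNIV::bool set). \<Sum>ls\<in>?N. f m ls s' l)"
        by (intro sum.cong refl sum.swap)
      also have "\<dots> = (\<Sum>s'\<in>?M. \<Sum>l\<in>(UNIV::bool set). \<Sum>m\<in>?M. \<Sum>ls\<in>?N. f m ls s' l)"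
        by (intro sum.cong refl sum.swap)
      also have "\<dots> = (\<Sum>s'\<in>?M. \<Sum>l\<in>(UNIV::bool set). \<Sum>ls\<in>?N. \<Sum>m\<in>?M. f m ls s' l)"
        by (intro sum.cong refl sum.swap)
      finally show ?thesis .
    qed
    show ?thesis by (rule sw)
  qed
  also have "\<dots> = (\<Sum>s'\<in>?M. \<Sum>l\<in>UNIV. \<Sum>ls\<in>?N. ?F * ?G * ennreal (rect_kernel t as (b # bs) s' (l # ls) s rs) *
      esum (\<lambda>kap'. ?P as s' kap' nu * ?Q (b # bs) (l # ls) kap' mu))"
  proof (intro sum.cong refl)
    fix s' l ls
    have nn: "0 \<le> row_kernel t b as s' l m r" "0 \<le> rect_kernel t as bs m ls s rs2" for m
      using row_kernel_nonneg[OF t as b] rect_kernel_nonneg[OF t as, of bs] Cons.prems by auto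
    then have "(\<Sum>m\<in>?M. ennreal (row_kernel t b as s' l m r) * ennreal (rect_kernel t as bs m ls s rs2)) =
        ennreal (rect_kernel t as (b # bs) s' (l # ls) s rs)"
      by (simp add: rs ennreal_mult[symmetric] sum_ennreal)
    then show "(\<Sum>m\<in>?M. ?F * ?G * (ennreal (row_kernel t b as s' l m r) * ennreal (rect_kernel t as bs m ls s rs2)) *
        esum (\<lambda>kap'. ?P as s' kap' nu * ?Q (b # bs) (l # ls) kap' mu)) =
      ?F * ?G * ennreal (rect_kernel t as (b # bs) s' (l # ls) s rs) * esum (\<lambda>kap'. ?P as s' kap' nu * ?Q (b # bs) (l # ls) kap' mu)"
      by (simp only: sum_distrib_left[symmetric] sum_distrib_right[symmetric])
  qed
  finally show ?case
    using row_factor_ge_1[OF t(2) as b] rect_factor_ge_1[OF t(2) as, of bs] Cons.prems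
    by (simp add: sum_bits_Suc sum_distrib_left rect_factor_def ennreal_mult'' mult_ac del: rect_kernel.simps chain_sum.simps)
qed

section \<open>Traces of the exchange relation\<close>

lemma esum_nonzeroE:
  assumes "esum f \<noteq> 0"
  obtains x where "f x \<noteq> 0"
proof (rule ccontr)
  assume "\<not> thesis"
  then have "f x = 0" for x using that by blast
  then show False using assms by simp
qed

lemma esum_mono: "(\<And>x. f x \<le> g x) \<Longrightarrow> esum f \<le> esum g"
  by (rule nn_integral_mono) simp

lemma esum_finite:
  assumes "finite S" "\<And>x. x \<notin> S \<Longrightarrow> f x = 0" "\<And>x. f x < \<top>"
  shows "esum f < \<top>"
  by (subst nn_integral_count_space'[of S]) (use assms in \<open>auto simp: less_top[symmetric]\<close>)

lemma bit_P_nonzero: "bit_P t a e lam mu \<noteq> 0 \<Longrightarrow> hstrip lam mu \<and> jumps lam mu = e"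
  using weight_eq_0(1)[of lam mu t a] by (cases "hstrip lam mu") (auto simp: bit_P_def)

lemma bit_Q_nonzero: "bit_Q t a e lam mu \<noteq> 0 \<Longrightarrow> hstrip lam mu \<and> jumps lam mu = (\<not> e)"
  using weight_eq_0(2)[of lam mu t a] by (cases "hstrip lam mu") (auto simp: bit_Q_def)

text \<open>The properties shared by \<open>P\<close>- and \<open>Q\<close>-steps: growth of the
  diagram, finiteness, a trivial step exactly for the bit \<open>d\<close>, and homogeneity in the
  parameter. The bit \<open>d\<close> is \<open>False\<close> for \<open>P\<close> and
  \<open>True\<close> for \<open>Q\<close>, where an arrow marks the absence of a jump. Homogeneity
  is what absorbs powers of \<open>u\<close> into the parameters.\<close>

definition step_weight :: "(real \<Rightarrow> bool \<Rightarrow> partition \<Rightarrow> partition \<Rightarrow> ennreal) \<Rightarrow> bool \<Rightarrow> bool" where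
  "step_weight B d \<longleftrightarrow> (\<forall>a e lam mu. B a e lam mu \<noteq> 0 \<longrightarrow> diagram_subset mu lam) \<and>
     (\<forall>a e lam mu. B a e lam mu < \<top>) \<and> (\<forall>a e mu. B a e mu mu = of_bool (e = d)) \<and>
     (\<forall>a y e lam mu. 0 \<le> y \<longrightarrow> B (y * a) e lam mu = ennreal (y ^ (psize lam - psize mu)) * B a e lam mu)"

lemma step_weight_P: "step_weight (bit_P t) False"
  unfolding step_weight_def
proof (intro conjI allI impI)
  fix a y :: real and e lam mu
  show "bit_P t a e lam mu \<noteq> 0 \<Longrightarrow> diagram_subset mu lam"
    using bit_P_nonzero hstrip_subset by blast
  show "bit_P t a e lam mu < \<top>" by (simp add: bit_P_def ennreal_mult_less_top)
  show "bit_P t a e mu mu = of_bool (e = False)" by (simp add: bit_P_def weight_P_def jumps_def)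
  assume "0 \<le> y"
  then show "bit_P t (y * a) e lam mu = ennreal (y ^ (psize lam - psize mu)) * bit_P t a e lam mu"
    by (simp add: bit_P_def weight_P_def power_mult_distrib ennreal_mult'[symmetric] mult_ac)
qed

lemma step_weight_Q: "step_weight (bit_Q t) True"
  unfolding step_weight_def
proof (intro conjI allI impI)
  fix a y :: real and e lam mu
  show "bit_Q t a e lam mu \<noteq> 0 \<Longrightarrow> diagram_subset mu lam"
    using bit_Q_nonzero hstrip_subset by blast
  show "bit_Q t a e lam mu < \<top>" by (simp add: bit_Q_def ennreal_mult_less_top)
  show "bit_Q t a e mu mu = of_bool (e = True)" by (simp add: bit_Q_def weight_Q_def jumps_def)
  assume "0 \<le> y"
  then show "bit_Q t (y * a) e lam mu = ennreal (y ^ (psize lam - psize mu)) * bit_Q t a e lam mu"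
    by (simp add: bit_Q_def weight_Q_def power_mult_distrib ennreal_mult'[symmetric] mult_ac)
qed

lemma chain_sum_nonzero:
  assumes "step_weight B d" "chain_sum B as s mu lam \<noteq> 0"
  shows "diagram_subset mu lam"
  using assms
proof (induction B as s mu lam rule: chain_sum.induct)
  case (1 B mu lam)
  then show ?case by (auto simp: diagram_subset_def split: if_splits)
next
  case (2 B a as e s mu lam)
  obtain rho where "B a e rho mu * chain_sum B as s rho lam \<noteq> 0"
    using 2(3) by (auto elim!: esum_nonzeroE)
  then show ?case using 2(1)[OF 2(2), of rho] 2(2) unfolding step_weight_def
    by (metis diagram_subset_trans mult_zero_left mult_zero_right)
qed auto

lemma chain_sum_plength:
  assumes "chain_sum (bit_P t) as s mu lam \<noteq> 0"
  shows "plength lam = plength mu + count_list s True"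
  using assms
proof (induction "bit_P t" as s mu lam rule: chain_sum.induct)
  case (2 a as e s mu lam)
  obtain rho where r: "bit_P t a e rho mu \<noteq> 0" "chain_sum (bit_P t) as s rho lam \<noteq> 0"
    using 2(2) by (auto elim!: esum_nonzeroE)
  have "plength rho = plength mu + of_bool e"
    using bit_P_nonzero[OF r(1)] hstrip_plength[of rho mu] by (auto simp: jumps_def)
  then show ?case using 2(1)[OF r(2)] by simp
qed (auto split: if_splits)

lemma chain_sum_finite:
  assumes "step_weight B d"
  shows "chain_sum B as s mu lam < \<top>"
  using assms
proof (induction B as s mu lam rule: chain_sum.induct)
  case (2 B a as e s mu lam)
  show ?case
    unfolding chain_sum.simps
  proof (rule esum_finite[OF finite_diagram_subset[of lam]])
    fix rho
    show "rho \<notin> {rho. diagram_subset rho lam} \<Longrightarrow> B a e rho mu * chain_sum B as s rho lam = 0"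
      using chain_sum_nonzero[OF 2(2), of as s rho lam] by auto
    show "B a e rho mu * chain_sum B as s rho lam < \<top>"
      using 2 unfolding step_weight_def by (simp add: ennreal_mult_less_top)
  qed
qed (auto simp: of_bool_def)

text \<open>Diagrams only grow along a chain, so a closed chain consists of trivial steps.\<close>

lemma chain_sum_diag:
  assumes "step_weight B d" "length s = length as"
  shows "chain_sum B as s mu mu = of_bool (s = replicate (length as) d)"
  using assms(2)
proof (induction as arbitrary: s)
  case (Cons a as)
  then obtain e s2 where s: "s = e # s2" "length s2 = length as" by (cases s) auto
  have "B a e rho mu * chain_sum B as s2 rho mu = (B a e rho mu * chain_sum B as s2 rho mu) * of_bool (rho = mu)" for rho
  proof (cases "rho = mu")
    case False
    then have "\<not> diagram_subset rho mu \<or> \<not> diagram_subset mu rho"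
      using diagram_subset_antisym_size[of rho mu] psize_mono[of mu rho] by auto
    then have "B a e rho mu * chain_sum B as s2 rho mu = 0"
      using chain_sum_nonzero[OF assms(1), of as s2 rho mu] assms(1) unfolding step_weight_def
      by (metis mult_zero_left mult_zero_right)
    then show ?thesis by simp
  qed simp
  then have "chain_sum B (a # as) s mu mu = esum (\<lambda>rho. (B a e rho mu * chain_sum B as s2 rho mu) * of_bool (rho = mu))"
    by (simp add: s)
  also have "\<dots> = B a e mu mu * chain_sum B as s2 mu mu" by (rule esum_single)
  finally show ?case
    using Cons.IH[OF s(2)] assms(1) unfolding step_weight_def by (auto simp: s)
qed simp

lemma chain_sum_scale:
  assumes "step_weight B d" "0 \<le> y"
  shows "chain_sum B (map ((*) y) as) s mu lam = ennreal (y ^ (psize lam - psize mu)) * chain_sum B as s mu lam"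
  using assms(1)
proof (induction B as s mu lam rule: chain_sum.induct)
  case (2 B a as e s mu lam)
  have "B (y * a) e rho mu * chain_sum B (map ((*) y) as) s rho lam =
      ennreal (y ^ (psize lam - psize mu)) * (B a e rho mu * chain_sum B as s rho lam)" for rho
  proof (cases "B a e rho mu * chain_sum B as s rho lam = 0")
    case True
    then show ?thesis using 2 assms(2) unfolding step_weight_def by auto
  next
    case False
    then have "diagram_subset mu rho" "diagram_subset rho lam"
      using chain_sum_nonzero[OF 2(2), of as s rho lam] 2(2) unfolding step_weight_def by auto
    then have "psize mu \<le> psize rho" "psize rho \<le> psize lam" by (auto intro: psize_mono)
    then have "psize lam - psize mu = (psize rho - psize mu) + (psize lam - psize rho)" by simp
    then have e1: "ennreal (y ^ (psize lam - psize mu)) = ennreal (y ^ (psize rho - psize mu)) * ennreal (y ^ (psize lam - psize rho))"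
      using assms(2) by (simp add: power_add ennreal_mult)
    have e2: "B (y * a) e rho mu = ennreal (y ^ (psize rho - psize mu)) * B a e rho mu"
      using 2(2) assms(2) unfolding step_weight_def by blast
    show ?thesis unfolding e1 e2 2(1)[OF 2(2), of rho] by (simp only: mult_ac)
  qed
  then show ?case by (simp add: esum_cmult)
qed auto

text \<open>The periodic sum with prescribed bits: both chains start at \<open>mu\<close> and end at
  a common \<open>lam\<close>. The function \<open>g\<close> tests the starting partition.\<close>

definition trace :: "(partition \<Rightarrow> ennreal) \<Rightarrow> real \<Rightarrow> real list \<Rightarrow> real list \<Rightarrow> real \<Rightarrow> bool list \<Rightarrow> bool list \<Rightarrow> ennreal" where
  "trace g t a b u s1 s2 = esum (\<lambda>mu. g mu * ennreal (u ^ psize mu) *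
     esum (\<lambda>lam. chain_sum (bit_P t) a s1 mu lam * chain_sum (bit_Q t) b s2 mu lam))"

definition total_trace :: "(partition \<Rightarrow> ennreal) \<Rightarrow> real \<Rightarrow> real list \<Rightarrow> real list \<Rightarrow> real \<Rightarrow> ennreal" where
  "total_trace g t a b u = (\<Sum>s1\<in>bits (length a). \<Sum>s2\<in>bits (length b). trace g t a b u s1 s2)"

definition diag_trace :: "(partition \<Rightarrow> ennreal) \<Rightarrow> real \<Rightarrow> ennreal" where
  "diag_trace g u = esum (\<lambda>mu. g mu * ennreal (u ^ psize mu))"

context
  fixes t u :: real
  assumes t: "0 \<le> t" "t < 1" and u: "0 \<le> u" "u < 1"
begin

abbreviation "cP \<equiv> chain_sum (bit_P t)"
abbreviation "cQ \<equiv> chain_sum (bit_Q t)"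

text \<open>With both lower ends equal to \<open>mu\<close>, the exchange makes \<open>mu\<close>
  the common upper end of two chains from \<open>kap\<close>. Writing \<open>psize mu\<close> as
  \<open>psize kap\<close> plus the boxes gained along the \<open>P\<close>-chain gives that chain
  the parameters \<open>u * a\<close>, by homogeneity. The test function stays at \<open>mu\<close>,
  now the upper end.\<close>

lemma trace_exchange:
  assumes a: "\<forall>x\<in>set a. 0 \<le> x \<and> x < 1" and b: "\<forall>y\<in>set b. 0 \<le> y \<and> y < 1"
    and s: "length s1 = length a" "length s2 = length b"
  shows "trace g t a b u s1 s2 = ennreal (rect_factor t a b) *
    (\<Sum>s1'\<in>bits (length a). \<Sum>s2'\<in>bits (length b). ennreal (rect_kernel t a b s1' s2' s1 s2) *
      esum (\<lambda>kap. ennreal (u ^ psize kap) *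
        esum (\<lambda>mu. g mu * cP (map ((*) u) a) s1' kap mu * cQ b s2' kap mu)))"
proof -
  have "trace g t a b u s1 s2 = esum (\<lambda>mu. \<Sum>s1'\<in>bits (length a). \<Sum>s2'\<in>bits (length b).
      (ennreal (rect_factor t a b) * ennreal (rect_kernel t a b s1' s2' s1 s2)) *
      esum (\<lambda>kap. g mu * ennreal (u ^ psize mu) * (cP a s1' kap mu * cQ b s2' kap mu)))"
    unfolding trace_def rect_exchange[OF t a b s]
    by (simp add: sum_distrib_left esum_cmult[symmetric] mult_ac)
  also have "\<dots> = (\<Sum>s1'\<in>bits (length a). \<Sum>s2'\<in>bits (length b).
      (ennreal (rect_factor t a b) * ennreal (rect_kernel t a b s1' s2' s1 s2)) *
      esum (\<lambda>kap. esum (\<lambda>mu. g mu * ennreal (u ^ psize mu) * (cP a s1' kap mu * cQ b s2' kap mu))))"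
    by (simp only: esum_sum esum_cmult) (subst esum_swap, simp only: esum_cmult)
  also have "\<dots> = (\<Sum>s1'\<in>bits (length a). \<Sum>s2'\<in>bits (length b).
      (ennreal (rect_factor t a b) * ennreal (rect_kernel t a b s1' s2' s1 s2)) *
      esum (\<lambda>kap. ennreal (u ^ psize kap) * esum (\<lambda>mu. g mu * cP (map ((*) u) a) s1' kap mu * cQ b s2' kap mu)))"
  proof -
    have "g mu * ennreal (u ^ psize mu) * (cP a s1' kap mu * cQ b s2' kap mu) =
       ennreal (u ^ psize kap) * (g mu * cP (map ((*) u) a) s1' kap mu * cQ b s2' kap mu)" for kap mu s1' s2'
    proof (cases "cP a s1' kap mu = 0")
      case True
      then show ?thesis unfolding chain_sum_scale[OF step_weight_P u(1)] by simp
    next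
      case False
      then have "psize kap \<le> psize mu" by (intro psize_mono chain_sum_nonzero[OF step_weight_P])
      then have "u ^ psize mu = u ^ psize kap * u ^ (psize mu - psize kap)"
        by (simp flip: power_add)
      then show ?thesis unfolding chain_sum_scale[OF step_weight_P u(1)]
        using u by (simp add: ennreal_mult mult_ac)
    qed
    then show ?thesis by (simp only: esum_cmult)
  qed
  finally show ?thesis by (simp add: sum_distrib_left mult.assoc)
qed

text \<open>The length of the upper end exceeds that of \<open>kap\<close> by the number of
  \<open>True\<close> bits in \<open>s1'\<close>, that is, by the number of arrows entering the
  rectangle from below. This is the origin of the count \<open>W\<close>.\<close>

lemma trace_exchange_plength:
  assumes a: "\<forall>x\<in>set a. 0 \<le> x \<and> x < 1" and b: "\<forall>y\<in>set b. 0 \<le> y \<and> y < 1"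
    and s: "length s1 = length a" "length s2 = length b"
  shows "trace (\<lambda>mu. of_bool (plength mu = n)) t a b u s1 s2 = ennreal (rect_factor t a b) *
    (\<Sum>s1'\<in>bits (length a). \<Sum>s2'\<in>bits (length b). ennreal (rect_kernel t a b s1' s2' s1 s2) *
      trace (\<lambda>mu. of_bool (plength mu + count_list s1' True = n)) t (map ((*) u) a) b u s1' s2')"
proof -
  have key: "of_bool (plength mu = n) * cP (map ((*) u) a) s1' kap mu =
      of_bool (plength kap + count_list s1' True = n) * cP (map ((*) u) a) s1' kap mu" for s1' kap mu
    using chain_sum_plength[of t "map ((*) u) a" s1' kap mu] by (cases "cP (map ((*) u) a) s1' kap mu = 0") auto
  have key2: "esum (\<lambda>mu. of_bool (plength mu = n) * cP (map ((*) u) a) s1' kap mu * cQ b s2' kap mu) =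
      of_bool (plength kap + count_list s1' True = n) * esum (\<lambda>mu. cP (map ((*) u) a) s1' kap mu * cQ b s2' kap mu)" for s1' s2' kap
    by (simp only: key mult.assoc esum_cmult)
  show ?thesis
    unfolding trace_exchange[OF assms] key2 unfolding trace_def by (simp only: mult_ac)
qed

lemma sum_kernel_ennreal:
  assumes a: "\<forall>x\<in>set a. 0 \<le> x \<and> x < 1" and b: "\<forall>y\<in>set b. 0 \<le> y \<and> y < 1"
  shows "(\<Sum>s1\<in>bits (length a). \<Sum>s2\<in>bits (length b). \<Sum>s1'\<in>bits (length a). \<Sum>s2'\<in>bits (length b).
      ennreal (rect_kernel t a b s1' s2' s1 s2) * X s1' s2') =
    (\<Sum>s1'\<in>bits (length a). \<Sum>s2'\<in>bits (length b). X s1' s2')" (is "?l = _")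
proof -
  let ?M = "bits (length a)" and ?N = "bits (length b)"
  have "?l = (\<Sum>p\<in>?M \<times> ?N. \<Sum>p'\<in>?M \<times> ?N. ennreal (rect_kernel t a b (fst p') (snd p') (fst p) (snd p)) * X (fst p') (snd p'))"
    by (simp add: sum.cartesian_product' )
  also have "\<dots> = (\<Sum>p'\<in>?M \<times> ?N. \<Sum>p\<in>?M \<times> ?N. ennreal (rect_kernel t a b (fst p') (snd p') (fst p) (snd p)) * X (fst p') (snd p'))"
    by (rule sum.swap)
  also have "\<dots> = (\<Sum>p'\<in>?M \<times> ?N. X (fst p') (snd p'))"
  proof (rule sum.cong[OF refl])
    fix p' assume "p' \<in> ?M \<times> ?N"
    then have l: "length (fst p') = length a" "length (snd p') = length b" by (auto simp: bits_def)
    have "(\<Sum>p\<in>?M \<times> ?N. ennreal (rect_kernel t a b (fst p') (snd p') (fst p) (snd p))) =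
        ennreal (\<Sum>p\<in>?M \<times> ?N. rect_kernel t a b (fst p') (snd p') (fst p) (snd p))"
      by (rule sum_ennreal) (rule rect_kernel_nonneg[OF t a b])
    also have "\<dots> = 1"
      using rect_kernel_stochastic[OF l, of t] by (simp add: sum.cartesian_product')
    finally show "(\<Sum>p\<in>?M \<times> ?N. ennreal (rect_kernel t a b (fst p') (snd p') (fst p) (snd p)) * X (fst p') (snd p')) = X (fst p') (snd p')"
      by (simp add: sum_distrib_right[symmetric])
  qed
  finally show ?thesis by (simp add: sum.cartesian_product')
qed

lemma total_trace_exchange:
  assumes a: "\<forall>x\<in>set a. 0 \<le> x \<and> x < 1" and b: "\<forall>y\<in>set b. 0 \<le> y \<and> y < 1"
  shows "total_trace g t a b u = ennreal (rect_factor t a b) *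
    (\<Sum>s1'\<in>bits (length a). \<Sum>s2'\<in>bits (length b).
      esum (\<lambda>kap. ennreal (u ^ psize kap) *
        esum (\<lambda>mu. g mu * cP (map ((*) u) a) s1' kap mu * cQ b s2' kap mu)))"
proof -
  have "total_trace g t a b u = (\<Sum>s1\<in>bits (length a). \<Sum>s2\<in>bits (length b). ennreal (rect_factor t a b) *
    (\<Sum>s1'\<in>bits (length a). \<Sum>s2'\<in>bits (length b). ennreal (rect_kernel t a b s1' s2' s1 s2) *
      esum (\<lambda>kap. ennreal (u ^ psize kap) *
        esum (\<lambda>mu. g mu * cP (map ((*) u) a) s1' kap mu * cQ b s2' kap mu))))"
    unfolding total_trace_def
    by (intro sum.cong refl trace_exchange a b) (simp_all add: bits_def)
  then show ?thesis by (simp only: sum_distrib_left[symmetric] sum_kernel_ennreal[OF a b])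
qed

abbreviation "below K \<equiv> (\<lambda>mu. of_bool (psize mu \<le> K) :: ennreal)"

text \<open>After the exchange the cutoff sits at the upper end \<open>mu\<close>. Moving it to the
  starting partition \<open>kap\<close> weakens it, since \<open>kap\<close> lies inside
  \<open>mu\<close>, so an upper bound results.\<close>

lemma total_trace_below_le:
  assumes a: "\<forall>x\<in>set a. 0 \<le> x \<and> x < 1" and b: "\<forall>y\<in>set b. 0 \<le> y \<and> y < 1"
  shows "total_trace (below K) t a b u \<le> ennreal (rect_factor t a b) * total_trace (below K) t (map ((*) u) a) b u"
proof -
  have "below K mu * cP (map ((*) u) a) s1' kap mu * cQ b s2' kap mu \<le>
      below K kap * (cP (map ((*) u) a) s1' kap mu * cQ b s2' kap mu)" for s1' s2' kap mu
  proof (cases "cQ b s2' kap mu = 0")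
    case False
    then have "psize kap \<le> psize mu" by (intro psize_mono chain_sum_nonzero[OF step_weight_Q])
    then show ?thesis by (auto simp: mult.assoc)
  qed simp
  then have "esum (\<lambda>kap. ennreal (u ^ psize kap) * esum (\<lambda>mu. below K mu * cP (map ((*) u) a) s1' kap mu * cQ b s2' kap mu)) \<le>
      esum (\<lambda>kap. ennreal (u ^ psize kap) * esum (\<lambda>mu. below K kap * (cP (map ((*) u) a) s1' kap mu * cQ b s2' kap mu)))" for s1' s2'
    by (intro esum_mono mult_left_mono) auto
  then have "esum (\<lambda>kap. ennreal (u ^ psize kap) * esum (\<lambda>mu. below K mu * cP (map ((*) u) a) s1' kap mu * cQ b s2' kap mu)) \<le>
      trace (below K) t (map ((*) u) a) b u s1' s2'" for s1' s2'
    unfolding trace_def esum_cmult by (simp add: mult_ac)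
  then show ?thesis
    unfolding total_trace_exchange[OF a b] unfolding total_trace_def
    by (auto intro!: mult_left_mono sum_mono)
qed

lemma total_trace_eq:
  assumes a: "\<forall>x\<in>set a. 0 \<le> x \<and> x < 1" and b: "\<forall>y\<in>set b. 0 \<le> y \<and> y < 1"
  shows "total_trace (\<lambda>_. 1) t a b u = ennreal (rect_factor t a b) * total_trace (\<lambda>_. 1) t (map ((*) u) a) b u"
  unfolding total_trace_exchange[OF a b] by (simp add: total_trace_def trace_def)

text \<open>Finiteness is visible in the exchanged form: there the cutoff bounds the common upper
  end of both chains, so finitely many pairs contribute.\<close>

lemma total_trace_below_finite:
  assumes a: "\<forall>x\<in>set a. 0 \<le> x \<and> x < 1" and b: "\<forall>y\<in>set b. 0 \<le> y \<and> y < 1"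
  shows "total_trace (below K) t a b u < \<top>"
proof -
  have "esum (\<lambda>kap. ennreal (u ^ psize kap) * esum (\<lambda>mu. below K mu * cP (map ((*) u) a) s1' kap mu * cQ b s2' kap mu)) < \<top>" for s1' s2'
  proof (rule esum_finite[OF finite_psize_le[of K]])
    fix kap
    have z: "below K mu * cP (map ((*) u) a) s1' kap mu * cQ b s2' kap mu = 0" if "\<not> psize kap \<le> K \<or> \<not> psize mu \<le> K" for mu
    proof (rule ccontr)
      assume n: "below K mu * cP (map ((*) u) a) s1' kap mu * cQ b s2' kap mu \<noteq> 0"
      then have "cQ b s2' kap mu \<noteq> 0" "psize mu \<le> K" by auto
      then have "psize kap \<le> psize mu" by (intro psize_mono chain_sum_nonzero[OF step_weight_Q])
      then show False using that \<open>psize mu \<le> K\<close> by simp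
    qed
    show "kap \<notin> {lam. psize lam \<le> K} \<Longrightarrow> ennreal (u ^ psize kap) * esum (\<lambda>mu. below K mu * cP (map ((*) u) a) s1' kap mu * cQ b s2' kap mu) = 0"
    proof -
      assume "kap \<notin> {lam. psize lam \<le> K}"
      then have "below K mu * cP (map ((*) u) a) s1' kap mu * cQ b s2' kap mu = 0" for mu by (intro z) simp
      then have "esum (\<lambda>mu. below K mu * cP (map ((*) u) a) s1' kap mu * cQ b s2' kap mu) = esum (\<lambda>_ :: partition. 0)"
        by (intro nn_integral_cong)
      then show ?thesis by simp
    qed
    have "esum (\<lambda>mu. below K mu * cP (map ((*) u) a) s1' kap mu * cQ b s2' kap mu) < \<top>"
    proof (rule esum_finite[OF finite_psize_le[of K]])
      fix mu
      show "mu \<notin> {lam. psize lam \<le> K} \<Longrightarrow> below K mu * cP (map ((*) u) a) s1' kap mu * cQ b s2' kap mu = 0" by (rule z) simp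
      show "below K mu * cP (map ((*) u) a) s1' kap mu * cQ b s2' kap mu < \<top>"
        using chain_sum_finite[OF step_weight_P] chain_sum_finite[OF step_weight_Q]
        by (simp add: ennreal_mult_less_top of_bool_def)
    qed
    then show "ennreal (u ^ psize kap) * esum (\<lambda>mu. below K mu * cP (map ((*) u) a) s1' kap mu * cQ b s2' kap mu) < \<top>"
      by (simp add: ennreal_mult_less_top)
  qed
  then show ?thesis
    unfolding total_trace_exchange[OF a b] by (simp add: ennreal_mult_less_top)
qed

lemma total_trace_regroup:
  "total_trace g t a b u = esum (\<lambda>mu. g mu * ennreal (u ^ psize mu) *
    (\<Sum>s1\<in>bits (length a). \<Sum>s2\<in>bits (length b). esum (\<lambda>lam. cP a s1 mu lam * cQ b s2 mu lam)))"
  by (simp only: total_trace_def trace_def sum_distrib_left esum_sum)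

lemma sum_chain_diag:
  "(\<Sum>s1\<in>bits (length a). \<Sum>s2\<in>bits (length b). cP a s1 mu mu * cQ b s2 mu mu) = 1"
proof -
  have "(\<Sum>s1\<in>bits (length a). \<Sum>s2\<in>bits (length b). cP a s1 mu mu * cQ b s2 mu mu) =
    (\<Sum>s1\<in>bits (length a). \<Sum>s2\<in>bits (length b). of_bool (s1 = replicate (length a) False) * of_bool (s2 = replicate (length b) True))"
    by (intro sum.cong refl) (simp add: bits_def chain_sum_diag[OF step_weight_P] chain_sum_diag[OF step_weight_Q])
  also have "\<dots> = (\<Sum>s1\<in>bits (length a). of_bool (s1 = replicate (length a) False)) * (\<Sum>s2\<in>bits (length b). of_bool (s2 = replicate (length b) True))"
    by (rule sum_product[symmetric])
  also have "\<dots> = 1"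
  proof -
    have "(\<Sum>s\<in>bits n. of_bool (s = replicate n d)) = (1::ennreal)" for n d
    proof -
      have "replicate n d \<in> bits n" by (simp add: bits_def)
      then show ?thesis by (simp add: of_bool_def)
    qed
    then show ?thesis by simp
  qed
  finally show ?thesis .
qed

lemma total_trace_ge_diag: "diag_trace g u \<le> total_trace g t a b u"
proof -
  have one: "1 \<le> (\<Sum>s1\<in>bits (length a). \<Sum>s2\<in>bits (length b). esum (\<lambda>lam. cP a s1 mu lam * cQ b s2 mu lam))" for mu
  proof -
    have "f mu \<le> esum f" for f :: "partition \<Rightarrow> ennreal"
      using esum_single[of f mu] esum_mono[of "\<lambda>x. f x * of_bool (x = mu)" f] by (simp add: of_bool_def)
    then have "(\<Sum>s1\<in>bits (length a). \<Sum>s2\<in>bits (length b). cP a s1 mu mu * cQ b s2 mu mu) \<le>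
        (\<Sum>s1\<in>bits (length a). \<Sum>s2\<in>bits (length b). esum (\<lambda>lam. cP a s1 mu lam * cQ b s2 mu lam))"
      by (intro sum_mono)
    then show ?thesis by (simp only: sum_chain_diag)
  qed
  show ?thesis unfolding total_trace_regroup diag_trace_def
  proof (rule esum_mono)
    fix mu
    show "g mu * ennreal (u ^ psize mu) \<le> g mu * ennreal (u ^ psize mu) *
        (\<Sum>s1\<in>bits (length a). \<Sum>s2\<in>bits (length b). esum (\<lambda>lam. cP a s1 mu lam * cQ b s2 mu lam))"
      using mult_left_mono[OF one[of mu], of "g mu * ennreal (u ^ psize mu)"] by simp
  qed
qed

text \<open>A chain that is not constant gains at least one box and thus a factor of at most
  \<open>y\<close>, while constant chains contribute exactly \<open>diag_trace\<close>.\<close>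

lemma total_trace_scale:
  assumes y: "0 \<le> y" "y \<le> 1"
  shows "total_trace g t (map ((*) y) a) b u \<le> diag_trace g u + ennreal y * total_trace g t a b u"
proof -
  let ?I = "\<lambda>a mu. \<Sum>s1\<in>bits (length a). \<Sum>s2\<in>bits (length b). esum (\<lambda>lam. cP a s1 mu lam * cQ b s2 mu lam)"
  have I: "?I (map ((*) y) a) mu \<le> 1 + ennreal y * ?I a mu" for mu
  proof -
    have pt: "cP (map ((*) y) a) s1 mu lam * cQ b s2 mu lam \<le>
        (cP a s1 mu lam * cQ b s2 mu lam) * of_bool (lam = mu) + ennreal y * (cP a s1 mu lam * cQ b s2 mu lam)" for s1 s2 lam
    proof (cases "cP a s1 mu lam = 0")
      case True
      then show ?thesis unfolding chain_sum_scale[OF step_weight_P y(1)] by simp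
    next
      case False
      then have sub: "diagram_subset mu lam" by (rule chain_sum_nonzero[OF step_weight_P])
      show ?thesis
      proof (cases "lam = mu")
        case True
        then show ?thesis unfolding chain_sum_scale[OF step_weight_P y(1)] by simp
      next
        case False
        then have "1 \<le> psize lam - psize mu"
        proof -
          have "\<not> psize lam \<le> psize mu" using diagram_subset_antisym_size[OF sub] False by blast
          then show ?thesis by linarith
        qed
        then have "y ^ (psize lam - psize mu) \<le> y" using y power_decreasing[of 1 "psize lam - psize mu" y] by simp
        then have "ennreal (y ^ (psize lam - psize mu)) * (cP a s1 mu lam * cQ b s2 mu lam) \<le> ennreal y * (cP a s1 mu lam * cQ b s2 mu lam)"
          by (intro mult_right_mono ennreal_leI) auto
        then show ?thesis unfolding chain_sum_scale[OF step_weight_P y(1)] using False by (simp add: mult.assoc)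
      qed
    qed
    have e: "esum (\<lambda>lam. cP (map ((*) y) a) s1 mu lam * cQ b s2 mu lam) \<le>
       cP a s1 mu mu * cQ b s2 mu mu + ennreal y * esum (\<lambda>lam. cP a s1 mu lam * cQ b s2 mu lam)" for s1 s2
    proof -
      have "esum (\<lambda>lam. cP (map ((*) y) a) s1 mu lam * cQ b s2 mu lam) \<le>
         esum (\<lambda>lam. (cP a s1 mu lam * cQ b s2 mu lam) * of_bool (lam = mu) + ennreal y * (cP a s1 mu lam * cQ b s2 mu lam))"
        by (rule esum_mono[OF pt])
      also have "\<dots> = esum (\<lambda>lam. (cP a s1 mu lam * cQ b s2 mu lam) * of_bool (lam = mu)) + esum (\<lambda>lam. ennreal y * (cP a s1 mu lam * cQ b s2 mu lam))"
        by (rule nn_integral_add) simp_all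
      finally show ?thesis unfolding esum_single esum_cmult .
    qed
    have "?I (map ((*) y) a) mu \<le> (\<Sum>s1\<in>bits (length a). \<Sum>s2\<in>bits (length b).
        cP a s1 mu mu * cQ b s2 mu mu + ennreal y * esum (\<lambda>lam. cP a s1 mu lam * cQ b s2 mu lam))"
      by (simp only: length_map) (intro sum_mono e)
    also have "\<dots> = 1 + ennreal y * ?I a mu"
      unfolding sum.distrib sum_chain_diag by (simp add: sum_distrib_left)
    finally show ?thesis .
  qed
  have "total_trace g t (map ((*) y) a) b u \<le> esum (\<lambda>mu. g mu * ennreal (u ^ psize mu) * (1 + ennreal y * ?I a mu))"
    unfolding total_trace_regroup by (intro esum_mono mult_left_mono I) simp
  also have "\<dots> = esum (\<lambda>mu. g mu * ennreal (u ^ psize mu) + ennreal y * (g mu * ennreal (u ^ psize mu) * ?I a mu))"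
    by (simp add: distrib_left mult_ac)
  also have "\<dots> = diag_trace g u + esum (\<lambda>mu. ennreal y * (g mu * ennreal (u ^ psize mu) * ?I a mu))"
    unfolding diag_trace_def by (rule nn_integral_add) simp_all
  also have "\<dots> = diag_trace g u + ennreal y * total_trace g t a b u"
    unfolding esum_cmult total_trace_regroup ..
  finally show ?thesis .
qed

definition partial_factor :: "real list \<Rightarrow> real list \<Rightarrow> nat \<Rightarrow> real" where
  "partial_factor a b L = (\<Prod>l<L. rect_factor t (map ((*) (u ^ l)) a) b)"

lemma scaled_params:
  assumes "\<forall>x\<in>set a. 0 \<le> x \<and> x < 1"
  shows "\<forall>x\<in>set (map ((*) (u ^ l)) a). 0 \<le> x \<and> x < 1"
proof -
  have "0 \<le> u ^ l" "u ^ l \<le> 1" using u by (simp_all add: power_le_one)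
  then have "0 \<le> u ^ l * x \<and> u ^ l * x < 1" if "x \<in> set a" for x
    using assms that by (metis mult_nonneg_nonneg mult_left_le_one_le order.strict_trans1)
  then show ?thesis by simp
qed

lemma map_scale_Suc: "map ((*) u) (map ((*) (u ^ l)) a) = map ((*) (u ^ Suc l)) a"
  by (simp add: mult.assoc)

lemma partial_factor_ge_1:
  assumes a: "\<forall>x\<in>set a. 0 \<le> x \<and> x < 1" and b: "\<forall>y\<in>set b. 0 \<le> y \<and> y < 1"
  shows "1 \<le> partial_factor a b L"
  unfolding partial_factor_def
  by (intro prod_ge_1 rect_factor_ge_1 t scaled_params a b)

lemma total_trace_iterate:
  assumes a: "\<forall>x\<in>set a. 0 \<le> x \<and> x < 1" and b: "\<forall>y\<in>set b. 0 \<le> y \<and> y < 1"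
  shows "total_trace (\<lambda>_. 1) t a b u = ennreal (partial_factor a b L) * total_trace (\<lambda>_. 1) t (map ((*) (u ^ L)) a) b u"
    "total_trace (below K) t a b u \<le> ennreal (partial_factor a b L) * total_trace (below K) t (map ((*) (u ^ L)) a) b u"
proof -
  have nn: "0 \<le> partial_factor a b L" for L using partial_factor_ge_1[OF a b, of L] by simp
  have rr: "0 \<le> rect_factor t (map ((*) (u ^ L)) a) b" for L
    using rect_factor_ge_1[OF t(2) scaled_params[OF a] b, of L] by simp
  have step: "partial_factor a b (Suc L) = partial_factor a b L * rect_factor t (map ((*) (u ^ L)) a) b" for L
    by (simp add: partial_factor_def)
  have zero: "partial_factor a b 0 = 1" "map ((*) (u ^ 0)) a = a" by (simp add: partial_factor_def) (rule map_idI, simp)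
  show "total_trace (\<lambda>_. 1) t a b u = ennreal (partial_factor a b L) * total_trace (\<lambda>_. 1) t (map ((*) (u ^ L)) a) b u"
  proof (induction L)
    case 0
    show ?case unfolding zero by simp
  next
    case (Suc L)
    show ?case
      unfolding Suc.IH total_trace_eq[OF scaled_params[OF a, of L] b, unfolded map_scale_Suc]
      by (simp only: step ennreal_mult[OF nn rr] mult.assoc)
  qed
  show "total_trace (below K) t a b u \<le> ennreal (partial_factor a b L) * total_trace (below K) t (map ((*) (u ^ L)) a) b u"
  proof (induction L)
    case 0
    show ?case unfolding zero by simp
  next
    case (Suc L)
    have "ennreal (partial_factor a b L) * total_trace (below K) t (map ((*) (u ^ L)) a) b u \<le>
      ennreal (partial_factor a b L) * (ennreal (rect_factor t (map ((*) (u ^ L)) a) b) * total_trace (below K) t (map ((*) (u ^ Suc L)) a) b u)"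
      using total_trace_below_le[OF scaled_params[OF a] b, of K L] unfolding map_scale_Suc by (rule mult_left_mono) simp
    then show ?case using Suc.IH by (simp only: step ennreal_mult[OF nn rr] mult.assoc)
  qed
qed

text \<open>
  Truncating the size of \<open>\<lambda>\<^sup>(\<^sup>0\<^sup>)\<close> makes the trace finite, which is needed to let \<open>L \<rightarrow> \<infinity>\<close> in the
  iterated exchange relation.
\<close>

lemma total_trace_limit:
  assumes a: "\<forall>x\<in>set a. 0 \<le> x \<and> x < 1" and b: "\<forall>y\<in>set b. 0 \<le> y \<and> y < 1"
    and lim: "partial_factor a b \<longlonglongrightarrow> F"
    and C: "diag_trace (\<lambda>_. 1) u = ennreal C" "0 \<le> C"
  shows "total_trace (\<lambda>_. 1) t a b u = ennreal (F * C)"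
proof (rule antisym)
  have F: "1 \<le> F" by (rule LIMSEQ_le_const[OF lim]) (use partial_factor_ge_1[OF a b] in auto)
  have below: "total_trace (below K) t a b u \<le> ennreal (F * C)" for K
  proof -
    let ?X = "total_trace (below K) t a b u"
    obtain X where X: "?X = ennreal X" "0 \<le> X"
      using total_trace_below_finite[OF a b, of K] by (cases ?X) auto
    have dC: "diag_trace (below K) u \<le> ennreal C"
      unfolding C(1)[symmetric] diag_trace_def by (intro esum_mono) (auto simp: of_bool_def)
    \<comment> \<open>Since \<open>X\<close> is a real number, the term \<open>u ^ L * X\<close>
      disappears as \<open>L\<close> grows; this is where the finiteness of the truncated trace
      enters.\<close>
    have "X \<le> partial_factor a b L * (C + u ^ L * X)" for L
    proof -
      have p: "0 \<le> partial_factor a b L" using partial_factor_ge_1[OF a b, of L] by simp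
      have "?X \<le> ennreal (partial_factor a b L) * (diag_trace (below K) u + ennreal (u ^ L) * ?X)"
        by (rule order_trans[OF total_trace_iterate(2)[OF a b, of K L]])
           (intro mult_left_mono total_trace_scale, use u in \<open>auto simp: power_le_one\<close>)
      also have "\<dots> \<le> ennreal (partial_factor a b L) * (ennreal C + ennreal (u ^ L) * ?X)"
        by (intro mult_left_mono add_right_mono dC) simp
      also have "\<dots> = ennreal (partial_factor a b L * (C + u ^ L * X))"
        using p C X u by (simp add: ennreal_mult)
      finally show ?thesis unfolding X(1) using X p C u by (subst (asm) ennreal_le_iff) auto
    qed
    moreover have "(\<lambda>L. partial_factor a b L * (C + u ^ L * X)) \<longlonglongrightarrow> F * (C + 0 * X)"
      by (intro tendsto_intros lim LIMSEQ_realpow_zero u)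
    ultimately have "X \<le> F * (C + 0 * X)" by (intro LIMSEQ_le_const) auto
    then show ?thesis unfolding X(1) by (intro ennreal_leI) simp
  qed
  \<comment> \<open>Monotone convergence in the cutoff transfers the uniform bound to the full
    trace.\<close>
  have "total_trace (\<lambda>_. 1) t a b u = (SUP K. total_trace (below K) t a b u)"
  proof -
    let ?h = "\<lambda>mu. ennreal (u ^ psize mu) * (\<Sum>s1\<in>bits (length a). \<Sum>s2\<in>bits (length b). esum (\<lambda>lam. cP a s1 mu lam * cQ b s2 mu lam))"
    have "incseq (\<lambda>K mu. below K mu * ?h mu)"
      by (auto simp: incseq_def le_fun_def intro!: mult_right_mono)
    then have "esum (\<lambda>mu. SUP K. below K mu * ?h mu) = (SUP K. esum (\<lambda>mu. below K mu * ?h mu))"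
      by (rule nn_integral_monotone_convergence_SUP) simp
    moreover have "(SUP K. below K mu * ?h mu) = ?h mu" for mu
    proof (rule antisym)
      show "(SUP K. below K mu * ?h mu) \<le> ?h mu" by (rule SUP_least) (simp add: of_bool_def)
      show "?h mu \<le> (SUP K. below K mu * ?h mu)" by (rule SUP_upper2[of "psize mu"]) auto
    qed
    ultimately show ?thesis unfolding total_trace_regroup by (simp add: mult.assoc)
  qed
  also have "\<dots> \<le> ennreal (F * C)" by (rule SUP_least[OF below])
  finally show "total_trace (\<lambda>_. 1) t a b u \<le> ennreal (F * C)" .
  \<comment> \<open>The lower bound keeps only the constant sequences after \<open>L\<close>
    exchanges.\<close>
  have ge: "ennreal (partial_factor a b L * C) \<le> total_trace (\<lambda>_. 1) t a b u" for L
  proof -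
    have p: "0 \<le> partial_factor a b L" using partial_factor_ge_1[OF a b, of L] by simp
    show ?thesis
      unfolding total_trace_iterate(1)[OF a b, of L] using total_trace_ge_diag[of "\<lambda>_. 1" "map ((*) (u ^ L)) a" b]
      unfolding C(1) by (simp add: ennreal_mult p C mult_left_mono)
  qed
  have "(\<lambda>L. ennreal (partial_factor a b L * C)) \<longlonglongrightarrow> ennreal (F * C)"
    by (intro tendsto_ennrealI tendsto_mult lim tendsto_const)
  then show "ennreal (F * C) \<le> total_trace (\<lambda>_. 1) t a b u"
    by (rule LIMSEQ_le_const2) (use ge in auto)
qed

end

section \<open>The normalization constant\<close>

lemma power_Suc_lt_1: "0 \<le> u \<Longrightarrow> u < 1 \<Longrightarrow> u ^ Suc k < (1 :: real)"
  using power_Suc_less_one[of u k] by (cases "u = 0") auto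

lemma qpoch_Suc: "qpoch u u (Suc k) = qpoch u u k * (1 - u ^ Suc k)"
  by (simp add: qpoch_def mult.commute)

lemma qpoch_pos:
  assumes "0 \<le> u" "u < 1"
  shows "0 < qpoch u u k"
  unfolding qpoch_def
proof (rule prod_pos)
  fix m
  have "u ^ Suc m < 1" by (rule power_Suc_lt_1[OF assms])
  then show "0 < 1 - u ^ m * u" by (simp add: mult.commute)
qed

lemma qpoch_inf_convergent:
  fixes u :: real
  assumes "0 \<le> u" "u < 1"
  shows "convergent_prod (\<lambda>m. 1 - u ^ m * u)"
proof -
  have "summable (\<lambda>m. u ^ m * u)" using assms by (intro summable_mult2 summable_geometric) simp_all
  then have "summable (\<lambda>m. norm ((1 - u ^ m * u) - 1))" using assms by (simp add: abs_mult)
  then show ?thesis by (intro abs_convergent_prod_imp_convergent_prod summable_imp_abs_convergent_prod)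
qed

lemma qpoch_limit:
  assumes "0 \<le> u" "u < 1"
  shows "qpoch u u \<longlonglongrightarrow> qpoch_inf u u" "0 < qpoch_inf u u"
proof -
  note c = qpoch_inf_convergent[OF assms]
  have pos: "0 < 1 - u ^ m * u" for m
    using power_Suc_lt_1[OF assms, of m] by (simp add: mult.commute)
  show "qpoch u u \<longlonglongrightarrow> qpoch_inf u u"
    using convergent_prod_LIMSEQ[OF c] unfolding qpoch_def qpoch_inf_def
    by (subst LIMSEQ_lessThan_iff_atMost)
  show "0 < qpoch_inf u u" unfolding qpoch_inf_def by (rule less_0_prodinf[OF c pos])
qed

definition rows_at_most :: "nat \<Rightarrow> real \<Rightarrow> ennreal" where
  "rows_at_most k u = diag_trace (\<lambda>mu. of_bool (plength mu \<le> k)) u"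

lemma part_PartitionI:
  assumes "antimono f" "finite {i. f i \<noteq> 0}"
  shows "part (Partition f) = f"
  using assms by (simp add: Partition_inverse)

text \<open>A partition with at most \<open>k + 1\<close> parts is a \<open>(k + 1) \<times> r\<close> rectangle next to one with at most \<open>k\<close> parts.\<close>

lemma bij_betw_add_rectangle:
  "\<exists>f. bij_betw f (UNIV \<times> {rho. plength rho \<le> k}) {lam. plength lam \<le> Suc k} \<and>
    (\<forall>r rho. plength rho \<le> k \<longrightarrow> psize (f (r, rho)) = r * Suc k + psize rho)"
proof -
  define h where "h = (\<lambda>(r :: nat, rho) i. if i < Suc k then part rho i + r else 0)"
  define f where "f p = Partition (h p)" for p :: "nat \<times> partition"
  \<comment> \<open>Row \<open>k\<close> is the shortest of the first \<open>k + 1\<close> rows, so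
    its length is the width of the widest rectangle that can be removed.\<close>
  define h' where "h' lam i = (if i < Suc k then part lam i - part lam k else 0)" for lam i
  define f' where "f' lam = (part lam k, Partition (h' lam))" for lam
  have pf: "part (f p) = h p" for p :: "nat \<times> partition"
    unfolding f_def
  proof (rule part_PartitionI)
    show "antimono (h p)"
      by (cases p) (auto simp: antimono_def h_def intro!: add_mono part_antimono)
    show "finite {i. h p i \<noteq> 0}"
      by (rule finite_subset[of _ "{..<Suc k}"]) (auto simp: h_def split: prod.splits if_splits)
  qed
  have pf': "part (Partition (h' lam)) = h' lam" for lam
  proof (rule part_PartitionI)
    show "antimono (h' lam)"
      by (auto simp: antimono_def h'_def intro!: diff_le_mono part_antimono)
    show "finite {i. h' lam i \<noteq> 0}"
      by (rule finite_subset[of _ "{..<Suc k}"]) (auto simp: h'_def split: if_splits)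
  qed
  have zero: "part rho k = 0" if "plength rho \<le> k" for rho using that part_zero_iff[of rho k] by simp
  have "bij_betw f (UNIV \<times> {rho. plength rho \<le> k}) {lam. plength lam \<le> Suc k}"
  proof (rule bij_betw_byWitness[where f' = f'])
    show "\<forall>p\<in>UNIV \<times> {rho. plength rho \<le> k}. f' (f p) = p"
    proof
      fix p :: "nat \<times> partition" assume "p \<in> UNIV \<times> {rho. plength rho \<le> k}"
      then obtain r rho where p: "p = (r, rho)" "plength rho \<le> k" by auto
      have "part (Partition (h' (f p))) i = part rho i" for i
        unfolding pf' using zero[OF p(2)] part_zero_iff[of rho i] p
        by (auto simp: h'_def pf h_def)
      then show "f' (f p) = p"
        using zero[OF p(2)] by (auto simp: f'_def p pf h_def intro: part_eqI)
    qed
    show "\<forall>lam\<in>{lam. plength lam \<le> Suc k}. f (f' lam) = lam"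
    proof
      fix lam assume lam: "lam \<in> {lam. plength lam \<le> Suc k}"
      show "f (f' lam) = lam"
      proof (rule part_eqI)
        fix i show "part (f (f' lam)) i = part lam i"
          using lam part_zero_iff[of lam i] part_antimono[of i k lam]
          by (auto simp: pf f'_def h_def pf' h'_def)
      qed
    qed
    show "f ` (UNIV \<times> {rho. plength rho \<le> k}) \<subseteq> {lam. plength lam \<le> Suc k}"
      using part_zero_iff[of "f _" "Suc k"] by (auto simp: pf h_def)
    show "f' ` {lam. plength lam \<le> Suc k} \<subseteq> UNIV \<times> {rho. plength rho \<le> k}"
      using part_zero_iff[of "Partition (h' _)" k] by (auto simp: f'_def pf' h'_def)
  qed
  moreover have "psize (f (r, rho)) = r * Suc k + psize rho" if "plength rho \<le> k" for r rho
  proof -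
    have "plength (f (r, rho)) \<le> Suc k" using part_zero_iff[of "f (r, rho)" "Suc k"] by (simp add: pf h_def)
    then have "psize (f (r, rho)) = (\<Sum>i<Suc k. part rho i + r)"
      using psize_parts[of "f (r, rho)" "Suc k"] by (simp add: pf h_def)
    also have "\<dots> = psize rho + Suc k * r"
      using psize_parts[of rho "Suc k"] that by (simp add: sum.distrib)
    finally show ?thesis by (simp add: mult.commute)
  qed
  ultimately show ?thesis by blast
qed

text \<open>Euler's product: the width of the rectangle of \<open>k + 1\<close> rows is free and
  sums to \<open>1 / (1 - u ^ Suc k)\<close>.\<close>

lemma rows_at_most_eq:
  assumes u: "0 \<le> u" "u < 1"
  shows "rows_at_most k u = ennreal (1 / qpoch u u k)"
proof (induction k)
  case 0
  obtain e where e: "psize e = 0" using ex_empty_partition by blast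
  have "plength mu \<le> 0 \<longleftrightarrow> mu = e" for mu
  proof
    assume "plength mu \<le> 0"
    then have "psize mu = 0" using psize_parts[of mu 0] by simp
    then show "mu = e" using e psize_0_unique by blast
  qed (use e plength_le_psize[of e] in simp)
  then have "rows_at_most 0 u = esum (\<lambda>mu. ennreal (u ^ psize mu) * of_bool (mu = e))"
    by (simp add: rows_at_most_def diag_trace_def mult.commute)
  then show ?case by (simp add: esum_single e qpoch_def)
next
  case (Suc k)
  obtain f where f: "bij_betw f (UNIV \<times> {rho. plength rho \<le> k}) {lam. plength lam \<le> Suc k}"
    "\<And>r rho. plength rho \<le> k \<Longrightarrow> psize (f (r, rho)) = r * Suc k + psize rho"
    using bij_betw_add_rectangle[of k] by auto
  have restrict: "rows_at_most k u = (\<integral>\<^sup>+mu. ennreal (u ^ psize mu) \<partial>count_space {mu. plength mu \<le> k})" for k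
    unfolding rows_at_most_def diag_trace_def
    by (subst (2) nn_integral_count_space_indicator) (auto intro!: nn_integral_cong simp: indicator_def)
  have "rows_at_most (Suc k) u = (\<integral>\<^sup>+p. ennreal (u ^ psize (f p)) \<partial>count_space (UNIV \<times> {rho. plength rho \<le> k}))"
    unfolding restrict by (rule nn_integral_bij_count_space[OF f(1), symmetric])
  also have "\<dots> = esum (\<lambda>p. ennreal (u ^ psize (f p)) * of_bool (plength (snd p) \<le> k))"
    by (subst nn_integral_count_space_indicator) (auto intro!: nn_integral_cong simp: indicator_def)
  also have "\<dots> = esum (\<lambda>(r, rho). ennreal ((u ^ Suc k) ^ r) * (of_bool (plength rho \<le> k) * ennreal (u ^ psize rho)))"
  proof (intro nn_integral_cong, clarify)
    fix r rho
    have "u ^ (r * Suc k + psize rho) = (u ^ Suc k) ^ r * u ^ psize rho"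
      by (simp only: power_add power_mult mult.commute[of r])
    then show "ennreal (u ^ psize (f (r, rho))) * of_bool (plength (snd (r, rho)) \<le> k) =
        ennreal ((u ^ Suc k) ^ r) * (of_bool (plength rho \<le> k) * ennreal (u ^ psize rho))"
      using f(2)[of rho r] u by (cases "plength rho \<le> k") (simp_all add: ennreal_mult del: power_Suc)
  qed
  also have "\<dots> = esum (\<lambda>r. esum (\<lambda>rho. ennreal ((u ^ Suc k) ^ r) * (of_bool (plength rho \<le> k) * ennreal (u ^ psize rho))))"
    using nn_integral_fst_count_space[of "\<lambda>(r, rho). ennreal ((u ^ Suc k) ^ r) * (of_bool (plength rho \<le> k) * ennreal (u ^ psize rho))"]
    by (simp del: power_Suc)
  also have "\<dots> = esum (\<lambda>r. ennreal ((u ^ Suc k) ^ r)) * rows_at_most k u"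
    unfolding esum_cmult esum_multc rows_at_most_def diag_trace_def ..
  also have "esum (\<lambda>r. ennreal ((u ^ Suc k) ^ r)) = ennreal (1 / (1 - u ^ Suc k))"
  proof -
    have q: "0 \<le> u ^ Suc k" "u ^ Suc k < 1" using u power_Suc_lt_1[OF u] by (simp_all del: power_Suc)
    have "((\<lambda>r. (u ^ Suc k) ^ r) has_sum 1 / (1 - u ^ Suc k)) UNIV"
    proof (rule norm_summable_imp_has_sum)
      show "summable (\<lambda>r. norm ((u ^ Suc k) ^ r))"
        using q by (simp only: norm_power[symmetric] real_norm_def abs_power_minus abs_of_nonneg zero_le_power summable_geometric)
      show "(\<lambda>r. (u ^ Suc k) ^ r) sums (1 / (1 - u ^ Suc k))"
        using q by (intro geometric_sums) (simp only: real_norm_def abs_of_nonneg)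
    qed
    from esum_has_sum[OF this] q show ?thesis by (simp del: power_Suc)
  qed
  also have "\<dots> * rows_at_most k u = ennreal (1 / (1 - u ^ Suc k) * (1 / qpoch u u k))"
    unfolding Suc.IH using u qpoch_pos[OF u, of k] power_Suc_lt_1[OF u, of k]
    by (subst ennreal_mult) (simp_all add: power_le_one)
  finally show ?case by (simp add: qpoch_Suc mult.commute del: power_Suc)
qed

lemma diag_trace_one:
  assumes u: "0 \<le> u" "u < 1"
  shows "diag_trace (\<lambda>_. 1) u = ennreal (1 / qpoch_inf u u)"
proof -
  have "incseq (\<lambda>k mu. of_bool (plength mu \<le> k) * ennreal (u ^ psize mu))"
    by (auto simp: incseq_def le_fun_def intro!: mult_right_mono)
  then have "esum (\<lambda>mu. SUP k. of_bool (plength mu \<le> k) * ennreal (u ^ psize mu)) = (SUP k. rows_at_most k u)"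
    unfolding rows_at_most_def diag_trace_def by (rule nn_integral_monotone_convergence_SUP) simp
  moreover have "(SUP k. of_bool (plength mu \<le> k) * ennreal (u ^ psize mu)) = ennreal (u ^ psize mu)" for mu
  proof (rule antisym)
    show "(SUP k. of_bool (plength mu \<le> k) * ennreal (u ^ psize mu)) \<le> ennreal (u ^ psize mu)"
      by (rule SUP_least) (simp add: of_bool_def)
    show "ennreal (u ^ psize mu) \<le> (SUP k. of_bool (plength mu \<le> k) * ennreal (u ^ psize mu))"
      by (rule SUP_upper2[of "plength mu"]) auto
  qed
  ultimately have e: "diag_trace (\<lambda>_. 1) u = (SUP k. rows_at_most k u)" by (simp add: diag_trace_def)
  have inc: "incseq (\<lambda>k. rows_at_most k u)"
    unfolding rows_at_most_def diag_trace_def incseq_def by (auto intro!: esum_mono mult_right_mono)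
  have "(\<lambda>k. rows_at_most k u) \<longlonglongrightarrow> ennreal (1 / qpoch_inf u u)"
    unfolding rows_at_most_eq[OF u]
    by (intro tendsto_ennrealI tendsto_divide tendsto_const qpoch_limit[OF u]) (use qpoch_limit(2)[OF u] in simp)
  then show ?thesis using LIMSEQ_SUP[OF inc] LIMSEQ_unique unfolding e by blast
qed

text \<open>The difference of two consecutive Euler products. Divided by
  \<open>diag_trace_one\<close> it becomes the u-geometric weight: that law describes the length of
  a partition chosen with weight \<open>u ^ psize mu\<close>.\<close>

lemma diag_trace_plength:
  assumes u: "0 \<le> u" "u < 1"
  shows "diag_trace (\<lambda>mu. of_bool (plength mu = k)) u = ennreal (u ^ k / qpoch u u k)"
proof (cases k)
  case 0
  then show ?thesis using rows_at_most_eq[OF u, of 0] by (simp add: rows_at_most_def)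
next
  case (Suc n)
  let ?g = "diag_trace (\<lambda>mu. of_bool (plength mu = Suc n)) u"
  have "rows_at_most (Suc n) u = esum (\<lambda>mu. of_bool (plength mu \<le> n) * ennreal (u ^ psize mu) + of_bool (plength mu = Suc n) * ennreal (u ^ psize mu))"
    unfolding rows_at_most_def diag_trace_def by (intro nn_integral_cong) (auto simp: le_Suc_eq)
  also have "\<dots> = rows_at_most n u + ?g"
    unfolding rows_at_most_def diag_trace_def by (rule nn_integral_add) simp_all
  finally have e: "ennreal (1 / qpoch u u (Suc n)) = ennreal (1 / qpoch u u n) + ?g"
    unfolding rows_at_most_eq[OF u] .
  have p: "0 < qpoch u u n" "0 < qpoch u u (Suc n)" using qpoch_pos[OF u] by auto
  have "1 / qpoch u u (Suc n) = 1 / qpoch u u n + u ^ Suc n / qpoch u u (Suc n)"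
    using p unfolding qpoch_Suc by (simp add: divide_simps del: power_Suc) (simp add: algebra_simps del: power_Suc)
  then have "ennreal (1 / qpoch u u (Suc n)) = ennreal (1 / qpoch u u n) + ennreal (u ^ Suc n / qpoch u u (Suc n))"
    using p u by (simp add: ennreal_plus[symmetric] del: ennreal_plus power_Suc)
  then have "?g = ennreal (u ^ Suc n / qpoch u u (Suc n))"
    using e by (simp add: ennreal_add_left_cancel)
  then show ?thesis by (simp only: Suc)
qed

text \<open>The factor with index \<open>l\<close> deviates from 1 by at most a constant times
  \<open>u ^ l\<close>, so the product converges absolutely.\<close>

lemma cell_factor_limit:
  assumes t: "0 \<le> t" "t < 1" and u: "0 \<le> u" "u < 1" and x: "0 \<le> x" "x < 1"
  shows "(\<lambda>L. \<Prod>l<L. cell_factor t (u ^ l * x)) \<longlonglongrightarrow> (\<Prod>l. cell_factor t (u ^ l * x))"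
proof -
  have le: "0 \<le> u ^ l * x" "u ^ l * x \<le> x" for l
    using u x by (simp_all add: mult_left_le_one_le power_le_one)
  have "summable (\<lambda>l. norm (cell_factor t (u ^ l * x) - 1))"
  proof (rule summable_comparison_test')
    show "summable (\<lambda>l. u ^ l * (x / (1 - x)))"
      using u by (intro summable_mult2 summable_geometric) simp
    fix l :: nat
    have p: "0 < 1 - u ^ l * x" "0 < 1 - x" using le[of l] x by auto
    have "cell_factor t (u ^ l * x) - 1 = (1 - t) * (u ^ l * x) / (1 - u ^ l * x)"
      using p by (simp add: cell_factor_def field_simps)
    moreover have "(1 - t) * (u ^ l * x) / (1 - u ^ l * x) \<le> (u ^ l * x) / (1 - x)"
    proof (rule frac_le)
      show "(1 - t) * (u ^ l * x) \<le> u ^ l * x" using t le[of l] by (simp add: mult_left_le_one_le)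
    qed (use le[of l] p t in auto)
    moreover have "0 \<le> (1 - t) * (u ^ l * x) / (1 - u ^ l * x)" using p t le[of l] by simp
    ultimately show "norm (norm (cell_factor t (u ^ l * x) - 1)) \<le> u ^ l * (x / (1 - x))"
      by (simp only: real_norm_def abs_abs abs_of_nonneg times_divide_eq_right)
  qed
  then have "convergent_prod (\<lambda>l. cell_factor t (u ^ l * x))"
    by (intro abs_convergent_prod_imp_convergent_prod summable_imp_abs_convergent_prod)
  from convergent_prod_LIMSEQ[OF this] show ?thesis by (subst LIMSEQ_lessThan_iff_atMost)
qed

definition kernel_product :: "real \<Rightarrow> real \<Rightarrow> real list \<Rightarrow> real list \<Rightarrow> real" where
  "kernel_product t u a b = (\<Prod>i<length a. \<Prod>j<length b. \<Prod>l. cell_factor t (u ^ l * (a ! i * b ! j)))"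

lemma rect_factor_nth: "rect_factor t as bs = (\<Prod>i<length as. \<Prod>j<length bs. cell_factor t (as ! i * bs ! j))"
proof -
  have "rect_factor t as bs = (\<Prod>j<length bs. \<Prod>i<length as. cell_factor t (as ! i * bs ! j))"
    unfolding rect_factor_def row_factor_def by (simp add: prod.list_conv_set_nth atLeast0LessThan)
  also have "\<dots> = (\<Prod>i<length as. \<Prod>j<length bs. cell_factor t (as ! i * bs ! j))" by (rule prod.swap)
  finally show ?thesis .
qed

lemma partial_factor_limit:
  assumes t: "0 \<le> t" "t < 1" and u: "0 \<le> u" "u < 1"
    and a: "\<forall>x\<in>set a. 0 \<le> x \<and> x < 1" and b: "\<forall>y\<in>set b. 0 \<le> y \<and> y < 1"
  shows "partial_factor t u a b \<longlonglongrightarrow> kernel_product t u a b"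
proof -
  have "partial_factor t u a b L = (\<Prod>i<length a. \<Prod>j<length b. \<Prod>l<L. cell_factor t (u ^ l * (a ! i * b ! j)))" for L
  proof -
    have "partial_factor t u a b L = (\<Prod>l<L. \<Prod>i<length a. \<Prod>j<length b. cell_factor t (u ^ l * (a ! i * b ! j)))"
      unfolding partial_factor_def[OF t u] rect_factor_nth by (simp add: mult.assoc)
    also have "\<dots> = (\<Prod>i<length a. \<Prod>l<L. \<Prod>j<length b. cell_factor t (u ^ l * (a ! i * b ! j)))"
      by (rule prod.swap)
    also have "\<dots> = (\<Prod>i<length a. \<Prod>j<length b. \<Prod>l<L. cell_factor t (u ^ l * (a ! i * b ! j)))"
      by (intro prod.cong refl prod.swap)
    finally show ?thesis .
  qed
  moreover have "(\<lambda>L. \<Prod>i<length a. \<Prod>j<length b. \<Prod>l<L. cell_factor t (u ^ l * (a ! i * b ! j))) \<longlonglongrightarrow> kernel_product t u a b"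
    unfolding kernel_product_def
  proof (intro tendsto_prod cell_factor_limit t u)
    fix i j assume "i \<in> {..<length a}" "j \<in> {..<length b}"
    then have "0 \<le> a ! i" "a ! i < 1" "0 \<le> b ! j" "b ! j < 1" using a b by auto
    then show "0 \<le> a ! i * b ! j" "a ! i * b ! j < 1" using mult_strict_mono[of "a ! i" 1 "b ! j" 1] by auto
  qed
  ultimately show ?thesis by presburger
qed

lemma phl_normalization_eq: "phl_normalization a b t u = 1 / qpoch_inf u u * kernel_product t u a b"
  unfolding phl_normalization_def kernel_product_def cell_factor_def by (simp add: mult.assoc)

lemma kernel_product_ge_1:
  assumes "0 \<le> t" "t < 1" "0 \<le> u" "u < 1"
    and "\<forall>x\<in>set a. 0 \<le> x \<and> x < 1" "\<forall>y\<in>set b. 0 \<le> y \<and> y < 1"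
  shows "1 \<le> kernel_product t u a b"
  by (rule LIMSEQ_le_const[OF partial_factor_limit[OF assms]]) (use partial_factor_ge_1[OF assms] in auto)

theorem total_trace_eq_normalization:
  assumes t: "0 \<le> t" "t < 1" and u: "0 \<le> u" "u < 1"
    and a: "\<forall>x\<in>set a. 0 \<le> x \<and> x < 1" and b: "\<forall>y\<in>set b. 0 \<le> y \<and> y < 1"
  shows "total_trace (\<lambda>_. 1) t a b u = ennreal (phl_normalization a b t u)" "0 < phl_normalization a b t u"
proof -
  have q: "0 < qpoch_inf u u" by (rule qpoch_limit[OF u])
  show "total_trace (\<lambda>_. 1) t a b u = ennreal (phl_normalization a b t u)"
    using total_trace_limit[OF t u a b partial_factor_limit[OF t u a b] diag_trace_one[OF u]] q
    by (simp add: phl_normalization_eq mult.commute)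
  show "0 < phl_normalization a b t u"
    using kernel_product_ge_1[OF assms] q by (simp add: phl_normalization_eq)
qed

lemma kernel_product_split:
  assumes t: "0 \<le> t" "t < 1" and u: "0 \<le> u" "u < 1"
    and a: "\<forall>x\<in>set a. 0 \<le> x \<and> x < 1" and b: "\<forall>y\<in>set b. 0 \<le> y \<and> y < 1"
  shows "kernel_product t u a b = partial_factor t u a b L * kernel_product t u (map ((*) (u ^ L)) a) b"
proof (rule LIMSEQ_unique)
  show "(\<lambda>n. partial_factor t u a b (n + L)) \<longlonglongrightarrow> kernel_product t u a b"
    by (rule LIMSEQ_ignore_initial_segment[OF partial_factor_limit[OF assms]])
  have "partial_factor t u a b (n + L) = partial_factor t u a b L * partial_factor t u (map ((*) (u ^ L)) a) b n" for n
  proof -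
    have "(\<Prod>l<n + L. f l) = (\<Prod>l<L. f l) * (\<Prod>l<n. f (l + L))" for f :: "nat \<Rightarrow> real"
      by (induction n) (simp_all add: mult_ac)
    moreover have "map ((*) (u ^ l)) (map ((*) (u ^ L)) a) = map ((*) (u ^ (l + L))) a" for l
      by (simp add: power_add mult.assoc)
    ultimately show ?thesis unfolding partial_factor_def[OF t u] by (simp only:)
  qed
  then show "(\<lambda>n. partial_factor t u a b (n + L)) \<longlonglongrightarrow> partial_factor t u a b L * kernel_product t u (map ((*) (u ^ L)) a) b"
    using tendsto_mult[OF tendsto_const partial_factor_limit[OF t u scaled_params[OF t u a] b]] by presburger
qed

text \<open>A tail of a convergent product with nonzero limit: at parameters
  \<open>u ^ L * a\<close> one has the full product divided by its first \<open>L\<close>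
  factors.\<close>

lemma kernel_product_tendsto_1:
  assumes t: "0 \<le> t" "t < 1" and u: "0 \<le> u" "u < 1"
    and a: "\<forall>x\<in>set a. 0 \<le> x \<and> x < 1" and b: "\<forall>y\<in>set b. 0 \<le> y \<and> y < 1"
  shows "(\<lambda>L. kernel_product t u (map ((*) (u ^ L)) a) b) \<longlonglongrightarrow> 1"
proof -
  have nz: "kernel_product t u a b \<noteq> 0" "partial_factor t u a b L \<noteq> 0" for L
    using kernel_product_ge_1[OF assms] partial_factor_ge_1[OF assms, of L] by auto
  have "(\<lambda>L. kernel_product t u a b / partial_factor t u a b L) \<longlonglongrightarrow> kernel_product t u a b / kernel_product t u a b"
    by (intro tendsto_divide tendsto_const partial_factor_limit[OF assms] nz)
  moreover have "kernel_product t u a b / partial_factor t u a b L = kernel_product t u (map ((*) (u ^ L)) a) b" for L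
    using kernel_product_split[OF assms, of L] nz(2)[of L] by simp
  ultimately show ?thesis using nz(1) by simp
qed

section \<open>Output law of a rectangle\<close>

text \<open>The list \<open>l # h\<close> runs through the horizontal edges of the row, so entry
  \<open>i\<close> enters and entry \<open>i + 1\<close> leaves column \<open>i\<close>. Summing
  over the first inner edge reproduces the recursion of \<open>row_kernel\<close>.\<close>

lemma row_kernel_eq_sum:
  "length bo = length as \<Longrightarrow> length m = length as \<Longrightarrow>
    (\<Sum>h\<in>bits (length as). of_bool ((l # h) ! length as = r) *
      (\<Prod>i<length as. vertex_weight t (as ! i * b) (bo ! i) ((l # h) ! i) (m ! i) (h ! i))) =
    row_kernel t b as bo l m r"
proof (induction as arbitrary: bo l m)
  case Nil
  then show ?case by simp
next
  case (Cons a as)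
  obtain e' bo' where bo: "bo = e' # bo'" "length bo' = length as" using Cons.prems(1) by (cases bo) auto
  obtain e m' where m: "m = e # m'" "length m' = length as" using Cons.prems(2) by (cases m) auto
  have "of_bool ((l # x # h) ! Suc (length as) = r) *
      (\<Prod>i<Suc (length as). vertex_weight t ((a # as) ! i * b) ((e' # bo') ! i) ((l # x # h) ! i) ((e # m') ! i) ((x # h) ! i)) =
      vertex_weight t (a * b) e' l e x * (of_bool ((x # h) ! length as = r) *
      (\<Prod>i<length as. vertex_weight t (as ! i * b) (bo' ! i) ((x # h) ! i) (m' ! i) (h ! i)))" for x h
    unfolding prod.lessThan_Suc_shift by (simp add: mult_ac)
  then show ?case
    by (simp only: bo(1) m(1) list.size add_0_right add_Suc_right sum_bits_Suc sum_distrib_left[symmetric]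
        Cons.IH[OF bo(2) m(2)] row_kernel.simps)
qed

lemma finite_configs: "finite (configs M N bo le)"
proof (rule finite_subset)
  show "configs M N bo le \<subseteq> Pow ({..<M} \<times> {..N}) \<times> Pow ({..M} \<times> {..<N})"
    by (auto simp: configs_def)
qed simp

text \<open>Puts a new bottom row under \<open>c\<close>. Here \<open>h\<close> includes the left
  boundary edge, so it has \<open>M + 1\<close> entries; the vertical edges joining the new row to
  \<open>c\<close> are the bottom edges of \<open>c\<close> itself.\<close>

definition add_row :: "nat \<Rightarrow> bool list \<Rightarrow> bool list \<Rightarrow> config \<Rightarrow> config" where
  "add_row M bo h c =
     ({(i, 0) |i. i < M \<and> bo ! i} \<union> {(i, Suc j) |i j. (i, j) \<in> fst c},
      {(i, 0) |i. i \<le> M \<and> h ! i} \<union> {(i, Suc j) |i j. (i, j) \<in> snd c})"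

lemma add_row_simps [simp]:
  "(i, 0) \<in> fst (add_row M bo h c) \<longleftrightarrow> i < M \<and> bo ! i"
  "(i, Suc j) \<in> fst (add_row M bo h c) \<longleftrightarrow> (i, j) \<in> fst c"
  "(i, 0) \<in> snd (add_row M bo h c) \<longleftrightarrow> i \<le> M \<and> h ! i"
  "(i, Suc j) \<in> snd (add_row M bo h c) \<longleftrightarrow> (i, j) \<in> snd c"
  by (auto simp: add_row_def)

lemma configs_iff: "c \<in> configs M N bo le \<longleftrightarrow>
    (\<forall>i j. (i, j) \<in> fst c \<longrightarrow> i < M \<and> j \<le> N) \<and> (\<forall>i j. (i, j) \<in> snd c \<longrightarrow> i \<le> M \<and> j < N) \<and>
    (\<forall>i<M. (i, 0) \<in> fst c \<longleftrightarrow> bo ! i) \<and> (\<forall>j<N. (0, j) \<in> snd c \<longleftrightarrow> le ! j)"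
  by (cases c) (auto simp: configs_def)

lemma config_eqI:
  fixes c d :: config
  assumes "\<And>i j. (i, j) \<in> fst c \<longleftrightarrow> (i, j) \<in> fst d" "\<And>i j. (i, j) \<in> snd c \<longleftrightarrow> (i, j) \<in> snd d"
  shows "c = d"
  using assms by (cases c, cases d) auto

text \<open>A configuration is cut above its bottom row: \<open>m\<close> is the occupation of the
  vertical edges on the cut, \<open>h\<close> that of the horizontal edges in the row right of the
  boundary, and \<open>c\<close> is what lies above.\<close>

lemma sum_configs_Suc:
  fixes f :: "config \<Rightarrow> real"
  assumes "length bo = M"
  shows "sum f (configs M (Suc N) bo (l # le)) =
    (\<Sum>m\<in>bits M. \<Sum>h\<in>bits M. \<Sum>c\<in>configs M N m le. f (add_row M bo (l # h) c))"
proof -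
  define up where "up c = ({(i, j). (i, Suc j) \<in> fst c}, {(i, j). (i, Suc j) \<in> snd c})" for c :: config
  have up: "(i, j) \<in> fst (up c) \<longleftrightarrow> (i, Suc j) \<in> fst c" "(i, j) \<in> snd (up c) \<longleftrightarrow> (i, Suc j) \<in> snd c" for i j c
    by (simp_all add: up_def)
  define B where "B c = map (\<lambda>i. (i, 1) \<in> fst c) [0..<M]" for c :: config
  define R where "R c = map (\<lambda>i. (Suc i, 0) \<in> snd c) [0..<M]" for c :: config
  let ?S = "Sigma (bits M) (\<lambda>m. bits M \<times> configs M N m le)"
  have "sum f (configs M (Suc N) bo (l # le)) = (\<Sum>(m, h, c)\<in>?S. f (add_row M bo (l # h) c))"
  proof (rule sum.reindex_bij_witness[where j = "\<lambda>c. (B c, R c, up c)" and i = "\<lambda>(m, h, c). add_row M bo (l # h) c"])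
    fix c assume c: "c \<in> configs M (Suc N) bo (l # le)"
    have nth: "(l # R c) ! i \<longleftrightarrow> (i, 0) \<in> snd c" if "i \<le> M" for i
      using that c by (cases i) (auto simp: R_def configs_iff)
    have "add_row M bo (l # R c) (up c) = c"
    proof (rule config_eqI)
      fix i j
      show "(i, j) \<in> fst (add_row M bo (l # R c) (up c)) \<longleftrightarrow> (i, j) \<in> fst c"
        using c by (cases j; cases "i < M") (auto simp: configs_iff up)
      show "(i, j) \<in> snd (add_row M bo (l # R c) (up c)) \<longleftrightarrow> (i, j) \<in> snd c"
        using c nth[of i] by (cases j) (auto simp: configs_iff up)
    qed
    then show "(case (B c, R c, up c) of (m, h, c) \<Rightarrow> add_row M bo (l # h) c) = c"
      "(case (B c, R c, up c) of (m, h, c) \<Rightarrow> f (add_row M bo (l # h) c)) = f c" by simp_all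
    have "up c \<in> configs M N (B c) le"
      using c unfolding configs_iff up by (fastforce simp: B_def)
    then show "(B c, R c, up c) \<in> ?S" by (simp add: B_def R_def bits_def)
  next
    fix x assume "x \<in> ?S"
    then obtain m h c where x: "x = (m, h, c)" "length m = M" "length h = M" "c \<in> configs M N m le"
      by (auto simp: bits_def)
    have "B (add_row M bo (l # h) c) = m"
      using x by (intro nth_equalityI) (simp_all add: B_def configs_iff)
    moreover have "R (add_row M bo (l # h) c) = h"
      using x by (intro nth_equalityI) (simp_all add: R_def)
    moreover have "up (add_row M bo (l # h) c) = c"
      by (rule config_eqI) (simp_all add: up)
    ultimately show "(B (case x of (m, h, c) \<Rightarrow> add_row M bo (l # h) c),
        R (case x of (m, h, c) \<Rightarrow> add_row M bo (l # h) c), up (case x of (m, h, c) \<Rightarrow> add_row M bo (l # h) c)) = x"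
      by (simp add: x(1))
    have "add_row M bo (l # h) c \<in> configs M (Suc N) bo (l # le)"
      unfolding configs_iff
    proof (intro conjI allI impI)
      fix i j assume "(i, j) \<in> fst (add_row M bo (l # h) c)"
      then show "i < M" "j \<le> Suc N" using x(4) by (cases j; auto simp: configs_iff)+
    next
      fix i j assume "(i, j) \<in> snd (add_row M bo (l # h) c)"
      then show "i \<le> M" "j < Suc N" using x(4) by (cases j; auto simp: configs_iff)+
    next
      fix j assume "j < Suc N"
      then show "(0, j) \<in> snd (add_row M bo (l # h) c) \<longleftrightarrow> (l # le) ! j"
        using x(4) by (cases j) (auto simp: configs_iff)
    qed simp
    then show "(case x of (m, h, c) \<Rightarrow> add_row M bo (l # h) c) \<in> configs M (Suc N) bo (l # le)"
      by (simp add: x(1))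
  qed
  also have "\<dots> = (\<Sum>m\<in>bits M. \<Sum>h\<in>bits M. \<Sum>c\<in>configs M N m le. f (add_row M bo (l # h) c))"
    by (simp add: sum.Sigma[symmetric] finite_configs sum.cartesian_product[symmetric])
  finally show ?thesis .
qed

lemma config_weight_add_row:
  assumes "c \<in> configs (length as) N m le"
  shows "config_weight as (b # bs) t (add_row (length as) bo (l # h) c) =
    (\<Prod>i<length as. vertex_weight t (as ! i * b) (bo ! i) ((l # h) ! i) (m ! i) (h ! i)) * config_weight as bs t c"
proof -
  have cw: "config_weight as bs t c = (\<Prod>i<length as. \<Prod>j<length bs. vertex_weight t (as ! i * bs ! j)
      ((i, j) \<in> fst c) ((i, j) \<in> snd c) ((i, Suc j) \<in> fst c) ((Suc i, j) \<in> snd c))" for bs c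
    by (simp add: config_weight_def case_prod_unfold)
  show ?thesis
    unfolding cw list.size add_0_right add_Suc_right prod.lessThan_Suc_shift prod.distrib
    by (intro arg_cong2[where f = "(*)"] prod.cong refl) (use assms in \<open>simp_all add: configs_iff\<close>)
qed

lemma output_add_row:
  "top_output M (Suc N) (add_row M bo h c) = top_output M N c"
  "right_output M (Suc N) (add_row M bo h c) = h ! M # right_output M N c"
  by (simp_all add: top_output_def right_output_def case_prod_unfold map_Suc_upt[symmetric] upt_conv_Cons o_def del: upt_Suc map_Suc_upt)

lemma sum_config_weight:
  "length bo = length as \<Longrightarrow> length le = length bs \<Longrightarrow> length to = length as \<Longrightarrow> length ri = length bs \<Longrightarrow>
    (\<Sum>c\<in>configs (length as) (length bs) bo le. config_weight as bs t c *
      of_bool (top_output (length as) (length bs) c = to \<and> right_output (length as) (length bs) c = ri)) =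
    rect_kernel t as bs bo le to ri"
proof (induction bs arbitrary: bo le ri)
  case Nil
  let ?c = "({(i, 0) |i. i < length as \<and> bo ! i}, {}) :: config"
  have c: "configs (length as) 0 bo [] = {?c}"
  proof (intro set_eqI iffI)
    fix c assume "c \<in> configs (length as) 0 bo []"
    then have "(i, j) \<in> fst c \<longleftrightarrow> (i, j) \<in> fst ?c" "(i, j) \<in> snd c \<longleftrightarrow> (i, j) \<in> snd ?c" for i j
      unfolding configs_iff by (cases j; cases "i < length as"; auto)+
    then have "c = ?c" by (rule config_eqI)
    then show "c \<in> {?c}" by simp
  qed (auto simp: configs_iff)
  have "top_output (length as) 0 ?c = bo"
    using Nil by (intro nth_equalityI) (auto simp: top_output_def)
  moreover have "right_output (length as) 0 ?c = []" by (simp add: right_output_def)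
  moreover have "config_weight as [] t ?c = 1" by (simp add: config_weight_def)
  ultimately show ?case using Nil c by simp
next
  case (Cons b bs)
  obtain l le' where le: "le = l # le'" "length le' = length bs" using Cons.prems(2) by (cases le) auto
  obtain r ri' where ri: "ri = r # ri'" "length ri' = length bs" using Cons.prems(4) by (cases ri) auto
  let ?M = "length as"
  let ?vw = "\<lambda>m h. \<Prod>i<?M. vertex_weight t (as ! i * b) (bo ! i) ((l # h) ! i) (m ! i) (h ! i)"
  let ?out = "\<lambda>c. of_bool (top_output ?M (length bs) c = to \<and> right_output ?M (length bs) c = ri')"
  have "(\<Sum>c\<in>configs ?M (Suc (length bs)) bo (l # le'). config_weight as (b # bs) t c *
      of_bool (top_output ?M (Suc (length bs)) c = to \<and> right_output ?M (Suc (length bs)) c = r # ri')) =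
    (\<Sum>m\<in>bits ?M. \<Sum>h\<in>bits ?M. \<Sum>c\<in>configs ?M (length bs) m le'.
      (of_bool ((l # h) ! ?M = r) * ?vw m h) * (config_weight as bs t c * ?out c))"
    unfolding sum_configs_Suc[OF Cons.prems(1)] output_add_row
    by (intro sum.cong refl) (simp add: config_weight_add_row of_bool_conj mult_ac)
  also have "\<dots> = (\<Sum>m\<in>bits ?M. (\<Sum>h\<in>bits ?M. of_bool ((l # h) ! ?M = r) * ?vw m h) *
      (\<Sum>c\<in>configs ?M (length bs) m le'. config_weight as bs t c * ?out c))"
    by (simp only: sum_distrib_left[symmetric] sum_distrib_right[symmetric])
  also have "\<dots> = (\<Sum>m\<in>bits ?M. row_kernel t b as bo l m r * rect_kernel t as bs m le' to ri')"
    by (intro sum.cong refl arg_cong2[where f = "(*)"] row_kernel_eq_sum Cons.IH)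
       (use Cons.prems le ri in \<open>auto simp: bits_def\<close>)
  finally show ?case by (simp add: le ri)
qed

definition transfer :: "real list \<Rightarrow> real list \<Rightarrow> real \<Rightarrow> bool list \<Rightarrow> bool list \<Rightarrow> (bool list \<times> bool list) pmf" where
  "transfer a b t bo le = map_pmf (\<lambda>c. (top_output (length a) (length b) c, right_output (length a) (length b) c))
     (six_vertex a b t bo le)"

lemma sum_of_bool_outputs:
  assumes "x \<in> bits M" "y \<in> bits N"
  shows "(\<Sum>to\<in>bits M. \<Sum>ri\<in>bits N. of_bool (x = to \<and> y = ri)) = (1 :: 'a :: comm_semiring_1)"
proof -
  have "(\<Sum>z\<in>bits K. of_bool (w = z)) = (1 :: 'a)" if "w \<in> bits K" for w K
    using that by (simp add: Int_insert_right)
  then show ?thesis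
    by (simp only: of_bool_conj sum_distrib_left[symmetric] assms mult_1_right)
qed

lemma output_bits: "top_output M N c \<in> bits M" "right_output M N c \<in> bits N"
  by (simp_all add: bits_def top_output_def right_output_def case_prod_unfold)

text \<open>For \<open>embed_pmf\<close> to return the given weights their mass has to be 1.
  Grouping configurations by outputs reduces this to the stochasticity of the rectangle
  kernel.\<close>

lemma pmf_six_vertex:
  assumes t: "0 \<le> t" "t < 1" and a: "\<forall>x\<in>set a. 0 \<le> x \<and> x < 1" and b: "\<forall>y\<in>set b. 0 \<le> y \<and> y < 1"
    and bo: "length bo = length a" and le: "length le = length b"
  shows "pmf (six_vertex a b t bo le) c =
    (if c \<in> configs (length a) (length b) bo le then config_weight a b t c else 0)"
proof -
  let ?C = "configs (length a) (length b) bo le"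
  let ?M = "length a" and ?N = "length b"
  have nn: "0 \<le> config_weight a b t c" for c
    unfolding config_weight_def case_prod_unfold
  proof (intro prod_nonneg vertex_weight_nonneg t ballI)
    fix i j assume "i \<in> {..<length a}" "j \<in> {..<length b}"
    then have "0 \<le> a ! i" "a ! i < 1" "0 \<le> b ! j" "b ! j < 1" using a b by auto
    then show "0 \<le> a ! i * b ! j" "a ! i * b ! j < 1" using mult_strict_mono[of "a ! i" 1 "b ! j" 1] by auto
  qed
  have "(\<Sum>c\<in>?C. config_weight a b t c) = (\<Sum>c\<in>?C. \<Sum>to\<in>bits ?M. \<Sum>ri\<in>bits ?N.
      config_weight a b t c * of_bool (top_output ?M ?N c = to \<and> right_output ?M ?N c = ri))"
    by (simp only: sum_distrib_left[symmetric] sum_of_bool_outputs[OF output_bits] mult_1_right)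
  also have "\<dots> = (\<Sum>to\<in>bits ?M. \<Sum>c\<in>?C. \<Sum>ri\<in>bits ?N.
      config_weight a b t c * of_bool (top_output ?M ?N c = to \<and> right_output ?M ?N c = ri))"
    by (rule sum.swap)
  also have "\<dots> = (\<Sum>to\<in>bits ?M. \<Sum>ri\<in>bits ?N. \<Sum>c\<in>?C.
      config_weight a b t c * of_bool (top_output ?M ?N c = to \<and> right_output ?M ?N c = ri))"
    by (intro sum.cong refl sum.swap)
  also have "\<dots> = (\<Sum>to\<in>bits ?M. \<Sum>ri\<in>bits ?N. rect_kernel t a b bo le to ri)"
    by (intro sum.cong refl sum_config_weight bo le) (simp_all add: bits_def)
  also have "\<dots> = 1" by (rule rect_kernel_stochastic[OF bo le])
  finally have total: "(\<Sum>c\<in>?C. config_weight a b t c) = 1" .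
  have "esum (\<lambda>c. ennreal (if c \<in> ?C then config_weight a b t c else 0)) = (\<Sum>c\<in>?C. ennreal (config_weight a b t c))"
    by (subst nn_integral_count_space'[of ?C]) (simp_all add: finite_configs)
  also have "\<dots> = 1" using total nn by (simp add: sum_ennreal)
  finally show ?thesis unfolding six_vertex_def by (intro pmf_embed_pmf) (simp_all add: nn)
qed

lemma pmf_transfer:
  assumes "0 \<le> t" "t < 1" "\<forall>x\<in>set a. 0 \<le> x \<and> x < 1" "\<forall>y\<in>set b. 0 \<le> y \<and> y < 1"
    and bo: "length bo = length a" and le: "length le = length b"
  shows "pmf (transfer a b t bo le) (to, ri) =
    (if length to = length a \<and> length ri = length b then rect_kernel t a b bo le to ri else 0)"
proof (cases "length to = length a \<and> length ri = length b")
  case True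
  let ?C = "configs (length a) (length b) bo le" and ?M = "length a" and ?N = "length b"
  let ?A = "{c. top_output ?M ?N c = to \<and> right_output ?M ?N c = ri}"
  have "pmf (transfer a b t bo le) (to, ri) = measure_pmf.prob (six_vertex a b t bo le) ?A"
    by (simp add: transfer_def pmf_map vimage_def)
  also have "\<dots> = measure_pmf.prob (six_vertex a b t bo le) (?C \<inter> ?A)"
    by (rule measure_prob_cong_0) (auto simp: pmf_six_vertex[OF assms])
  also have "\<dots> = (\<Sum>c\<in>?C \<inter> ?A. config_weight a b t c)"
    by (subst measure_measure_pmf_finite) (auto simp: pmf_six_vertex[OF assms] finite_configs intro!: sum.cong)
  also have "\<dots> = (\<Sum>c\<in>?C. config_weight a b t c * of_bool (top_output ?M ?N c = to \<and> right_output ?M ?N c = ri))"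
    by (subst sum.inter_restrict[OF finite_configs]) (auto intro!: sum.cong)
  also have "\<dots> = rect_kernel t a b bo le to ri"
    using True by (intro sum_config_weight bo le) auto
  finally show ?thesis using True by simp
next
  case False
  have "(\<lambda>c. (top_output (length a) (length b) c, right_output (length a) (length b) c)) -` {(to, ri)} = {}"
    using False output_bits[of "length a" "length b"] by (auto simp: bits_def)
  then show ?thesis using False by (auto simp: transfer_def pmf_map)
qed

section \<open>Lengths in the periodic process\<close>

lemma esum_Cons:
  assumes "f [] = 0"
  shows "esum f = esum (\<lambda>y. esum (\<lambda>ys. f (y # ys)))"
proof -
  let ?c = "\<lambda>p. fst p # snd p"
  have "bij_betw ?c UNIV {xs. xs \<noteq> []}"
    by (rule bij_betw_byWitness[where f' = "\<lambda>xs. (hd xs, tl xs)"]) auto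
  from nn_integral_bij_count_space[OF this, of f]
  have "esum (\<lambda>p. f (?c p)) = (\<integral>\<^sup>+xs. f xs \<partial>count_space {xs. xs \<noteq> []})" .
  also have "\<dots> = esum f"
    using assms by (subst nn_integral_count_space_indicator) (auto intro!: nn_integral_cong simp: indicator_def)
  finally show ?thesis using nn_integral_fst_count_space[of "\<lambda>p. f (?c p)"] by simp
qed

fun path_weight :: "(real \<Rightarrow> bool \<Rightarrow> partition \<Rightarrow> partition \<Rightarrow> ennreal) \<Rightarrow> real list \<Rightarrow> bool list \<Rightarrow> partition list \<Rightarrow> ennreal" where
  "path_weight B [] [] [x] = 1"
| "path_weight B (a # as) (e # s) (x # y # ys) = B a e y x * path_weight B as s (y # ys)"
| "path_weight B _ _ _ = 0"

lemma esum_path_weight: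
  "esum (\<lambda>ls. path_weight B as s (mu # ls) * of_bool (last (mu # ls) = lam)) = chain_sum B as s mu lam"
proof (induction as arbitrary: s mu)
  case Nil
  show ?case
  proof (cases s)
    case Nil
    have "path_weight B [] [] (mu # ls) * of_bool (last (mu # ls) = lam) = of_bool (last (mu # ls) = lam) * of_bool (ls = [])" for ls
      by (cases ls) simp_all
    then show ?thesis using esum_single[of "\<lambda>ls. of_bool (last (mu # ls) = lam)" "[]"] by (simp add: Nil)
  next
    case (Cons e s')
    have "path_weight B [] (e # s') (mu # ls) = 0" for ls by (cases ls) simp_all
    then show ?thesis by (simp add: Cons)
  qed
next
  case (Cons a as)
  show ?case
  proof (cases s)
    case Nil
    have "path_weight B (a # as) [] (mu # ls) = 0" for ls by (cases ls) simp_all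
    then show ?thesis by (simp add: Nil)
  next
    case (Cons e s')
    have "esum (\<lambda>ls. path_weight B (a # as) (e # s') (mu # ls) * of_bool (last (mu # ls) = lam)) =
        esum (\<lambda>y. esum (\<lambda>ys. path_weight B (a # as) (e # s') (mu # y # ys) * of_bool (last (mu # y # ys) = lam)))"
      by (rule esum_Cons) simp
    also have "\<dots> = esum (\<lambda>y. esum (\<lambda>ys. B a e y mu * (path_weight B as s' (y # ys) * of_bool (last (y # ys) = lam))))"
      by (simp add: mult.assoc)
    also have "\<dots> = esum (\<lambda>y. B a e y mu * chain_sum B as s' y lam)"
      by (simp only: esum_cmult Cons.IH)
    finally show ?thesis by (simp only: Cons chain_sum.simps)
  qed
qed

lemma map_upt_Suc: "map f [0..<Suc n] = f 0 # map (\<lambda>i. f (Suc i)) [0..<n]"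
  by (simp add: map_Suc_upt[symmetric] upt_conv_Cons o_def del: upt_Suc map_Suc_upt)

lemma path_weight_eq:
  assumes B: "\<And>a e x y. B a e x y = ennreal (w a x y) * of_bool (J x y = e)"
    and w: "\<And>a x y. a \<in> set as \<Longrightarrow> 0 \<le> w a x y" and "length s = length as"
  shows "path_weight B as s lam =
    ennreal (if length lam = Suc (length as) then \<Prod>i<length as. w (as ! i) (lam ! Suc i) (lam ! i) else 0) *
    of_bool (map (\<lambda>i. J (lam ! Suc i) (lam ! i)) [0..<length lam - 1] = s)"
  using w assms(3)
proof (induction as arbitrary: s lam)
  case Nil
  then have s: "s = []" by simp
  show ?case unfolding s by (cases lam rule: remdups_adj.cases) simp_all
next
  case (Cons a as)
  obtain e s' where s: "s = e # s'" "length s' = length as" using Cons.prems(2) by (cases s) auto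
  show ?case
  proof (cases lam rule: remdups_adj.cases)
    case (3 x y ys)
    have l: "[0..<length (x # y # ys) - 1] = [0..<Suc (length ys)]" by simp
    have j: "map (\<lambda>i. J ((x # y # ys) ! Suc i) ((x # y # ys) ! i)) [0..<length (x # y # ys) - 1] =
        J y x # map (\<lambda>i. J ((y # ys) ! Suc i) ((y # ys) ! i)) [0..<length (y # ys) - 1]"
      unfolding l map_upt_Suc by simp
    have p: "(\<Prod>i<length (a # as). w ((a # as) ! i) ((x # y # ys) ! Suc i) ((x # y # ys) ! i)) =
        w a y x * (\<Prod>i<length as. w (as ! i) ((y # ys) ! Suc i) ((y # ys) ! i))"
      by (simp only: list.size add_0_right add_Suc_right prod.lessThan_Suc_shift nth_Cons_0 nth_Cons_Suc)
    have nn: "0 \<le> (\<Prod>i<length as. w (as ! i) ((y # ys) ! Suc i) ((y # ys) ! i))" "0 \<le> w a y x"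
      using Cons.prems(1) by (auto intro: prod_nonneg)
    have IH: "path_weight B as s' (y # ys) = ennreal (if length (y # ys) = Suc (length as)
        then \<Prod>i<length as. w (as ! i) ((y # ys) ! Suc i) ((y # ys) ! i) else 0) *
      of_bool (map (\<lambda>i. J ((y # ys) ! Suc i) ((y # ys) ! i)) [0..<length (y # ys) - 1] = s')"
      using Cons.prems(1) s(2) by (intro Cons.IH) auto
    show ?thesis
      unfolding 3 s(1) j p path_weight.simps IH B[of a e y x]
      using nn by (cases "length ys = length as") (simp_all add: ennreal_mult mult_ac)
  qed (simp_all add: s)
qed

text \<open>The common endpoint is inserted as a summation variable, which decouples the two
  paths.\<close>

lemma esum_join:
  fixes P :: "'a \<Rightarrow> ennreal" and Q :: "'b \<Rightarrow> ennreal" and l :: "'a \<Rightarrow> 'c"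
  shows "esum (\<lambda>x. esum (\<lambda>y. P x * Q y * of_bool (l x = k y))) =
    esum (\<lambda>z. esum (\<lambda>x. P x * of_bool (l x = z)) * esum (\<lambda>y. Q y * of_bool (k y = z)))"
proof -
  have "P x * Q y * of_bool (l x = k y) = esum (\<lambda>z. of_bool (l x = z) * (P x * Q y * of_bool (k y = z)))" for x y
    unfolding esum_single' by (simp add: eq_commute)
  then have "esum (\<lambda>x. esum (\<lambda>y. P x * Q y * of_bool (l x = k y))) =
      esum (\<lambda>x. esum (\<lambda>y. esum (\<lambda>z. of_bool (l x = z) * (P x * Q y * of_bool (k y = z)))))"
    by presburger
  also have "\<dots> = esum (\<lambda>x. esum (\<lambda>z. esum (\<lambda>y. of_bool (l x = z) * (P x * Q y * of_bool (k y = z)))))"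
    by (subst (2) esum_swap) simp
  also have "\<dots> = esum (\<lambda>z. esum (\<lambda>x. esum (\<lambda>y. of_bool (l x = z) * (P x * Q y * of_bool (k y = z)))))"
    by (rule esum_swap)
  also have "\<dots> = esum (\<lambda>z. esum (\<lambda>x. esum (\<lambda>y. (P x * of_bool (l x = z)) * (Q y * of_bool (k y = z)))))"
    by (simp add: mult_ac)
  finally show ?thesis by (simp only: esum_cmult esum_multc)
qed

definition observables :: "partition list \<times> partition list \<Rightarrow> nat \<times> bool list \<times> bool list" where
  "observables = (\<lambda>(lam, mu). (plength (lam ! 0), length_jumps lam, length_jumps_compl mu))"

definition observables_law :: "real list \<Rightarrow> real list \<Rightarrow> real \<Rightarrow> real \<Rightarrow> (nat \<times> bool list \<times> bool list) pmf" where
  "observables_law a b t u = map_pmf observables (periodic_hall_littlewood a b t u)"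

context
  fixes t u :: real and a b :: "real list"
  assumes t: "0 \<le> t" "t < 1" and u: "0 \<le> u" "u < 1"
    and a: "\<forall>x\<in>set a. 0 \<le> x \<and> x < 1" and b: "\<forall>y\<in>set b. 0 \<le> y \<and> y < 1"
begin

abbreviation "Z \<equiv> phl_normalization a b t u"

lemma Z_pos: "0 < Z"
  by (rule total_trace_eq_normalization[OF t u a b])

lemma weights_nonneg: "0 \<le> (\<Prod>i<length a. weight_P t (a ! i) (lam ! Suc i) (lam ! i))"
  "0 \<le> (\<Prod>j<length b. weight_Q t (b ! j) (mu ! Suc j) (mu ! j))"
  using a b by (auto intro!: prod_nonneg weight_nonneg t)

text \<open>The inclusions demanded by \<open>phl_sequences\<close> hold wherever the strip weights
  are nonzero, so only the list lengths and the matching of the ends remain as conditions.\<close>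

lemma phl_weight_eq:
  "phl_weight a b t u (lam, mu) =
    (if length lam = Suc (length a) \<and> length mu = Suc (length b) \<and> mu ! 0 = lam ! 0 \<and> mu ! length b = lam ! length a
     then u ^ psize (mu ! 0) / Z * (\<Prod>i<length a. weight_P t (a ! i) (lam ! Suc i) (lam ! i)) *
       (\<Prod>j<length b. weight_Q t (b ! j) (mu ! Suc j) (mu ! j)) else 0)"
proof -
  have P: "(\<Prod>i<length a. weight_P t (a ! i) (lam ! Suc i) (lam ! i)) = 0"
    if "i < length a" "\<not> diagram_subset (lam ! i) (lam ! Suc i)" for i
  proof (rule prod_zero)
    have "\<not> hstrip (lam ! Suc i) (lam ! i)" using that hstrip_subset by blast
    then show "\<exists>i\<in>{..<length a}. weight_P t (a ! i) (lam ! Suc i) (lam ! i) = 0"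
      using that(1) by (intro bexI[of _ i] weight_eq_0) auto
  qed simp
  have Q: "(\<Prod>j<length b. weight_Q t (b ! j) (mu ! Suc j) (mu ! j)) = 0"
    if "j < length b" "\<not> diagram_subset (mu ! j) (mu ! Suc j)" for j
  proof (rule prod_zero)
    have "\<not> hstrip (mu ! Suc j) (mu ! j)" using that hstrip_subset by blast
    then show "\<exists>j\<in>{..<length b}. weight_Q t (b ! j) (mu ! Suc j) (mu ! j) = 0"
      using that(1) by (intro bexI[of _ j] weight_eq_0) auto
  qed simp
  show ?thesis
    unfolding phl_weight_def phl_sequences_def using P Q
    by (auto simp: eval_skew_P[OF t] eval_skew_Q[OF t])
qed

lemma phl_weight_nonneg: "0 \<le> phl_weight a b t u p"
  using Z_pos u by (cases p) (simp add: phl_weight_eq weights_nonneg)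

lemma phl_weight_paths:
  assumes s: "length s1 = length a" "length s2 = length b"
  shows "ennreal (phl_weight a b t u (lam, mu)) * of_bool (length_jumps lam = s1 \<and> length_jumps_compl mu = s2) =
    of_bool (lam \<noteq> [] \<and> mu \<noteq> [] \<and> hd lam = hd mu \<and> last lam = last mu) *
      (ennreal (1 / Z) * ennreal (u ^ psize (hd lam)) * (path_weight (bit_P t) a s1 lam * path_weight (bit_Q t) b s2 mu))"
proof -
  let ?p = "\<Prod>i<length a. weight_P t (a ! i) (lam ! Suc i) (lam ! i)"
  let ?q = "\<Prod>j<length b. weight_Q t (b ! j) (mu ! Suc j) (mu ! j)"
  have P: "path_weight (bit_P t) a s1 lam = ennreal (if length lam = Suc (length a) then ?p else 0) *
      of_bool (length_jumps lam = s1)"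
    using path_weight_eq[of "bit_P t" "weight_P t" jumps a s1 lam] a s
    by (simp add: bit_P_def weight_nonneg t length_jumps_def jumps_def)
  have "length_jumps_compl mu = map (\<lambda>i. \<not> jumps (mu ! Suc i) (mu ! i)) [0..<length mu - 1]"
    by (simp add: length_jumps_compl_def length_jumps_def jumps_def)
  then have Q: "path_weight (bit_Q t) b s2 mu = ennreal (if length mu = Suc (length b) then ?q else 0) *
      of_bool (length_jumps_compl mu = s2)"
    using path_weight_eq[of "bit_Q t" "weight_Q t" "\<lambda>x y. \<not> jumps x y" b s2 mu] b s
    by (auto simp: bit_Q_def weight_nonneg t)
  show ?thesis
  proof (cases "length lam = Suc (length a) \<and> length mu = Suc (length b)")
    case True
    then have "lam \<noteq> []" "mu \<noteq> []" by auto
    then have e: "hd lam = lam ! 0" "hd mu = mu ! 0" "last lam = lam ! length a" "last mu = mu ! length b"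
      using True by (simp_all add: hd_conv_nth last_conv_nth)
    have m: "ennreal (u ^ n / Z * ?p * ?q) = ennreal (1 / Z) * ennreal (u ^ n) * (ennreal ?p * ennreal ?q)" for n
      using Z_pos u weights_nonneg by (simp add: ennreal_mult[symmetric])
    show ?thesis
      unfolding P Q phl_weight_eq using True m \<open>lam \<noteq> []\<close> \<open>mu \<noteq> []\<close>
      by (auto simp: e)
  qed (auto simp: P Q phl_weight_eq)
qed

lemma esum_paths:
  assumes s: "length s1 = length a" "length s2 = length b"
  shows "esum (\<lambda>p. ennreal (phl_weight a b t u p) *
      of_bool (length_jumps (fst p) = s1 \<and> length_jumps_compl (snd p) = s2) * g (hd (fst p))) =
    ennreal (1 / Z) * trace g t a b u s1 s2"
proof -
  let ?c = "\<lambda>x. ennreal (1 / Z) * (g x * ennreal (u ^ psize x))"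
  let ?P = "path_weight (bit_P t) a s1" and ?Q = "path_weight (bit_Q t) b s2"
  let ?G = "\<lambda>lam mu. of_bool (lam \<noteq> [] \<and> mu \<noteq> [] \<and> hd lam = hd mu \<and> last lam = last mu) *
      (?c (hd lam) * (?P lam * ?Q mu))"
  have "esum (\<lambda>p. ennreal (phl_weight a b t u p) *
      of_bool (length_jumps (fst p) = s1 \<and> length_jumps_compl (snd p) = s2) * g (hd (fst p))) =
    esum (\<lambda>p. ?G (fst p) (snd p))"
  proof (rule nn_integral_cong)
    fix p :: "partition list \<times> partition list"
    show "ennreal (phl_weight a b t u p) *
      of_bool (length_jumps (fst p) = s1 \<and> length_jumps_compl (snd p) = s2) * g (hd (fst p)) = ?G (fst p) (snd p)"
      using phl_weight_paths[OF s, of "fst p" "snd p"] by (simp add: mult_ac)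
  qed
  also have "\<dots> = esum (\<lambda>lam. esum (\<lambda>mu. ?G lam mu))"
    using nn_integral_fst_count_space[of "\<lambda>p. ?G (fst p) (snd p)"] by simp
  also have "\<dots> = esum (\<lambda>x. esum (\<lambda>ls. esum (\<lambda>mu. ?G (x # ls) mu)))"
    by (rule esum_Cons) simp
  also have "\<dots> = esum (\<lambda>x. esum (\<lambda>ls. esum (\<lambda>y. esum (\<lambda>ms. ?G (x # ls) (y # ms)))))"
    by (intro nn_integral_cong esum_Cons) simp
  also have "\<dots> = esum (\<lambda>x. esum (\<lambda>ls. esum (\<lambda>y. of_bool (x = y) *
      esum (\<lambda>ms. ?c x * (?P (x # ls) * ?Q (y # ms) * of_bool (last (x # ls) = last (y # ms)))))))"
    unfolding esum_cmult[symmetric] by (simp add: of_bool_conj mult_ac)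
  also have "\<dots> = esum (\<lambda>x. ?c x * esum (\<lambda>ls. esum (\<lambda>ms. ?P (x # ls) * ?Q (x # ms) * of_bool (last (x # ls) = last (x # ms)))))"
    by (simp only: esum_single' esum_cmult)
  also have "\<dots> = esum (\<lambda>x. ?c x * esum (\<lambda>k. chain_sum (bit_P t) a s1 x k * chain_sum (bit_Q t) b s2 x k))"
    by (simp only: esum_join esum_path_weight)
  also have "\<dots> = ennreal (1 / Z) * trace g t a b u s1 s2"
    unfolding trace_def by (simp only: mult.assoc esum_cmult)
  finally show ?thesis .
qed

lemma esum_phl_weight:
  "esum (\<lambda>p. ennreal (phl_weight a b t u p) * F (observables p)) =
    (\<Sum>s1\<in>bits (length a). \<Sum>s2\<in>bits (length b).
      ennreal (1 / Z) * trace (\<lambda>x. F (plength x, s1, s2)) t a b u s1 s2)"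
proof -
  have "ennreal (phl_weight a b t u p) * F (observables p) =
      (\<Sum>s1\<in>bits (length a). \<Sum>s2\<in>bits (length b). ennreal (phl_weight a b t u p) *
        of_bool (length_jumps (fst p) = s1 \<and> length_jumps_compl (snd p) = s2) * F (plength (hd (fst p)), s1, s2))" for p
  proof (cases "length (fst p) = Suc (length a) \<and> length (snd p) = Suc (length b)")
    case True
    then have b: "length_jumps (fst p) \<in> bits (length a)" "length_jumps_compl (snd p) \<in> bits (length b)"
      by (simp_all add: bits_def length_jumps_compl_def length_jumps_def)
    have "fst p \<noteq> []" using True by auto
    then have o: "observables p = (plength (hd (fst p)), length_jumps (fst p), length_jumps_compl (snd p))"
      by (simp add: observables_def case_prod_unfold hd_conv_nth)
    have "of_bool (length_jumps (fst p) = s1 \<and> length_jumps_compl (snd p) = s2) * F (plength (hd (fst p)), s1, s2) =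
        of_bool (length_jumps (fst p) = s1 \<and> length_jumps_compl (snd p) = s2) * F (observables p)" for s1 s2
      by (simp add: o)
    then show ?thesis
      by (simp only: mult.assoc sum_distrib_left[symmetric] sum_distrib_right[symmetric] sum_of_bool_outputs[OF b] mult_1_left)
  next
    case False
    then have "phl_weight a b t u p = 0" by (cases p) (auto simp: phl_weight_eq)
    then show ?thesis by simp
  qed
  then have "esum (\<lambda>p. ennreal (phl_weight a b t u p) * F (observables p)) =
      (\<Sum>s1\<in>bits (length a). \<Sum>s2\<in>bits (length b). esum (\<lambda>p. ennreal (phl_weight a b t u p) *
        of_bool (length_jumps (fst p) = s1 \<and> length_jumps_compl (snd p) = s2) * F (plength (hd (fst p)), s1, s2)))"
    by (simp only: esum_sum)
  also have "\<dots> = (\<Sum>s1\<in>bits (length a). \<Sum>s2\<in>bits (length b).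
      ennreal (1 / Z) * trace (\<lambda>x. F (plength x, s1, s2)) t a b u s1 s2)"
    by (intro sum.cong refl esum_paths) (simp_all add: bits_def)
  finally show ?thesis .
qed

text \<open>The mass of the weights is the total trace divided by the normalization constant, hence
  1.\<close>

lemma pmf_periodic_hall_littlewood: "pmf (periodic_hall_littlewood a b t u) p = phl_weight a b t u p"
  unfolding periodic_hall_littlewood_def
proof (rule pmf_embed_pmf[OF phl_weight_nonneg])
  have "esum (\<lambda>p. ennreal (phl_weight a b t u p)) = ennreal (1 / Z) * total_trace (\<lambda>_. 1) t a b u"
    using esum_phl_weight[of "\<lambda>_. 1"] by (simp add: total_trace_def sum_distrib_left)
  also have "\<dots> = 1"
    unfolding total_trace_eq_normalization(1)[OF t u a b] using Z_pos by (simp add: ennreal_mult[symmetric])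
  finally show "esum (\<lambda>p. ennreal (phl_weight a b t u p)) = 1" .
qed

lemma nn_integral_observables_law:
  "(\<integral>\<^sup>+x. F x \<partial>observables_law a b t u) =
    (\<Sum>s1\<in>bits (length a). \<Sum>s2\<in>bits (length b).
      ennreal (1 / Z) * trace (\<lambda>x. F (plength x, s1, s2)) t a b u s1 s2)"
  unfolding observables_law_def nn_integral_map_pmf
  unfolding nn_integral_measure_pmf pmf_periodic_hall_littlewood
  by (rule esum_phl_weight)

lemma pmf_observables_law:
  "ennreal (pmf (observables_law a b t u) (n, s1, s2)) =
    (if length s1 = length a \<and> length s2 = length b
     then ennreal (1 / Z) * trace (\<lambda>x. of_bool (plength x = n)) t a b u s1 s2 else 0)"
proof -
  let ?T = "\<lambda>r1 r2. ennreal (1 / Z) * trace (\<lambda>x. of_bool (plength x = n)) t a b u r1 r2"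
  have "ennreal (pmf (observables_law a b t u) (n, s1, s2)) =
      (\<integral>\<^sup>+x. of_bool (x = (n, s1, s2)) \<partial>observables_law a b t u)"
    using nn_integral_indicator[of "{(n, s1, s2)}" "observables_law a b t u"]
    by (simp add: emeasure_pmf_single indicator_def of_bool_def if_distrib)
  also have "\<dots> = (\<Sum>r1\<in>bits (length a). \<Sum>r2\<in>bits (length b). of_bool (s1 = r1 \<and> s2 = r2) * ?T s1 s2)"
    unfolding nn_integral_observables_law
  proof (intro sum.cong refl)
    fix r1 r2
    show "ennreal (1 / Z) * trace (\<lambda>x. of_bool ((plength x, r1, r2) = (n, s1, s2))) t a b u r1 r2 =
        of_bool (s1 = r1 \<and> s2 = r2) * ?T s1 s2"
      by (cases "s1 = r1 \<and> s2 = r2") (auto simp: trace_def)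
  qed
  also have "\<dots> = (\<Sum>r1\<in>bits (length a). \<Sum>r2\<in>bits (length b). of_bool (s1 = r1 \<and> s2 = r2)) * ?T s1 s2"
    by (simp only: sum_distrib_right)
  also have "\<dots> = (if length s1 = length a \<and> length s2 = length b then ?T s1 s2 else 0)"
  proof (cases "length s1 = length a \<and> length s2 = length b")
    case True
    then have "(\<Sum>r1\<in>bits (length a). \<Sum>r2\<in>bits (length b). of_bool (s1 = r1 \<and> s2 = r2)) = (1 :: ennreal)"
      by (intro sum_of_bool_outputs) (simp_all add: bits_def)
    then show ?thesis using True by (simp only: if_True mult_1_left simp_thms)
  next
    case False
    then have "(\<Sum>r1\<in>bits (length a). \<Sum>r2\<in>bits (length b). of_bool (s1 = r1 \<and> s2 = r2)) = (0 :: ennreal)"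
      by (intro sum.neutral ballI) (auto simp: bits_def)
    then show ?thesis using False by auto
  qed
  finally show ?thesis .
qed

end

section \<open>The limit of long quasi-periodic models\<close>

lemma integrable_pmf_bounded:
  fixes f :: "'a \<Rightarrow> real"
  assumes "\<And>x. \<bar>f x\<bar> \<le> C"
  shows "integrable (measure_pmf p) f"
  by (rule measure_pmf.integrable_const_bound[where B = C]) (use assms in auto)

lemma expectation_le_of_pmf_le:
  fixes g h :: "'a \<Rightarrow> real"
  assumes le: "\<And>x. pmf q x * g x \<le> pmf p x * h x"
    and g: "\<And>x. 0 \<le> g x" "\<And>x. g x \<le> C" and h: "\<And>x. 0 \<le> h x" "\<And>x. h x \<le> C"
  shows "measure_pmf.expectation q g \<le> measure_pmf.expectation p h"
proof -
  have i: "integrable (measure_pmf q) g" "integrable (measure_pmf p) h"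
    by (rule integrable_pmf_bounded[of _ C], use g h in simp)+
  have "ennreal (measure_pmf.expectation q g) = (\<integral>\<^sup>+x. ennreal (g x) \<partial>q)"
    by (rule nn_integral_eq_integral[symmetric]) (use i g in auto)
  also have "\<dots> \<le> (\<integral>\<^sup>+x. ennreal (h x) \<partial>p)"
    unfolding nn_integral_measure_pmf
    by (rule esum_mono) (use le g h in \<open>simp add: ennreal_mult[symmetric] ennreal_leI\<close>)
  also have "\<dots> = ennreal (measure_pmf.expectation p h)"
    by (rule nn_integral_eq_integral) (use i h in auto)
  finally show ?thesis
    by (subst (asm) ennreal_le_iff) (auto intro!: Bochner_Integration.integral_nonneg h)
qed

text \<open>Scheffe's argument: the defect \<open>r\<close> of \<open>X L\<close> below \<open>Y\<close> tends to 0 in \<open>L\<^sup>1(Y)\<close> by dominated convergence.\<close>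

lemma pmf_tendsto_imp_converges_in_distribution:
  assumes lim: "\<And>x. (\<lambda>L. pmf (X L) x) \<longlonglongrightarrow> pmf Y x"
  shows "converges_in_distribution X Y"
  unfolding converges_in_distribution_def
proof (intro allI impI)
  fix f :: "'a \<Rightarrow> real" assume "bounded (range f)"
  then obtain C where "\<forall>y\<in>range f. norm y \<le> C" unfolding bounded_iff by blast
  then have C: "\<bar>f x\<bar> \<le> C" for x by auto
  define r where "r L x = max 0 (1 - pmf (X L) x / pmf Y x)" for L x
  have r: "0 \<le> r L x" "r L x \<le> 1" for L x by (simp_all add: r_def)
  let ?e = "\<lambda>L. measure_pmf.expectation Y (r L)"
  have rY: "pmf Y x * (1 - r L x) \<le> pmf (X L) x" for L x
  proof (cases "pmf Y x = 0")
    case False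
    then have "0 < pmf Y x" by (simp add: less_le)
    then show ?thesis by (simp add: r_def max_def field_simps)
  qed simp
  \<comment> \<open>A one-sided estimate for nonnegative \<open>g\<close> suffices, because it is
    applied to both \<open>f + C\<close> and \<open>C - f\<close>, which are bounded by
    \<open>2 * C\<close>.\<close>
  have lower: "measure_pmf.expectation Y g - 2 * C * ?e L \<le> measure_pmf.expectation (X L) g"
    if g: "\<And>x. 0 \<le> g x" "\<And>x. g x \<le> 2 * C" for g :: "'a \<Rightarrow> real" and L
  proof -
    have ig: "integrable (measure_pmf Y) g" by (rule integrable_pmf_bounded[of _ "2 * C"]) (use g in simp)
    have ir: "integrable (measure_pmf Y) (r L)" by (rule integrable_pmf_bounded[of _ 1]) (use r in simp)
    have igr: "integrable (measure_pmf Y) (\<lambda>x. g x * (1 - r L x))"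
      by (rule integrable_pmf_bounded[of _ "2 * C"]) (use mult_mono[OF g(2), of "1 - r L _" 1] r g order_trans[OF g] in \<open>simp add: abs_mult\<close>)
    have "measure_pmf.expectation Y g - 2 * C * ?e L = measure_pmf.expectation Y (\<lambda>x. g x - 2 * C * r L x)"
      using ig ir by simp
    also have "\<dots> \<le> measure_pmf.expectation Y (\<lambda>x. g x * (1 - r L x))"
    proof (rule integral_mono)
      fix x show "g x - 2 * C * r L x \<le> g x * (1 - r L x)"
        using mult_right_mono[OF g(2)[of x] r(1)[of L x]] by (simp add: algebra_simps)
    qed (use ig ir igr in simp_all)
    also have "\<dots> \<le> measure_pmf.expectation (X L) g"
    proof (rule expectation_le_of_pmf_le)
      fix x
      show "pmf Y x * (g x * (1 - r L x)) \<le> pmf (X L) x * g x"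
        using mult_right_mono[OF rY[of x L] g(1)[of x]] by (simp add: mult_ac)
      show "0 \<le> g x * (1 - r L x)" using g r by simp
      show "g x * (1 - r L x) \<le> 2 * C"
        using mult_left_mono[of "1 - r L x" 1 "g x"] g[of x] r[of L x] by simp
    qed (use g in auto)
    finally show ?thesis .
  qed
  have "?e \<longlonglongrightarrow> measure_pmf.expectation Y (\<lambda>_. 0)"
  proof (rule integral_dominated_convergence[where w = "\<lambda>_. 1"])
    show "AE x in measure_pmf Y. (\<lambda>L. r L x) \<longlonglongrightarrow> 0"
    proof (rule AE_pmfI)
      fix x assume "x \<in> set_pmf Y"
      then have nz: "pmf Y x \<noteq> 0" by (simp add: set_pmf_iff)
      have "(\<lambda>L. max 0 (1 - pmf (X L) x / pmf Y x)) \<longlonglongrightarrow> max 0 (1 - pmf Y x / pmf Y x)"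
        by (intro tendsto_intros lim nz)
      then show "(\<lambda>L. r L x) \<longlonglongrightarrow> 0" using nz by (simp add: r_def)
    qed
  qed (use r in auto)
  then have e0: "(\<lambda>L. 2 * C * ?e L) \<longlonglongrightarrow> 0" using tendsto_mult_right_zero[of ?e] by simp
  have i: "integrable (measure_pmf p) f" for p by (rule integrable_pmf_bounded[OF C])
  have bound: "norm (measure_pmf.expectation (X L) f - measure_pmf.expectation Y f) \<le> 2 * C * ?e L" for L
  proof -
    have "0 \<le> f x + C" "f x + C \<le> 2 * C" "0 \<le> C - f x" "C - f x \<le> 2 * C" for x using C[of x] by auto
    then show ?thesis
      using lower[of "\<lambda>x. f x + C" L] lower[of "\<lambda>x. C - f x" L] i by simp
  qed
  have "(\<lambda>L. measure_pmf.expectation (X L) f - measure_pmf.expectation Y f) \<longlonglongrightarrow> 0"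
    by (rule Lim_null_comparison[OF always_eventually e0]) (use bound in blast)
  then show "(\<lambda>L. measure_pmf.expectation (X L) f) \<longlonglongrightarrow> measure_pmf.expectation Y f"
    by (rule LIM_zero_cancel)
qed

section \<open>Minorization, convolution and deconvolution\<close>

lemma prob_ge_of_pmf_ge:
  assumes "0 \<le> c" "\<And>x. c * pmf q x \<le> pmf p x"
  shows "c * measure_pmf.prob q A \<le> measure_pmf.prob p A"
proof -
  have "ennreal c * emeasure q A \<le> emeasure p A"
    unfolding nn_integral_pmf[symmetric] nn_integral_cmult[symmetric, OF borel_measurable_count_space]
    by (rule nn_integral_mono) (use assms in \<open>simp add: ennreal_mult[symmetric] ennreal_leI\<close>)
  then show ?thesis
    using assms(1) by (simp add: measure_pmf.emeasure_eq_measure ennreal_mult[symmetric])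
qed

text \<open>Under the minorization the two laws share a mass of at least \<open>c\<close>. One
  direction uses the domination at \<open>x\<close>, the other its version for the complement of
  \<open>x\<close>.\<close>

lemma pmf_diff_le:
  assumes c: "0 \<le> c" "c \<le> 1" and dom: "\<And>x. c * pmf q x \<le> pmf p x"
  shows "\<bar>pmf q x - pmf p x\<bar> \<le> 1 - c"
proof -
  have "c * (1 - pmf q x) \<le> 1 - pmf p x"
    using prob_ge_of_pmf_ge[OF c(1) dom, of "UNIV - {x}"] measure_pmf.prob_compl[of "{x}" p] measure_pmf.prob_compl[of "{x}" q]
    by (simp add: measure_pmf_single)
  moreover have "c * pmf q x \<le> pmf q x" using c by (simp add: mult_left_le_one_le)
  moreover have "(1 - c) * pmf q x \<le> 1 - c" using c mult_left_mono[OF pmf_le_1[of q x], of "1 - c"] by simp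
  ultimately show ?thesis using dom[of x] by (simp add: algebra_simps abs_le_iff)
qed

text \<open>A minorization of initial laws survives running the same Markov kernel from
  both.\<close>

lemma pmf_bind_ge:
  assumes c: "0 \<le> c" and dom: "\<And>x. c * pmf q x \<le> pmf p x"
  shows "c * pmf (bind_pmf q R) y \<le> pmf (bind_pmf p R) y"
proof -
  have "ennreal (c * pmf (bind_pmf q R) y) = ennreal c * (\<integral>\<^sup>+x. ennreal (pmf (R x) y) \<partial>q)"
    unfolding ennreal_pmf_bind[symmetric] using c by (simp add: ennreal_mult)
  also have "\<dots> \<le> (\<integral>\<^sup>+x. ennreal (pmf (R x) y) \<partial>p)"
    unfolding nn_integral_measure_pmf esum_cmult[symmetric]
  proof (rule esum_mono)
    fix x
    show "ennreal c * (ennreal (pmf q x) * ennreal (pmf (R x) y)) \<le> ennreal (pmf p x) * ennreal (pmf (R x) y)"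
      using c dom[of x] by (simp add: ennreal_mult[symmetric] ennreal_leI mult_right_mono flip: mult.assoc)
  qed
  finally show ?thesis unfolding ennreal_pmf_bind[symmetric] by simp
qed

lemma convolution_eq_esum:
  fixes n :: nat
  shows   "(\<Sum>k\<le>n. f k * h (n - k)) = esum (\<lambda>k. esum (\<lambda>m. f k * h m * of_bool (k + m = n)))"
proof -
  have "esum (\<lambda>m. f k * h m * of_bool (k + m = n)) = (if k \<le> n then f k * h (n - k) else 0)" for k
  proof (cases "k \<le> n")
    case True
    then have "k + m = n \<longleftrightarrow> m = n - k" for m by auto
    then show ?thesis using True esum_single[of "\<lambda>m. f k * h m" "n - k"] by simp
  qed simp
  then show ?thesis by (subst nn_integral_count_space'[of "{..n}"]) simp_all
qed

lemma esum_convolution: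
  fixes f h :: "nat \<Rightarrow> ennreal"
  shows   "esum (\<lambda>n. \<Sum>k\<le>n. f k * h (n - k)) = esum f * esum h"
proof -
  have "esum (\<lambda>n. \<Sum>k\<le>n. f k * h (n - k)) = esum (\<lambda>k. esum (\<lambda>n. esum (\<lambda>m. f k * h m * of_bool (k + m = n))))"
    unfolding convolution_eq_esum by (rule esum_swap)
  also have "\<dots> = esum (\<lambda>k. esum (\<lambda>m. esum (\<lambda>n. of_bool (k + m = n) * (f k * h m))))"
    by (subst (2) esum_swap) (simp add: mult.commute)
  also have "\<dots> = esum f * esum h"
    by (simp only: esum_single' esum_cmult esum_multc)
  finally show ?thesis .
qed

lemma pmf_shift:
  fixes k n :: nat
  shows "pmf (map_pmf (\<lambda>(W, y). (k + W, y)) law) (n, y) = (if k \<le> n then pmf law (n - k, y) else 0)"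
proof (cases "k \<le> n")
  case True
  then have "(\<lambda>(W, y). (k + W, y)) -` {(n, y)} = {(n - k, y)}" by auto
  then show ?thesis using True by (simp add: pmf_map measure_pmf_single)
next
  case False
  then have "(\<lambda>(W, y). (k + W, y)) -` {(n, y)} = {}" by auto
  then show ?thesis using False by (simp add: pmf_map)
qed

lemma pmf_bind_shift:
  fixes n :: nat
  shows   "pmf (bind_pmf p (\<lambda>k. map_pmf (\<lambda>(W, y). (k + W, y)) law)) (n, y) = (\<Sum>k\<le>n. pmf p k * pmf law (n - k, y))"
proof -
  have "ennreal (pmf (bind_pmf p (\<lambda>k. map_pmf (\<lambda>(W, y). (k + W, y)) law)) (n, y)) =
      esum (\<lambda>k. ennreal (pmf p k) * ennreal (if k \<le> n then pmf law (n - k, y) else 0))"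
    unfolding ennreal_pmf_bind nn_integral_measure_pmf pmf_shift ..
  also have "\<dots> = (\<Sum>k\<le>n. ennreal (pmf p k * pmf law (n - k, y)))"
    by (subst nn_integral_count_space'[of "{..n}"]) (simp_all add: ennreal_mult)
  also have "\<dots> = ennreal (\<Sum>k\<le>n. pmf p k * pmf law (n - k, y))" by (simp add: sum_ennreal)
  finally show ?thesis by (simp add: sum_nonneg)
qed

lemma prob_pair_pmf_sum:
  fixes n :: nat
  shows   "measure_pmf.prob (pair_pmf law p) {((W, S1, S2), chi). W + chi = n \<and> S1 = s1 \<and> S2 = s2} =
    (\<Sum>k\<le>n. pmf p k * pmf law (n - k, s1, s2))"
proof -
  have e: "{((W, S1, S2), chi). W + chi = n \<and> S1 = s1 \<and> S2 = s2} = (\<lambda>k. ((n - k, s1, s2), k)) ` {..n}" by (auto simp: image_iff)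
  have "inj_on (\<lambda>k. ((n - k, s1, s2), k)) {..n}" by (auto simp: inj_on_def)
  then show ?thesis
    unfolding e by (simp add: measure_measure_pmf_finite sum.reindex pmf_pair mult.commute)
qed

text \<open>Convolution is triangular in \<open>n\<close> with diagonal entry \<open>g 0\<close>, so
  each entry of \<open>q\<close> is recovered from finitely many convergent ones.\<close>

lemma convergent_deconvolution:
  fixes g :: "nat \<Rightarrow> real"
  assumes g: "g 0 \<noteq> 0" and conv: "\<And>n. convergent (\<lambda>L. \<Sum>k\<le>n. g k * q L (n - k))"
  shows "convergent (\<lambda>L. q L n)"
proof (induction n rule: less_induct)
  case (less n)
  have "{..n} = insert 0 {1..n}" by auto
  then have "q L n = ((\<Sum>k\<le>n. g k * q L (n - k)) - (\<Sum>k\<in>{1..n}. g k * q L (n - k))) / g 0" for L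
    using g by simp
  moreover have "convergent (\<lambda>L. ((\<Sum>k\<le>n. g k * q L (n - k)) - (\<Sum>k\<in>{1..n}. g k * q L (n - k))) * (1 / g 0))"
  proof (intro convergent_diff conv convergent_const convergent_sum convergent_mult)
    fix k assume "k \<in> {1..n}"
    then show "convergent (\<lambda>L. q L (n - k))" by (intro less) auto
  qed
  ultimately show ?case by simp
qed

text \<open>The weights sum to 1 by counting all partitions once according to their length and once
  in total.\<close>

lemma pmf_u_geometric:
  assumes u: "0 \<le> u" "u < 1"
  shows "pmf (u_geometric u) k = u ^ k * (qpoch_inf u u / qpoch u u k)"
  unfolding u_geometric_def
proof (rule pmf_embed_pmf)
  note q = qpoch_limit(2)[OF u] qpoch_pos[OF u]
  show "0 \<le> u ^ k * (qpoch_inf u u / qpoch u u k)" for k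
    using u q(1) q(2)[of k] by (intro mult_nonneg_nonneg divide_nonneg_nonneg) auto
  have "ennreal (u ^ k * (qpoch_inf u u / qpoch u u k)) = ennreal (qpoch_inf u u) * diag_trace (\<lambda>mu. of_bool (plength mu = k)) u" for k
    unfolding diag_trace_plength[OF u] using u q(1) q(2)[of k] by (subst ennreal_mult[symmetric]) (auto simp: mult_ac)
  then have "esum (\<lambda>k. ennreal (u ^ k * (qpoch_inf u u / qpoch u u k))) =
      ennreal (qpoch_inf u u) * esum (\<lambda>k. esum (\<lambda>mu. of_bool (plength mu = k) * ennreal (u ^ psize mu)))"
    by (simp only: esum_cmult diag_trace_def)
  also have "\<dots> = ennreal (qpoch_inf u u) * diag_trace (\<lambda>_. 1) u"
    by (subst esum_swap) (simp only: esum_single' diag_trace_def mult_1_left)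
  also have "\<dots> = 1" unfolding diag_trace_one[OF u] using q(1) by (subst ennreal_mult[symmetric]) auto
  finally show "esum (\<lambda>k. ennreal (u ^ k * (qpoch_inf u u / qpoch u u k))) = 1" .
qed

definition rect_step :: "real \<Rightarrow> real list \<Rightarrow> real list \<Rightarrow> nat \<times> bool list \<times> bool list \<Rightarrow> (nat \<times> bool list \<times> bool list) pmf" where
  "rect_step t a b = (\<lambda>(w, bo, le). map_pmf (\<lambda>y. (w + count_list bo True, y)) (transfer a b t bo le))"

lemma run_rectangles_Suc:
  "run_rectangles a b t u (Suc l) s = rect_step t (map ((*) (u ^ l)) a) b s \<bind> run_rectangles a b t u l"
  by (cases s) (simp add: rect_step_def transfer_def bind_map_pmf)

text \<open>The winding counter is only added to and never influences the arrows, so its starting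
  value is a translation. Starting it at a u-geometric value thus amounts to adding an independent
  such variable to \<open>W\<close>.\<close>

lemma run_rectangles_shift:
  "run_rectangles a b t u L (k + w, x) = map_pmf (\<lambda>(W, y). (k + W, y)) (run_rectangles a b t u L (w, x))"
proof (induction L arbitrary: w x)
  case (Suc L)
  then show ?case by (cases x) (simp add: map_bind_pmf add.assoc)
qed simp

lemma pmf_rect_step:
  assumes "0 \<le> t" "t < 1" "\<forall>x\<in>set a. 0 \<le> x \<and> x < 1" "\<forall>y\<in>set b. 0 \<le> y \<and> y < 1"
    and "length bo = length a" "length le = length b"
  shows "pmf (rect_step t a b (w, bo, le)) (n, s1, s2) = of_bool (w + count_list bo True = n) *
    (if length s1 = length a \<and> length s2 = length b then rect_kernel t a b bo le s1 s2 else 0)"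
proof -
  have "(\<lambda>y. (w + count_list bo True, y)) -` {(n, s1, s2)} = (if w + count_list bo True = n then {(s1, s2)} else {})"
    by auto
  then show ?thesis by (simp add: rect_step_def pmf_map measure_pmf_single pmf_transfer[OF assms])
qed

lemma trace_cmult: "trace (\<lambda>x. c * g x) t a b u s1 s2 = c * trace g t a b u s1 s2"
  unfolding trace_def by (simp only: mult.assoc esum_cmult)

lemma trace_ge_diag:
  "diag_trace g u \<le> trace g t a b u (replicate (length a) False) (replicate (length b) True)"
  unfolding diag_trace_def trace_def
proof (rule esum_mono)
  fix mu
  let ?f = "\<lambda>lam. chain_sum (bit_P t) a (replicate (length a) False) mu lam *
    chain_sum (bit_Q t) b (replicate (length b) True) mu lam"
  have "1 \<le> esum ?f"
    using nn_integral_ge_point[of mu UNIV ?f]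
    by (simp add: chain_sum_diag[OF step_weight_P] chain_sum_diag[OF step_weight_Q])
  then show "g mu * ennreal (u ^ psize mu) \<le> g mu * ennreal (u ^ psize mu) * esum ?f"
    using mult_left_mono[of 1 "esum ?f" "g mu * ennreal (u ^ psize mu)"] by simp
qed

context
  fixes t u :: real and b :: "real list"
  assumes t: "0 \<le> t" "t < 1" and u: "0 \<le> u" "u < 1"
    and b: "\<forall>y\<in>set b. 0 \<le> y \<and> y < 1"
begin

text \<open>The trace exchange after normalization; the normalizations at \<open>a\<close> and
  \<open>u * a\<close> differ by \<open>rect_factor\<close>. The counter of \<open>rect_step\<close>
  plays the role of the starting length.\<close>

lemma observables_law_step:
  assumes a: "\<forall>x\<in>set a. 0 \<le> x \<and> x < 1"
  shows "observables_law a b t u = observables_law (map ((*) u) a) b t u \<bind> rect_step t a b"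
proof (rule pmf_eqI)
  fix x :: "nat \<times> bool list \<times> bool list"
  obtain n s1 s2 where x: "x = (n, s1, s2)" by (cases x)
  let ?a = "map ((*) u) a"
  have a': "\<forall>x\<in>set ?a. 0 \<le> x \<and> x < 1" using scaled_params[OF t u a, of 1] by simp
  define Z where "Z = phl_normalization a b t u"
  define Z' where "Z' = phl_normalization ?a b t u"
  define rf where "rf = rect_factor t a b"
  have pos: "0 < Z" "0 < Z'" "1 \<le> rf"
    unfolding Z_def Z'_def rf_def
    using total_trace_eq_normalization(2)[OF t u a b] total_trace_eq_normalization(2)[OF t u a' b] rect_factor_ge_1[OF t(2) a b]
    by auto
  have "ennreal Z = ennreal (rf * Z')"
    using total_trace_eq[OF t u a b] pos
    unfolding total_trace_eq_normalization(1)[OF t u a b] total_trace_eq_normalization(1)[OF t u a' b]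
    by (simp add: Z_def Z'_def rf_def ennreal_mult)
  then have Z: "Z = rf * Z'" using pos by (simp add: ennreal_inj)
  let ?k = "\<lambda>r1 r2. if length s1 = length a \<and> length s2 = length b then rect_kernel t a b r1 r2 s1 s2 else 0"
  let ?T = "\<lambda>r1 r2. trace (\<lambda>x. of_bool (plength x + count_list r1 True = n)) t ?a b u r1 r2"
  have "ennreal (pmf (observables_law ?a b t u \<bind> rect_step t a b) (n, s1, s2)) =
      (\<Sum>r1\<in>bits (length a). \<Sum>r2\<in>bits (length b). ennreal (1 / Z') *
        trace (\<lambda>x. ennreal (pmf (rect_step t a b (plength x, r1, r2)) (n, s1, s2))) t ?a b u r1 r2)"
    unfolding ennreal_pmf_bind nn_integral_observables_law[OF t u a' b] Z'_def by simp
  also have "\<dots> = (\<Sum>r1\<in>bits (length a). \<Sum>r2\<in>bits (length b). ennreal (1 / Z') * (ennreal (?k r1 r2) * ?T r1 r2))"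
  proof (intro sum.cong refl arg_cong2[where f = "(*)"])
    fix r1 r2 assume "r1 \<in> bits (length a)" "r2 \<in> bits (length b)"
    then have r: "length r1 = length a" "length r2 = length b" by (simp_all add: bits_def)
    have "ennreal (of_bool P * c) = ennreal c * of_bool P" for P c by simp
    then show "trace (\<lambda>x. ennreal (pmf (rect_step t a b (plength x, r1, r2)) (n, s1, s2))) t ?a b u r1 r2 =
        ennreal (?k r1 r2) * ?T r1 r2"
      by (simp only: pmf_rect_step[OF t a b r] trace_cmult)
  qed
  also have "\<dots> = ennreal (pmf (observables_law a b t u) (n, s1, s2))"
  proof (cases "length s1 = length a \<and> length s2 = length b")
    case True
    have "ennreal (pmf (observables_law a b t u) (n, s1, s2)) = ennreal (1 / Z) * (ennreal rf *
        (\<Sum>r1\<in>bits (length a). \<Sum>r2\<in>bits (length b). ennreal (rect_kernel t a b r1 r2 s1 s2) * ?T r1 r2))"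
      using True trace_exchange_plength[OF t u a b, of s1 s2 n]
      by (simp add: pmf_observables_law[OF t u a b] Z_def rf_def)
    also have "\<dots> = ennreal (1 / Z') *
        (\<Sum>r1\<in>bits (length a). \<Sum>r2\<in>bits (length b). ennreal (rect_kernel t a b r1 r2 s1 s2) * ?T r1 r2)"
    proof -
      have "ennreal (1 / Z) * ennreal rf = ennreal (1 / Z')"
        using pos by (subst ennreal_mult[symmetric]) (auto simp: Z)
      then show ?thesis by (simp only: mult.assoc[symmetric])
    qed
    finally show ?thesis using True by (simp add: sum_distrib_left)
  next
    case False
    show ?thesis by (simp only: pmf_observables_law[OF t u a b] if_not_P[OF False]) simp
  qed
  finally show "pmf (observables_law a b t u) x = pmf (observables_law ?a b t u \<bind> rect_step t a b) x"
    by (simp add: x)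
qed

lemma observables_law_run:
  assumes a: "\<forall>x\<in>set a. 0 \<le> x \<and> x < 1"
  shows "observables_law a b t u = observables_law (map ((*) (u ^ L)) a) b t u \<bind> run_rectangles a b t u L"
proof (induction L)
  case 0
  have e: "map ((*) (u ^ 0)) a = a" by (rule map_idI) simp
  have r: "run_rectangles a b t u 0 = return_pmf" by (rule ext) simp
  show ?case unfolding e r by (simp add: bind_return_pmf')
next
  case (Suc L)
  have run: "run_rectangles a b t u (Suc L) = (\<lambda>s. rect_step t (map ((*) (u ^ L)) a) b s \<bind> run_rectangles a b t u L)"
    by (rule ext) (rule run_rectangles_Suc)
  have step: "observables_law (map ((*) (u ^ L)) a) b t u =
      observables_law (map ((*) (u ^ Suc L)) a) b t u \<bind> rect_step t (map ((*) (u ^ L)) a) b"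
    using observables_law_step[OF scaled_params[OF t u a, of L], unfolded map_scale_Suc[OF t u, of L a]] .
  show ?case
    unfolding run bind_assoc_pmf[symmetric] step[symmetric] by (rule Suc.IH)
qed

text \<open>Only constant sequences are kept: their lengths follow the u-geometric weights and their
  bits are the boundary input of the model. The constant is their share of the normalization, which
  tends to 1 along the parameters \<open>u ^ L * a\<close>.\<close>

lemma observables_law_ge:
  assumes a: "\<forall>x\<in>set a. 0 \<le> x \<and> x < 1"
  shows "1 / kernel_product t u a b *
      pmf (map_pmf (\<lambda>k. (k, replicate (length a) False, replicate (length b) True)) (u_geometric u)) x
    \<le> pmf (observables_law a b t u) x"
proof -
  let ?F = "replicate (length a) False" and ?T = "replicate (length b) True"
  obtain n s1 s2 where x: "x = (n, s1, s2)" by (cases x)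
  show ?thesis
  proof (cases "s1 = ?F \<and> s2 = ?T")
    case True
    have K: "1 \<le> kernel_product t u a b" by (rule kernel_product_ge_1[OF t u a b])
    note q = qpoch_limit(2)[OF u] qpoch_pos[OF u, of n]
    have Z: "0 < phl_normalization a b t u" by (rule total_trace_eq_normalization(2)[OF t u a b])
    have "pmf (map_pmf (\<lambda>k. (k, ?F, ?T)) (u_geometric u)) (n, ?F, ?T) = pmf (u_geometric u) n"
      by (rule pmf_map_inj') (auto simp: inj_on_def)
    moreover have "ennreal (1 / kernel_product t u a b * pmf (u_geometric u) n) \<le> ennreal (pmf (observables_law a b t u) (n, ?F, ?T))"
    proof -
      have "1 / kernel_product t u a b * pmf (u_geometric u) n = 1 / phl_normalization a b t u * (u ^ n / qpoch u u n)"
        using K q by (simp add: pmf_u_geometric[OF u] phl_normalization_eq)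
      then have "ennreal (1 / kernel_product t u a b * pmf (u_geometric u) n) =
          ennreal (1 / phl_normalization a b t u) * diag_trace (\<lambda>mu. of_bool (plength mu = n)) u"
        unfolding diag_trace_plength[OF u] using Z q u by (subst ennreal_mult[symmetric]) simp_all
      also have "\<dots> \<le> ennreal (pmf (observables_law a b t u) (n, ?F, ?T))"
        by (simp add: pmf_observables_law[OF t u a b] mult_left_mono trace_ge_diag)
      finally show ?thesis .
    qed
    ultimately show ?thesis using True by (simp add: x)
  next
    case False
    then have "(\<lambda>k. (k, ?F, ?T)) -` {(n, s1, s2)} = {}" by auto
    then show ?thesis by (simp add: x pmf_map)
  qed
qed

text \<open>Two initial laws are sent through the same \<open>L\<close> rectangles: the exact one at
  \<open>u ^ L * a\<close>, and in \<open>tau L\<close> a u-geometric counter with the boundary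
  input of the model. The minorization between them survives, so the outputs differ pointwise by at
  most \<open>1 - c L\<close>.\<close>

lemma quasi_periodic_convolution_tendsto:
  assumes a: "\<forall>x\<in>set a. 0 \<le> x \<and> x < 1"
  shows "(\<lambda>L. \<Sum>k\<le>n. pmf (u_geometric u) k * pmf (quasi_periodic_law a b t u L) (n - k, y))
    \<longlonglongrightarrow> pmf (observables_law a b t u) (n, y)"
proof -
  let ?F = "replicate (length a) False" and ?T = "replicate (length b) True"
  define c where "c L = 1 / kernel_product t u (map ((*) (u ^ L)) a) b" for L
  have c: "0 \<le> c L" "c L \<le> 1" for L
    using kernel_product_ge_1[OF t u scaled_params[OF t u a, of L] b] by (simp_all add: c_def)
  define tau where "tau L = map_pmf (\<lambda>k. (k, ?F, ?T)) (u_geometric u) \<bind> run_rectangles a b t u L" for L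
  have "tau L = u_geometric u \<bind> (\<lambda>k. map_pmf (\<lambda>(W, y). (k + W, y)) (quasi_periodic_law a b t u L))" for L
  proof -
    have "run_rectangles a b t u L (k, ?F, ?T) = map_pmf (\<lambda>(W, y). (k + W, y)) (quasi_periodic_law a b t u L)" for k
      using run_rectangles_shift[of a b t u L k 0 "(?F, ?T)"] by (simp only: quasi_periodic_law_def add_0_right)
    then show ?thesis by (simp only: tau_def bind_map_pmf)
  qed
  then have tau: "pmf (tau L) (n, y) = (\<Sum>k\<le>n. pmf (u_geometric u) k * pmf (quasi_periodic_law a b t u L) (n - k, y))" for L
    by (simp only: pmf_bind_shift)
  have "c L * pmf (tau L) x \<le> pmf (observables_law a b t u) x" for L x
  proof (subst observables_law_run[OF a, of L], subst tau_def, rule pmf_bind_ge[OF c(1)])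
    fix x
    show "c L * pmf (map_pmf (\<lambda>k. (k, ?F, ?T)) (u_geometric u)) x \<le> pmf (observables_law (map ((*) (u ^ L)) a) b t u) x"
      using observables_law_ge[OF scaled_params[OF t u a, of L], of x] by (simp only: c_def length_map)
  qed
  then have bound: "\<bar>pmf (tau L) (n, y) - pmf (observables_law a b t u) (n, y)\<bar> \<le> 1 - c L" for L
    by (rule pmf_diff_le[OF c])
  have "(\<lambda>L. 1 - c L) \<longlonglongrightarrow> 1 - 1 / 1"
    unfolding c_def
    by (rule tendsto_diff[OF tendsto_const tendsto_divide[OF tendsto_const kernel_product_tendsto_1[OF t u a b]]]) simp
  then have c0: "(\<lambda>L. 1 - c L) \<longlonglongrightarrow> 0" by (simp only: div_by_1 diff_self)
  have "(\<lambda>L. pmf (tau L) (n, y) - pmf (observables_law a b t u) (n, y)) \<longlonglongrightarrow> 0"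
    by (rule Lim_null_comparison[OF always_eventually c0]) (use bound in \<open>simp only: real_norm_def, blast\<close>)
  then show ?thesis unfolding tau[symmetric] by (rule LIM_zero_cancel)
qed

text \<open>Deconvolution applies because the u-geometric law charges 0. No mass escapes in the
  limit: the convolution of the pointwise limit with a probability law is again a probability law,
  so the limit has mass 1.\<close>

lemma quasi_periodic_limit_law:
  assumes a: "\<forall>x\<in>set a. 0 \<le> x \<and> x < 1"
  obtains law where "\<And>x. (\<lambda>L. pmf (quasi_periodic_law a b t u L) x) \<longlonglongrightarrow> pmf law x"
    "\<And>n y. (\<Sum>k\<le>n. pmf (u_geometric u) k * pmf law (n - k, y)) = pmf (observables_law a b t u) (n, y)"
proof -
  let ?g = "pmf (u_geometric u)" and ?q = "quasi_periodic_law a b t u" and ?z = "pmf (observables_law a b t u)"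
  define l where "l x = lim (\<lambda>L. pmf (?q L) x)" for x
  have "?g 0 \<noteq> 0" using qpoch_limit(2)[OF u] by (simp add: pmf_u_geometric[OF u] qpoch_def)
  then have "convergent (\<lambda>L. pmf (?q L) (n, y))" for n y
    by (rule convergent_deconvolution[where q = "\<lambda>L n. pmf (?q L) (n, y)"])
       (rule convergentI, rule quasi_periodic_convolution_tendsto[OF a])
  then have l: "(\<lambda>L. pmf (?q L) x) \<longlonglongrightarrow> l x" for x
    unfolding l_def convergent_LIMSEQ_iff[symmetric] by (cases x) simp
  have nn: "0 \<le> l x" for x by (rule LIMSEQ_le_const[OF l]) auto
  have conv: "(\<Sum>k\<le>n. ?g k * l (n - k, y)) = ?z (n, y)" for n y
    by (rule LIMSEQ_unique[OF _ quasi_periodic_convolution_tendsto[OF a]]) (intro tendsto_intros l)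
  have one: "esum (\<lambda>x. ennreal (pmf p x)) = 1" for p :: "'z pmf"
    using nn_integral_pmf[of UNIV p] by simp
  have "1 = esum (\<lambda>y. esum (\<lambda>n. ennreal (?z (n, y))))"
    using nn_integral_snd_count_space[of "\<lambda>x. ennreal (?z x)"] one[of "observables_law a b t u"] by simp
  also have "\<dots> = esum (\<lambda>y. esum (\<lambda>n. \<Sum>k\<le>n. ennreal (?g k) * ennreal (l (n - k, y))))"
    unfolding conv[symmetric] by (simp add: sum_ennreal[symmetric] ennreal_mult nn)
  also have "\<dots> = esum (\<lambda>y. esum (\<lambda>m. ennreal (l (m, y))))"
    using esum_convolution[of "\<lambda>k. ennreal (?g k)" "\<lambda>m. ennreal (l (m, _))"] by (simp add: one)
  also have "\<dots> = esum (\<lambda>x. ennreal (l x))"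
    using nn_integral_snd_count_space[of "\<lambda>x. ennreal (l x)"] by simp
  finally have "pmf (embed_pmf l) x = l x" for x by (intro pmf_embed_pmf nn) simp
  then show thesis using that[of "embed_pmf l"] l conv by simp
qed

end

theorem theorem5p1:
  fixes M N :: nat and t u :: real and a b :: "real list"
  assumes "M \<ge> 1" and "N \<ge> 1"
    and "0 \<le> t" and "t < 1" and "0 \<le> u" and "u < 1"
    and "length a = M" and "\<forall>x\<in>set a. 0 < x \<and> x < 1"
    and "length b = N" and "\<forall>y\<in>set b. 0 < y \<and> y < 1"
  shows "\<exists>law :: (nat \<times> bool list \<times> bool list) pmf.
    converges_in_distribution (quasi_periodic_law a b t u) law \<and>
    (\<forall>(n :: nat) (s1 :: bool list) (s2 :: bool list). length s1 = M \<longrightarrow> length s2 = N \<longrightarrow>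
      measure_pmf.prob (periodic_hall_littlewood a b t u)
        {(lam, mu). plength (lam ! 0) = n \<and> length_jumps lam = s1 \<and> length_jumps_compl mu = s2} =
      measure_pmf.prob (pair_pmf law (u_geometric u))
        {((W, S1, S2), chi). W + chi = n \<and> S1 = s1 \<and> S2 = s2})"
proof -
  have t: "0 \<le> t" "t < 1" and u: "0 \<le> u" "u < 1" by fact+
  have a: "\<forall>x\<in>set a. 0 \<le> x \<and> x < 1" and b: "\<forall>y\<in>set b. 0 \<le> y \<and> y < 1"
    using assms(8,10) by auto
  obtain law where law: "\<And>x. (\<lambda>L. pmf (quasi_periodic_law a b t u L) x) \<longlonglongrightarrow> pmf law x"
    "\<And>n y. (\<Sum>k\<le>n. pmf (u_geometric u) k * pmf law (n - k, y)) = pmf (observables_law a b t u) (n, y)"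
    using quasi_periodic_limit_law[OF t u b a] by blast
  have "measure_pmf.prob (periodic_hall_littlewood a b t u)
      {(lam, mu). plength (lam ! 0) = n \<and> length_jumps lam = s1 \<and> length_jumps_compl mu = s2} =
    pmf (observables_law a b t u) (n, s1, s2)" for n s1 s2
    by (simp add: observables_law_def pmf_map observables_def vimage_def case_prod_unfold)
  then show ?thesis
    using pmf_tendsto_imp_converges_in_distribution[OF law(1)]
    by (intro exI[of _ law]) (simp add: prob_pair_pmf_sum law(2))
qed

end
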